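(* Let $\mathsf f$ be an a.s. uniformly bounded additive functional on a uniformly elliptic Markov chain $\mathsf X$. Suppose $\mathsf f$ is irreducible with algebraic range $\mathbb R$. If $z_N\in\mathbb R$ satisfy $\frac{z_N-\mathbb E(S_N)}{V_N}\to0$, then for every non-empty (finite) interval $(a,b)$ and every $x\in\mathfrak S_1$, as $N\to\infty$, $$\mathbb P_x[S_N-z_N\in(a,b)]=[1+o(1)]\frac{|a-b|}{\sqrt{2\pi V_N}}\exp\left(-V_N\mathcal I_N\left(\frac{z_N}{V_N}\right)\right),$$ $$\mathbb P_x[S_N-z_N\in(a,b)]=[1+o(1)]\frac{|a-b|}{\sqrt{2\pi V_N}}\exp\left[-\frac{1+o(1)}{2}\left(\frac{z_N-\mathbb E(S_N)}{\sqrt{V_N}}\right)^2\right].$$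
   Context: A Markov chain $\mathsf X=\{X_n\}_{n\ge1}$ (possibly inhomogeneous) has complete separable metric state spaces $\mathfrak S_n\ni X_n$ with Borel $\sigma$-algebras, an initial distribution on $\mathfrak S_1$, and transition kernels $\pi_{n,n+1}(x,dy)$, so that $\mathbb P(X_{n+1}\in E\mid X_n,\dots,X_1)=\pi_{n,n+1}(X_n,E)$. $\mathbb P_x$ denotes probability when the initial distribution is replaced by the point mass at $x\in\mathfrak S_1$. The chain is uniformly elliptic if there are $0<\epsilon_0<1$, Borel probability measures $\mu_n$ on $\mathfrak S_n$ and measurable $p_n:\mathfrak S_n\times\mathfrak S_{n+1}\to[0,\infty)$ such that for all $n\ge1$: (a) $\pi_{n,n+1}(x,dy)=p_n(x,y)\mu_{n+1}(dy)$; (b) $0\le p_n\le1/\epsilon_0$; (c) $\int_{\mathfrak S_{n+1}}p_n(x,y)p_{n+1}(y,z)\mu_{n+1}(dy)>\epsilon_0$ for all $x\in\mathfrak S_n$, $z\in\mathfrak S_{n+2}$. An additive functional is a sequence $\mathsf f=\{f_n\}$ of measurable $f_n:\mathfrak S_n\times\mathfrak S_{n+1}\to\mathbb R$; $S_N=\sum_{n=1}^Nf_n(X_n,X_{n+1})$; $V_N=\mathrm{Var}(S_N)$. $\mathsf f$ is a.s. uniformly bounded if $\sup_n\mathrm{ess\,sup}|f_n(X_n,X_{n+1})|<\infty$. $\mathsf f$ is center-tight if there are constants $m_N$ such that for every $\epsilon>0$ there is $M$ with $\mathbb P[|S_N-m_N|>M]<\epsilon$ for all $N$. $G_{alg}(\mathsf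 X,\mathsf f)$ (algebraic range) is the intersection of all closed subgroups $G\le\mathbb R$ for which there are $c_n\in\mathbb R$ with $\mathbb P[f_n(X_n,X_{n+1})-c_n\in G]=1$ for all $n\ge1$. $G_{ess}(\mathsf X,\mathsf f)=\bigcap\{G_{alg}(\mathsf X,\mathsf g):\mathsf g$ an additive functional on $\mathsf X$ with $\mathsf f-\mathsf g$ center-tight$\}$. $\mathsf f$ is irreducible if $G_{ess}(\mathsf X,\mathsf f)=G_{alg}(\mathsf X,\mathsf f)$. Rate functions. When $V_N\ne0$, $\mathcal F_N(\xi)=\frac1{V_N}\log\mathbb E(e^{\xi S_N})$ ($\xi\in\mathbb R$), which is smooth and strictly convex. $\mathcal I_N$ is its Legendre transform: for $\eta\in(\inf\mathcal F_N',\sup\mathcal F_N')$, $\mathcal I_N(\eta)=\xi\eta-\mathcal F_N(\xi)$ for the unique $\xi$ with $\mathcal F_N'(\xi)=\eta$. (Under the hypotheses $z_N/V_N$ lies in this domain for all large $N$.)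
   Formalization: The functional f is also assumed a.s. uniformly bounded under P_x (automatic for almost every starting point x, and for every x if the f_n are uniformly bounded functions); without this the claim can fail for exceptional x. *)

theory Defs
  imports "HOL-Probability.Probability" "HOL-Library.Landau_Symbols"
begin

text \<open>
  All sequences are indexed from 1; the values at index 0 play no role.

  The state spaces may differ from one time to the next. They are given as metric spaces whose
  carriers live in one common type (any sequence of spaces can be placed in such a type by
  taking a disjoint union), each with its own carrier and its own metric.
\<close>

definition state_spaces :: "(nat \<Rightarrow> 'a metric) \<Rightarrow> bool" where
  "state_spaces S \<longleftrightarrow>
     (\<forall>n\<ge>1. mcomplete_of (S n) \<and> separable_space (mtopology_of (S n)))"

definition borel_of_metric :: "'a metric \<Rightarrow> 'a measure" where
  "borel_of_metric m = sigma (mspace m) {U. openin (mtopology_of m) U}"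

text \<open>
  The kernel \<open>\<pi> n\<close> is the transition kernel from \<open>S n\<close> to \<open>S (n + 1)\<close>. Measurability into
  \<open>prob_algebra\<close> says that \<open>\<pi> n x\<close> is a probability measure for every \<open>x\<close> in \<open>S n\<close>, depending
  measurably on \<open>x\<close>.
\<close>

definition transition_kernels :: "(nat \<Rightarrow> 'a metric) \<Rightarrow> (nat \<Rightarrow> 'a \<Rightarrow> 'a measure) \<Rightarrow> bool" where
  "transition_kernels S \<pi> \<longleftrightarrow>
     (\<forall>n\<ge>1. \<pi> n \<in> measurable (borel_of_metric (S n)) (prob_algebra (borel_of_metric (S (Suc n)))))"

text \<open>The sigma-algebra on the sample space generated by \<open>X 1, \<dots>, X n\<close>.\<close>

definition past :: "(nat \<Rightarrow> 'a metric) \<Rightarrow> 'w measure \<Rightarrow> (nat \<Rightarrow> 'w \<Rightarrow> 'a) \<Rightarrow> nat \<Rightarrow> 'w measure" where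
  "past S P X n =
     vimage_algebra (space P) (\<lambda>\<omega>. \<lambda>i\<in>{1..n}. X i \<omega>) (PiM {1..n} (\<lambda>i. borel_of_metric (S i)))"

text \<open>
  \<open>markov_chain S \<nu> \<pi> P X\<close>: on the probability space \<open>P\<close>, the process \<open>X\<close> is a Markov chain with
  initial distribution \<open>\<nu>\<close> and transition kernels \<open>\<pi>\<close>. The joint law of \<open>X\<close> is determined by \<open>\<nu>\<close>
  and \<open>\<pi>\<close>, so probabilities ``when the chain is started at \<open>x\<close>'' are those of any chain with the
  same kernels and initial distribution \<open>return (borel_of_metric (S 1)) x\<close>; such a chain exists
  by the Ionescu-Tulcea theorem.
\<close>

definition markov_chain ::
    "(nat \<Rightarrow> 'a metric) \<Rightarrow> 'a measure \<Rightarrow> (nat \<Rightarrow> 'a \<Rightarrow> 'a measure) \<Rightarrow> 'w measure \<Rightarrow> (nat \<Rightarrow> 'w \<Rightarrow> 'a) \<Rightarrow> bool"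
  where
  "markov_chain S \<nu> \<pi> P X \<longleftrightarrow>
     state_spaces S \<and> transition_kernels S \<pi> \<and>
     prob_space P \<and>
     (\<forall>n\<ge>1. X n \<in> measurable P (borel_of_metric (S n))) \<and>
     distr P (borel_of_metric (S 1)) (X 1) = \<nu> \<and>
     (\<forall>n\<ge>1. \<forall>E \<in> sets (borel_of_metric (S (Suc n))).
        AE \<omega> in P. real_cond_exp P (past S P X n) (\<lambda>\<omega>. indicator E (X (Suc n) \<omega>)) \<omega>
                     = measure (\<pi> n (X n \<omega>)) E)"

definition uniformly_elliptic :: "(nat \<Rightarrow> 'a metric) \<Rightarrow> (nat \<Rightarrow> 'a \<Rightarrow> 'a measure) \<Rightarrow> bool" where
  "uniformly_elliptic S \<pi> \<longleftrightarrow>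
     (\<exists>(\<epsilon>0::real) (\<mu> :: nat \<Rightarrow> 'a measure) (p :: nat \<Rightarrow> 'a \<times> 'a \<Rightarrow> real).
        0 < \<epsilon>0 \<and> \<epsilon>0 < 1 \<and>
        (\<forall>n\<ge>1. prob_space (\<mu> n) \<and> sets (\<mu> n) = sets (borel_of_metric (S n))) \<and>
        (\<forall>n\<ge>1. p n \<in> borel_measurable (borel_of_metric (S n) \<Otimes>\<^sub>M borel_of_metric (S (Suc n)))) \<and>
        (\<forall>n\<ge>1. \<forall>x\<in>mspace (S n). \<pi> n x = density (\<mu> (Suc n)) (\<lambda>y. ennreal (p n (x, y)))) \<and>
        (\<forall>n\<ge>1. \<forall>x\<in>mspace (S n). \<forall>y\<in>mspace (S (Suc n)). 0 \<le> p n (x, y) \<and> p n (x, y) \<le> 1 / \<epsilon>0) \<and>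
        (\<forall>n\<ge>1. \<forall>x\<in>mspace (S n). \<forall>z\<in>mspace (S (Suc (Suc n))).
           (\<integral>y. p n (x, y) * p (Suc n) (y, z) \<partial>\<mu> (Suc n)) > \<epsilon>0))"

definition additive_functional :: "(nat \<Rightarrow> 'a metric) \<Rightarrow> (nat \<Rightarrow> 'a \<times> 'a \<Rightarrow> real) \<Rightarrow> bool" where
  "additive_functional S f \<longleftrightarrow>
     (\<forall>n\<ge>1. f n \<in> borel_measurable (borel_of_metric (S n) \<Otimes>\<^sub>M borel_of_metric (S (Suc n))))"

definition partial_sum ::
    "(nat \<Rightarrow> 'w \<Rightarrow> 'a) \<Rightarrow> (nat \<Rightarrow> 'a \<times> 'a \<Rightarrow> real) \<Rightarrow> nat \<Rightarrow> 'w \<Rightarrow> real" where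
  "partial_sum X f N \<omega> = (\<Sum>n=1..N. f n (X n \<omega>, X (Suc n) \<omega>))"

definition mean_sum ::
    "'w measure \<Rightarrow> (nat \<Rightarrow> 'w \<Rightarrow> 'a) \<Rightarrow> (nat \<Rightarrow> 'a \<times> 'a \<Rightarrow> real) \<Rightarrow> nat \<Rightarrow> real" where
  "mean_sum P X f N = (\<integral>\<omega>. partial_sum X f N \<omega> \<partial>P)"

definition var_sum ::
    "'w measure \<Rightarrow> (nat \<Rightarrow> 'w \<Rightarrow> 'a) \<Rightarrow> (nat \<Rightarrow> 'a \<times> 'a \<Rightarrow> real) \<Rightarrow> nat \<Rightarrow> real" where
  "var_sum P X f N = (\<integral>\<omega>. (partial_sum X f N \<omega> - mean_sum P X f N)\<^sup>2 \<partial>P)"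

text \<open>
  The essential supremum is relative to the law of the chain. In particular a bound for one
  initial distribution does not control the first two terms of the sum for an initial
  distribution that is singular to it.
\<close>

definition as_uniformly_bounded ::
    "'w measure \<Rightarrow> (nat \<Rightarrow> 'w \<Rightarrow> 'a) \<Rightarrow> (nat \<Rightarrow> 'a \<times> 'a \<Rightarrow> real) \<Rightarrow> bool" where
  "as_uniformly_bounded P X f \<longleftrightarrow>
     (SUP n\<in>{1..}. esssup P (\<lambda>\<omega>. ereal \<bar>f n (X n \<omega>, X (Suc n) \<omega>)\<bar>)) < \<infinity>"

definition center_tight ::
    "'w measure \<Rightarrow> (nat \<Rightarrow> 'w \<Rightarrow> 'a) \<Rightarrow> (nat \<Rightarrow> 'a \<times> 'a \<Rightarrow> real) \<Rightarrow> bool" where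
  "center_tight P X f \<longleftrightarrow>
     (\<exists>m :: nat \<Rightarrow> real. \<forall>\<epsilon>>0. \<exists>M. \<forall>N\<ge>1. \<P>(\<omega> in P. \<bar>partial_sum X f N \<omega> - m N\<bar> > M) < \<epsilon>)"

definition closed_real_subgroup :: "real set \<Rightarrow> bool" where
  "closed_real_subgroup G \<longleftrightarrow> closed G \<and> 0 \<in> G \<and> (\<forall>x\<in>G. \<forall>y\<in>G. x + y \<in> G) \<and> (\<forall>x\<in>G. - x \<in> G)"

definition G_alg ::
    "'w measure \<Rightarrow> (nat \<Rightarrow> 'w \<Rightarrow> 'a) \<Rightarrow> (nat \<Rightarrow> 'a \<times> 'a \<Rightarrow> real) \<Rightarrow> real set" where
  "G_alg P X f =
     \<Inter>{G. closed_real_subgroup G \<and>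
          (\<exists>c :: nat \<Rightarrow> real. \<forall>n\<ge>1. \<P>(\<omega> in P. f n (X n \<omega>, X (Suc n) \<omega>) - c n \<in> G) = 1)}"

definition G_ess ::
    "(nat \<Rightarrow> 'a metric) \<Rightarrow> 'w measure \<Rightarrow> (nat \<Rightarrow> 'w \<Rightarrow> 'a) \<Rightarrow> (nat \<Rightarrow> 'a \<times> 'a \<Rightarrow> real) \<Rightarrow> real set" where
  "G_ess S P X f =
     \<Inter>{G_alg P X g | g. additive_functional S g \<and> center_tight P X (\<lambda>n u. f n u - g n u)}"

definition irreducible_functional ::
    "(nat \<Rightarrow> 'a metric) \<Rightarrow> 'w measure \<Rightarrow> (nat \<Rightarrow> 'w \<Rightarrow> 'a) \<Rightarrow> (nat \<Rightarrow> 'a \<times> 'a \<Rightarrow> real) \<Rightarrow> bool" where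
  "irreducible_functional S P X f \<longleftrightarrow> G_ess S P X f = G_alg P X f"

definition log_mgf ::
    "'w measure \<Rightarrow> (nat \<Rightarrow> 'w \<Rightarrow> 'a) \<Rightarrow> (nat \<Rightarrow> 'a \<times> 'a \<Rightarrow> real) \<Rightarrow> nat \<Rightarrow> real \<Rightarrow> real" where
  "log_mgf P X f N \<xi> = 1 / var_sum P X f N * ln (\<integral>\<omega>. exp (\<xi> * partial_sum X f N \<omega>) \<partial>P)"

text \<open>
  The Legendre transform. Since the derivative of \<open>log_mgf P X f N\<close> is continuous and strictly
  increasing when the variance is non-zero, the point \<open>\<xi>\<close> exists and is unique exactly for \<open>\<eta>\<close>
  strictly between the infimum and the supremum of that derivative; for other \<open>\<eta>\<close> the value is
  unspecified.
\<close>

definition rate_fun ::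
    "'w measure \<Rightarrow> (nat \<Rightarrow> 'w \<Rightarrow> 'a) \<Rightarrow> (nat \<Rightarrow> 'a \<times> 'a \<Rightarrow> real) \<Rightarrow> nat \<Rightarrow> real \<Rightarrow> real" where
  "rate_fun P X f N \<eta> =
     (let \<xi> = (THE \<xi>. deriv (log_mgf P X f N) \<xi> = \<eta>) in \<xi> * \<eta> - log_mgf P X f N \<xi>)"

end

theory Submission
 imports Defs "HOL-Complex_Analysis.Complex_Analysis" "HOL-Real_Asymp.Real_Asymp"
begin

text \<open>
 The transition operators perturbed by \<open>exp (\<zeta> * f n x y)\<close> are followed backwards in time. For small
 complex \<open>\<zeta>\<close> the contraction of two steps of the chain keeps the functions \<open>E\<^sub>x (exp (\<zeta> * S\<^sub>N))\<close> close to
 their mean, which is bounded above and below by exponentials of the sum of the second moments of the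
 summands. For every frequency \<open>\<theta>\<close> three consecutive steps contract by an amount \<open>DD f \<theta> n\<close>, which measures
 how far the phases of two paths with the same endpoints differ. If these amounts are small along the whole
 chain, the phases split off a coboundary: for small \<open>\<theta>\<close> this makes the sum of the second moments comparable
 with both the variance and the total contraction, and for any \<open>\<theta> \<noteq> 0\<close> with summable amounts it exhibits \<open>f\<close>
 as a lattice-valued functional up to a center-tight one, which irreducibility with range \<open>\<real>\<close>
 excludes. Hence the characteristic functions of the exponentially tilted laws converge to that of
 the normal law and are negligible away from zero, and a Fejer kernel argument gives the local limit
 theorem at the point where the tilted mean is \<open>z\<close>.
\<close>

section \<open>Bounded measurable functions\<close>

text \<open>Three obstacles shape the argument. The second moments of the summands may add up to far
  more than the variance, since telescoping terms enter the former without entering the latter.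
  Expansions in \<open>\<zeta>\<close> are therefore made for a functional altered by such terms,
  chosen anew for every horizon \<open>N\<close> and with the added functions vanishing at the times
  \<open>0\<close> and \<open>N\<close>; the moment generating functions then change only by an
  explicit exponential factor. Next, the chain started at \<open>x\<close> has its own moment
  generating function, while the tilt has to be the one that defines the rate function. This is
  harmless because the two functions differ by a factor \<open>1 + O(|\<zeta>|)\<close> and the tilt
  tends to zero. Finally, divergence of the total contraction at each fixed
  \<open>\<theta> \<noteq> 0\<close> carries no rate, whereas these frequencies must contribute less
  than \<open>1 / sqrt V\<close>. The missing rate comes from the inequality
  \<open>g (a + b) \<le> 2 * g a + 2 * g b\<close> for the total contraction
  \<open>g\<close>.\<close>

definition bm :: "'b measure \<Rightarrow> ('b \<Rightarrow> 'c::{banach,second_countable_topology}) \<Rightarrow> bool" where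
 "bm M F \<longleftrightarrow> F \<in> borel_measurable M \<and> (\<exists>B. \<forall>x\<in>space M. norm (F x) \<le> B)"

lemma bmI: "F \<in> borel_measurable M \<Longrightarrow> (\<And>x. x \<in> space M \<Longrightarrow> norm (F x) \<le> B) \<Longrightarrow> bm M F"
 by (auto simp: bm_def)

lemma bm_measurable: "bm M F \<Longrightarrow> F \<in> borel_measurable M"
 by (simp add: bm_def)

lemma bmE:
 assumes "bm M F" obtains B where "0 \<le> B" "\<And>x. x \<in> space M \<Longrightarrow> norm (F x) \<le> B"
proof -
 from assms obtain B where B: "\<forall>x\<in>space M. norm (F x) \<le> B" by (auto simp: bm_def)
 show ?thesis by (rule that[of "max 0 B"]) (use B in force)+
qed

lemma bm_integrable: "finite_measure M \<Longrightarrow> bm M F \<Longrightarrow> integrable M F"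
 by (auto simp: bm_def intro!: finite_measure.integrable_const_bound)

lemma bm_sets_cong: "sets M = sets N \<Longrightarrow> bm M F = bm N F"
 unfolding bm_def by (metis measurable_cong_sets sets_eq_imp_space_eq)

lemma integral_norm_le_integral:
 fixes F :: "'b \<Rightarrow> 'c::{banach,second_countable_topology}" and G :: "'b \<Rightarrow> real"
 assumes "integrable M F" "integrable M G" "\<And>x. x \<in> space M \<Longrightarrow> norm (F x) \<le> G x"
 shows "norm (\<integral>x. F x \<partial>M) \<le> (\<integral>x. G x \<partial>M)"
proof -
 have "norm (\<integral>x. F x \<partial>M) \<le> (\<integral>x. norm (F x) \<partial>M)"
  by (rule integral_norm_bound)
 also have "\<dots> \<le> (\<integral>x. G x \<partial>M)"
  using assms by (intro integral_mono integrable_norm)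
 finally show ?thesis .
qed

lemma bm_integral_norm_le:
 fixes F :: "'b \<Rightarrow> 'c::{banach,second_countable_topology}"
 assumes "finite_measure M" "bm M F" "bm M G" "\<And>x. x \<in> space M \<Longrightarrow> norm (F x) \<le> G x"
 shows "norm (\<integral>x. F x \<partial>M) \<le> (\<integral>x. G x \<partial>M)"
 using assms by (intro integral_norm_le_integral bm_integrable)

lemmas integral_congI = Bochner_Integration.integral_cong[OF refl]

named_theorems bm_intros

lemma bm_const [bm_intros]: "bm M (\<lambda>x. c)"
 by (auto simp: bm_def)

lemma bm_add [bm_intros]: "bm M F \<Longrightarrow> bm M G \<Longrightarrow> bm M (\<lambda>x. F x + G x)"
proof -
 assume F: "bm M F" and G: "bm M G"
 obtain B where B: "0 \<le> B" "\<And>x. x \<in> space M \<Longrightarrow> norm (F x) \<le> B" using bmE[OF F] by blast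
 obtain C where C: "0 \<le> C" "\<And>x. x \<in> space M \<Longrightarrow> norm (G x) \<le> C" using bmE[OF G] by blast
 show ?thesis
  by (rule bmI[where B = "B + C"])
    (use F G B C in \<open>auto simp: bm_measurable intro!: norm_triangle_mono borel_measurable_add\<close>)
qed

lemma bm_uminus [bm_intros]: "bm M F \<Longrightarrow> bm M (\<lambda>x. - F x)"
 by (auto simp: bm_def)

lemma bm_diff [bm_intros]: "bm M F \<Longrightarrow> bm M G \<Longrightarrow> bm M (\<lambda>x. F x - G x)"
 using bm_add[of M F "\<lambda>x. - G x"] bm_uminus[of M G] by simp

lemma bm_mult [bm_intros]:
 fixes F G :: "'b \<Rightarrow> 'c::{banach,second_countable_topology,real_normed_algebra}"
 shows "bm M F \<Longrightarrow> bm M G \<Longrightarrow> bm M (\<lambda>x. F x * G x)"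
proof -
 assume F: "bm M F" and G: "bm M G"
 obtain B where B: "0 \<le> B" "\<And>x. x \<in> space M \<Longrightarrow> norm (F x) \<le> B" using bmE[OF F] by blast
 obtain C where C: "0 \<le> C" "\<And>x. x \<in> space M \<Longrightarrow> norm (G x) \<le> C" using bmE[OF G] by blast
 show ?thesis
  by (rule bmI[where B = "B * C"])
    (use F G B C in \<open>auto simp: bm_measurable intro!: order.trans[OF norm_mult_ineq] mult_mono borel_measurable_times\<close>)
qed

lemma bm_norm [bm_intros]: "bm M F \<Longrightarrow> bm M (\<lambda>x. norm (F x))"
 by (auto simp: bm_def)

lemma bm_power [bm_intros]:
 fixes F :: "'b \<Rightarrow> 'c::{banach,second_countable_topology,real_normed_div_algebra}"
 shows "bm M F \<Longrightarrow> bm M (\<lambda>x. F x ^ k)"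
proof -
 assume F: "bm M F"
 obtain B where B: "0 \<le> B" "\<And>x. x \<in> space M \<Longrightarrow> norm (F x) \<le> B" using bmE[OF F] by blast
 show ?thesis
  by (rule bmI[where B = "B ^ k"])
    (use F B in \<open>auto simp: bm_measurable norm_power intro!: power_mono borel_measurable_power\<close>)
qed

lemma bm_of_real [bm_intros]: "bm M F \<Longrightarrow> bm M (\<lambda>x. complex_of_real (F x))"
 by (auto simp: bm_def)

lemma bm_Re [bm_intros]: "bm M F \<Longrightarrow> bm M (\<lambda>x. Re (F x))"
 by (auto simp: bm_def intro: order.trans[OF abs_Re_le_cmod])

lemma bm_cnj [bm_intros]: "bm M F \<Longrightarrow> bm M (\<lambda>x. cnj (F x))"
 by (auto simp: bm_def intro: borel_measurable_continuous_on[of cnj] continuous_intros)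

lemma bm_divide_const [bm_intros]:
 fixes F :: "'b \<Rightarrow> 'c::{banach,second_countable_topology,real_normed_field}"
 shows "bm M F \<Longrightarrow> bm M (\<lambda>x. F x / c)"
 using bm_mult[OF _ bm_const[of M "inverse c"], of F] by (simp add: divide_inverse)

lemma bm_cos [bm_intros]: "F \<in> borel_measurable M \<Longrightarrow> bm M (\<lambda>x. cos (F x :: real))"
 by (rule bmI[where B = 1]) auto

lemma bm_exp [bm_intros]:
 fixes F :: "'b \<Rightarrow> 'c::{banach,second_countable_topology,real_normed_field}"
 assumes "bm M F" shows "bm M (\<lambda>x. exp (F x))"
proof -
 obtain B where "0 \<le> B" "\<And>x. x \<in> space M \<Longrightarrow> norm (F x) \<le> B" using bmE[OF assms] by blast
 then show ?thesis
  by (intro bmI[where B = "exp B"] order.trans[OF norm_exp]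
     measurable_compose[OF bm_measurable[OF assms] borel_measurable_continuous_onI[OF continuous_on_exp[OF continuous_on_id]]])
   simp_all
qed

lemma bm_comp: "bm M F \<Longrightarrow> g \<in> measurable N M \<Longrightarrow> bm N (\<lambda>x. F (g x))"
 by (auto simp: bm_def dest: measurable_space)

lemma bm_integral [bm_intros]:
 assumes A: "prob_space A" and F: "bm (N \<Otimes>\<^sub>M A) (\<lambda>w. F (fst w) (snd w))"
 shows "bm N (\<lambda>x. \<integral>y. F x y \<partial>A)"
proof -
 interpret prob_space A by fact
 obtain B where B: "0 \<le> B" "\<And>w. w \<in> space (N \<Otimes>\<^sub>M A) \<Longrightarrow> norm (F (fst w) (snd w)) \<le> B" using bmE[OF F] by blast
 have m: "(\<lambda>(x, y). F x y) \<in> borel_measurable (N \<Otimes>\<^sub>M A)"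
  using bm_measurable[OF F] by (simp add: case_prod_unfold)
 show ?thesis
 proof (rule bmI[where B = B])
  show "(\<lambda>x. \<integral>y. F x y \<partial>A) \<in> borel_measurable N"
   by (rule borel_measurable_lebesgue_integral) fact
  fix x assume x: "x \<in> space N"
  have "norm (F x y) \<le> B" if "y \<in> space A" for y
   using B(2)[of "(x, y)"] x that by (simp add: space_pair_measure)
  then have "norm (\<integral>y. F x y \<partial>A) \<le> (\<integral>y. B \<partial>A)"
   by (intro integral_norm_le_integral integrable_const_bound[of _ B] measurable_Pair2[OF m x, simplified]) (use B in auto)
  then show "norm (\<integral>y. F x y \<partial>A) \<le> B" by (simp add: prob_space)
 qed
qed

lemma bm_section:
 "bm (N \<Otimes>\<^sub>M A) (\<lambda>w. F (fst w) (snd w)) \<Longrightarrow> x \<in> space N \<Longrightarrow> bm A (F x)"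
 using bm_comp[of "N \<Otimes>\<^sub>M A" "\<lambda>w. F (fst w) (snd w)" "\<lambda>y. (x, y)" A] by simp

lemma bm_integral_swap:
 assumes A: "prob_space A" and B: "prob_space B" and F: "bm (A \<Otimes>\<^sub>M B) (\<lambda>w. F (fst w) (snd w))"
 shows "(\<integral>x. \<integral>y. F x y \<partial>B \<partial>A) = (\<integral>y. \<integral>x. F x y \<partial>A \<partial>B)"
proof -
 interpret A: prob_space A by fact
 interpret B: prob_space B by fact
 interpret pair_prob_space A B by unfold_locales
 have "finite_measure (A \<Otimes>\<^sub>M B)" by (rule finite_measure)
 from bm_integrable[OF this F] show ?thesis
  by (intro Fubini_integral[symmetric]) (simp add: case_prod_unfold)
qed

lemma bm_integral_pair:
 assumes A: "prob_space A" and B: "prob_space B" and F: "bm (A \<Otimes>\<^sub>M B) F"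
 shows "(\<integral>w. F w \<partial>(A \<Otimes>\<^sub>M B)) = (\<integral>x. \<integral>y. F (x, y) \<partial>B \<partial>A)"
proof -
 interpret A: prob_space A by fact
 interpret B: prob_space B by fact
 interpret pair_prob_space A B by unfold_locales
 have "finite_measure (A \<Otimes>\<^sub>M B)" by (rule finite_measure)
 from bm_integrable[OF this F] show ?thesis
  by (intro integral_fst'[symmetric])
qed

lemma bm_integral_mono:
 fixes F G :: "'b \<Rightarrow> real"
 assumes "finite_measure M" "bm M F" "bm M G" "\<And>x. x \<in> space M \<Longrightarrow> F x \<le> G x"
 shows "(\<integral>x. F x \<partial>M) \<le> (\<integral>x. G x \<partial>M)"
 using assms by (intro integral_mono bm_integrable) auto

text \<open>Write \<open>a\<close> for the mass of \<open>k\<close> and \<open>b\<close>,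
  \<open>c\<close> for the integrals of \<open>k * |v|^2\<close> and \<open>k * v\<close>. Then
  \<open>k * |a v - c|^2\<close> integrates to \<open>a * (a * b - |c|^2)\<close>, which must be
  nonnegative; if \<open>a = 0\<close>, boundedness of \<open>v\<close> forces \<open>c = 0\<close>.
  The mass stays explicit because the contraction estimate uses a weight of mass less than
  one.\<close>

lemma weighted_Cauchy_Schwarz:
 fixes k :: "'b \<Rightarrow> real" and v :: "'b \<Rightarrow> complex"
 assumes fin: "finite_measure M" and k: "bm M k" "\<And>x. x \<in> space M \<Longrightarrow> 0 \<le> k x" and v: "bm M v"
 shows "(norm (\<integral>x. of_real (k x) * v x \<partial>M))\<^sup>2 \<le> (\<integral>x. k x \<partial>M) * (\<integral>x. k x * (norm (v x))\<^sup>2 \<partial>M)"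
proof -
 define a where "a = (\<integral>x. k x \<partial>M)"
 define c where "c = (\<integral>x. of_real (k x) * v x \<partial>M)"
 define b where "b = (\<integral>x. k x * (norm (v x))\<^sup>2 \<partial>M)"
 have a0: "0 \<le> a" unfolding a_def using k by (intro integral_nonneg_AE) auto
 have Re_c: "(\<integral>x. k x * Re (cnj c * v x) \<partial>M) = (norm c)\<^sup>2"
 proof -
  have "(\<integral>x. k x * Re (cnj c * v x) \<partial>M) = (\<integral>x. Re (cnj c * (of_real (k x) * v x)) \<partial>M)"
   by (intro Bochner_Integration.integral_cong) (auto simp: algebra_simps)
  also have "\<dots> = Re (\<integral>x. cnj c * (of_real (k x) * v x) \<partial>M)"
   by (intro integral_Re bm_integrable[OF fin] bm_intros k(1) v)
  also have "\<dots> = Re (cnj c * c)" unfolding c_def by simp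
  also have "\<dots> = (norm c)\<^sup>2" by (simp add: cmod_power2 flip: power2_eq_square)
  finally show ?thesis .
 qed
 have expand: "k x * (norm (of_real a * v x - c))\<^sup>2 =
   a\<^sup>2 * (k x * (norm (v x))\<^sup>2) - 2 * a * (k x * Re (cnj c * v x)) + (norm c)\<^sup>2 * k x" for x
  unfolding cmod_power2 by (simp add: power2_eq_square algebra_simps)
 have "(\<integral>x. k x * (norm (of_real a * v x - c))\<^sup>2 \<partial>M) = (\<integral>x. a\<^sup>2 * (k x * (norm (v x))\<^sup>2) - 2 * a * (k x * Re (cnj c * v x)) + (norm c)\<^sup>2 * k x \<partial>M)"
  by (simp only: expand)
 also have "\<dots> = a\<^sup>2 * b - 2 * a * (norm c)\<^sup>2 + (norm c)\<^sup>2 * a"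
 proof -
  have "integrable M (\<lambda>x. a\<^sup>2 * (k x * (norm (v x))\<^sup>2))" "integrable M (\<lambda>x. 2 * a * (k x * Re (cnj c * v x)))"
   "integrable M (\<lambda>x. (norm c)\<^sup>2 * k x)"
   by (intro bm_integrable[OF fin] bm_intros k(1) v)+
  then show ?thesis using Re_c by (simp add: a_def b_def)
 qed
 also have "\<dots> = a * (a * b - (norm c)\<^sup>2)" by (simp add: algebra_simps power2_eq_square)
 finally have eq: "(\<integral>x. k x * (norm (of_real a * v x - c))\<^sup>2 \<partial>M) = a * (a * b - (norm c)\<^sup>2)" .
 have *: "0 \<le> a * (a * b - (norm c)\<^sup>2)"
  unfolding eq[symmetric] using k by (intro integral_nonneg_AE) auto
 show ?thesis
 proof (cases "a = 0")
  case False
  with * a0 have "0 \<le> a * b - (norm c)\<^sup>2" by (simp add: zero_le_mult_iff)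
  then show ?thesis by (simp add: a_def b_def c_def)
 next
  case True
  obtain B where B: "0 \<le> B" "\<And>x. x \<in> space M \<Longrightarrow> norm (v x) \<le> B" using bmE[OF v] by blast
  have "norm c \<le> (\<integral>x. B * k x \<partial>M)" unfolding c_def
  proof (rule bm_integral_norm_le[OF fin])
   fix x assume "x \<in> space M"
   with B k show "norm (of_real (k x) * v x) \<le> B * k x"
    using mult_right_mono[of "norm (v x)" B "k x"] by (simp add: norm_mult algebra_simps)
  qed (intro bm_intros k(1) v)+
  also have "\<dots> = 0" using True by (simp add: a_def)
  finally show ?thesis by (simp add: c_def[symmetric] a_def[symmetric] True)
 qed
qed

section \<open>Elliptic kernels and perturbed transition operators\<close>

lemma exp_minus_1_le:
 fixes z :: complex
 assumes "norm z \<le> 1"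
 shows "norm (exp z - 1) \<le> 3 * norm z" "norm (exp z - 1 - z) \<le> 3 * (norm z)\<^sup>2" "norm (exp z) \<le> 3"
proof -
 have e: "exp (norm z) \<le> 3" using assms exp_le by (smt (verit) exp_le_cancel_iff)
 have "norm (exp z - 1) \<le> exp (norm z) * norm z"
  using Taylor_exp_field[of z 0] by simp
 also have "\<dots> \<le> 3 * norm z" using e by (intro mult_right_mono) auto
 finally show "norm (exp z - 1) \<le> 3 * norm z" .
 have "norm (exp z - 1 - z) \<le> exp (norm z) * (norm z)\<^sup>2"
  using Taylor_exp_field[of z 1] by (simp add: power2_eq_square diff_diff_eq)
 also have "\<dots> \<le> 3 * (norm z)\<^sup>2" using e by (intro mult_right_mono) auto
 finally show "norm (exp z - 1 - z) \<le> 3 * (norm z)\<^sup>2" .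
 show "norm (exp z) \<le> 3" using norm_exp[of z] e by linarith
qed

lemma integral_complex_of_real':
 "(\<integral>x. complex_of_real (g x) \<partial>M) = complex_of_real (\<integral>x. g x \<partial>M)"
 by (rule integral_complex_of_real)

text \<open>\<open>M n\<close> is the reference measure at time \<open>n\<close>. The bounds on
  \<open>p\<close> are required at all arguments and not only at points of the state spaces, so that
  membership need not be carried through each estimate; the densities of a given chain are extended
  by zero to fit this form.\<close>

locale elliptic_chain =
 fixes M :: "nat \<Rightarrow> 'a measure" and p :: "nat \<Rightarrow> 'a \<Rightarrow> 'a \<Rightarrow> real" and \<epsilon> :: real
 assumes prob_M: "prob_space (M n)"
  and p_measurable: "(\<lambda>w. p n (fst w) (snd w)) \<in> borel_measurable (M n \<Otimes>\<^sub>M M (Suc n))"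
  and p_nonneg: "0 \<le> p n x y" and p_le: "p n x y \<le> 1 / \<epsilon>"
  and p_integral: "x \<in> space (M n) \<Longrightarrow> (\<integral>y. p n x y \<partial>M (Suc n)) = 1"
  and p2_ge: "x \<in> space (M n) \<Longrightarrow> z \<in> space (M (Suc (Suc n))) \<Longrightarrow>
   \<epsilon> \<le> (\<integral>y. p n x y * p (Suc n) y z \<partial>M (Suc n))"
  and eps: "0 < \<epsilon>" "\<epsilon> < 1"
begin

lemma fin_M: "finite_measure (M n)"
 using prob_M prob_space.finite_measure by blast

lemma bm_p [bm_intros]:
 "x \<in> measurable N (M n) \<Longrightarrow> y \<in> measurable N (M (Suc n)) \<Longrightarrow> bm N (\<lambda>w. p n (x w) (y w))"
 using p_nonneg p_le
 by (intro bmI[where B = "1 / \<epsilon>"]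
    measurable_compose[of "\<lambda>w. (x w, y w)" N "M n \<Otimes>\<^sub>M M (Suc n)", OF _ p_measurable, simplified]) auto

text \<open>The bound is pointwise rather than almost sure: later \<open>f\<close> is evaluated
  along one chosen reference path, about which an almost sure bound says nothing.\<close>

definition adm :: "real \<Rightarrow> (nat \<Rightarrow> 'a \<Rightarrow> 'a \<Rightarrow> real) \<Rightarrow> bool" where
 "adm K f \<longleftrightarrow> (\<forall>n. (\<lambda>w. f n (fst w) (snd w)) \<in> borel_measurable (M n \<Otimes>\<^sub>M M (Suc n)))
   \<and> (\<forall>n x y. \<bar>f n x y\<bar> \<le> K)"

lemma adm_le: "adm K f \<Longrightarrow> \<bar>f n x y\<bar> \<le> K"
 by (auto simp: adm_def)

lemma adm_nonneg: "adm K f \<Longrightarrow> 0 \<le> K"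
 by (meson adm_le abs_ge_zero order_trans)

lemma bm_f:
 assumes "adm K f" "x \<in> measurable N (M n)" "y \<in> measurable N (M (Suc n))"
 shows "bm N (\<lambda>w. f n (x w) (y w))"
 using assms
 by (intro bmI[where B = K]
    measurable_compose[of "\<lambda>w. (x w, y w)" N "M n \<Otimes>\<^sub>M M (Suc n)" "\<lambda>w. f n (fst w) (snd w)", simplified])
   (auto simp: adm_def)

definition PP :: "nat \<Rightarrow> ('a \<Rightarrow> complex) \<Rightarrow> 'a \<Rightarrow> complex" where
 "PP n h x = (\<integral>y. of_real (p n x y) * h y \<partial>M (Suc n))"

definition LL :: "(nat \<Rightarrow> 'a \<Rightarrow> 'a \<Rightarrow> real) \<Rightarrow> complex \<Rightarrow> nat \<Rightarrow> ('a \<Rightarrow> complex) \<Rightarrow> 'a \<Rightarrow> complex" where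
 "LL f \<zeta> n h x = (\<integral>y. of_real (p n x y) * (exp (\<zeta> * of_real (f n x y)) * h y) \<partial>M (Suc n))"

text \<open>\<open>HH f \<zeta> k n x\<close> is the expectation of \<open>exp (\<zeta> * S)\<close>
  for the chain at \<open>x\<close> at time \<open>n\<close>, where \<open>S\<close> is the sum of
  the next \<open>k\<close> terms of \<open>f\<close>. Counting the remaining steps lets an
  induction on \<open>k\<close> run backwards in time with \<open>n\<close> arbitrary.\<close>

primrec HH :: "(nat \<Rightarrow> 'a \<Rightarrow> 'a \<Rightarrow> real) \<Rightarrow> complex \<Rightarrow> nat \<Rightarrow> nat \<Rightarrow> 'a \<Rightarrow> complex" where
 "HH f \<zeta> 0 n = (\<lambda>x. 1)"
| "HH f \<zeta> (Suc k) n = LL f \<zeta> n (HH f \<zeta> k (Suc n))"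

lemma bm_PP [bm_intros]:
 assumes "bm (M (Suc n)) h" shows "bm (M n) (PP n h)"
 unfolding PP_def
 by (intro bm_intros prob_M bm_comp[OF assms]; measurable)

lemma bm_LL:
 assumes "adm K f" "bm (M (Suc n)) h"
 shows "bm (M n) (LL f s n h)"
 unfolding LL_def
 by (intro bm_intros prob_M bm_comp[OF assms(2)] bm_f[OF assms(1)]; measurable)

lemma bm_HH: "adm K f \<Longrightarrow> bm (M n) (HH f s k n)"
 by (induction k arbitrary: n) (auto intro: bm_intros bm_LL)

lemma integrable_M: "bm (M n) h \<Longrightarrow> integrable (M n) h"
 by (rule bm_integrable[OF fin_M])

lemma bm_p_fix: "x \<in> space (M n) \<Longrightarrow> bm (M (Suc n)) (p n x)"
 using bm_p[of "\<lambda>_. x" "M (Suc n)" n "\<lambda>y. y"] by simp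

lemma bm_f_fix: "adm K f \<Longrightarrow> x \<in> space (M n) \<Longrightarrow> bm (M (Suc n)) (f n x)"
 using bm_f[of K f "\<lambda>_. x" "M (Suc n)" n "\<lambda>y. y"] by simp

lemma PP_norm_sq_le:
 assumes h: "bm (M (Suc n)) h" and x: "x \<in> space (M n)"
 shows "(norm (PP n h x))\<^sup>2 \<le> (\<integral>y. p n x y * (norm (h y))\<^sup>2 \<partial>M (Suc n))"
 using weighted_Cauchy_Schwarz[OF fin_M bm_p_fix[OF x] p_nonneg h] p_integral[OF x]
 unfolding PP_def by simp

lemma PP_const: "x \<in> space (M n) \<Longrightarrow> PP n (\<lambda>_. c) x = c"
 unfolding PP_def using p_integral[of x n] by (simp add: integral_complex_of_real')

definition p2 :: "nat \<Rightarrow> 'a \<Rightarrow> 'a \<Rightarrow> real" where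
 "p2 n x z = (\<integral>y. p n x y * p (Suc n) y z \<partial>M (Suc n))"

lemma bm_p2 [bm_intros]:
 assumes "x \<in> measurable N (M n)" "z \<in> measurable N (M (Suc (Suc n)))"
 shows "bm N (\<lambda>w. p2 n (x w) (z w))"
 unfolding p2_def
 by (intro bm_intros prob_M; use assms in measurable)

lemma p2_ge': "x \<in> space (M n) \<Longrightarrow> z \<in> space (M (Suc (Suc n))) \<Longrightarrow> \<epsilon> \<le> p2 n x z"
 unfolding p2_def by (rule p2_ge)

lemma p2_nonneg: "0 \<le> p2 n x z"
 unfolding p2_def by (simp add: p_nonneg)

lemma p2_le:
 assumes x: "x \<in> space (M n)" and z: "z \<in> space (M (Suc (Suc n)))"
 shows "p2 n x z \<le> 1 / \<epsilon>"
proof -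
 have "p2 n x z \<le> (\<integral>y. p n x y * (1 / \<epsilon>) \<partial>M (Suc n))"
  unfolding p2_def
  by (rule bm_integral_mono[OF fin_M])
    (auto intro!: bm_intros bm_p_fix[OF x] bm_p mult_left_mono p_nonneg p_le
     measurable_const z simp del: times_divide_eq_right)
 then show ?thesis using p_integral[OF x] by simp
qed

lemma PP_PP:
 assumes h: "bm (M (Suc (Suc n))) h" and x: "x \<in> space (M n)"
 shows "PP n (PP (Suc n) h) x = (\<integral>z. of_real (p2 n x z) * h z \<partial>M (Suc (Suc n)))"
proof -
 have "PP n (PP (Suc n) h) x =
   (\<integral>y. \<integral>z. of_real (p n x y) * (of_real (p (Suc n) y z) * h z) \<partial>M (Suc (Suc n)) \<partial>M (Suc n))"
  unfolding PP_def by simp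
 also have "\<dots> = (\<integral>z. \<integral>y. of_real (p n x y) * (of_real (p (Suc n) y z) * h z) \<partial>M (Suc n) \<partial>M (Suc (Suc n)))"
  by (rule bm_integral_swap[OF prob_M prob_M])
    (intro bm_intros bm_comp[OF h]; use x in measurable)
 also have "\<dots> = (\<integral>z. of_real (p2 n x z) * h z \<partial>M (Suc (Suc n)))"
  unfolding p2_def integral_complex_of_real'[symmetric]
  by (simp only: of_real_mult mult.assoc[symmetric] integral_mult_left_zero)
 finally show ?thesis .
qed

end

section \<open>Two-step contraction along the law of the chain\<close>

locale chain_law = elliptic_chain +
 fixes \<nu> :: "nat \<Rightarrow> 'a measure"
 assumes prob_nu: "prob_space (\<nu> n)" and sets_nu: "sets (\<nu> n) = sets (M n)"
  and nu_inv: "bm (M (Suc n)) g \<Longrightarrow> (\<integral>x. PP n g x \<partial>\<nu> n) = (\<integral>y. g y \<partial>\<nu> (Suc n))"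
begin

lemma fin_nu: "finite_measure (\<nu> n)"
 using prob_nu prob_space.finite_measure by blast

lemma space_nu: "space (\<nu> n) = space (M n)"
 using sets_nu by (rule sets_eq_imp_space_eq)

lemma bm_nu: "bm (\<nu> n) F = bm (M n) F"
 by (rule bm_sets_cong[OF sets_nu])

lemma bm_nu_pair: "bm (\<nu> n \<Otimes>\<^sub>M N) F = bm (M n \<Otimes>\<^sub>M N) F"
 by (rule bm_sets_cong[OF sets_pair_measure_cong[OF sets_nu refl]])

lemma integrable_nu: "bm (M n) h \<Longrightarrow> integrable (\<nu> n) h"
 using bm_integrable[OF fin_nu] bm_nu by blast

lemma nu_norm_le:
 "bm (M n) F \<Longrightarrow> bm (M n) G \<Longrightarrow> (\<And>x. x \<in> space (M n) \<Longrightarrow> norm (F x) \<le> G x) \<Longrightarrow>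
  norm (\<integral>x. F x \<partial>\<nu> n) \<le> (\<integral>x. G x \<partial>\<nu> n)"
 by (rule bm_integral_norm_le[OF fin_nu]) (auto simp: bm_nu space_nu)

lemma nu_mono:
 fixes F G :: "'a \<Rightarrow> real"
 shows "bm (M n) F \<Longrightarrow> bm (M n) G \<Longrightarrow> (\<And>x. x \<in> space (M n) \<Longrightarrow> F x \<le> G x) \<Longrightarrow>
  (\<integral>x. F x \<partial>\<nu> n) \<le> (\<integral>x. G x \<partial>\<nu> n)"
 by (rule bm_integral_mono[OF fin_nu]) (auto simp: bm_nu space_nu)

lemma nu_cong: "(\<And>x. x \<in> space (M n) \<Longrightarrow> F x = G x) \<Longrightarrow> (\<integral>x. F x \<partial>\<nu> n) = (\<integral>x. G x \<partial>\<nu> n)"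
 by (rule Bochner_Integration.integral_cong) (auto simp: space_nu)

lemma measure_nu_space [simp]: "measure (\<nu> n) (space (\<nu> n)) = 1" "measure (M n) (space (M n)) = 1"
 using prob_space.prob_space[OF prob_nu] prob_space.prob_space[OF prob_M] by auto

text \<open>This is the density of \<open>\<nu> (n + 2)\<close> with respect to
  \<open>M (n + 2)\<close>. The law at time 0 is arbitrary, so the bounds \<open>\<epsilon>\<close>
  and \<open>1 / \<epsilon>\<close> are available from time 2 on.\<close>

definition dd :: "nat \<Rightarrow> 'a \<Rightarrow> real" where
 "dd n z = (\<integral>x. p2 n x z \<partial>\<nu> n)"

lemma bm_dd: "bm (M (Suc (Suc n))) (dd n)"
 unfolding dd_def
 by (intro bm_intros prob_nu; simp add: measurable_cong_sets[OF sets_pair_measure_cong[OF refl sets_nu] refl])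

lemma dd_bounds:
 assumes z: "z \<in> space (M (Suc (Suc n)))"
 shows "\<epsilon> \<le> dd n z" "dd n z \<le> 1 / \<epsilon>"
proof -
 have b: "bm (M n) (\<lambda>x. p2 n x z)" by (intro bm_intros) (use z in measurable)
 have "(\<integral>x. \<epsilon> \<partial>\<nu> n) \<le> dd n z" unfolding dd_def
  by (intro nu_mono bm_intros b p2_ge' z)
 then show "\<epsilon> \<le> dd n z" by simp
 have "dd n z \<le> (\<integral>x. 1 / \<epsilon> \<partial>\<nu> n)" unfolding dd_def
  by (intro nu_mono bm_intros b p2_le z)
 then show "dd n z \<le> 1 / \<epsilon>" by simp
qed

lemma nu_two_step:
 fixes v :: "'a \<Rightarrow> complex"
 assumes v: "bm (M (Suc (Suc n))) v"
 shows "(\<integral>z. v z \<partial>\<nu> (Suc (Suc n))) = (\<integral>z. of_real (dd n z) * v z \<partial>M (Suc (Suc n)))"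
proof -
 have "(\<integral>z. v z \<partial>\<nu> (Suc (Suc n))) = (\<integral>x. PP n (PP (Suc n) v) x \<partial>\<nu> n)"
  using nu_inv[OF v] nu_inv[OF bm_PP[OF v]] by simp
 also have "\<dots> = (\<integral>x. \<integral>z. of_real (p2 n x z) * v z \<partial>M (Suc (Suc n)) \<partial>\<nu> n)"
  by (intro nu_cong PP_PP v)
 also have "\<dots> = (\<integral>z. \<integral>x. of_real (p2 n x z) * v z \<partial>\<nu> n \<partial>M (Suc (Suc n)))"
  by (rule bm_integral_swap[OF prob_nu prob_M], unfold bm_nu_pair)
    (intro bm_intros bm_comp[OF v]; measurable)
 also have "\<dots> = (\<integral>z. of_real (dd n z) * v z \<partial>M (Suc (Suc n)))"
  unfolding dd_def integral_complex_of_real'[symmetric] by simp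
 finally show ?thesis .
qed

lemma nu_two_step_real:
 fixes v :: "'a \<Rightarrow> real"
 assumes v: "bm (M (Suc (Suc n))) v"
 shows "(\<integral>z. v z \<partial>\<nu> (Suc (Suc n))) = (\<integral>z. dd n z * v z \<partial>M (Suc (Suc n)))"
 using nu_two_step[OF bm_of_real[OF v]]
 by (simp add: integral_complex_of_real' flip: of_real_mult)

lemma nu_inv_real:
 fixes v :: "'a \<Rightarrow> real"
 assumes v: "bm (M (Suc n)) v"
 shows "(\<integral>x. \<integral>y. p n x y * v y \<partial>M (Suc n) \<partial>\<nu> n) = (\<integral>z. v z \<partial>\<nu> (Suc n))"
 using nu_inv[OF bm_of_real[OF v]]
 by (simp add: PP_def integral_complex_of_real' flip: of_real_mult)

lemma p2_integral: "x \<in> space (M n) \<Longrightarrow> (\<integral>z. p2 n x z \<partial>M (Suc (Suc n))) = 1"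
proof -
 assume x: "x \<in> space (M n)"
 have "complex_of_real (\<integral>z. p2 n x z \<partial>M (Suc (Suc n))) = PP n (PP (Suc n) (\<lambda>_. 1)) x"
  using PP_PP[OF bm_const[of _ 1] x] by (simp add: integral_complex_of_real')
 also have "\<dots> = PP n (\<lambda>_. 1) x"
  unfolding PP_def[of n] by (intro Bochner_Integration.integral_cong) (auto simp: PP_const)
 also have "\<dots> = complex_of_real 1" using PP_const[OF x] by simp
 finally show ?thesis using of_real_eq_iff by blast
qed

definition QQ :: "nat \<Rightarrow> ('a \<Rightarrow> complex) \<Rightarrow> real" where
 "QQ n v = (\<integral>x. (norm (v x))\<^sup>2 \<partial>\<nu> n)"

lemma QQ_nonneg: "0 \<le> QQ n v"
 unfolding QQ_def by simp

lemma QQ_cong: "(\<And>x. x \<in> space (M n) \<Longrightarrow> v x = u x) \<Longrightarrow> QQ n v = QQ n u"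
 unfolding QQ_def by (intro nu_cong) simp

lemma QQ_scale: "QQ n (\<lambda>x. c * v x) = (norm c)\<^sup>2 * QQ n v"
 unfolding QQ_def by (simp add: norm_mult power_mult_distrib)

lemma QQ_add:
 assumes v: "bm (M n) v" and u: "bm (M n) u" and d: "0 < d"
 shows "QQ n (\<lambda>x. v x + u x) \<le> (1 + d) * QQ n v + (1 + 1 / d) * QQ n u"
proof -
 have "QQ n (\<lambda>x. v x + u x) \<le> (\<integral>x. (1 + d) * (norm (v x))\<^sup>2 + (1 + 1 / d) * (norm (u x))\<^sup>2 \<partial>\<nu> n)"
  unfolding QQ_def
 proof (intro nu_mono bm_intros v u)
  fix x
  have "(norm (v x + u x))\<^sup>2 \<le> (norm (v x) + norm (u x))\<^sup>2"
   by (intro power_mono norm_triangle_ineq) auto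
  also have "\<dots> \<le> (1 + d) * (norm (v x))\<^sup>2 + (1 + 1 / d) * (norm (u x))\<^sup>2"
  proof -
   have "0 \<le> (sqrt d * norm (v x) - norm (u x) / sqrt d)\<^sup>2" by simp
   also have "\<dots> = d * (norm (v x))\<^sup>2 - 2 * norm (v x) * norm (u x) + (norm (u x))\<^sup>2 / d"
    using d by (simp add: power2_diff power_mult_distrib power_divide)
   finally show ?thesis by (simp add: power2_sum algebra_simps)
  qed
  finally show "(norm (v x + u x))\<^sup>2 \<le> (1 + d) * (norm (v x))\<^sup>2 + (1 + 1 / d) * (norm (u x))\<^sup>2" .
 qed
 also have "\<dots> = (1 + d) * QQ n v + (1 + 1 / d) * QQ n u"
  unfolding QQ_def
  by (subst Bochner_Integration.integral_add) (auto intro!: integrable_nu bm_intros v u)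
 finally show ?thesis .
qed

lemma nu_norm_sq_le_QQ:
 assumes v: "bm (M n) v"
 shows "(norm (\<integral>x. v x \<partial>\<nu> n))\<^sup>2 \<le> QQ n v"
 using weighted_Cauchy_Schwarz[OF fin_nu, of n "\<lambda>_. 1" v] v unfolding QQ_def
 by (simp add: bm_const bm_nu)

lemma QQ_PP_le:
 assumes v: "bm (M (Suc n)) v"
 shows "QQ n (PP n v) \<le> QQ (Suc n) v"
proof -
 have "QQ n (PP n v) \<le> (\<integral>x. \<integral>y. p n x y * (norm (v y))\<^sup>2 \<partial>M (Suc n) \<partial>\<nu> n)"
  unfolding QQ_def
  by (intro nu_mono PP_norm_sq_le v bm_intros prob_M bm_comp[OF v]; measurable)
 also have "\<dots> = QQ (Suc n) v"
  unfolding QQ_def by (intro nu_inv_real bm_intros v)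
 finally show ?thesis .
qed

text \<open>Doeblin's argument. Since \<open>p2 n \<ge> \<epsilon>\<close> and
  \<open>dd n \<le> 1 / \<epsilon>\<close>, the kernel
  \<open>k = p2 - \<epsilon>\<^sup>2 * dd\<close> is nonnegative, and the subtracted part integrates
  \<open>v\<close> to zero. The mass of \<open>k\<close> in \<open>z\<close> is
  \<open>1 - \<epsilon>\<^sup>2\<close>, which Cauchy-Schwarz turns into one factor; its integral
  over \<open>x\<close> is \<open>(1 - \<epsilon>\<^sup>2) * dd\<close>, which yields the other
  after Fubini.\<close>

lemma QQ_PP_PP_le:
 assumes v: "bm (M (Suc (Suc n))) v" and v0: "(\<integral>z. v z \<partial>\<nu> (Suc (Suc n))) = 0"
 shows "QQ n (PP n (PP (Suc n) v)) \<le> (1 - \<epsilon>\<^sup>2)\<^sup>2 * QQ (Suc (Suc n)) v"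
proof -
 let ?N = "M (Suc (Suc n))"
 define k where "k x z = p2 n x z - \<epsilon>\<^sup>2 * dd n z" for x z
 have bk: "bm N (\<lambda>w. k (x w) (z w))"
  if "x \<in> measurable N (M n)" "z \<in> measurable N ?N" for N :: "'z measure" and x z
  unfolding k_def by (intro bm_intros bm_comp[OF bm_dd] that)
 have bk': "bm N (\<lambda>w. k (x w) (z w))"
  if "x \<in> measurable N (M n)" "z \<in> measurable N ?N" for N :: "('a \<times> 'a) measure" and x z
  unfolding k_def by (intro bm_intros bm_comp[OF bm_dd] that)
 have bkx: "bm ?N (k x)" if "x \<in> space (M n)" for x
  unfolding k_def by (intro bm_intros bm_dd; use that in measurable)
 have k0: "0 \<le> k x z" if "x \<in> space (M n)" "z \<in> space ?N" for x z
 proof -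
  have "\<epsilon>\<^sup>2 * dd n z \<le> \<epsilon>\<^sup>2 * (1 / \<epsilon>)" using dd_bounds[OF that(2)] by (intro mult_left_mono) auto
  also have "\<dots> = \<epsilon>" using eps by (simp add: power2_eq_square)
  also have "\<dots> \<le> p2 n x z" by (rule p2_ge'[OF that])
  finally show ?thesis by (simp add: k_def)
 qed
 have kint: "(\<integral>z. k x z \<partial>?N) = 1 - \<epsilon>\<^sup>2" if x: "x \<in> space (M n)" for x
 proof -
  have "(\<integral>z. dd n z \<partial>?N) = 1" using nu_two_step_real[OF bm_const[of _ 1], of n] by simp
  moreover have "bm ?N (p2 n x)" using bm_p2[of "\<lambda>_. x" ?N n "\<lambda>z. z"] x by simp
  ultimately show ?thesis
   unfolding k_def using p2_integral[OF x] by (simp add: integrable_M bm_dd bm_intros)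
 qed
 have eq: "PP n (PP (Suc n) v) x = (\<integral>z. of_real (k x z) * v z \<partial>?N)" if x: "x \<in> space (M n)" for x
 proof -
  have bp: "bm ?N (p2 n x)" using bm_p2[of "\<lambda>_. x" ?N n "\<lambda>z. z"] x by simp
  have "(\<integral>z. of_real (k x z) * v z \<partial>?N) =
    (\<integral>z. of_real (p2 n x z) * v z - of_real (\<epsilon>\<^sup>2) * (of_real (dd n z) * v z) \<partial>?N)"
   by (simp add: k_def algebra_simps)
  also have "\<dots> = (\<integral>z. of_real (p2 n x z) * v z \<partial>?N) - of_real (\<epsilon>\<^sup>2) * (\<integral>z. of_real (dd n z) * v z \<partial>?N)"
   by (subst Bochner_Integration.integral_diff) (auto intro!: integrable_M bm_intros bp v bm_dd)
  finally show ?thesis using PP_PP[OF v x] nu_two_step[OF v] v0 by simp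
 qed
 have "QQ n (PP n (PP (Suc n) v)) \<le> (\<integral>x. (1 - \<epsilon>\<^sup>2) * (\<integral>z. k x z * (norm (v z))\<^sup>2 \<partial>?N) \<partial>\<nu> n)"
  unfolding QQ_def
 proof (intro nu_mono bm_intros v prob_M bm_comp[OF v] bk')
  fix x assume x: "x \<in> space (M n)"
  show "(norm (PP n (PP (Suc n) v) x))\<^sup>2 \<le> (1 - \<epsilon>\<^sup>2) * (\<integral>z. k x z * (norm (v z))\<^sup>2 \<partial>?N)"
   unfolding eq[OF x] kint[OF x, symmetric]
   by (intro weighted_Cauchy_Schwarz fin_M bkx x k0 v)
 qed measurable
 also have "\<dots> = (1 - \<epsilon>\<^sup>2) * (\<integral>x. \<integral>z. k x z * (norm (v z))\<^sup>2 \<partial>?N \<partial>\<nu> n)" by simp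
 also have "(\<integral>x. \<integral>z. k x z * (norm (v z))\<^sup>2 \<partial>?N \<partial>\<nu> n) = (\<integral>z. \<integral>x. k x z * (norm (v z))\<^sup>2 \<partial>\<nu> n \<partial>?N)"
  by (rule bm_integral_swap[OF prob_nu prob_M], unfold bm_nu_pair)
    (intro bm_intros bm_comp[OF v] bk'; measurable)
 also have "\<dots> = (\<integral>z. (1 - \<epsilon>\<^sup>2) * (dd n z * (norm (v z))\<^sup>2) \<partial>?N)"
 proof (intro integral_congI)
  fix z assume z: "z \<in> space ?N"
  have b: "bm (M n) (\<lambda>x. p2 n x z)" by (intro bm_intros) (use z in measurable)
  have "(\<integral>x. k x z \<partial>\<nu> n) = (1 - \<epsilon>\<^sup>2) * dd n z"
   unfolding k_def by (subst Bochner_Integration.integral_diff)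
    (auto intro!: integrable_nu b bm_intros simp: dd_def[symmetric] algebra_simps)
  then show "(\<integral>x. k x z * (norm (v z))\<^sup>2 \<partial>\<nu> n) = (1 - \<epsilon>\<^sup>2) * (dd n z * (norm (v z))\<^sup>2)" by simp
 qed
 also have "\<dots> = (1 - \<epsilon>\<^sup>2) * QQ (Suc (Suc n)) v"
  unfolding QQ_def by (subst nu_two_step_real; (intro bm_intros v)?) simp
 finally show ?thesis by (simp add: power2_eq_square)
qed

end

lemma three_ab_le: "3 * a\<^sup>2 + 3 * a * b \<le> 5 * a\<^sup>2 + 2 * (b::real)\<^sup>2"
proof -
 have "2 * a * b \<le> a\<^sup>2 + b\<^sup>2" by (rule sum_squares_bound)
 then have "3 * a * b \<le> 3 / 2 * a\<^sup>2 + 3 / 2 * b\<^sup>2" by simp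
 then show ?thesis using zero_le_power2[of a] zero_le_power2[of b] by linarith
qed

section \<open>One perturbed step near the constant function\<close>

context chain_law
begin

text \<open>The expectation of \<open>F\<close> at the pair of states visited at the times
  \<open>n\<close> and \<open>n + 1\<close>.\<close>

definition EE :: "nat \<Rightarrow> ('a \<Rightarrow> 'a \<Rightarrow> real) \<Rightarrow> real" where
 "EE n F = (\<integral>x. \<integral>y. p n x y * F x y \<partial>M (Suc n) \<partial>\<nu> n)"

lemma EE_lincomb:
 assumes F: "bm (M n \<Otimes>\<^sub>M M (Suc n)) (\<lambda>w. F (fst w) (snd w))"
  and G: "bm (M n \<Otimes>\<^sub>M M (Suc n)) (\<lambda>w. G (fst w) (snd w))"
 shows "EE n (\<lambda>x y. a * F x y + b * G x y) = a * EE n F + b * EE n G"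
proof -
 have s: "bm (M (Suc n)) (F x)" "bm (M (Suc n)) (G x)" if "x \<in> space (M n)" for x
  using bm_section[OF F that] bm_section[OF G that] by auto
 have "EE n (\<lambda>x y. a * F x y + b * G x y) =
   (\<integral>x. a * (\<integral>y. p n x y * F x y \<partial>M (Suc n)) + b * (\<integral>y. p n x y * G x y \<partial>M (Suc n)) \<partial>\<nu> n)"
  unfolding EE_def
 proof (rule nu_cong)
  fix x assume x: "x \<in> space (M n)"
  have i: "integrable (M (Suc n)) (\<lambda>y. p n x y * F x y)" "integrable (M (Suc n)) (\<lambda>y. p n x y * G x y)"
   by (intro integrable_M bm_intros bm_p_fix x s)+
  have "(\<integral>y. p n x y * (a * F x y + b * G x y) \<partial>M (Suc n)) =
   (\<integral>y. a * (p n x y * F x y) + b * (p n x y * G x y) \<partial>M (Suc n))"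
   by (simp add: algebra_simps)
  also have "\<dots> = a * (\<integral>y. p n x y * F x y \<partial>M (Suc n)) + b * (\<integral>y. p n x y * G x y \<partial>M (Suc n))"
   using i by simp
  finally show "(\<integral>y. p n x y * (a * F x y + b * G x y) \<partial>M (Suc n)) =
   a * (\<integral>y. p n x y * F x y \<partial>M (Suc n)) + b * (\<integral>y. p n x y * G x y \<partial>M (Suc n))" .
 qed
 moreover have "integrable (\<nu> n) (\<lambda>x. \<integral>y. p n x y * F x y \<partial>M (Suc n))"
  "integrable (\<nu> n) (\<lambda>x. \<integral>y. p n x y * G x y \<partial>M (Suc n))"
  by (intro integrable_nu bm_intros prob_M F G; measurable)+
 ultimately show ?thesis unfolding EE_def by simp
qed

lemma EE_mono:
 assumes F: "bm (M n \<Otimes>\<^sub>M M (Suc n)) (\<lambda>w. F (fst w) (snd w))"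
  and G: "bm (M n \<Otimes>\<^sub>M M (Suc n)) (\<lambda>w. G (fst w) (snd w))"
  and le: "\<And>x y. x \<in> space (M n) \<Longrightarrow> y \<in> space (M (Suc n)) \<Longrightarrow> F x y \<le> G x y"
 shows "EE n F \<le> EE n G"
 unfolding EE_def
 by (intro nu_mono bm_integral_mono[OF fin_M] bm_intros prob_M F G bm_p_fix bm_section[OF F]
   bm_section[OF G] mult_left_mono le p_nonneg; measurable)

lemma EE_snd:
 fixes v :: "'a \<Rightarrow> real"
 shows "bm (M (Suc n)) v \<Longrightarrow> EE n (\<lambda>x y. v y) = (\<integral>y. v y \<partial>\<nu> (Suc n))"
 unfolding EE_def by (rule nu_inv_real)

lemma EE_fst:
 fixes v :: "'a \<Rightarrow> real"
 shows "bm (M n) v \<Longrightarrow> EE n (\<lambda>x y. v x) = (\<integral>x. v x \<partial>\<nu> n)"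
 unfolding EE_def by (intro nu_cong) (simp add: p_integral)

lemma EE_const [simp]: "EE n (\<lambda>x y. c) = c"
 using EE_fst[of n "\<lambda>_. c"] by (simp add: bm_intros)

definition edge_centered :: "(nat \<Rightarrow> 'a \<Rightarrow> 'a \<Rightarrow> real) \<Rightarrow> bool" where
 "edge_centered f \<longleftrightarrow> (\<forall>n. EE n (f n) = 0)"

definition ww :: "(nat \<Rightarrow> 'a \<Rightarrow> 'a \<Rightarrow> real) \<Rightarrow> nat \<Rightarrow> real" where
 "ww f n = EE n (\<lambda>x y. (f n x y)\<^sup>2)"

lemma bm_f_pair: "adm K f \<Longrightarrow> bm (M n \<Otimes>\<^sub>M M (Suc n)) (\<lambda>w. f n (fst w) (snd w))"
 by (rule bm_f) auto

lemma ww_bounds: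
 assumes "adm K f" shows "0 \<le> ww f n" "ww f n \<le> K\<^sup>2"
proof -
 have "EE n (\<lambda>x y. 0) \<le> ww f n" unfolding ww_def
  by (intro EE_mono bm_intros bm_f_pair[OF assms]) auto
 then show "0 \<le> ww f n" by simp
 have "ww f n \<le> EE n (\<lambda>x y. K\<^sup>2)" unfolding ww_def
  using adm_le[OF assms] adm_nonneg[OF assms]
  by (intro EE_mono bm_intros bm_f_pair[OF assms]) (auto simp: abs_le_square_iff[symmetric])
 then show "ww f n \<le> K\<^sup>2" by simp
qed

text \<open>A single step need not contract, only two steps together do. Adding the norm one step
  further back with weight \<open>1 / (1 - \<epsilon>\<^sup>2)\<close> turns the two-step factor
  \<open>(1 - \<epsilon>\<^sup>2)\<^sup>2\<close> into a factor
  \<open>1 - \<epsilon>\<^sup>2\<close> for every single step: the two summands of the new value are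
  controlled by the two of the old one in exchanged order.\<close>

definition Bq :: "nat \<Rightarrow> ('a \<Rightarrow> complex) \<Rightarrow> real" where
 "Bq m v = QQ (Suc m) v + QQ m (PP m v) / (1 - \<epsilon>\<^sup>2)"

lemma eps2: "0 < \<epsilon>\<^sup>2" "\<epsilon>\<^sup>2 < 1" "0 < 1 - \<epsilon>\<^sup>2"
 using eps by (auto simp: power_less_one_iff)

lemma Bq_nonneg: "0 \<le> Bq m v" and QQ_le_Bq: "QQ (Suc m) v \<le> Bq m v"
 unfolding Bq_def using QQ_nonneg eps2 by (auto intro!: add_nonneg_nonneg divide_nonneg_nonneg)

lemma Bq_scale:
 "Bq m (\<lambda>x. c * v x) = (norm c)\<^sup>2 * Bq m v"
proof -
 have "PP m (\<lambda>x. c * v x) = (\<lambda>x. c * PP m v x)"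
  unfolding PP_def by (simp add: mult.left_commute)
 then show ?thesis unfolding Bq_def by (simp add: QQ_scale algebra_simps)
qed

lemma Bq_perturb:
 assumes v: "bm (M (Suc (Suc m))) v" and v0: "(\<integral>z. v z \<partial>\<nu> (Suc (Suc m))) = 0"
  and e: "bm (M (Suc m)) e" and d: "0 < d"
 shows "Bq m (\<lambda>x. PP (Suc m) v x + e x) \<le>
  (1 + d) * (1 - \<epsilon>\<^sup>2) * Bq (Suc m) v + (1 + 1 / d) * (1 + 1 / (1 - \<epsilon>\<^sup>2)) * QQ (Suc m) e"
proof -
 define r where "r = 1 - \<epsilon>\<^sup>2"
 have r: "0 < r" using eps2 by (simp add: r_def)
 have bu: "bm (M (Suc m)) (\<lambda>x. PP (Suc m) v x)" by (intro bm_intros v)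
 have PPadd: "PP m (\<lambda>x. PP (Suc m) v x + e x) x = PP m (PP (Suc m) v) x + PP m e x"
  if x: "x \<in> space (M m)" for x
  unfolding PP_def[of m] using x
  by (simp add: distrib_left integrable_M bm_intros bm_p_fix bu e)
 have "QQ m (PP m (\<lambda>x. PP (Suc m) v x + e x)) = QQ m (\<lambda>x. PP m (PP (Suc m) v) x + PP m e x)"
  by (intro QQ_cong PPadd)
 also have "\<dots> \<le> (1 + d) * QQ m (PP m (PP (Suc m) v)) + (1 + 1 / d) * QQ m (PP m e)"
  by (intro QQ_add bm_intros v e d)
 also have "\<dots> \<le> (1 + d) * (r\<^sup>2 * QQ (Suc (Suc m)) v) + (1 + 1 / d) * QQ (Suc m) e"
  unfolding r_def using d
  by (intro add_mono mult_left_mono QQ_PP_PP_le[OF v v0] QQ_PP_le e) auto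
 finally have "QQ m (PP m (\<lambda>x. PP (Suc m) v x + e x)) / r \<le>
   ((1 + d) * (r\<^sup>2 * QQ (Suc (Suc m)) v) + (1 + 1 / d) * QQ (Suc m) e) / r"
  using r by (intro divide_right_mono) auto
 also have "\<dots> = (1 + d) * (r * QQ (Suc (Suc m)) v) + (1 + 1 / d) * (QQ (Suc m) e / r)"
  using r by (simp add: add_divide_distrib power2_eq_square)
 finally have 1: "QQ m (PP m (\<lambda>x. PP (Suc m) v x + e x)) / r \<le>
   (1 + d) * (r * QQ (Suc (Suc m)) v) + (1 + 1 / d) * (QQ (Suc m) e / r)" .
 have 2: "QQ (Suc m) (\<lambda>x. PP (Suc m) v x + e x) \<le>
   (1 + d) * QQ (Suc m) (PP (Suc m) v) + (1 + 1 / d) * QQ (Suc m) e"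
  by (intro QQ_add bm_intros v e d)
 have "Bq m (\<lambda>x. PP (Suc m) v x + e x) \<le>
   (1 + d) * (QQ (Suc m) (PP (Suc m) v) + r * QQ (Suc (Suc m)) v) + (1 + 1 / d) * (QQ (Suc m) e + QQ (Suc m) e / r)"
  using 1 2 unfolding Bq_def r_def[symmetric] by (simp add: algebra_simps)
 also have "\<dots> = (1 + d) * r * Bq (Suc m) v + (1 + 1 / d) * (1 + 1 / r) * QQ (Suc m) e"
  unfolding Bq_def r_def[symmetric] using r d by (simp add: field_simps)
 finally show ?thesis by (simp add: r_def)
qed

context
 fixes f :: "nat \<Rightarrow> 'a \<Rightarrow> 'a \<Rightarrow> real" and K :: real and \<zeta> :: complex and v :: "'a \<Rightarrow> complex" and n :: nat
 assumes f: "adm K f" and cent: "EE n (f n) = 0" and small: "norm \<zeta> * K \<le> 1"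
  and v: "bm (M (Suc n)) v" and v0: "(\<integral>y. v y \<partial>\<nu> (Suc n)) = 0"
begin

private definition "g = LL f \<zeta> n (\<lambda>y. 1 + v y)"
private definition "E x = g x - 1 - PP n v x"

private lemma bm_g: "bm (M n) g"
 unfolding g_def by (intro bm_LL[OF f] bm_intros v)

private lemma bm_E: "bm (M n) E"
 unfolding E_def by (intro bm_intros bm_g v)

private lemma arg_le: "norm (\<zeta> * of_real (f n x y)) \<le> 1"
 using mult_left_mono[OF adm_le[OF f], of "norm \<zeta>" n x y] small by (simp add: norm_mult)

private lemma exp1_le: "norm (exp (\<zeta> * of_real (f n x y)) - 1) \<le> 3 * norm \<zeta> * \<bar>f n x y\<bar>"
 using exp_minus_1_le(1)[OF arg_le[of x y]] by (simp add: norm_mult)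

private lemma E_eq:
 assumes x: "x \<in> space (M n)"
 shows "E x = (\<integral>y. of_real (p n x y) * ((exp (\<zeta> * of_real (f n x y)) - 1) * (1 + v y)) \<partial>M (Suc n))"
proof -
 have b: "integrable (M (Suc n)) (\<lambda>y. of_real (p n x y) * (exp (\<zeta> * of_real (f n x y)) * (1 + v y)))"
  "integrable (M (Suc n)) (\<lambda>y. of_real (p n x y) * v y)"
  "integrable (M (Suc n)) (\<lambda>y. complex_of_real (p n x y))"
  by (intro integrable_M bm_intros bm_p_fix[OF x] bm_f_fix[OF f x] v)+
 have "E x = (\<integral>y. of_real (p n x y) * (exp (\<zeta> * of_real (f n x y)) * (1 + v y)) \<partial>M (Suc n))
   - (\<integral>y. complex_of_real (p n x y) \<partial>M (Suc n)) - (\<integral>y. of_real (p n x y) * v y \<partial>M (Suc n))"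
  using p_integral[OF x] by (simp add: E_def g_def LL_def PP_def integral_complex_of_real')
 also have "\<dots> = (\<integral>y. of_real (p n x y) * (exp (\<zeta> * of_real (f n x y)) * (1 + v y))
   - of_real (p n x y) - of_real (p n x y) * v y \<partial>M (Suc n))"
  by (subst Bochner_Integration.integral_diff Bochner_Integration.integral_diff,
    intro b Bochner_Integration.integrable_diff, simp add: b)+ simp
 also have "\<dots> = (\<integral>y. of_real (p n x y) * ((exp (\<zeta> * of_real (f n x y)) - 1) * (1 + v y)) \<partial>M (Suc n))"
  by (intro Bochner_Integration.integral_cong) (auto simp: algebra_simps)
 finally show ?thesis .
qed

private lemma QQ_E: "QQ n E \<le> 18 * (norm \<zeta>)\<^sup>2 * (ww f n + K\<^sup>2 * QQ (Suc n) v)"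
proof -
 let ?G = "\<lambda>x y. (18 * (norm \<zeta>)\<^sup>2) * (f n x y)\<^sup>2 + (18 * (norm \<zeta>)\<^sup>2 * K\<^sup>2) * (norm (v y))\<^sup>2"
 have bG: "bm (M n \<Otimes>\<^sub>M M (Suc n)) (\<lambda>w. ?G (fst w) (snd w))"
  by (intro bm_intros bm_f[OF f] bm_comp[OF v]; measurable)
 have "QQ n E \<le> EE n ?G"
  unfolding QQ_def EE_def
 proof (intro nu_mono)
  fix x assume x: "x \<in> space (M n)"
  let ?h = "\<lambda>y. (exp (\<zeta> * of_real (f n x y)) - 1) * (1 + v y)"
  have bh: "bm (M (Suc n)) ?h" by (intro bm_intros bm_f_fix[OF f x] v)
  have "(norm (E x))\<^sup>2 \<le> (\<integral>y. p n x y * (norm (?h y))\<^sup>2 \<partial>M (Suc n))"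
   using weighted_Cauchy_Schwarz[OF fin_M bm_p_fix[OF x] p_nonneg bh] p_integral[OF x]
   by (simp add: E_eq[OF x])
  also have "\<dots> \<le> (\<integral>y. p n x y * ?G x y \<partial>M (Suc n))"
  proof (intro bm_integral_mono[OF fin_M] mult_left_mono p_nonneg bm_intros bh
    bm_f_fix[OF f x] v measurable_const[OF x] measurable_ident_sets[OF refl])
   fix y
   have "norm (?h y) \<le> (3 * norm \<zeta> * \<bar>f n x y\<bar>) * (1 + norm (v y))"
    unfolding norm_mult using exp1_le[of x y]
    by (intro mult_mono) (auto intro: order.trans[OF norm_triangle_ineq])
   then have "(norm (?h y))\<^sup>2 \<le> ((3 * norm \<zeta> * \<bar>f n x y\<bar>) * (1 + norm (v y)))\<^sup>2"
    by (intro power_mono) auto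
   also have "\<dots> = 9 * (norm \<zeta>)\<^sup>2 * (f n x y)\<^sup>2 * (1 + norm (v y))\<^sup>2"
    by (simp add: power_mult_distrib)
   also have "\<dots> \<le> 9 * (norm \<zeta>)\<^sup>2 * (f n x y)\<^sup>2 * (2 + 2 * (norm (v y))\<^sup>2)"
    using sum_squares_bound[of 1 "norm (v y)"]
    by (intro mult_left_mono) (auto simp: power2_sum)
   also have "\<dots> = 18 * (norm \<zeta>)\<^sup>2 * (f n x y)\<^sup>2 + 18 * (norm \<zeta>)\<^sup>2 * (norm (v y))\<^sup>2 * (f n x y)\<^sup>2"
    by (simp add: algebra_simps)
   also have "\<dots> \<le> 18 * (norm \<zeta>)\<^sup>2 * (f n x y)\<^sup>2 + 18 * (norm \<zeta>)\<^sup>2 * (norm (v y))\<^sup>2 * K\<^sup>2"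
    using adm_le[OF f, of n x y] adm_nonneg[OF f]
    by (intro add_mono mult_left_mono) (auto simp: abs_le_square_iff[symmetric])
   finally show "(norm (?h y))\<^sup>2 \<le> ?G x y" by (simp add: algebra_simps)
  qed
  finally show "(norm (E x))\<^sup>2 \<le> (\<integral>y. p n x y * ?G x y \<partial>M (Suc n))" .
 qed (intro bm_intros bm_E prob_M bm_f[OF f] bm_comp[OF v]; measurable)+
 also have "EE n ?G = 18 * (norm \<zeta>)\<^sup>2 * ww f n + 18 * (norm \<zeta>)\<^sup>2 * K\<^sup>2 * EE n (\<lambda>x y. (norm (v y))\<^sup>2)"
  unfolding ww_def
  by (rule EE_lincomb) (intro bm_intros bm_f[OF f] bm_comp[OF v]; measurable)+
 also have "EE n (\<lambda>x y. (norm (v y))\<^sup>2) = QQ (Suc n) v"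
  unfolding QQ_def by (intro EE_snd bm_intros v)
 finally show ?thesis by (simp add: algebra_simps)
qed

private lemma lam_eq: "(\<integral>x. g x \<partial>\<nu> n) - 1 = (\<integral>x. E x \<partial>\<nu> n)"
proof -
 have "(\<integral>x. E x \<partial>\<nu> n) = (\<integral>x. g x \<partial>\<nu> n) - (\<integral>x. 1 \<partial>\<nu> n) - (\<integral>x. PP n v x \<partial>\<nu> n)"
  unfolding E_def using integrable_nu[OF bm_g] integrable_nu[OF bm_PP[OF v]] by (simp add: integrable_nu bm_intros)
 then show ?thesis using nu_inv[OF v] v0 by simp
qed

text \<open>Centering removes the mean of the linear term \<open>\<zeta> * f\<close>, which may
  therefore be subtracted under the integral. What remains is quadratic in \<open>\<zeta>\<close> or
  a product of \<open>\<zeta> * f\<close> with \<open>v\<close>, so the mean of the image deviates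
  from 1 only to second order although \<open>E\<close> itself is of first order.\<close>

private lemma lam_le: "norm ((\<integral>x. g x \<partial>\<nu> n) - 1) \<le> 5 * (norm \<zeta>)\<^sup>2 * ww f n + 2 * QQ (Suc n) v"
proof -
 let ?F = "\<lambda>x. \<integral>y. of_real (p n x y) * of_real (f n x y) \<partial>M (Suc n) :: complex"
 let ?G = "\<lambda>x y. (5 * (norm \<zeta>)\<^sup>2) * (f n x y)\<^sup>2 + 2 * (norm (v y))\<^sup>2"
 have bF: "bm (M n) ?F" by (intro bm_intros prob_M bm_f[OF f]; measurable)
 have bG: "bm (M n \<Otimes>\<^sub>M M (Suc n)) (\<lambda>w. ?G (fst w) (snd w))"
  by (intro bm_intros bm_f[OF f] bm_comp[OF v]; measurable)
 have "(\<integral>x. ?F x \<partial>\<nu> n) = complex_of_real (EE n (f n))"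
  unfolding EE_def by (simp add: integral_complex_of_real' flip: of_real_mult)
 then have "(\<integral>x. E x \<partial>\<nu> n) = (\<integral>x. E x - \<zeta> * ?F x \<partial>\<nu> n)"
  using cent integrable_nu[OF bm_E] integrable_nu[OF bF] by simp
 also have "norm \<dots> \<le> EE n ?G"
  unfolding EE_def
 proof (rule nu_norm_le)
  fix x assume x: "x \<in> space (M n)"
  let ?u = "\<lambda>y. (exp (\<zeta> * of_real (f n x y)) - 1) * (1 + v y)"
  have bu: "bm (M (Suc n)) ?u" by (intro bm_intros bm_f_fix[OF f x] v)
  have "E x - \<zeta> * ?F x = (\<integral>y. of_real (p n x y) * ?u y - \<zeta> * (of_real (p n x y) * of_real (f n x y)) \<partial>M (Suc n))"
   unfolding E_eq[OF x]
   by (subst Bochner_Integration.integral_diff)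
     (auto intro!: integrable_M bm_intros bu bm_p_fix x bm_f_fix[OF f])
  also have "\<dots> = (\<integral>y. of_real (p n x y) * (?u y - \<zeta> * of_real (f n x y)) \<partial>M (Suc n))"
   by (simp add: algebra_simps)
  also have "norm \<dots> \<le> (\<integral>y. p n x y * ?G x y \<partial>M (Suc n))"
  proof (intro bm_integral_norm_le[OF fin_M] bm_intros bu
    bm_f_fix[OF f x] v measurable_const[OF x] measurable_ident_sets[OF refl])
   fix y
   let ?z = "\<zeta> * of_real (f n x y)"
   have "norm (?u y - ?z) = norm ((exp ?z - 1 - ?z) + (exp ?z - 1) * v y)"
    by (simp add: algebra_simps)
   also have "\<dots> \<le> 3 * (norm ?z)\<^sup>2 + (3 * norm \<zeta> * \<bar>f n x y\<bar>) * norm (v y)"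
    using exp_minus_1_le(2)[OF arg_le[of x y]] mult_right_mono[OF exp1_le[of x y], of "norm (v y)"]
    by (intro norm_triangle_mono) (simp_all add: norm_mult)
   also have "\<dots> = 3 * (norm \<zeta> * \<bar>f n x y\<bar>)\<^sup>2 + 3 * (norm \<zeta> * \<bar>f n x y\<bar>) * norm (v y)"
    by (simp add: norm_mult)
   also have "\<dots> \<le> 5 * (norm \<zeta> * \<bar>f n x y\<bar>)\<^sup>2 + 2 * (norm (v y))\<^sup>2"
    by (rule three_ab_le)
   also have "\<dots> = ?G x y" by (simp add: power_mult_distrib)
   finally show "norm (complex_of_real (p n x y) * (?u y - ?z)) \<le> p n x y * ?G x y"
    by (simp add: norm_mult p_nonneg mult_left_mono)
  qed
  finally show "norm (E x - \<zeta> * ?F x) \<le> (\<integral>y. p n x y * ?G x y \<partial>M (Suc n))" .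
 qed (intro bm_intros bm_E bF prob_M bm_f[OF f] bm_comp[OF v]; measurable)+
 also have "EE n ?G = 5 * (norm \<zeta>)\<^sup>2 * ww f n + 2 * EE n (\<lambda>x y. (norm (v y))\<^sup>2)"
  unfolding ww_def
  by (rule EE_lincomb) (intro bm_intros bm_f[OF f] bm_comp[OF v]; measurable)+
 also have "EE n (\<lambda>x y. (norm (v y))\<^sup>2) = QQ (Suc n) v"
  unfolding QQ_def by (intro EE_snd bm_intros v)
 finally show ?thesis by (simp add: lam_eq)
qed

text \<open>Subtracting the mean from \<open>E\<close> costs a factor 4 over the bound 18, which is
  the origin of the 72 in the constant \<open>A\<close>.\<close>

private lemma QQ_e:
 "QQ n (\<lambda>x. E x - ((\<integral>x. g x \<partial>\<nu> n) - 1)) \<le> 72 * (norm \<zeta>)\<^sup>2 * (ww f n + K\<^sup>2 * QQ (Suc n) v)"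
proof -
 let ?c = "(\<integral>x. g x \<partial>\<nu> n) - 1"
 have "QQ n (\<lambda>x. E x + (- ?c)) \<le> (1 + 1) * QQ n E + (1 + 1 / 1) * QQ n (\<lambda>_. - ?c)"
  by (intro QQ_add bm_intros bm_E) simp
 also have "QQ n (\<lambda>_. - ?c) = (norm ?c)\<^sup>2" by (simp add: QQ_def norm_minus_commute)
 also have "(norm ?c)\<^sup>2 \<le> QQ n E" unfolding lam_eq by (rule nu_norm_sq_le_QQ[OF bm_E])
 finally have "QQ n (\<lambda>x. E x + (- ?c)) \<le> 4 * QQ n E" by simp
 then show ?thesis using QQ_E by (simp only: add_uminus_conv_diff)
qed

lemma perturb_eigenvalue:
 "norm ((\<integral>x. LL f \<zeta> n (\<lambda>y. 1 + v y) x \<partial>\<nu> n) - 1) \<le> 5 * (norm \<zeta>)\<^sup>2 * ww f n + 2 * QQ (Suc n) v"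
 using lam_le unfolding g_def .

text \<open>With \<open>s = \<epsilon>\<^sup>2\<close>, the perturbation inequality for
  \<open>Bq\<close> is used with \<open>d = s / 4\<close>. The contraction \<open>1 - s\<close>, the
  loss \<open>1 + s / 4\<close> and the share \<open>s / 4\<close> of the error that is proportional
  to \<open>Bq\<close> combine to at most \<open>1 - s / 2\<close>. Dividing by \<open>lam\<close>,
  which lies within \<open>s / 16\<close> of 1, costs another \<open>1 + s / 4\<close> and leaves
  \<open>1 - s / 4\<close>. The constant \<open>A\<close> collects 72, \<open>1 + 1 / d\<close> and
  \<open>1 + 1 / (1 - s)\<close>.\<close>

lemma perturb_eigenvector:
 assumes n: "n = Suc m" and A: "A = 72 * (1 + 4 / \<epsilon>\<^sup>2) * (1 + 1 / (1 - \<epsilon>\<^sup>2))"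
  and Asmall: "A * (norm \<zeta>)\<^sup>2 * K\<^sup>2 \<le> \<epsilon>\<^sup>2 / 4"
  and lam: "lam = (\<integral>x. LL f \<zeta> n (\<lambda>y. 1 + v y) x \<partial>\<nu> n)" "norm (lam - 1) \<le> \<epsilon>\<^sup>2 / 16"
 shows "Bq m (\<lambda>x. LL f \<zeta> n (\<lambda>y. 1 + v y) x / lam - 1) \<le> (1 - \<epsilon>\<^sup>2 / 4) * Bq n v + 2 * A * (norm \<zeta>)\<^sup>2 * ww f n"
proof -
 define s where "s = \<epsilon>\<^sup>2"
 have s: "0 < s" "s < 1" using eps2 by (auto simp: s_def)
 define h where "h = norm \<zeta>"
 let ?e = "\<lambda>x. E x - (lam - 1)"
 have lamg: "lam = (\<integral>x. g x \<partial>\<nu> n)" by (simp add: lam g_def)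
 have Qe: "QQ n ?e \<le> 72 * (norm \<zeta>)\<^sup>2 * (ww f n + K\<^sup>2 * QQ (Suc n) v)"
  unfolding lamg by (rule QQ_e)
 let ?w = "ww f n" and ?B = "Bq n v"
 have B0: "0 \<le> ?B" "QQ (Suc n) v \<le> ?B" and w0: "0 \<le> ?w"
  using Bq_nonneg QQ_le_Bq ww_bounds[OF f] by auto
 have A0: "0 < A" unfolding A s_def[symmetric] using s by (intro mult_pos_pos add_pos_pos) auto
 have 1: "Bq m (\<lambda>x. PP (Suc m) v x + ?e x) \<le>
  (1 + s / 4) * (1 - s) * ?B + (1 + 1 / (s / 4)) * (1 + 1 / (1 - s)) * QQ (Suc m) ?e"
  using Bq_perturb[of m v ?e "s / 4"] v v0 s bm_E unfolding n s_def by (simp add: bm_intros)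
 have "(1 + 1 / (s / 4)) * (1 + 1 / (1 - s)) * QQ (Suc m) ?e \<le>
  (1 + 1 / (s / 4)) * (1 + 1 / (1 - s)) * (72 * h\<^sup>2 * (?w + K\<^sup>2 * QQ (Suc n) v))"
  using Qe s unfolding n h_def by (intro mult_left_mono) auto
 also have "\<dots> = A * h\<^sup>2 * ?w + A * h\<^sup>2 * K\<^sup>2 * QQ (Suc n) v"
 proof -
  define b where "b = (1 + 1 / (s / 4)) * (1 + 1 / (1 - s))"
  have "A = 72 * b" by (simp add: A b_def s_def)
  then show ?thesis unfolding b_def[symmetric] by (simp add: algebra_simps)
 qed
 also have "\<dots> \<le> A * h\<^sup>2 * ?w + (s / 4) * ?B"
  using Asmall B0 s QQ_nonneg unfolding h_def s_def
  by (intro add_left_mono mult_mono) auto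
 finally have 2: "Bq m (\<lambda>x. PP (Suc m) v x + ?e x) \<le> ((1 + s / 4) * (1 - s) + s / 4) * ?B + A * h\<^sup>2 * ?w"
  using 1 by (simp add: algebra_simps)
 also have "\<dots> \<le> (1 - s / 2) * ?B + A * h\<^sup>2 * ?w"
  using s B0 by (intro add_right_mono mult_right_mono) (auto simp: algebra_simps)
 finally have 3: "Bq m (\<lambda>x. PP (Suc m) v x + ?e x) \<le> (1 - s / 2) * ?B + A * h\<^sup>2 * ?w" .
 have nl: "1 - s / 16 \<le> norm lam"
  using norm_triangle_ineq2[of 1 "1 - lam"] lam(2) by (simp add: s_def norm_minus_commute)
 then have lam0: "lam \<noteq> 0" and nl0: "0 < norm lam" using s by auto
 have "1 \<le> (1 - s / 16)\<^sup>2 * (1 + s / 4)"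
 proof -
  have "(1 - s / 16)\<^sup>2 * (1 + s / 4) - 1 = s * (1 / 8 - 7 * s / 256 + s\<^sup>2 / 1024)"
   by (simp add: power2_eq_square algebra_simps)
  moreover have "0 \<le> s * (1 / 8 - 7 * s / 256 + s\<^sup>2 / 1024)"
   using s by (intro mult_nonneg_nonneg add_nonneg_nonneg) auto
  ultimately show ?thesis by linarith
 qed
 also have "\<dots> \<le> (norm lam)\<^sup>2 * (1 + s / 4)"
  using nl s by (intro mult_right_mono power_mono) auto
 finally have inv: "(norm (1 / lam))\<^sup>2 \<le> 1 + s / 4"
  using nl0 by (simp add: norm_divide power_divide divide_le_eq mult.commute)
 have "LL f \<zeta> n (\<lambda>y. 1 + v y) x = PP n v x + (E x + 1)" for x
  by (simp add: E_def g_def)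
 then have "(\<lambda>x. LL f \<zeta> n (\<lambda>y. 1 + v y) x / lam - 1) = (\<lambda>x. (1 / lam) * (PP n v x + ?e x))"
  using lam0 by (simp add: divide_simps fun_eq_iff)
 then have "Bq m (\<lambda>x. LL f \<zeta> n (\<lambda>y. 1 + v y) x / lam - 1) =
   (norm (1 / lam))\<^sup>2 * Bq m (\<lambda>x. PP (Suc m) v x + ?e x)"
  by (simp only: Bq_scale n)
 also have "\<dots> \<le> (1 + s / 4) * ((1 - s / 2) * ?B + A * h\<^sup>2 * ?w)"
  using inv 3 s Bq_nonneg by (intro mult_mono) auto
 also have "\<dots> = (1 + s / 4) * (1 - s / 2) * ?B + (1 + s / 4) * (A * h\<^sup>2 * ?w)"
  by (simp add: algebra_simps)
 also have "\<dots> \<le> (1 - s / 4) * ?B + 2 * (A * h\<^sup>2 * ?w)"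
  using s B0 w0 A0 by (intro add_mono mult_right_mono) (auto simp: algebra_simps)
 finally show ?thesis by (simp add: s_def h_def)
qed

end

end

section \<open>Exponential bounds for moment generating functions at small complex arguments\<close>

context chain_law
begin

lemma LL_scale: "LL f s n (\<lambda>y. c * h y) x = c * LL f s n h x"
 unfolding LL_def integral_mult_right_zero[symmetric] by (simp only: ac_simps)

lemma nearly_one_exp_bounds:
 fixes a :: complex
 assumes "norm (a - 1) \<le> t" "t \<le> 1 / 2"
 shows "exp (- 2 * t) \<le> norm a" "norm a \<le> exp (2 * t)"
proof -
 have t0: "0 \<le> t" using assms(1) norm_ge_zero order_trans by blast
 have a: "1 - t \<le> norm a" "norm a \<le> 1 + t"
  using norm_triangle_ineq2[of 1 "1 - a"] norm_triangle_ineq[of 1 "a - 1"] assms(1)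
  by (auto simp: norm_minus_commute)
 have "1 \<le> (1 - t) * (1 + 2 * t)"
  using mult_left_mono[of "2 * t" 1 t] assms t0 by (simp add: algebra_simps)
 also have "\<dots> \<le> (1 - t) * exp (2 * t)"
  using assms exp_ge_add_one_self[of "2 * t"] by (intro mult_left_mono) auto
 finally have "exp (- 2 * t) \<le> 1 - t"
  by (simp add: exp_minus field_simps)
 then show "exp (- 2 * t) \<le> norm a" using a by linarith
 show "norm a \<le> exp (2 * t)" using a exp_ge_add_one_self[of "2 * t"] t0 by linarith
qed

definition Lam :: "(nat \<Rightarrow> 'a \<Rightarrow> 'a \<Rightarrow> real) \<Rightarrow> complex \<Rightarrow> nat \<Rightarrow> nat \<Rightarrow> complex" where
 "Lam f \<zeta> k n = (\<integral>x. HH f \<zeta> k n x \<partial>\<nu> n)"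

text \<open>The constant \<open>C = 8 * A / s\<close> solves
  \<open>C = (1 - s / 4) * C + 2 * A\<close>, so \<open>C * |\<zeta>|^2 * K^2\<close> is preserved
  as a bound on \<open>Bq\<close> by the recursion of \<open>perturb_eigenvector\<close>. The
  smallness condition says that with this bound every normalising factor stays within
  \<open>s / 16\<close> of 1.\<close>

context
 fixes f :: "nat \<Rightarrow> 'a \<Rightarrow> 'a \<Rightarrow> real" and K :: real and \<zeta> :: complex and A C s :: real
 assumes f: "adm K f" and cent: "edge_centered f"
  and s_def: "s = \<epsilon>\<^sup>2" and A_def: "A = 72 * (1 + 4 / s) * (1 + 1 / (1 - s))" and C_def: "C = 8 * A / s"
  and small: "(norm \<zeta>)\<^sup>2 * K\<^sup>2 \<le> s / (16 * (5 + 2 * C))"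
begin

private lemma const: "0 < s" "s < 1" "0 < A" "0 < C" "A \<le> C"
proof -
 show s: "0 < s" "s < 1" using eps2 by (auto simp: s_def)
 show A: "0 < A" unfolding A_def using s by (intro mult_pos_pos add_pos_pos) auto
 then show "0 < C" unfolding C_def using s by simp
 show "A \<le> C" unfolding C_def using s A by (simp add: field_simps)
qed

private definition "\<kappa> = (norm \<zeta>)\<^sup>2 * K\<^sup>2"

private lemma kap: "0 \<le> \<kappa>" "5 * \<kappa> + 2 * C * \<kappa> \<le> s / 16" "A * \<kappa> \<le> s / 4" "norm \<zeta> * K \<le> 1"
proof -
 show k0: "0 \<le> \<kappa>" by (simp add: \<kappa>_def)
 have "\<kappa> * (16 * (5 + 2 * C)) \<le> s"
  using small const unfolding \<kappa>_def[symmetric] by (simp add: pos_le_divide_eq)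
 then show 1: "5 * \<kappa> + 2 * C * \<kappa> \<le> s / 16" by (simp add: algebra_simps)
 have 2: "0 \<le> C * \<kappa>" using const k0 by simp
 have "A * \<kappa> \<le> C * \<kappa>" using const k0 by (intro mult_right_mono)
 then show "A * \<kappa> \<le> s / 4" using 1 2 k0 const by linarith
 have "\<kappa> \<le> 1" using 1 2 k0 const by linarith
 then have "(norm \<zeta> * K)\<^sup>2 \<le> 1" by (simp add: \<kappa>_def power_mult_distrib)
 then show "norm \<zeta> * K \<le> 1"
  using power2_le_imp_le[of "norm \<zeta> * K" 1] by simp
qed

private definition "vv k n x = HH f \<zeta> k n x / Lam f \<zeta> k n - 1"

private lemma bm_vv: "bm (M n) (vv k n)"
 unfolding vv_def by (intro bm_intros bm_HH[OF f])

private lemma vv_mean: "Lam f \<zeta> k n \<noteq> 0 \<Longrightarrow> (\<integral>x. vv k n x \<partial>\<nu> n) = 0"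
 unfolding vv_def using integrable_nu[OF bm_HH[OF f, of n \<zeta> k]]
 by (simp add: integrable_nu[OF bm_const] Lam_def)

private definition "lam k n = (\<integral>x. LL f \<zeta> n (\<lambda>y. 1 + vv k (Suc n) y) x \<partial>\<nu> n)"

private lemma HH_Suc:
 assumes "Lam f \<zeta> k (Suc n) \<noteq> 0"
 shows "HH f \<zeta> (Suc k) n x = Lam f \<zeta> k (Suc n) * LL f \<zeta> n (\<lambda>y. 1 + vv k (Suc n) y) x"
  and "Lam f \<zeta> (Suc k) n = Lam f \<zeta> k (Suc n) * lam k n"
proof -
 have "HH f \<zeta> k (Suc n) = (\<lambda>y. Lam f \<zeta> k (Suc n) * (1 + vv k (Suc n) y))"
  using assms by (simp add: vv_def)
 then show 1: "HH f \<zeta> (Suc k) n x = Lam f \<zeta> k (Suc n) * LL f \<zeta> n (\<lambda>y. 1 + vv k (Suc n) y) x" for x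
  by (simp only: HH.simps LL_scale)
 then show "Lam f \<zeta> (Suc k) n = Lam f \<zeta> k (Suc n) * lam k n"
 proof -
  have "HH f \<zeta> (Suc k) n = (\<lambda>x. Lam f \<zeta> k (Suc n) * LL f \<zeta> n (\<lambda>y. 1 + vv k (Suc n) y) x)"
   by (rule ext) (rule 1)
  then show ?thesis
   by (simp only: Lam_def[of f \<zeta> "Suc k" n] lam_def integral_mult_right_zero)
 qed
qed

private lemma lam_step:
 assumes nz: "Lam f \<zeta> k (Suc n) \<noteq> 0" and B: "Bq n (vv k (Suc n)) \<le> C * \<kappa>"
 shows "norm (lam k n - 1) \<le> 5 * (norm \<zeta>)\<^sup>2 * ww f n + 2 * Bq n (vv k (Suc n))"
  and "norm (lam k n - 1) \<le> s / 16"
proof -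
 have c: "EE n (f n) = 0" using cent by (simp add: edge_centered_def)
 show 1: "norm (lam k n - 1) \<le> 5 * (norm \<zeta>)\<^sup>2 * ww f n + 2 * Bq n (vv k (Suc n))"
  using perturb_eigenvalue[OF f c kap(4) bm_vv vv_mean[OF nz]] QQ_le_Bq[of n "vv k (Suc n)"]
  by (simp add: lam_def)
 have "(norm \<zeta>)\<^sup>2 * ww f n \<le> \<kappa>"
  unfolding \<kappa>_def by (intro mult_left_mono ww_bounds[OF f]) auto
 then show "norm (lam k n - 1) \<le> s / 16" using 1 B kap by linarith
qed

text \<open>The logarithmic error \<open>l\<close> grows in each step by \<open>2 * t\<close>, which
  contains \<open>4 * Bq\<close>. This is paid for by the term \<open>16 / s * Bq\<close>, since
  \<open>Bq\<close> loses at least the fraction \<open>s / 4\<close> of its value apart from a term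
  of order \<open>ww\<close>. Thus \<open>l + 16 / s * Bq\<close> grows only by a multiple of
  \<open>|\<zeta>|^2 * ww\<close>. The time is a successor because \<open>Bq m\<close> looks one
  step further back.\<close>

private lemma invariant:
 "Lam f \<zeta> k (Suc m) \<noteq> 0 \<and> Bq m (vv k (Suc m)) \<le> C * \<kappa> \<and>
  (\<exists>l. exp (- l) \<le> norm (Lam f \<zeta> k (Suc m)) \<and> norm (Lam f \<zeta> k (Suc m)) \<le> exp l \<and>
   l + 16 / s * Bq m (vv k (Suc m)) \<le> (10 + 32 * A / s) * (norm \<zeta>)\<^sup>2 * (\<Sum>j=Suc m..<Suc m+k. ww f j))"
proof (induction k arbitrary: m)
 case 0
 have L: "Lam f \<zeta> 0 (Suc m) = 1" by (simp add: Lam_def)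
 then have "Bq m (vv 0 (Suc m)) = Bq m (\<lambda>x. 0 * 0)"
  by (simp add: vv_def[abs_def])
 then have "Bq m (vv 0 (Suc m)) = 0" unfolding Bq_scale by simp
 then show ?case using L kap const by (auto intro!: exI[of _ 0])
next
 case (Suc k)
 let ?n = "Suc m"
 let ?B = "Bq ?n (vv k (Suc ?n))" and ?h = "norm \<zeta>"
 from Suc[of ?n] obtain l where nz: "Lam f \<zeta> k (Suc ?n) \<noteq> 0" and B: "?B \<le> C * \<kappa>"
  and l: "exp (- l) \<le> norm (Lam f \<zeta> k (Suc ?n))" "norm (Lam f \<zeta> k (Suc ?n)) \<le> exp l"
   "l + 16 / s * ?B \<le> (10 + 32 * A / s) * ?h\<^sup>2 * (\<Sum>j=Suc ?n..<Suc ?n+k. ww f j)"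
  by blast
 have c: "EE ?n (f ?n) = 0" using cent by (simp add: edge_centered_def)
 have B0: "0 \<le> ?B" by (rule Bq_nonneg)
 define t where "t = 5 * ?h\<^sup>2 * ww f ?n + 2 * ?B"
 have lam1: "norm (lam k ?n - 1) \<le> t" unfolding t_def by (rule lam_step[OF nz B])
 have lam2: "norm (lam k ?n - 1) \<le> s / 16" by (rule lam_step[OF nz B])
 have lam0: "lam k ?n \<noteq> 0" using lam2 const by auto
 have w: "0 \<le> ww f ?n" "?h\<^sup>2 * ww f ?n \<le> \<kappa>"
  using ww_bounds[OF f] unfolding \<kappa>_def by (auto intro!: mult_left_mono)
 have t12: "t \<le> 1 / 2"
  unfolding t_def using w B kap const by linarith
 have nz': "Lam f \<zeta> (Suc k) ?n \<noteq> 0" using HH_Suc(2)[OF nz] nz lam0 by simp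
 have veq: "vv (Suc k) ?n = (\<lambda>x. LL f \<zeta> ?n (\<lambda>y. 1 + vv k (Suc ?n) y) x / lam k ?n - 1)"
  unfolding vv_def[of "Suc k"] HH_Suc[OF nz] using nz by simp
 have Bstep: "Bq m (vv (Suc k) ?n) \<le> (1 - s / 4) * ?B + 2 * A * ?h\<^sup>2 * ww f ?n"
  unfolding veq s_def
  by (rule perturb_eigenvector[OF f c kap(4) bm_vv vv_mean[OF nz] refl A_def[unfolded s_def]])
    (use kap lam2 in \<open>simp_all add: lam_def s_def \<kappa>_def\<close>)
 have "Bq m (vv (Suc k) ?n) \<le> (1 - s / 4) * (C * \<kappa>) + 2 * A * \<kappa>"
 proof -
  have "(1 - s / 4) * ?B \<le> (1 - s / 4) * (C * \<kappa>)" using B const by (intro mult_left_mono) auto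
  moreover have "2 * A * (?h\<^sup>2 * ww f ?n) \<le> 2 * A * \<kappa>" using w const by (intro mult_left_mono) auto
  ultimately show ?thesis using Bstep by linarith
 qed
 also have "\<dots> = C * \<kappa>" unfolding C_def using const by (simp add: field_simps)
 finally have Bfin: "Bq m (vv (Suc k) ?n) \<le> C * \<kappa>" .
 have norms: "exp (- (l + 2 * t)) \<le> norm (Lam f \<zeta> (Suc k) ?n)" "norm (Lam f \<zeta> (Suc k) ?n) \<le> exp (l + 2 * t)"
  unfolding HH_Suc(2)[OF nz] norm_mult minus_add_distrib exp_add
  using nearly_one_exp_bounds[OF lam1 t12] l by (auto intro!: mult_mono)
 have "l + 2 * t + 16 / s * Bq m (vv (Suc k) ?n) \<le>
   l + 2 * t + 16 / s * ((1 - s / 4) * ?B + 2 * A * ?h\<^sup>2 * ww f ?n)"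
  using Bstep const by (intro add_left_mono mult_left_mono) auto
 also have "\<dots> = l + 16 / s * ?B + (10 + 32 * A / s) * ?h\<^sup>2 * ww f ?n"
  unfolding t_def using const by (simp add: field_simps)
 also have "\<dots> \<le> (10 + 32 * A / s) * ?h\<^sup>2 * (\<Sum>j=Suc ?n..<Suc ?n+k. ww f j) + (10 + 32 * A / s) * ?h\<^sup>2 * ww f ?n"
  using l(3) by simp
 also have "\<dots> = (10 + 32 * A / s) * ?h\<^sup>2 * (\<Sum>j=?n..<?n + Suc k. ww f j)"
  by (subst (2) sum.atLeast_Suc_lessThan) (auto simp: algebra_simps)
 finally show ?case using nz' Bfin norms by blast
qed

text \<open>The step back to time 0 is done by hand: no earlier time is available for
  \<open>Bq\<close>, but only the mean has to be followed there, and its error is again absorbed by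
  \<open>16 / s * Bq\<close>.\<close>

lemma mgf_norm_bounds:
 assumes "1 \<le> N"
 shows "exp (- ((10 + 32 * A / s) * (norm \<zeta>)\<^sup>2 * (\<Sum>j<N. ww f j))) \<le> norm (Lam f \<zeta> N 0)"
  "norm (Lam f \<zeta> N 0) \<le> exp ((10 + 32 * A / s) * (norm \<zeta>)\<^sup>2 * (\<Sum>j<N. ww f j))"
proof -
 from assms obtain k where N: "N = Suc k" by (cases N) auto
 let ?B = "Bq 0 (vv k (Suc 0))"
 from invariant[of k 0] obtain l where nz: "Lam f \<zeta> k (Suc 0) \<noteq> 0" and B: "?B \<le> C * \<kappa>"
  and l: "exp (- l) \<le> norm (Lam f \<zeta> k (Suc 0))" "norm (Lam f \<zeta> k (Suc 0)) \<le> exp l"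
   "l + 16 / s * ?B \<le> (10 + 32 * A / s) * (norm \<zeta>)\<^sup>2 * (\<Sum>j=Suc 0..<Suc 0+k. ww f j)"
  by blast
 define t where "t = 5 * (norm \<zeta>)\<^sup>2 * ww f 0 + 2 * ?B"
 have lam1: "norm (lam k 0 - 1) \<le> t" unfolding t_def by (rule lam_step[OF nz B])
 have w: "0 \<le> ww f 0" "(norm \<zeta>)\<^sup>2 * ww f 0 \<le> \<kappa>"
  using ww_bounds[OF f] unfolding \<kappa>_def by (auto intro!: mult_left_mono)
 have t12: "t \<le> 1 / 2" unfolding t_def using w B kap const by linarith
 have norms: "exp (- (l + 2 * t)) \<le> norm (Lam f \<zeta> N 0)" "norm (Lam f \<zeta> N 0) \<le> exp (l + 2 * t)"
  unfolding N HH_Suc(2)[OF nz] norm_mult minus_add_distrib exp_add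
  using nearly_one_exp_bounds[OF lam1 t12] l by (auto intro!: mult_mono)
 have "4 * ?B \<le> 16 / s * ?B" using const Bq_nonneg by (intro mult_right_mono) (auto simp: field_simps)
 moreover have "10 * ((norm \<zeta>)\<^sup>2 * ww f 0) \<le> (10 + 32 * A / s) * ((norm \<zeta>)\<^sup>2 * ww f 0)"
  using const w by (intro mult_right_mono) auto
 moreover have "l + 2 * t = l + 4 * ?B + 10 * ((norm \<zeta>)\<^sup>2 * ww f 0)" by (simp add: t_def)
 ultimately have "l + 2 * t \<le> l + 16 / s * ?B + (10 + 32 * A / s) * ((norm \<zeta>)\<^sup>2 * ww f 0)"
  by (simp only: add_mono order_refl)
 also have "\<dots> \<le> (10 + 32 * A / s) * (norm \<zeta>)\<^sup>2 * (\<Sum>j=Suc 0..<Suc 0+k. ww f j)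
   + (10 + 32 * A / s) * ((norm \<zeta>)\<^sup>2 * ww f 0)"
  by (rule add_right_mono[OF l(3)])
 also have "\<dots> = (10 + 32 * A / s) * (norm \<zeta>)\<^sup>2 * (\<Sum>j<N. ww f j)"
  unfolding N lessThan_atLeast0 by (subst (2) sum.atLeast_Suc_lessThan) (auto simp: algebra_simps)
 finally have "l + 2 * t \<le> (10 + 32 * A / s) * (norm \<zeta>)\<^sup>2 * (\<Sum>j<N. ww f j)" .
 then show "exp (- ((10 + 32 * A / s) * (norm \<zeta>)\<^sup>2 * (\<Sum>j<N. ww f j))) \<le> norm (Lam f \<zeta> N 0)"
  "norm (Lam f \<zeta> N 0) \<le> exp ((10 + 32 * A / s) * (norm \<zeta>)\<^sup>2 * (\<Sum>j<N. ww f j))"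
  by (auto intro!: order.trans[OF _ norms(1)] order.trans[OF norms(2)])
qed

private lemma LL_near_one:
 assumes v: "bm (M (Suc n)) v" and x: "x \<in> space (M n)"
 shows "norm (LL f \<zeta> n (\<lambda>y. 1 + v y) x - 1) \<le> 3 * (norm \<zeta> * K) + 3 * (\<integral>y. p n x y * norm (v y) \<partial>M (Suc n))"
proof -
 let ?e = "\<lambda>y. exp (\<zeta> * of_real (f n x y))"
 have "LL f \<zeta> n (\<lambda>y. 1 + v y) x - 1 = (\<integral>y. of_real (p n x y) * (?e y * (1 + v y)) - of_real (p n x y) \<partial>M (Suc n))"
 proof -
  have "bm (M (Suc n)) (\<lambda>y. of_real (p n x y) * (?e y * (1 + v y)))"
   by (rule bm_mult bm_of_real bm_exp bm_add bm_const bm_p_fix[OF x] bm_f_fix[OF f x] v)+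
  from integrable_M[OF this] integrable_M[OF bm_of_real[OF bm_p_fix[OF x]]] show ?thesis
   unfolding LL_def using p_integral[OF x] by (simp add: integral_complex_of_real')
 qed
 also have "norm \<dots> \<le> (\<integral>y. 3 * (norm \<zeta> * K) * p n x y + 3 * (p n x y * norm (v y)) \<partial>M (Suc n))"
 proof (rule bm_integral_norm_le[OF fin_M])
  show "bm (M (Suc n)) (\<lambda>y. of_real (p n x y) * (?e y * (1 + v y)) - of_real (p n x y))"
   by (rule bm_diff bm_mult bm_of_real bm_exp bm_add bm_const bm_p_fix[OF x] bm_f_fix[OF f x] v)+
  show "bm (M (Suc n)) (\<lambda>y. 3 * (norm \<zeta> * K) * p n x y + 3 * (p n x y * norm (v y)))"
   by (rule bm_add bm_const bm_norm v bm_p_fix[OF x] | rule bm_mult)+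
  fix y
  have a: "norm (\<zeta> * of_real (f n x y)) \<le> norm \<zeta> * K"
   using mult_left_mono[OF adm_le[OF f], of "norm \<zeta>" n x y] by (simp add: norm_mult)
  then have a1: "norm (\<zeta> * of_real (f n x y)) \<le> 1" using kap(4) by linarith
  have "norm (?e y * (1 + v y) - 1) = norm ((?e y - 1) + ?e y * v y)" by (simp add: algebra_simps)
  also have "\<dots> \<le> 3 * (norm \<zeta> * K) + 3 * norm (v y)"
  proof (rule norm_triangle_mono)
   show "norm (?e y - 1) \<le> 3 * (norm \<zeta> * K)" using exp_minus_1_le(1)[OF a1] a by linarith
   show "norm (?e y * v y) \<le> 3 * norm (v y)"
    unfolding norm_mult by (intro mult_right_mono exp_minus_1_le(3)[OF a1]) simp
  qed
  finally have le: "norm (?e y * (1 + v y) - 1) \<le> 3 * (norm \<zeta> * K) + 3 * norm (v y)" .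
  have "of_real (p n x y) * (?e y * (1 + v y)) - of_real (p n x y) = of_real (p n x y) * (?e y * (1 + v y) - 1)"
   by (simp add: algebra_simps)
  then have "norm (of_real (p n x y) * (?e y * (1 + v y)) - of_real (p n x y)) = p n x y * norm (?e y * (1 + v y) - 1)"
   by (simp only: norm_mult norm_of_real abs_of_nonneg[OF p_nonneg])
  also have "\<dots> \<le> p n x y * (3 * (norm \<zeta> * K) + 3 * norm (v y))"
   by (intro mult_left_mono p_nonneg le)
  also have "\<dots> = 3 * (norm \<zeta> * K) * p n x y + 3 * (p n x y * norm (v y))"
   by (simp add: algebra_simps)
  finally show "norm (of_real (p n x y) * (?e y * (1 + v y)) - of_real (p n x y)) \<le>
    3 * (norm \<zeta> * K) * p n x y + 3 * (p n x y * norm (v y))" .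
 qed
 also have "\<dots> = 3 * (norm \<zeta> * K) + 3 * (\<integral>y. p n x y * norm (v y) \<partial>M (Suc n))"
 proof -
  have "bm (M (Suc n)) (\<lambda>y. p n x y * norm (v y))"
   by (rule bm_mult bm_norm v bm_p_fix[OF x])+
  from integrable_M[OF this] show ?thesis
   using p_integral[OF x] integrable_M[OF bm_p_fix[OF x]] by simp
 qed
 finally show ?thesis .
qed

text \<open>A mean square bound under \<open>\<nu> 2\<close> becomes a bound uniform in the starting
  point \<open>y\<close> at time 1, because \<open>p \<le> 1 / \<epsilon>\<close> while
  \<open>\<nu> 2\<close> has density at least \<open>\<epsilon>\<close>. Time 2 is the earliest at
  which such a lower bound holds for every initial law.\<close>

private lemma vv2_integral:
 assumes y: "y \<in> space (M (Suc 0))"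
 shows "(\<integral>z. p (Suc 0) y z * norm (vv k (Suc (Suc 0)) z) \<partial>M (Suc (Suc 0))) \<le> sqrt C * (norm \<zeta> * K) / \<epsilon>\<^sup>2"
proof -
 let ?v = "vv k (Suc (Suc 0))" and ?N = "M (Suc (Suc 0))"
 have bv: "bm ?N (\<lambda>z. norm (?v z))" by (intro bm_intros bm_vv)
 have "(\<integral>z. p (Suc 0) y z * norm (?v z) \<partial>?N) \<le> (\<integral>z. 1 / \<epsilon>\<^sup>2 * (dd 0 z * norm (?v z)) \<partial>?N)"
 proof (rule bm_integral_mono[OF fin_M])
  fix z assume z: "z \<in> space ?N"
  have "p (Suc 0) y z \<le> 1 / \<epsilon>" by (rule p_le)
  also have "\<dots> = 1 / \<epsilon>\<^sup>2 * \<epsilon>" using eps by (simp add: power2_eq_square)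
  also have "\<dots> \<le> 1 / \<epsilon>\<^sup>2 * dd 0 z" using dd_bounds[OF z] by (intro mult_left_mono) auto
  finally have "p (Suc 0) y z * norm (?v z) \<le> 1 / \<epsilon>\<^sup>2 * dd 0 z * norm (?v z)"
   by (intro mult_right_mono) auto
  then show "p (Suc 0) y z * norm (?v z) \<le> 1 / \<epsilon>\<^sup>2 * (dd 0 z * norm (?v z))" by simp
 qed (rule bm_mult bm_dd bm_const bv bm_p_fix[OF y])+
 also have "\<dots> = (\<integral>z. norm (?v z) \<partial>\<nu> (Suc (Suc 0))) / \<epsilon>\<^sup>2"
  using nu_two_step_real[OF bv] by simp
 also have "\<dots> \<le> sqrt C * (norm \<zeta> * K) / \<epsilon>\<^sup>2"
 proof (intro divide_right_mono)
  have "(\<integral>z. norm (?v z) \<partial>\<nu> (Suc (Suc 0)))\<^sup>2 \<le> QQ (Suc (Suc 0)) ?v"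
   using nu_norm_sq_le_QQ[OF bm_of_real[OF bv]]
   by (simp add: integral_complex_of_real' QQ_def power2_abs)
  also have "\<dots> \<le> C * \<kappa>" using invariant[of k "Suc 0"] QQ_le_Bq[of "Suc 0" ?v] by linarith
  finally have "(\<integral>z. norm (?v z) \<partial>\<nu> (Suc (Suc 0))) \<le> sqrt (C * \<kappa>)"
   by (rule real_le_rsqrt)
  also have "\<dots> = sqrt C * (norm \<zeta> * K)"
   using adm_nonneg[OF f] by (simp add: \<kappa>_def real_sqrt_mult)
  finally show "(\<integral>z. norm (?v z) \<partial>\<nu> (Suc (Suc 0))) \<le> sqrt C * (norm \<zeta> * K)" .
 qed simp
 finally show ?thesis .
qed

text \<open>From time 2 two steps back to time 0 are taken pointwise, each multiplying the deviation
  by at most 3 and adding \<open>3 * |\<zeta>| * K\<close>. This gives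
  \<open>c = 3 + 3 * (3 + 3 * sqrt C / \<epsilon>\<^sup>2)\<close>. The deviation vanishes with
  \<open>\<zeta>\<close>, which is what makes the initial point invisible in the limit. The factor 4
  comes from comparing the value at \<open>x\<close> with the mean and from
  \<open>norm a \<ge> 1 / 2\<close>.\<close>

lemma mgf_initial_point:
 assumes N: "2 \<le> N" and c: "c = 12 + 9 * sqrt C / \<epsilon>\<^sup>2" "c * (norm \<zeta> * K) \<le> 1 / 2"
  and x: "x \<in> space (M 0)"
 shows "norm (HH f \<zeta> N 0 x - Lam f \<zeta> N 0) \<le> 4 * c * (norm \<zeta> * K) * norm (Lam f \<zeta> N 0)"
proof -
 define k where "k = N - 2"
 have k: "N = Suc (Suc k)" using N by (simp add: k_def)
 let ?v = "vv k (Suc (Suc 0))" and ?t = "norm \<zeta> * K"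
 let ?L = "Lam f \<zeta> k (Suc (Suc 0))"
 have nz: "?L \<noteq> 0" using invariant[of k "Suc 0"] by simp
 have K0: "0 \<le> ?t" using adm_nonneg[OF f] by simp
 define u where "u y = LL f \<zeta> (Suc 0) (\<lambda>z. 1 + ?v z) y - 1" for y
 have bu: "bm (M (Suc 0)) u" unfolding u_def by (intro bm_intros bm_LL[OF f] bm_vv)
 have u: "norm (u y) \<le> (3 + 3 * sqrt C / \<epsilon>\<^sup>2) * ?t" if y: "y \<in> space (M (Suc 0))" for y
 proof -
  have "norm (u y) \<le> 3 * ?t + 3 * (sqrt C * ?t / \<epsilon>\<^sup>2)"
   using LL_near_one[OF bm_vv y, of k] vv2_integral[OF y, of k] unfolding u_def by linarith
  also have "\<dots> = (3 + 3 * sqrt C / \<epsilon>\<^sup>2) * ?t" by (simp add: algebra_simps)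
  finally show ?thesis .
 qed
 have near: "norm (LL f \<zeta> 0 (\<lambda>y. 1 + u y) x - 1) \<le> c * ?t" if x: "x \<in> space (M 0)" for x
 proof -
  have "norm (LL f \<zeta> 0 (\<lambda>y. 1 + u y) x - 1) \<le> 3 * ?t + 3 * (\<integral>y. p 0 x y * norm (u y) \<partial>M (Suc 0))"
   by (rule LL_near_one[OF bu x])
  also have "(\<integral>y. p 0 x y * norm (u y) \<partial>M (Suc 0)) \<le> (\<integral>y. p 0 x y * ((3 + 3 * sqrt C / \<epsilon>\<^sup>2) * ?t) \<partial>M (Suc 0))"
  proof (rule bm_integral_mono[OF fin_M])
   show "bm (M (Suc 0)) (\<lambda>y. p 0 x y * norm (u y))"
    by (rule bm_mult[OF bm_p_fix[OF x] bm_norm[OF bu]])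
   show "bm (M (Suc 0)) (\<lambda>y. p 0 x y * ((3 + 3 * sqrt C / \<epsilon>\<^sup>2) * ?t))"
    by (rule bm_mult[OF bm_p_fix[OF x] bm_const])
  qed (intro mult_left_mono u p_nonneg)
  also have "\<dots> = (3 + 3 * sqrt C / \<epsilon>\<^sup>2) * ?t" using p_integral[OF x] by simp
  finally show ?thesis unfolding c by (simp add: algebra_simps)
 qed
 have H: "HH f \<zeta> N 0 = (\<lambda>x. ?L * LL f \<zeta> 0 (\<lambda>y. 1 + u y) x)"
 proof -
  have "HH f \<zeta> (Suc k) (Suc 0) = (\<lambda>y. ?L * (1 + u y))"
   by (rule ext) (simp only: HH_Suc(1)[OF nz] u_def add_diff_cancel_left' diff_add_cancel add.commute[of 1])
  then show ?thesis unfolding k by (intro ext) (simp only: HH.simps(2)[of f \<zeta> "Suc k"] LL_scale)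
 qed
 have bb: "bm (M 0) (\<lambda>x. LL f \<zeta> 0 (\<lambda>y. 1 + u y) x)"
  by (intro bm_LL[OF f] bm_intros bu)
 define a where "a = (\<integral>x. LL f \<zeta> 0 (\<lambda>y. 1 + u y) x \<partial>\<nu> 0)"
 have "a - 1 = (\<integral>x. LL f \<zeta> 0 (\<lambda>y. 1 + u y) x - 1 \<partial>\<nu> 0)"
  unfolding a_def using integrable_nu[OF bb] integrable_nu[OF bm_const[of _ "1::complex"]] by simp
 also have "norm \<dots> \<le> (\<integral>x. c * ?t \<partial>\<nu> 0)"
  by (rule nu_norm_le[OF bm_diff[OF bb bm_const] bm_const near])
 finally have a: "norm (a - 1) \<le> c * ?t" by simp
 have a2: "1 / 2 \<le> norm a"
  using norm_triangle_ineq2[of 1 "1 - a"] a c(2) by (simp add: norm_minus_commute)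
 have La: "Lam f \<zeta> N 0 = ?L * a"
  unfolding Lam_def[of f \<zeta> N 0] H a_def by simp
 have "HH f \<zeta> N 0 x - Lam f \<zeta> N 0 = ?L * ((LL f \<zeta> 0 (\<lambda>y. 1 + u y) x - 1) - (a - 1))"
  unfolding La H by (simp add: algebra_simps)
 also have "norm \<dots> \<le> norm ?L * (c * ?t + c * ?t)"
  unfolding norm_mult
  by (intro mult_left_mono order.trans[OF norm_triangle_ineq4] add_mono near[OF x] a norm_ge_zero)
 also have "\<dots> \<le> (2 * (norm ?L * norm a)) * (c * ?t + c * ?t)"
 proof (rule mult_right_mono)
  show "norm ?L \<le> 2 * (norm ?L * norm a)"
   using mult_left_mono[OF a2, of "norm ?L"] by simp
  have "0 \<le> c" unfolding c using const by simp
  then have "0 \<le> c * ?t" using K0 by (rule mult_nonneg_nonneg)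
  then show "0 \<le> c * ?t + c * ?t" by (rule add_nonneg_nonneg) fact
 qed
 finally show ?thesis unfolding La norm_mult by (simp add: algebra_simps)
qed

end

text \<open>The constants are fixed before \<open>f\<close>, \<open>N\<close> and \<open>v\<close>:
  the estimates are later applied to a different functional for each horizon \<open>N\<close>, and
  the radius and the constant must not vary with it.\<close>

theorem mgf_estimates:
 assumes K: "0 < K"
 obtains r C where "0 < r" "0 < C"
  "\<And>f N v. adm K f \<Longrightarrow> edge_centered f \<Longrightarrow> 2 \<le> N \<Longrightarrow> norm v \<le> r \<Longrightarrow>
   exp (- (C * (norm v)\<^sup>2 * (\<Sum>n<N. ww f n))) \<le> norm (Lam f v N 0) \<and>
   norm (Lam f v N 0) \<le> exp (C * (norm v)\<^sup>2 * (\<Sum>n<N. ww f n)) \<and>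
   (\<forall>x\<in>space (M 0). norm (HH f v N 0 x - Lam f v N 0) \<le> C * norm v * norm (Lam f v N 0))"
proof -
 define s where "s = \<epsilon>\<^sup>2"
 define A where "A = 72 * (1 + 4 / s) * (1 + 1 / (1 - s))"
 define C where "C = 8 * A / s"
 define c where "c = 12 + 9 * sqrt C / \<epsilon>\<^sup>2"
 have s: "0 < s" "s < 1" using eps2 by (auto simp: s_def)
 have A: "0 < A" unfolding A_def using s by (intro mult_pos_pos add_pos_pos) auto
 have C: "0 < C" unfolding C_def using s A by simp
 have c: "0 < c"
 proof -
  have "0 \<le> 9 * sqrt C / \<epsilon>\<^sup>2" using C by (intro divide_nonneg_nonneg mult_nonneg_nonneg real_sqrt_ge_zero) auto
  then show ?thesis unfolding c_def by linarith
 qed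
 define q where "q = s / (16 * (5 + 2 * C))"
 have q: "0 < q" unfolding q_def by (rule divide_pos_pos) (use s C in auto)
 define r where "r = min (sqrt q / K) (1 / (2 * c * K))"
 define D where "D = max (10 + 32 * A / s) (4 * c * K)"
 have r: "0 < r" unfolding r_def min_less_iff_conj
  by (intro conjI divide_pos_pos mult_pos_pos real_sqrt_gt_zero q K c zero_less_one zero_less_numeral)
 have D: "0 < D" unfolding D_def less_max_iff_disj
  by (intro disjI2 mult_pos_pos c K zero_less_numeral)
 show ?thesis
 proof (rule that[OF r D])
  fix f N v assume f: "adm K f" and cent: "edge_centered f" and N: "2 \<le> (N::nat)" and v: "norm (v::complex) \<le> r"
  have 1: "norm v \<le> sqrt q / K" "norm v \<le> 1 / (2 * c * K)" using v by (auto simp: r_def)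
  then have "(norm v * K)\<^sup>2 \<le> (sqrt q)\<^sup>2" using K by (intro power_mono) (auto simp: field_simps)
  then have small: "(norm v)\<^sup>2 * K\<^sup>2 \<le> s / (16 * (5 + 2 * C))"
   using q unfolding q_def[symmetric] by (simp add: power_mult_distrib)
  have small2: "c * (norm v * K) \<le> 1 / 2" using 1(2) c K by (simp add: field_simps)
  have S0: "0 \<le> (\<Sum>n<N. ww f n)" by (intro sum_nonneg ww_bounds[OF f])
  have le: "(10 + 32 * A / s) * (norm v)\<^sup>2 * (\<Sum>n<N. ww f n) \<le> D * (norm v)\<^sup>2 * (\<Sum>n<N. ww f n)"
   using S0 by (intro mult_right_mono) (auto simp: D_def)
  have N1: "1 \<le> N" using N by simp
  note b = mgf_norm_bounds[OF f cent s_def A_def C_def small N1]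
  have x: "norm (HH f v N 0 x - Lam f v N 0) \<le> D * norm v * norm (Lam f v N 0)" if "x \<in> space (M 0)" for x
  proof -
   have "4 * c * K * norm v * norm (Lam f v N 0) \<le> D * norm v * norm (Lam f v N 0)"
    by (intro mult_right_mono) (auto simp: D_def)
   then show ?thesis
    using mgf_initial_point[OF f cent s_def A_def C_def small N c_def small2 that]
    by (simp add: algebra_simps)
  qed
  show "exp (- (D * (norm v)\<^sup>2 * (\<Sum>n<N. ww f n))) \<le> norm (Lam f v N 0) \<and>
   norm (Lam f v N 0) \<le> exp (D * (norm v)\<^sup>2 * (\<Sum>n<N. ww f n)) \<and>
   (\<forall>x\<in>space (M 0). norm (HH f v N 0 x - Lam f v N 0) \<le> D * norm v * norm (Lam f v N 0))"
   using le x by (auto intro!: order.trans[OF _ b(1)] order.trans[OF b(2)])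
 qed
qed

end

section \<open>Decay of characteristic functions\<close>

text \<open>The product of one integral with the conjugate of the other is a double integral whose
  real part has the cosine of the phase difference as integrand. Allowing two different measures and
  an extra phase \<open>v\<close> covers the comparison of two bridges that share no
  endpoint.\<close>

lemma cross_char_integral:
 fixes A g :: "'b \<Rightarrow> real" and A' g' :: "'c \<Rightarrow> real"
 assumes S: "prob_space S" and A: "bm S A" and g: "bm S g"
  and S': "prob_space S'" and A': "bm S' A'" and g': "bm S' g'"
 shows "(\<integral>s'. \<integral>s. A s * A' s' * (1 - cos (v + g s - g' s')) \<partial>S \<partial>S') = (\<integral>s. A s \<partial>S) * (\<integral>s. A' s \<partial>S') -
   Re (exp (\<i> * of_real v) * (\<integral>s. of_real (A s) * exp (\<i> * of_real (g s)) \<partial>S)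
    * cnj (\<integral>s. of_real (A' s) * exp (\<i> * of_real (g' s)) \<partial>S'))"
proof -
 have fin: "finite_measure S" "finite_measure S'"
  using S S' prob_space.finite_measure by blast+
 let ?w = "exp (\<i> * of_real v)"
 let ?e = "\<lambda>s. of_real (A s) * exp (\<i> * of_real (g s)) :: complex"
 let ?e' = "\<lambda>s. of_real (A' s) * exp (\<i> * of_real (g' s)) :: complex"
 note bs = bm_mult bm_diff bm_of_real bm_exp bm_const bm_cnj bm_comp[OF A] bm_comp[OF g] bm_comp[OF A'] bm_comp[OF g'] bm_cos
  borel_measurable_diff borel_measurable_add borel_measurable_const measurable_compose[OF _ bm_measurable[OF g]] measurable_compose[OF _ bm_measurable[OF g']]
 have be: "bm S ?e" by (intro bm_intros A g)
 have be': "bm S' ?e'" by (intro bm_intros A' g')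
 have bA2: "bm S' (\<lambda>s'. \<integral>s. A s * A' s' \<partial>S)" and
  bA3: "bm S' (\<lambda>s'. \<integral>s. A s * A' s' * cos (v + g s - g' s') \<partial>S)"
  by (intro bm_integral[OF S] bs; measurable)+
 have sec: "bm S (\<lambda>s. A s * A' s')" "bm S (\<lambda>s. A s * A' s' * cos (v + g s - g' s'))" for s'
  by (intro bm_mult A bm_const bm_cos borel_measurable_diff borel_measurable_add bm_measurable[OF g] borel_measurable_const)+
 have "?w * (\<integral>s. ?e s \<partial>S) * cnj (\<integral>s. ?e' s \<partial>S') = ?w * (\<integral>s. ?e s \<partial>S) * (\<integral>s. cnj (?e' s) \<partial>S')"
  by (simp only: Bochner_Integration.integral_cnj)
 also have "\<dots> = (\<integral>s'. \<integral>s. ?w * ?e s * cnj (?e' s') \<partial>S \<partial>S')"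
  by simp
 finally have "Re (?w * (\<integral>s. ?e s \<partial>S) * cnj (\<integral>s. ?e' s \<partial>S')) = Re (\<integral>s'. \<integral>s. ?w * ?e s * cnj (?e' s') \<partial>S \<partial>S')"
  by (simp only:)
 also have "\<dots> = (\<integral>s'. Re (\<integral>s. ?w * ?e s * cnj (?e' s') \<partial>S) \<partial>S')"
  by (intro integral_Re[symmetric] bm_integrable[OF fin(2)] bm_integral[OF S] bs; measurable)
 also have "\<dots> = (\<integral>s'. \<integral>s. Re (?w * ?e s * cnj (?e' s')) \<partial>S \<partial>S')"
  by (intro integral_congI integral_Re[symmetric] bm_integrable[OF fin(1)] bm_mult be bm_const)
 also have "\<dots> = (\<integral>s'. \<integral>s. A s * A' s' * cos (v + g s - g' s') \<partial>S \<partial>S')"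
 proof -
  have "Re (?w * ?e s * cnj (?e' s')) = A s * A' s' * cos (v + g s - g' s')" for s s'
  proof -
   have "?w * ?e s * cnj (?e' s') = of_real (A s * A' s') * exp (\<i> * of_real (v + g s - g' s'))"
    by (simp add: exp_add exp_diff exp_minus exp_cnj field_simps)
   then show ?thesis by (simp only: Re_complex_of_real Re_exp) (simp add: Re_exp)
  qed
  then show ?thesis by (simp only:)
 qed
 also have "\<dots> = (\<integral>s'. (\<integral>s. A s * A' s' \<partial>S) - (\<integral>s. A s * A' s' * (1 - cos (v + g s - g' s')) \<partial>S) \<partial>S')"
 proof (intro integral_congI)
  fix s'
  have "(\<integral>s. A s * A' s' * (1 - cos (v + g s - g' s')) \<partial>S) =
    (\<integral>s. A s * A' s' - A s * A' s' * cos (v + g s - g' s') \<partial>S)" by (simp add: algebra_simps)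
  also have "\<dots> = (\<integral>s. A s * A' s' \<partial>S) - (\<integral>s. A s * A' s' * cos (v + g s - g' s') \<partial>S)"
   by (intro Bochner_Integration.integral_diff bm_integrable[OF fin(1)] sec)
  finally show "(\<integral>s. A s * A' s' * cos (v + g s - g' s') \<partial>S) =
   (\<integral>s. A s * A' s' \<partial>S) - (\<integral>s. A s * A' s' * (1 - cos (v + g s - g' s')) \<partial>S)" by simp
 qed
 also have "\<dots> = (\<integral>s'. \<integral>s. A s * A' s' \<partial>S \<partial>S') - (\<integral>s'. \<integral>s. A s * A' s' * (1 - cos (v + g s - g' s')) \<partial>S \<partial>S')"
  by (intro Bochner_Integration.integral_diff bm_integrable[OF fin(2)] bA2 bm_integral[OF S] bs; measurable)
 also have "(\<integral>s'. \<integral>s. A s * A' s' \<partial>S \<partial>S') = (\<integral>s. A s \<partial>S) * (\<integral>s. A' s \<partial>S')"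
  by simp
 finally show ?thesis by linarith
qed

text \<open>The amount by which the modulus of an oscillating integral falls short of its mass is
  measured by the phase difference of two independent samples.\<close>

lemma square_char_integral:
 fixes A g :: "'b \<Rightarrow> real"
 assumes S: "prob_space S" and A: "bm S A" and g: "bm S g"
 shows "(norm (\<integral>s. of_real (A s) * exp (\<i> * of_real (g s)) \<partial>S))\<^sup>2 =
  (\<integral>s. A s \<partial>S)\<^sup>2 - (\<integral>s'. \<integral>s. A s * A s' * (1 - cos (g s - g s')) \<partial>S \<partial>S)"
proof -
 have "Re (z * cnj z) = (norm z)\<^sup>2" for z
  by (simp only: complex_norm_square[symmetric] Re_complex_of_real)
 then show ?thesis
  using cross_char_integral[OF S A g S A g, of 0]
  by (simp only: of_real_0 mult_zero_right exp_zero mult_1 add_0 power2_eq_square)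
qed

section \<open>Real tilts and Harnack inequalities\<close>

context elliptic_chain
begin

definition LLr :: "(nat \<Rightarrow> 'a \<Rightarrow> 'a \<Rightarrow> real) \<Rightarrow> real \<Rightarrow> nat \<Rightarrow> ('a \<Rightarrow> real) \<Rightarrow> 'a \<Rightarrow> real" where
 "LLr f \<xi> n h x = (\<integral>y. p n x y * (exp (\<xi> * f n x y) * h y) \<partial>M (Suc n))"

primrec HHr :: "(nat \<Rightarrow> 'a \<Rightarrow> 'a \<Rightarrow> real) \<Rightarrow> real \<Rightarrow> nat \<Rightarrow> nat \<Rightarrow> 'a \<Rightarrow> real" where
 "HHr f \<xi> 0 n = (\<lambda>x. 1)"
| "HHr f \<xi> (Suc k) n = LLr f \<xi> n (HHr f \<xi> k (Suc n))"

lemma LL_of_real: "LL f (of_real \<xi>) n (\<lambda>y. of_real (h y)) x = of_real (LLr f \<xi> n h x)"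
 unfolding LL_def LLr_def integral_complex_of_real'[symmetric] by (simp add: exp_of_real flip: of_real_mult)

lemma HH_of_real: "HH f (of_real \<xi>) k n = (\<lambda>x. of_real (HHr f \<xi> k n x))"
proof (induction k arbitrary: n)
 case (Suc k)
 show ?case by (simp only: HH.simps HHr.simps Suc LL_of_real[abs_def])
qed simp

lemma bm_LLr:
 assumes "adm K f" "bm (M (Suc n)) h"
 shows "bm (M n) (LLr f \<xi> n h)"
 unfolding LLr_def
 by (intro bm_intros prob_M bm_comp[OF assms(2)] bm_f[OF assms(1)]; measurable)

lemma bm_HHr: "adm K f \<Longrightarrow> bm (M n) (HHr f \<xi> k n)"
 by (induction k arbitrary: n) (auto intro: bm_intros bm_LLr)

lemma PP_real: "PP n (\<lambda>y. of_real (h y)) x = of_real (\<integral>y. p n x y * h y \<partial>M (Suc n))"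
 unfolding PP_def integral_complex_of_real'[symmetric] by simp

lemma two_step_real:
 fixes h :: "'a \<Rightarrow> real"
 assumes h: "bm (M (Suc (Suc n))) h" and x: "x \<in> space (M n)"
 shows "(\<integral>y. p n x y * (\<integral>z. p (Suc n) y z * h z \<partial>M (Suc (Suc n))) \<partial>M (Suc n)) = (\<integral>z. p2 n x z * h z \<partial>M (Suc (Suc n)))"
proof -
 have "complex_of_real (\<integral>y. p n x y * (\<integral>z. p (Suc n) y z * h z \<partial>M (Suc (Suc n))) \<partial>M (Suc n)) =
   PP n (PP (Suc n) (\<lambda>z. of_real (h z))) x"
  unfolding PP_real[abs_def] PP_real by simp
 also have "\<dots> = of_real (\<integral>z. p2 n x z * h z \<partial>M (Suc (Suc n)))"
  unfolding PP_PP[OF bm_of_real[OF h] x] integral_complex_of_real'[symmetric] by simp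
 finally show ?thesis using of_real_eq_iff by blast
qed

lemma LLr_mono:
 assumes "adm K f" "bm (M (Suc n)) g" "bm (M (Suc n)) h" "x \<in> space (M n)"
  "\<And>y. y \<in> space (M (Suc n)) \<Longrightarrow> g y \<le> h y"
 shows "LLr f \<xi> n g x \<le> LLr f \<xi> n h x"
 unfolding LLr_def
proof (rule bm_integral_mono[OF fin_M])
 show "bm (M (Suc n)) (\<lambda>y. p n x y * (exp (\<xi> * f n x y) * g y))"
  "bm (M (Suc n)) (\<lambda>y. p n x y * (exp (\<xi> * f n x y) * h y))"
  by (rule bm_mult bm_exp bm_const assms bm_p_fix[OF assms(4)] bm_f_fix[OF assms(1,4)])+
qed (intro mult_left_mono assms p_nonneg; simp)

lemma LLr_cong:
 assumes "\<And>y. y \<in> space (M (Suc n)) \<Longrightarrow> g y = h y"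
 shows "LLr f \<xi> n g x = LLr f \<xi> n h x"
 unfolding LLr_def using assms by (intro Bochner_Integration.integral_cong) auto

lemma LLr_scale: "LLr f \<xi> n (\<lambda>y. c * h y) x = c * LLr f \<xi> n h x"
 unfolding LLr_def integral_mult_right_zero[symmetric] by (simp only: ac_simps)

lemma LLr_diff:
 assumes "adm K f" "bm (M (Suc n)) g" "bm (M (Suc n)) h" "x \<in> space (M n)"
 shows "LLr f \<xi> n (\<lambda>y. g y - h y) x = LLr f \<xi> n g x - LLr f \<xi> n h x"
proof -
 have b: "bm (M (Suc n)) (\<lambda>y. p n x y * (exp (\<xi> * f n x y) * g y))"
  "bm (M (Suc n)) (\<lambda>y. p n x y * (exp (\<xi> * f n x y) * h y))"
  by (rule bm_mult bm_exp bm_const assms bm_p_fix[OF assms(4)] bm_f_fix[OF assms(1,4)])+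
 show ?thesis unfolding LLr_def
  using integrable_M[OF b(1)] integrable_M[OF b(2)] by (simp add: algebra_simps)
qed

lemma exp_f_bounds:
 assumes f: "adm K f" and \<xi>: "\<bar>\<xi>\<bar> \<le> 1"
 shows "exp (- K) \<le> exp (\<xi> * f n x y)" "exp (\<xi> * f n x y) \<le> exp K"
proof -
 have "\<bar>\<xi> * f n x y\<bar> \<le> 1 * K"
  unfolding abs_mult using \<xi> adm_le[OF f, of n x y] by (intro mult_mono) auto
 then show "exp (- K) \<le> exp (\<xi> * f n x y)" "exp (\<xi> * f n x y) \<le> exp K" by auto
qed

lemma LLr_bounds:
 assumes f: "adm K f" and \<xi>: "\<bar>\<xi>\<bar> \<le> 1" and h: "bm (M (Suc n)) h" "\<And>y. y \<in> space (M (Suc n)) \<Longrightarrow> 0 \<le> h y"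
  and x: "x \<in> space (M n)"
 shows "exp (- K) * (\<integral>y. p n x y * h y \<partial>M (Suc n)) \<le> LLr f \<xi> n h x"
  "LLr f \<xi> n h x \<le> exp K * (\<integral>y. p n x y * h y \<partial>M (Suc n))"
proof -
 have b: "bm (M (Suc n)) (\<lambda>y. p n x y * (exp (\<xi> * f n x y) * h y))"
  "bm (M (Suc n)) (\<lambda>y. c * (p n x y * h y))" for c
  by (rule bm_mult bm_exp bm_const h bm_p_fix[OF x] bm_f_fix[OF f x])+
 have *: "c * (p n x y * h y) = p n x y * (c * h y)" for c y by simp
 show "exp (- K) * (\<integral>y. p n x y * h y \<partial>M (Suc n)) \<le> LLr f \<xi> n h x"
  unfolding LLr_def integral_mult_right_zero[symmetric]
  by (rule bm_integral_mono[OF fin_M b(2) b(1)], unfold *)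
    (intro mult_left_mono mult_right_mono exp_f_bounds[OF f \<xi>] h p_nonneg)
 show "LLr f \<xi> n h x \<le> exp K * (\<integral>y. p n x y * h y \<partial>M (Suc n))"
  unfolding LLr_def integral_mult_right_zero[symmetric]
  by (rule bm_integral_mono[OF fin_M b(1) b(2)], unfold *)
    (intro mult_left_mono mult_right_mono exp_f_bounds[OF f \<xi>] h p_nonneg)
qed

lemma LLr_nonneg: "(\<And>y. y \<in> space (M (Suc n)) \<Longrightarrow> 0 \<le> h y) \<Longrightarrow> 0 \<le> LLr f \<xi> n h x"
 unfolding LLr_def by (intro integral_nonneg_AE AE_I2 mult_nonneg_nonneg p_nonneg) auto

lemma LLr_two_bounds:
 assumes f: "adm K f" and \<xi>: "\<bar>\<xi>\<bar> \<le> 1" and h: "bm (M (Suc (Suc n))) h" "\<And>y. y \<in> space (M (Suc (Suc n))) \<Longrightarrow> 0 \<le> h y"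
  and x: "x \<in> space (M n)"
 shows "exp (- 2 * K) * \<epsilon> * (\<integral>z. h z \<partial>M (Suc (Suc n))) \<le> LLr f \<xi> n (LLr f \<xi> (Suc n) h) x"
  "LLr f \<xi> n (LLr f \<xi> (Suc n) h) x \<le> exp (2 * K) / \<epsilon> * (\<integral>z. h z \<partial>M (Suc (Suc n)))"
proof -
 let ?N = "M (Suc (Suc n))"
 have bp2: "bm ?N (p2 n x)" using bm_p2[of "\<lambda>_. x" ?N n "\<lambda>z. z"] x by simp
 let ?P = "\<lambda>y. \<integral>z. p (Suc n) y z * h z \<partial>?N"
 have bP: "bm (M (Suc n)) ?P" by (intro bm_intros prob_M bm_comp[OF h(1)]; measurable)
 have bL: "bm (M (Suc n)) (LLr f \<xi> (Suc n) h)" by (rule bm_LLr[OF f h(1)])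
 have L0: "0 \<le> LLr f \<xi> (Suc n) h y" for y by (rule LLr_nonneg[OF h(2)])
 have e2: "exp (- 2 * K) = exp (- K) * exp (- K)" "exp (2 * K) = exp K * exp K"
  by (simp_all flip: exp_add)
 have b: "bm (M (Suc n)) (\<lambda>y. p n x y * LLr f \<xi> (Suc n) h y)" "bm (M (Suc n)) (\<lambda>y. c * (p n x y * ?P y))" for c
  by (rule bm_mult bm_const bL bP bm_p_fix[OF x])+
 have *: "c * (p n x y * g) = p n x y * (c * g)" for c y g by simp
 have "\<epsilon> * (\<integral>z. h z \<partial>?N) \<le> (\<integral>z. p2 n x z * h z \<partial>?N)"
  unfolding integral_mult_right_zero[symmetric]
  by (rule bm_integral_mono[OF fin_M bm_mult[OF bm_const h(1)] bm_mult[OF bp2 h(1)]])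
    (intro mult_right_mono p2_ge' x h(2))
 also have "\<dots> = (\<integral>y. p n x y * ?P y \<partial>M (Suc n))" by (rule two_step_real[OF h(1) x, symmetric])
 finally have "exp (- K) * (exp (- K) * (\<epsilon> * (\<integral>z. h z \<partial>?N))) \<le> exp (- K) * (\<integral>y. exp (- K) * (p n x y * ?P y) \<partial>M (Suc n))"
  unfolding integral_mult_right_zero by (intro mult_left_mono) auto
 also have "\<dots> \<le> exp (- K) * (\<integral>y. p n x y * LLr f \<xi> (Suc n) h y \<partial>M (Suc n))"
  by (rule mult_left_mono, rule bm_integral_mono[OF fin_M b(2) b(1)], unfold *)
    (auto intro!: mult_left_mono p_nonneg LLr_bounds[OF f \<xi> h])
 also have "\<dots> \<le> LLr f \<xi> n (LLr f \<xi> (Suc n) h) x"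
  by (rule LLr_bounds[OF f \<xi> bL L0 x])
 finally show "exp (- 2 * K) * \<epsilon> * (\<integral>z. h z \<partial>?N) \<le> LLr f \<xi> n (LLr f \<xi> (Suc n) h) x"
  unfolding e2 by (simp only: mult.assoc)
 have "LLr f \<xi> n (LLr f \<xi> (Suc n) h) x \<le> exp K * (\<integral>y. p n x y * LLr f \<xi> (Suc n) h y \<partial>M (Suc n))"
  by (rule LLr_bounds[OF f \<xi> bL L0 x])
 also have "\<dots> \<le> exp K * (\<integral>y. exp K * (p n x y * ?P y) \<partial>M (Suc n))"
  by (rule mult_left_mono, rule bm_integral_mono[OF fin_M b(1) b(2)], unfold *)
    (auto intro!: mult_left_mono p_nonneg LLr_bounds[OF f \<xi> h])
 also have "\<dots> = exp K * (exp K * (\<integral>z. p2 n x z * h z \<partial>?N))"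
  unfolding integral_mult_right_zero two_step_real[OF h(1) x] ..
 also have "\<dots> \<le> exp K * (exp K * (1 / \<epsilon> * (\<integral>z. h z \<partial>?N)))"
  unfolding integral_mult_right_zero[of _ "1 / \<epsilon>", symmetric]
  by (intro mult_left_mono bm_integral_mono[OF fin_M] bm_mult[OF bm_const h(1)] bm_mult[OF bp2 h(1)] mult_right_mono p2_le x h(2)) auto
 finally show "LLr f \<xi> n (LLr f \<xi> (Suc n) h) x \<le> exp (2 * K) / \<epsilon> * (\<integral>z. h z \<partial>?N)"
  unfolding e2 by simp
qed

lemma HHr_pos:
 assumes f: "adm K f" and \<xi>: "\<bar>\<xi>\<bar> \<le> 1" and x: "x \<in> space (M n)"
 shows "exp (- (K * real k)) \<le> HHr f \<xi> k n x"
 using x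
proof (induction k arbitrary: n x)
 case (Suc k)
 have "exp (- K) * exp (- (K * real k)) = exp (- K) * (\<integral>y. p n x y * exp (- (K * real k)) \<partial>M (Suc n))"
  using p_integral[OF Suc.prems] by simp
 also have "\<dots> \<le> LLr f \<xi> n (\<lambda>_. exp (- (K * real k))) x"
  by (rule LLr_bounds[OF f \<xi> bm_const _ Suc.prems]) simp
 also have "\<dots> \<le> HHr f \<xi> (Suc k) n x"
  using LLr_mono[OF f bm_const bm_HHr[OF f] Suc.prems Suc.IH] by simp
 finally show ?case by (simp add: algebra_simps flip: exp_add)
qed simp

lemma HHr_pos': "adm K f \<Longrightarrow> \<bar>\<xi>\<bar> \<le> 1 \<Longrightarrow> x \<in> space (M n) \<Longrightarrow> 0 < HHr f \<xi> k n x"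
 using HHr_pos[of K f \<xi> x n k] by (meson exp_gt_zero less_le_trans)

text \<open>A Harnack inequality: after two steps the value at any point lies between
  \<open>exp (- 2 * K) * \<epsilon>\<close> and \<open>exp (2 * K) / \<epsilon>\<close> times one
  integral that does not depend on the point. The constant is the ratio of these bounds; horizons of
  fewer than two steps are compared with constants directly.\<close>

lemma HHr_oscillation:
 assumes f: "adm K f" and \<xi>: "\<bar>\<xi>\<bar> \<le> 1" and x: "x \<in> space (M n)" and y: "y \<in> space (M n)"
 shows "HHr f \<xi> k n x \<le> exp (4 * K) / \<epsilon>\<^sup>2 * HHr f \<xi> k n y"
proof -
 have K: "0 \<le> K" by (rule adm_nonneg[OF f])
 have R: "1 \<le> 1 / \<epsilon>\<^sup>2" using eps by (simp add: power_le_one)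
 consider "k = 0" | "k = 1" | j where "k = Suc (Suc j)" by (metis One_nat_def not0_implies_Suc)
 then show ?thesis
 proof cases
  case 1
  then show ?thesis using K R mult_mono[of 1 "exp (4 * K)" 1 "1 / \<epsilon>\<^sup>2"] by simp
 next
  case 2
  have "HHr f \<xi> k n x \<le> exp K" using 2 LLr_bounds(2)[OF f \<xi> bm_const[of _ 1] _ x] p_integral[OF x] by simp
  also have "exp K = exp (2 * K) * exp (- K)" by (simp flip: exp_add)
  also have "\<dots> \<le> exp (2 * K) * HHr f \<xi> k n y"
   using 2 LLr_bounds(1)[OF f \<xi> bm_const[of _ 1] _ y] p_integral[OF y] by (intro mult_left_mono) auto
  also have "\<dots> \<le> (exp (4 * K) * (1 / \<epsilon>\<^sup>2)) * HHr f \<xi> k n y"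
   using K R HHr_pos'[OF f \<xi> y, of k] mult_mono[of "exp (2 * K)" "exp (4 * K)" 1 "1 / \<epsilon>\<^sup>2"]
   by (intro mult_right_mono) auto
  finally show ?thesis by simp
 next
  case 3
  let ?h = "HHr f \<xi> j (Suc (Suc n))" and ?N = "M (Suc (Suc n))"
  have bh: "bm ?N ?h" "0 \<le> ?h z" if "z \<in> space ?N" for z
   using bm_HHr[OF f] HHr_pos'[OF f \<xi> that] by (auto intro: less_imp_le)
  note B = LLr_two_bounds[OF f \<xi> bm_HHr[OF f] less_imp_le[OF HHr_pos'[OF f \<xi>]]]
  have "HHr f \<xi> k n x \<le> exp (2 * K) / \<epsilon> * (\<integral>z. ?h z \<partial>?N)"
   unfolding 3 HHr.simps by (rule B(2)[OF _ x])
  also have "\<dots> = exp (4 * K) / \<epsilon>\<^sup>2 * (exp (- 2 * K) * \<epsilon> * (\<integral>z. ?h z \<partial>?N))"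
  proof -
   have "exp (2 * K) = exp (4 * K) * exp (- 2 * K)" by (simp flip: exp_add)
   then show ?thesis using eps by (simp add: power2_eq_square)
  qed
  also have "\<dots> \<le> exp (4 * K) / \<epsilon>\<^sup>2 * HHr f \<xi> k n y"
   unfolding 3 HHr.simps by (intro mult_left_mono B(1)[OF _ y]) auto
  finally show ?thesis .
 qed
qed

subsection \<open>Three-step kernels and hexagons\<close>

definition SS :: "nat \<Rightarrow> ('a \<times> 'a) measure" where
 "SS n = M (Suc n) \<Otimes>\<^sub>M M (Suc (Suc n))"

definition wt :: "nat \<Rightarrow> 'a \<Rightarrow> 'a \<times> 'a \<Rightarrow> 'a \<Rightarrow> real" where
 "wt n x s z = p n x (fst s) * p (Suc n) (fst s) (snd s) * p (Suc (Suc n)) (snd s) z"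

definition ph :: "(nat \<Rightarrow> 'a \<Rightarrow> 'a \<Rightarrow> real) \<Rightarrow> nat \<Rightarrow> 'a \<Rightarrow> 'a \<times> 'a \<Rightarrow> 'a \<Rightarrow> real" where
 "ph f n x s z = f n x (fst s) + f (Suc n) (fst s) (snd s) + f (Suc (Suc n)) (snd s) z"

definition TT :: "(nat \<Rightarrow> 'a \<Rightarrow> 'a \<Rightarrow> real) \<Rightarrow> real \<Rightarrow> nat \<Rightarrow> 'a \<Rightarrow> 'a \<Rightarrow> real" where
 "TT f \<theta> n x z = (\<integral>s'. \<integral>s. wt n x s z * wt n x s' z * (1 - cos (\<theta> * (ph f n x s z - ph f n x s' z))) \<partial>SS n \<partial>SS n)"

text \<open>The mean square deviation of the phase around a random hexagon
 \<open>x, (x\<^sub>1, x\<^sub>2), (y\<^sub>1, y\<^sub>2), z\<close> at the times \<open>n, \<dots>, n + 3\<close>.\<close>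

definition DD :: "(nat \<Rightarrow> 'a \<Rightarrow> 'a \<Rightarrow> real) \<Rightarrow> real \<Rightarrow> nat \<Rightarrow> real" where
 "DD f \<theta> n = (\<integral>x. \<integral>z. TT f \<theta> n x z \<partial>M (Suc (Suc (Suc n))) \<partial>M n)"

lemma prob_SS: "prob_space (SS n)"
 unfolding SS_def by (intro prob_space_pair prob_M)

lemma fin_SS: "finite_measure (SS n)"
 using prob_SS prob_space.finite_measure by blast

lemma SS_proj [measurable]:
 "fst \<in> measurable (SS n) (M (Suc n))" "snd \<in> measurable (SS n) (M (Suc (Suc n)))"
 unfolding SS_def by measurable

lemma bm_wt:
 assumes "x \<in> measurable N (M n)" "s \<in> measurable N (SS n)" "z \<in> measurable N (M (Suc (Suc (Suc n))))"
 shows "bm N (\<lambda>w. wt n (x w) (s w) (z w))"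
 unfolding wt_def
 by (intro bm_mult bm_p assms measurable_compose[OF assms(2)] SS_proj)

lemma bm_ph:
 assumes "adm K f" "x \<in> measurable N (M n)" "s \<in> measurable N (SS n)" "z \<in> measurable N (M (Suc (Suc (Suc n))))"
 shows "bm N (\<lambda>w. ph f n (x w) (s w) (z w))"
 unfolding ph_def
 by (intro bm_add bm_f[OF assms(1)] assms measurable_compose[OF assms(3)] SS_proj)

lemma wt_nonneg: "0 \<le> wt n x s z"
 unfolding wt_def by (intro mult_nonneg_nonneg p_nonneg)

lemma ph_le: "adm K f \<Longrightarrow> \<bar>ph f n x s z\<bar> \<le> 3 * K"
 unfolding ph_def
 using adm_le[of K f n x "fst s"] adm_le[of K f "Suc n" "fst s" "snd s"] adm_le[of K f "Suc (Suc n)" "snd s" z]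
 by linarith

lemma TT_nonneg: "0 \<le> TT f t n x z"
 unfolding TT_def by (intro integral_nonneg_AE AE_I2 mult_nonneg_nonneg wt_nonneg) auto

lemma DD_nonneg: "0 \<le> DD f t n"
 unfolding DD_def by (intro integral_nonneg_AE AE_I2 TT_nonneg)

lemma bm_TT:
 assumes f: "adm K f" and x: "x \<in> measurable N (M n)" and z: "z \<in> measurable N (M (Suc (Suc (Suc n))))"
 shows "bm N (\<lambda>w. TT f t n (x w) (z w))"
 unfolding TT_def
 by (intro bm_integral[OF prob_SS] bm_mult bm_diff bm_const bm_cos borel_measurable_times
   borel_measurable_diff borel_measurable_const bm_wt bm_measurable[OF bm_ph[OF f]]
   measurable_compose[OF _ x] measurable_compose[OF _ z]; measurable)

text \<open>The kernel of three perturbed steps. Two free intermediate points allow a hexagon to be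
  cut into an edge on either side and two two-step bridges, and bridges have mass at least
  \<open>\<epsilon>\<close>, although single edges may have density zero.\<close>

definition KK :: "(nat \<Rightarrow> 'a \<Rightarrow> 'a \<Rightarrow> real) \<Rightarrow> complex \<Rightarrow> nat \<Rightarrow> 'a \<Rightarrow> 'a \<Rightarrow> complex" where
 "KK f \<zeta> n x z = (\<integral>s. of_real (wt n x s z) * exp (\<zeta> * of_real (ph f n x s z)) \<partial>SS n)"

lemma bm_KK:
 assumes f: "adm K f" and x: "x \<in> measurable N (M n)" and z: "z \<in> measurable N (M (Suc (Suc (Suc n))))"
 shows "bm N (\<lambda>w. KK f s n (x w) (z w))"
 unfolding KK_def
 by (intro bm_integral[OF prob_SS] bm_mult bm_const bm_of_real bm_exp bm_wt bm_ph[OF f]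
   measurable_compose[OF _ x] measurable_compose[OF _ z]; measurable)

lemma LL_three_steps:
 assumes f: "adm K f" and g: "bm (M (Suc (Suc (Suc n)))) g" and x: "x \<in> space (M n)"
 shows "LL f c n (LL f c (Suc n) (LL f c (Suc (Suc n)) g)) x =
  (\<integral>z. KK f c n x z * g z \<partial>M (Suc (Suc (Suc n))))"
proof -
 let ?M1 = "M (Suc n)" and ?M2 = "M (Suc (Suc n))" and ?M3 = "M (Suc (Suc (Suc n)))"
 let ?F = "\<lambda>y b z. of_real (wt n x (y, b) z) * exp (c * of_real (ph f n x (y, b) z)) * g z"
 have x': "(\<lambda>_. x) \<in> measurable N (M n)" for N :: "'z measure" using x by measurable
 have pair: "(\<lambda>w. (u w, v w)) \<in> measurable N (SS n)"
  if "u \<in> measurable N ?M1" "v \<in> measurable N ?M2" for N :: "'z measure" and u v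
  unfolding SS_def using that by measurable
 have bF: "bm N (\<lambda>w. ?F (u w) (v w) (z w))"
  if "u \<in> measurable N ?M1" "v \<in> measurable N ?M2" "z \<in> measurable N ?M3" for N :: "(('a \<times> 'a) \<times> 'a) measure" and u v z
  using that x by (intro bm_mult bm_of_real bm_exp bm_const bm_wt bm_ph[OF f] bm_comp[OF g]) (auto simp: SS_def)
 have bF2: "bm N (\<lambda>w. ?F (u w) (v w) (z w))"
  if "u \<in> measurable N ?M1" "v \<in> measurable N ?M2" "z \<in> measurable N ?M3" for N :: "('a \<times> 'a) measure" and u v z
  using that x by (intro bm_mult bm_of_real bm_exp bm_const bm_wt bm_ph[OF f] bm_comp[OF g]) (auto simp: SS_def)
 have "LL f c n (LL f c (Suc n) (LL f c (Suc (Suc n)) g)) x = (\<integral>y. \<integral>b. \<integral>z. ?F y b z \<partial>?M3 \<partial>?M2 \<partial>?M1)"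
  unfolding LL_def integral_mult_right_zero[symmetric]
  by (intro integral_congI)
    (simp add: wt_def ph_def distrib_left exp_add)
 also have "\<dots> = (\<integral>y. \<integral>z. \<integral>b. ?F y b z \<partial>?M2 \<partial>?M3 \<partial>?M1)"
  by (intro integral_congI bm_integral_swap[OF prob_M prob_M] bF2; measurable)
 also have "\<dots> = (\<integral>z. \<integral>y. \<integral>b. ?F y b z \<partial>?M2 \<partial>?M1 \<partial>?M3)"
  by (rule bm_integral_swap[OF prob_M prob_M]) (intro bm_integral[OF prob_M] bF; measurable)
 also have "\<dots> = (\<integral>z. KK f c n x z * g z \<partial>?M3)"
 proof (intro integral_congI)
  fix z assume z: "z \<in> space ?M3"
  have b: "bm (?M1 \<Otimes>\<^sub>M ?M2) (\<lambda>s. of_real (wt n x s z) * exp (c * of_real (ph f n x s z)) * g z)"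
   using x z by (intro bm_mult bm_of_real bm_exp bm_const bm_wt bm_ph[OF f]) (auto simp: SS_def)
  have "(\<integral>y. \<integral>b. ?F y b z \<partial>?M2 \<partial>?M1) = (\<integral>s. of_real (wt n x s z) * exp (c * of_real (ph f n x s z)) * g z \<partial>SS n)"
   unfolding SS_def by (rule bm_integral_pair[OF prob_M prob_M b, symmetric])
  then show "(\<integral>y. \<integral>b. ?F y b z \<partial>?M2 \<partial>?M1) = KK f c n x z * g z"
   unfolding KK_def by simp
 qed
 finally show ?thesis .
qed

lemma wt_integral_le:
 assumes x: "x \<in> space (M n)" and z: "z \<in> space (M (Suc (Suc (Suc n))))"
 shows "(\<integral>s. wt n x s z \<partial>SS n) \<le> 1 / \<epsilon>"
proof -
 let ?M1 = "M (Suc n)" and ?M2 = "M (Suc (Suc n))"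
 have b: "bm (SS n) (\<lambda>s. p n x (fst s) * p (Suc n) (fst s) (snd s))"
  using x by (intro bm_mult bm_p) auto
 have "(\<integral>s. wt n x s z \<partial>SS n) \<le> (\<integral>s. 1 / \<epsilon> * (p n x (fst s) * p (Suc n) (fst s) (snd s)) \<partial>SS n)"
 proof (rule bm_integral_mono[OF fin_SS])
  show "bm (SS n) (\<lambda>s. wt n x s z)" using x z by (intro bm_wt) auto
  show "bm (SS n) (\<lambda>s. 1 / \<epsilon> * (p n x (fst s) * p (Suc n) (fst s) (snd s)))" by (rule bm_mult[OF bm_const b])
  fix s show "wt n x s z \<le> 1 / \<epsilon> * (p n x (fst s) * p (Suc n) (fst s) (snd s))"
   unfolding wt_def using mult_left_mono[OF p_le, of "p n x (fst s) * p (Suc n) (fst s) (snd s)" "Suc (Suc n)" "snd s" z]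
   by (simp add: p_nonneg mult.commute)
 qed
 also have "\<dots> = 1 / \<epsilon> * (\<integral>y. \<integral>b. p n x y * p (Suc n) y b \<partial>?M2 \<partial>?M1)"
  unfolding integral_mult_right_zero using bm_integral_pair[OF prob_M prob_M b[unfolded SS_def]]
  by (simp add: SS_def)
 also have "(\<integral>y. \<integral>b. p n x y * p (Suc n) y b \<partial>?M2 \<partial>?M1) = (\<integral>y. p n x y \<partial>?M1)"
  by (intro integral_congI) (simp add: p_integral)
 finally show ?thesis using p_integral[OF x] by simp
qed

text \<open>With \<open>a\<close> the tilted mass and \<open>b\<close> the modulus at frequency
  \<open>t\<close>, the square identity gives
  \<open>a\<^sup>2 - b\<^sup>2 \<ge> exp (- 6 * K) * TT\<close>, each tilt being at least
  \<open>exp (- 3 * K)\<close>. Dividing by \<open>a + b \<le> 2 * exp (3 * K) / \<epsilon>\<close>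
  gives the stated gap for \<open>a - b\<close>.\<close>

lemma KK_gap:
 assumes f: "adm K f" and \<xi>: "\<bar>\<xi>\<bar> \<le> 1" and x: "x \<in> space (M n)" and z: "z \<in> space (M (Suc (Suc (Suc n))))"
 shows "norm (KK f (Complex \<xi> t) n x z) \<le> Re (KK f (of_real \<xi>) n x z) - exp (- 9 * K) * \<epsilon> / 2 * TT f t n x z"
proof -
 define A where "A s = wt n x s z * exp (\<xi> * ph f n x s z)" for s
 have bw: "bm (SS n) (\<lambda>s. wt n x s z)" and bp: "bm (SS n) (\<lambda>s. ph f n x s z)"
  using x z by (intro bm_wt bm_ph[OF f]; simp)+
 have bA: "bm (SS n) A" unfolding A_def by (intro bm_intros bw bp)
 define g where "g s = t * ph f n x s z" for s
 have bg: "bm (SS n) g" unfolding g_def by (intro bm_intros bp)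
 have A0: "0 \<le> A s" for s unfolding A_def by (simp add: wt_nonneg)
 have e: "exp (- 3 * K) \<le> exp (\<xi> * ph f n x s z)" "exp (\<xi> * ph f n x s z) \<le> exp (3 * K)" for s
 proof -
  have "\<bar>\<xi> * ph f n x s z\<bar> \<le> 1 * (3 * K)"
   unfolding abs_mult using \<xi> ph_le[OF f, of n x s z] by (intro mult_mono) auto
  then show "exp (- 3 * K) \<le> exp (\<xi> * ph f n x s z)" "exp (\<xi> * ph f n x s z) \<le> exp (3 * K)" by auto
 qed
 have Keq: "KK f (Complex \<xi> t) n x z = (\<integral>s. of_real (A s) * exp (\<i> * of_real (g s)) \<partial>SS n)"
  unfolding KK_def A_def g_def
  by (intro integral_congI)
    (simp add: complex_eq_iff Re_exp Im_exp)
 have Kreal: "Re (KK f (of_real \<xi>) n x z) = (\<integral>s. A s \<partial>SS n)"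
 proof -
  have "KK f (of_real \<xi>) n x z = of_real (\<integral>s. A s \<partial>SS n)"
   unfolding KK_def A_def integral_complex_of_real'[symmetric]
   by (simp add: exp_of_real flip: of_real_mult)
  then show ?thesis by simp
 qed
 let ?a = "\<integral>s. A s \<partial>SS n" and ?b = "norm (KK f (Complex \<xi> t) n x z)"
 have a0: "0 \<le> ?a" by (intro integral_nonneg_AE AE_I2 A0)
 have a_le: "?a \<le> exp (3 * K) / \<epsilon>"
 proof -
  have "?a \<le> (\<integral>s. exp (3 * K) * wt n x s z \<partial>SS n)"
   unfolding A_def
   by (rule bm_integral_mono[OF fin_SS bA[unfolded A_def[abs_def]] bm_mult[OF bm_const bw]])
     (use mult_left_mono[OF e(2) wt_nonneg] in \<open>simp add: mult.commute\<close>)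
  also have "\<dots> \<le> exp (3 * K) * (1 / \<epsilon>)"
   unfolding integral_mult_right_zero by (intro mult_left_mono wt_integral_le x z) simp
  finally show ?thesis by simp
 qed
 have gap: "exp (- 6 * K) * TT f t n x z \<le> ?a\<^sup>2 - ?b\<^sup>2"
 proof -
  have bTT: "bm (SS n) (\<lambda>s'. \<integral>s. wt n x s z * wt n x s' z * (1 - cos (t * (ph f n x s z - ph f n x s' z))) \<partial>SS n)"
   "bm (SS n) (\<lambda>s'. \<integral>s. A s * A s' * (1 - cos (g s - g s')) \<partial>SS n)"
   by (intro bm_integral[OF prob_SS] bm_mult bm_diff bm_const bm_cos borel_measurable_times
      borel_measurable_diff borel_measurable_const bm_comp[OF bw] bm_comp[OF bA]
      measurable_compose[OF _ bm_measurable[OF bp]] measurable_compose[OF _ bm_measurable[OF bg]]; measurable)+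
  have "exp (- 6 * K) * TT f t n x z =
   (\<integral>s'. exp (- 6 * K) * (\<integral>s. wt n x s z * wt n x s' z * (1 - cos (t * (ph f n x s z - ph f n x s' z))) \<partial>SS n) \<partial>SS n)"
   unfolding TT_def by simp
  also have "\<dots> \<le> (\<integral>s'. \<integral>s. A s * A s' * (1 - cos (g s - g s')) \<partial>SS n \<partial>SS n)"
  proof (rule bm_integral_mono[OF fin_SS bm_mult[OF bm_const bTT(1)] bTT(2)])
   fix s' assume s': "s' \<in> space (SS n)"
   show "exp (- 6 * K) * (\<integral>s. wt n x s z * wt n x s' z * (1 - cos (t * (ph f n x s z - ph f n x s' z))) \<partial>SS n)
    \<le> (\<integral>s. A s * A s' * (1 - cos (g s - g s')) \<partial>SS n)"
    unfolding integral_mult_right_zero[symmetric]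
   proof (rule bm_integral_mono[OF fin_SS])
    show "bm (SS n) (\<lambda>s. exp (- 6 * K) * (wt n x s z * wt n x s' z * (1 - cos (t * (ph f n x s z - ph f n x s' z)))))"
     "bm (SS n) (\<lambda>s. A s * A s' * (1 - cos (g s - g s')))"
     by (intro bm_mult bm_diff bm_const bm_cos borel_measurable_times borel_measurable_diff
       borel_measurable_const bw bA bm_measurable[OF bp] bm_measurable[OF bg])+
    fix s
    have "exp (- 6 * K) = exp (- 3 * K) * exp (- 3 * K)" by (simp flip: exp_add)
    also have "\<dots> \<le> exp (\<xi> * ph f n x s z) * exp (\<xi> * ph f n x s' z)" by (intro mult_mono e) auto
    finally have "exp (- 6 * K) * (wt n x s z * wt n x s' z * (1 - cos (t * (ph f n x s z - ph f n x s' z)))) \<le>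
     exp (\<xi> * ph f n x s z) * exp (\<xi> * ph f n x s' z) * (wt n x s z * wt n x s' z * (1 - cos (t * (ph f n x s z - ph f n x s' z))))"
     by (intro mult_right_mono mult_nonneg_nonneg wt_nonneg) auto
    also have "\<dots> = A s * A s' * (1 - cos (g s - g s'))"
     unfolding A_def g_def by (simp add: right_diff_distrib)
    finally show "exp (- 6 * K) * (wt n x s z * wt n x s' z * (1 - cos (t * (ph f n x s z - ph f n x s' z)))) \<le> A s * A s' * (1 - cos (g s - g s'))" .
   qed
  qed
  also have "\<dots> = ?a\<^sup>2 - ?b\<^sup>2"
   unfolding Keq square_char_integral[OF prob_SS bA bg] by simp
  finally show ?thesis .
 qed
 have "?b\<^sup>2 \<le> ?a\<^sup>2" using gap mult_nonneg_nonneg[OF exp_ge_zero TT_nonneg, of "- 6 * K" f t n x z] by linarith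
 then have ba: "?b \<le> ?a" using a0 by (rule power2_le_imp_le)
 have "?a\<^sup>2 - ?b\<^sup>2 = (?a - ?b) * (?a + ?b)" by (simp add: power2_eq_square algebra_simps)
 also have "\<dots> \<le> (?a - ?b) * (2 * (exp (3 * K) / \<epsilon>))" using ba a_le by (intro mult_left_mono) auto
 finally have "exp (- 6 * K) * TT f t n x z \<le> (?a - ?b) * (2 * (exp (3 * K) / \<epsilon>))" using gap by linarith
 then have "(exp (- 6 * K) * TT f t n x z) * (exp (- 3 * K) * \<epsilon> / 2) \<le> (?a - ?b) * (2 * (exp (3 * K) / \<epsilon>)) * (exp (- 3 * K) * \<epsilon> / 2)"
  using eps by (intro mult_right_mono) auto
 also have "\<dots> = ?a - ?b" using eps by (simp add: exp_minus field_simps)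
 also have "(exp (- 6 * K) * TT f t n x z) * (exp (- 3 * K) * \<epsilon> / 2) = exp (- 9 * K) * \<epsilon> / 2 * TT f t n x z"
 proof -
  have "exp (- 9 * K) = exp (- 6 * K) * exp (- 3 * K)" by (simp flip: exp_add)
  then show ?thesis by simp
 qed
 finally show ?thesis unfolding Kreal by linarith
qed

lemma LL_norm_le:
 assumes f: "adm K f" and g: "bm (M (Suc n)) g" and G: "bm (M (Suc n)) G"
  and le: "\<And>y. y \<in> space (M (Suc n)) \<Longrightarrow> norm (g y) \<le> G y" and x: "x \<in> space (M n)"
 shows "norm (LL f (Complex \<xi> t) n g x) \<le> LLr f \<xi> n G x"
 unfolding LL_def LLr_def
proof (rule bm_integral_norm_le[OF fin_M])
 show "bm (M (Suc n)) (\<lambda>y. of_real (p n x y) * (exp (Complex \<xi> t * of_real (f n x y)) * g y))"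
  "bm (M (Suc n)) (\<lambda>y. p n x y * (exp (\<xi> * f n x y) * G y))"
  by (rule bm_mult bm_of_real bm_exp bm_const g G bm_p_fix[OF x] bm_f_fix[OF f x])+
 fix y assume y: "y \<in> space (M (Suc n))"
 have "norm (of_real (p n x y) * (exp (Complex \<xi> t * of_real (f n x y)) * g y)) = p n x y * (exp (\<xi> * f n x y) * norm (g y))"
  by (simp add: norm_mult p_nonneg)
 also have "\<dots> \<le> p n x y * (exp (\<xi> * f n x y) * G y)"
  by (intro mult_left_mono le y p_nonneg) simp
 finally show "norm (of_real (p n x y) * (exp (Complex \<xi> t * of_real (f n x y)) * g y)) \<le> p n x y * (exp (\<xi> * f n x y) * G y)" .
qed

lemma HHr_add_le:
 assumes f: "adm K f" and \<xi>: "\<bar>\<xi>\<bar> \<le> 1" and x: "x \<in> space (M n)"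
  and B: "\<And>z. z \<in> space (M (n + j)) \<Longrightarrow> HHr f \<xi> k (n + j) z \<le> B"
 shows "HHr f \<xi> (j + k) n x \<le> exp (K * real j) * B"
 using x B
proof (induction j arbitrary: n x)
 case (Suc j)
 have IH: "HHr f \<xi> (j + k) (Suc n) y \<le> exp (K * real j) * B" if "y \<in> space (M (Suc n))" for y
  by (rule Suc.IH[OF that]) (use Suc.prems in simp)
 have B0: "0 \<le> B"
 proof -
  obtain z where "z \<in> space (M (n + Suc j))" using prob_space.not_empty[OF prob_M] by blast
  then show ?thesis using Suc.prems(2) HHr_pos'[OF f \<xi>] by (meson less_le_trans less_imp_le)
 qed
 have "HHr f \<xi> (Suc j + k) n x = LLr f \<xi> n (HHr f \<xi> (j + k) (Suc n)) x" by simp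
 also have "\<dots> \<le> LLr f \<xi> n (\<lambda>_. exp (K * real j) * B) x"
  by (rule LLr_mono[OF f bm_HHr[OF f] bm_const Suc.prems(1) IH])
 also have "\<dots> \<le> exp K * (\<integral>y. p n x y * (exp (K * real j) * B) \<partial>M (Suc n))"
  by (rule LLr_bounds[OF f \<xi> bm_const _ Suc.prems(1)]) (use B0 in simp)
 also have "\<dots> = exp (K * real (Suc j)) * B"
  using p_integral[OF Suc.prems(1)] by (simp add: algebra_simps exp_add)
 finally show ?case .
qed simp

lemma three_step_gap:
 assumes f: "adm K f" and \<xi>: "\<bar>\<xi>\<bar> \<le> 1" and x: "x \<in> space (M n)" and m: "0 \<le> m"
  and g: "bm (M (Suc (Suc (Suc n)))) g"
  and le: "\<And>z. z \<in> space (M (Suc (Suc (Suc n)))) \<Longrightarrow> norm (g z) \<le> m * HHr f \<xi> k (Suc (Suc (Suc n))) z"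
  and low: "\<And>z. z \<in> space (M (Suc (Suc (Suc n)))) \<Longrightarrow> l \<le> HHr f \<xi> k (Suc (Suc (Suc n))) z"
 shows "norm (LL f (Complex \<xi> t) n (LL f (Complex \<xi> t) (Suc n) (LL f (Complex \<xi> t) (Suc (Suc n)) g)) x) \<le>
   m * (HHr f \<xi> (Suc (Suc (Suc k))) n x - exp (- 9 * K) * \<epsilon> / 2 * l * (\<integral>z. TT f t n x z \<partial>M (Suc (Suc (Suc n)))))"
proof -
 let ?N = "M (Suc (Suc (Suc n)))" and ?h = "HHr f \<xi> k (Suc (Suc (Suc n)))" and ?c = "exp (- 9 * K) * \<epsilon> / 2"
 let ?R = "\<lambda>z. Re (KK f (of_real \<xi>) n x z)" and ?T = "\<lambda>z. TT f t n x z"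
 have bh: "bm ?N ?h" by (rule bm_HHr[OF f])
 have bR: "bm ?N ?R" using x by (intro bm_Re bm_KK[OF f]) auto
 have bT: "bm ?N ?T" using x by (intro bm_TT[OF f]) auto
 have bK: "bm ?N (\<lambda>z. KK f s n x z)" for s using x by (intro bm_KK[OF f]) auto
 have "HH f (of_real \<xi>) (Suc (Suc (Suc k))) n x = (\<integral>z. KK f (of_real \<xi>) n x z * of_real (?h z) \<partial>?N)"
  using LL_three_steps[OF f bm_of_real[OF bh] x, of "of_real \<xi>"] by (simp add: HH_of_real)
 then have "HHr f \<xi> (Suc (Suc (Suc k))) n x = Re (\<integral>z. KK f (of_real \<xi>) n x z * of_real (?h z) \<partial>?N)"
  unfolding HH_of_real by (metis Re_complex_of_real)
 also have "\<dots> = (\<integral>z. ?R z * ?h z \<partial>?N)"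
  using integral_Re[OF integrable_M[OF bm_mult[OF bK bm_of_real[OF bh]]], symmetric] by simp
 finally have H: "HHr f \<xi> (Suc (Suc (Suc k))) n x = (\<integral>z. ?R z * ?h z \<partial>?N)" .
 have "norm (LL f (Complex \<xi> t) n (LL f (Complex \<xi> t) (Suc n) (LL f (Complex \<xi> t) (Suc (Suc n)) g)) x)
   = norm (\<integral>z. KK f (Complex \<xi> t) n x z * g z \<partial>?N)"
  unfolding LL_three_steps[OF f g x] ..
 also have "\<dots> \<le> (\<integral>z. m * (?R z * ?h z) - m * (?c * l) * ?T z \<partial>?N)"
 proof (rule bm_integral_norm_le[OF fin_M])
  show "bm ?N (\<lambda>z. KK f (Complex \<xi> t) n x z * g z)" by (rule bm_mult[OF bK g])
  show "bm ?N (\<lambda>z. m * (?R z * ?h z) - m * (?c * l) * ?T z)"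
   by (rule bm_diff[OF bm_mult[OF bm_const bm_mult[OF bR bh]] bm_mult[OF bm_const bT]])
  fix z assume z: "z \<in> space ?N"
  have h0: "0 \<le> ?h z" using HHr_pos'[OF f \<xi> z] by (rule less_imp_le)
  have "norm (KK f (Complex \<xi> t) n x z * g z) \<le> (?R z - ?c * ?T z) * (m * ?h z)"
   unfolding norm_mult by (intro mult_mono' KK_gap[OF f \<xi> x z] le z norm_ge_zero)
  also have "\<dots> = m * (?R z * ?h z) - m * ?c * ?T z * ?h z" by (simp add: algebra_simps)
  also have "\<dots> \<le> m * (?R z * ?h z) - m * ?c * ?T z * l"
   using low[OF z] m eps TT_nonneg[of f t n x z]
   by (intro diff_left_mono mult_left_mono mult_nonneg_nonneg) auto
  finally show "norm (KK f (Complex \<xi> t) n x z * g z) \<le> m * (?R z * ?h z) - m * (?c * l) * ?T z"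
   by (simp add: algebra_simps)
 qed
 also have "\<dots> = m * (\<integral>z. ?R z * ?h z \<partial>?N) - m * (?c * l) * (\<integral>z. ?T z \<partial>?N)"
  using integrable_M[OF bm_mult[OF bR bh]] integrable_M[OF bT] by simp
 finally show ?thesis unfolding H by (simp add: algebra_simps)
qed

text \<open>The gain of three steps depends on the starting point and may vanish there. Two further
  steps in front spread the starting point with density at least \<open>\<epsilon>\<close> relative
  to \<open>M n\<close>, so that the averaged quantity \<open>DD\<close> appears at every
  \<open>x\<close>. The Harnack inequality makes the gain relative to \<open>HHr\<close>. With
  \<open>R = exp (4 * K) / \<epsilon>\<^sup>2\<close>, the constant is
  \<open>exp (- 9 * K) * \<epsilon> / 2\<close> times \<open>exp (- 2 * K) * \<epsilon>\<close>
  divided by \<open>exp (5 * K) * R\<^sup>2\<close>.\<close>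

lemma five_step_gap:
 fixes \<xi> t :: real
 assumes f: "adm K f" and \<xi>: "\<bar>\<xi>\<bar> \<le> 1" and x: "x \<in> space (M q)" and m: "0 \<le> m"
  and n: "n = Suc (Suc q)"
  and g: "bm (M (Suc (Suc (Suc n)))) g"
  and le: "\<And>z. z \<in> space (M (Suc (Suc (Suc n)))) \<Longrightarrow> norm (g z) \<le> m * HHr f \<xi> k (Suc (Suc (Suc n))) z"
  and c: "c = exp (- 24 * K) * \<epsilon> ^ 6 / 2"
 defines "L \<equiv> LL f (Complex \<xi> t)"
 shows "norm (L q (L (Suc q) (L n (L (Suc n) (L (Suc (Suc n)) g)))) x) \<le>
   exp (- c * DD f t n) * m * HHr f \<xi> (5 + k) q x"
proof -
 let ?N = "M (Suc (Suc (Suc n)))" and ?h = "HHr f \<xi> k (Suc (Suc (Suc n)))" and ?c = "exp (- 9 * K) * \<epsilon> / 2"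
 define R where "R = exp (4 * K) / \<epsilon>\<^sup>2"
 have R: "0 < R" unfolding R_def using eps by simp
 obtain z0 where z0: "z0 \<in> space ?N" using prob_space.not_empty[OF prob_M] by blast
 define l where "l = ?h z0 / R"
 have l: "0 < l" unfolding l_def using HHr_pos'[OF f \<xi> z0] R by simp
 have low: "l \<le> ?h z" if "z \<in> space ?N" for z
  using HHr_oscillation[OF f \<xi> z0 that, of k] R unfolding l_def R_def[symmetric] by (simp add: divide_le_eq mult.commute)
 have high: "?h z \<le> R\<^sup>2 * l" if "z \<in> space ?N" for z
  using HHr_oscillation[OF f \<xi> that z0, of k] R unfolding l_def R_def[symmetric] by (simp add: power2_eq_square)
 define u where "u y = (\<integral>z. TT f t n y z \<partial>?N)" for y
 have bu: "bm (M n) u" unfolding u_def by (intro bm_integral[OF prob_M] bm_TT[OF f]; measurable)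
 have u0: "0 \<le> u y" for y unfolding u_def by (intro integral_nonneg_AE AE_I2 TT_nonneg)
 have D: "DD f t n = (\<integral>y. u y \<partial>M n)" unfolding DD_def u_def ..
 let ?G = "\<lambda>y. m * HHr f \<xi> (Suc (Suc (Suc k))) n y - m * (?c * l) * u y"
 have bG: "bm (M n) ?G" by (rule bm_diff[OF bm_mult[OF bm_const bm_HHr[OF f]] bm_mult[OF bm_const bu]])
 have bg: "bm (M n) (L n (L (Suc n) (L (Suc (Suc n)) g)))" unfolding L_def by (intro bm_LL[OF f] g)
 have 1: "norm (L n (L (Suc n) (L (Suc (Suc n)) g)) y) \<le> ?G y" if "y \<in> space (M n)" for y
  using three_step_gap[OF f \<xi> that m g le low] unfolding L_def u_def by (simp add: algebra_simps)
 note bg' = bg[unfolded n] and bG' = bG[unfolded n]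
 have 2: "norm (L (Suc q) (L n (L (Suc n) (L (Suc (Suc n)) g))) y) \<le> LLr f \<xi> (Suc q) ?G y" if "y \<in> space (M (Suc q))" for y
  unfolding L_def by (rule LL_norm_le[OF f _ _ _ that]) (use bg bG 1 in \<open>simp_all add: L_def n\<close>)
 have bg2: "bm (M (Suc q)) (L (Suc q) (L n (L (Suc n) (L (Suc (Suc n)) g))))"
  using bg unfolding L_def n by (rule bm_LL[OF f])
 have bG2: "bm (M (Suc q)) (LLr f \<xi> (Suc q) ?G)" using bG unfolding n by (intro bm_LLr[OF f])
 have "norm (L q (L (Suc q) (L n (L (Suc n) (L (Suc (Suc n)) g)))) x) \<le> LLr f \<xi> q (LLr f \<xi> (Suc q) ?G) x"
  unfolding L_def by (rule LL_norm_le[OF f _ bG2 _ x]) (use bg2 2 in \<open>simp_all add: L_def\<close>)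
 also have "\<dots> = LLr f \<xi> q (\<lambda>y. m * HHr f \<xi> (Suc (Suc (Suc (Suc k)))) (Suc q) y - m * (?c * l) * LLr f \<xi> (Suc q) u y) x"
 proof (rule LLr_cong)
  fix y assume y: "y \<in> space (M (Suc q))"
  have "LLr f \<xi> (Suc q) ?G y = LLr f \<xi> (Suc q) (\<lambda>y. m * HHr f \<xi> (Suc (Suc (Suc k))) n y) y - LLr f \<xi> (Suc q) (\<lambda>y. m * (?c * l) * u y) y"
   by (rule LLr_diff[OF f _ _ y])
     (use bu in \<open>simp_all only: n bm_mult bm_const bm_HHr[OF f]\<close>)
  then show "LLr f \<xi> (Suc q) ?G y = m * HHr f \<xi> (Suc (Suc (Suc (Suc k)))) (Suc q) y - m * (?c * l) * LLr f \<xi> (Suc q) u y"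
   unfolding LLr_scale by (simp add: n)
 qed
 also have "\<dots> = m * HHr f \<xi> (5 + k) q x - m * (?c * l) * LLr f \<xi> q (LLr f \<xi> (Suc q) u) x"
 proof -
  have b1: "bm (M (Suc q)) (\<lambda>y. m * HHr f \<xi> (Suc (Suc (Suc (Suc k)))) (Suc q) y)" "bm (M (Suc q)) (\<lambda>y. m * (?c * l) * LLr f \<xi> (Suc q) u y)"
   using bu unfolding n by (intro bm_mult bm_const bm_HHr[OF f] bm_LLr[OF f])+
  show ?thesis unfolding LLr_diff[OF f b1 x] LLr_scale by (simp add: eval_nat_numeral)
 qed
 also have "\<dots> \<le> m * HHr f \<xi> (5 + k) q x - m * (?c * l) * (exp (- 2 * K) * \<epsilon> * DD f t n)"
  using LLr_two_bounds(1)[OF f \<xi> bu[unfolded n] u0 x] m l eps unfolding D[unfolded n] n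
  by (intro diff_left_mono mult_left_mono mult_nonneg_nonneg) auto
 also have "\<dots> \<le> m * HHr f \<xi> (5 + k) q x - m * (c * HHr f \<xi> (5 + k) q x * DD f t n)"
 proof -
  have q5: "q + 5 = Suc (Suc (Suc n))" by (simp add: n)
  have "HHr f \<xi> (5 + k) q x \<le> exp (K * real 5) * (R\<^sup>2 * l)"
   by (rule HHr_add_le[OF f \<xi> x]) (use high in \<open>simp add: q5\<close>)
  then have "c * HHr f \<xi> (5 + k) q x \<le> c * (exp (5 * K) * (R\<^sup>2 * l))"
   using eps unfolding c by (intro mult_left_mono) (auto simp: mult.commute)
  also have "\<dots> = ?c * l * (exp (- 2 * K) * \<epsilon>)"
  proof -
   have e: "exp (- 24 * K) * exp (5 * K) * (exp (4 * K))\<^sup>2 = exp (- 9 * K) * exp (- 2 * K)"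
    by (simp add: power2_eq_square flip: exp_add)
   have "c * (exp (5 * K) * (R\<^sup>2 * l)) = (exp (- 24 * K) * exp (5 * K) * (exp (4 * K))\<^sup>2) * (\<epsilon> ^ 6 / (\<epsilon>\<^sup>2)\<^sup>2) / 2 * l"
    unfolding c R_def by (simp add: power_divide mult_ac)
   also have "\<epsilon> ^ 6 / (\<epsilon>\<^sup>2)\<^sup>2 = \<epsilon>\<^sup>2" using eps by (simp add: power2_eq_square eval_nat_numeral)
   finally show ?thesis unfolding e by (simp add: power2_eq_square mult_ac)
  qed
  finally have "m * (c * HHr f \<xi> (5 + k) q x * DD f t n) \<le> m * (?c * l * (exp (- 2 * K) * \<epsilon>) * DD f t n)"
   by (intro mult_left_mono mult_right_mono DD_nonneg m)
  then show ?thesis by (simp add: algebra_simps)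
 qed
 also have "\<dots> = (1 + (- c * DD f t n)) * (m * HHr f \<xi> (5 + k) q x)" by (simp add: algebra_simps)
 also have "\<dots> \<le> exp (- c * DD f t n) * (m * HHr f \<xi> (5 + k) q x)"
  using m HHr_pos'[OF f \<xi> x, of "5 + k"] by (intro mult_right_mono exp_ge_add_one_self) auto
 finally show ?thesis by (simp only: mult.assoc)
qed

text \<open>A block of five steps starting at \<open>q\<close> gains from the hexagon at
  \<open>q + 2\<close>, so the blocks overlap. Instead of selecting disjoint blocks, and with them
  one residue class of hexagons, the products of five consecutive ratios are followed; taking a
  fifth root at the end explains the 10 in the constant. The hexagons in reach are those from time 2
  to time \<open>N - 3\<close>.\<close>

theorem char_decay:
 assumes f: "adm K f" and \<xi>: "\<bar>\<xi>\<bar> \<le> 1" and x: "x \<in> space (M 0)"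
  and c: "c = exp (- 24 * K) * \<epsilon> ^ 6 / 10"
 shows "norm (HH f (Complex \<xi> t) N 0 x) \<le> exp (- c * (\<Sum>n\<in>{2..<N - 2}. DD f t n)) * HHr f \<xi> N 0 x"
proof -
 let ?H = "\<lambda>q x. HH f (Complex \<xi> t) (N - q) q x" and ?h = "\<lambda>q x. HHr f \<xi> (N - q) q x"
 define a where "a q = (SUP x\<in>space (M q). norm (?H q x) / ?h q x)" for q
 have ne: "space (M q) \<noteq> {}" for q by (rule prob_space.not_empty[OF prob_M])
 have triv: "norm (HH f (Complex \<xi> t) k q y) \<le> HHr f \<xi> k q y" if "y \<in> space (M q)" for k q y
  using that
 proof (induction k arbitrary: q y)
  case (Suc k)
  then show ?case by (simp add: LL_norm_le[OF f bm_HH[OF f] bm_HHr[OF f]])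
 qed simp
 have h0: "0 < ?h q y" if "y \<in> space (M q)" for q y by (rule HHr_pos'[OF f \<xi> that])
 have r1: "norm (?H q y) / ?h q y \<le> 1" if "y \<in> space (M q)" for q y
  using triv[OF that] h0[OF that] by (simp add: divide_le_eq)
 have bdd: "bdd_above ((\<lambda>x. norm (?H q x) / ?h q x) ` space (M q))" for q
  using r1 by (intro bdd_aboveI2)
 have a1: "a q \<le> 1" for q unfolding a_def by (rule cSUP_least[OF ne r1])
 have upper: "norm (?H q y) \<le> a q * ?h q y" if "y \<in> space (M q)" for q y
  using cSUP_upper[OF that bdd] h0[OF that] unfolding a_def by (simp add: divide_le_eq)
 have least: "a q \<le> b" if "\<And>y. y \<in> space (M q) \<Longrightarrow> norm (?H q y) \<le> b * ?h q y" for q b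
  unfolding a_def using that h0 by (intro cSUP_least[OF ne]) (simp add: divide_le_eq)
 have a0: "0 \<le> a q" for q
 proof -
  obtain y where y: "y \<in> space (M q)" using ne by blast
  have "0 \<le> norm (?H q y) / ?h q y" using h0[OF y] by simp
  also have "\<dots> \<le> a q" unfolding a_def by (rule cSUP_upper[OF y bdd])
  finally show ?thesis .
 qed
 have mono: "a q \<le> a (Suc q)" if q: "q < N" for q
 proof (rule least)
  fix y assume y: "y \<in> space (M q)"
  have N: "N - q = Suc (N - Suc q)" using q by simp
  have "norm (?H q y) \<le> LLr f \<xi> q (\<lambda>y. a (Suc q) * ?h (Suc q) y) y"
   unfolding N HH.simps
   by (rule LL_norm_le[OF f bm_HH[OF f] bm_mult[OF bm_const bm_HHr[OF f]] upper y])
  then show "norm (?H q y) \<le> a (Suc q) * ?h q y" unfolding LLr_scale N HHr.simps .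
 qed
 have five: "a q \<le> exp (- (5 * c) * DD f t (Suc (Suc q))) * a (q + 5)" if q: "q + 5 \<le> N" for q
 proof (rule least)
  fix y assume y: "y \<in> space (M q)"
  have N: "N - q = Suc (Suc (Suc (Suc (Suc (N - (q + 5))))))" using q by simp
  have N': "N - q = 5 + (N - (q + 5))" using q by simp
  have 5: "q + 5 = Suc (Suc (Suc (Suc (Suc q))))" by simp
  have c5: "5 * c = exp (- 24 * K) * \<epsilon> ^ 6 / 2" by (simp add: c)
  have "norm (?H q y) \<le> exp (- (5 * c) * DD f t (Suc (Suc q))) * a (q + 5) * HHr f \<xi> (5 + (N - (q + 5))) q y"
   unfolding N HH.simps
   by (rule five_step_gap[OF f \<xi> y a0 refl bm_HH[OF f] _ c5]) (use upper[of _ "q + 5"] in \<open>simp add: 5\<close>)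
  then show "norm (?H q y) \<le> exp (- (5 * c) * DD f t (Suc (Suc q))) * a (q + 5) * ?h q y"
   unfolding N'[symmetric] .
 qed
 \<comment> \<open>Replacing \<open>a q\<close> by the five-step bound shifts the window of five
   factors by one and picks up exactly one hexagon.\<close>
 have prods: "a q * a (q + 1) * a (q + 2) * a (q + 3) * a (q + 4) \<le> exp (- (5 * c) * (\<Sum>n\<in>{q+2..<N - 2}. DD f t n))"
  if "q + 4 + j = N" for q j
  using that
 proof (induction j arbitrary: q)
  case 0
  have "a q * a (q + 1) * a (q + 2) * a (q + 3) * a (q + 4) \<le> 1"
   using a0 a1 by (intro mult_le_one mult_nonneg_nonneg) auto
  then show ?case using 0 by simp
 next
  case (Suc j)
  have "a q * a (q + 1) * a (q + 2) * a (q + 3) * a (q + 4) \<le>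
   (exp (- (5 * c) * DD f t (q + 2)) * a (q + 5)) * a (q + 1) * a (q + 2) * a (q + 3) * a (q + 4)"
   using five[of q] Suc.prems by (intro mult_right_mono a0) simp
  also have "\<dots> = exp (- (5 * c) * DD f t (q + 2)) * (a (Suc q) * a (Suc q + 1) * a (Suc q + 2) * a (Suc q + 3) * a (Suc q + 4))"
   by (simp add: eval_nat_numeral mult_ac)
  also have "\<dots> \<le> exp (- (5 * c) * DD f t (q + 2)) * exp (- (5 * c) * (\<Sum>n\<in>{Suc q+2..<N - 2}. DD f t n))"
   using Suc.IH[of "Suc q"] Suc.prems by (intro mult_left_mono) auto
  also have "\<dots> = exp (- (5 * c) * (\<Sum>n\<in>{q+2..<N - 2}. DD f t n))"
   using Suc.prems by (subst (2) sum.atLeast_Suc_lessThan) (auto simp: algebra_simps simp flip: exp_add)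
  finally show ?case .
 qed
 have "a 0 \<le> exp (- c * (\<Sum>n\<in>{2..<N - 2}. DD f t n))"
 proof (cases "4 \<le> N")
  case True
  then have m: "a 0 \<le> a 1" "a 0 \<le> a 2" "a 0 \<le> a 3" "a 0 \<le> a 4"
   using mono[of 0] mono[of 1] mono[of 2] mono[of 3] by (auto simp: eval_nat_numeral)
  have "a 0 ^ 5 = a 0 * a 0 * a 0 * a 0 * a 0" by (simp add: eval_nat_numeral)
  also have "\<dots> \<le> a 0 * a 1 * a 2 * a 3 * a 4"
   using m a0 by (intro mult_mono mult_nonneg_nonneg) auto
  also have "\<dots> \<le> exp (- (5 * c) * (\<Sum>n\<in>{2..<N - 2}. DD f t n))"
   using prods[of 0 "N - 4"] True by (simp add: eval_nat_numeral)
  also have "\<dots> = exp (- c * (\<Sum>n\<in>{2..<N - 2}. DD f t n)) ^ 5"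
   by (simp add: exp_of_nat_mult[symmetric])
  finally show ?thesis by (rule power_le_imp_le_base[of _ 4, simplified]) simp
 next
  case False
  then have "{2..<N - 2} = {}" by auto
  then show ?thesis using a1[of 0] by simp
 qed
 then have "a 0 * ?h 0 x \<le> exp (- c * (\<Sum>n\<in>{2..<N - 2}. DD f t n)) * ?h 0 x"
  using h0[OF x] by (intro mult_right_mono) auto
 then show ?thesis using upper[OF x] by simp
qed

end

section \<open>Phases along a reference path\<close>

lemma Arg_measurable [measurable]: "Arg \<in> borel_measurable borel"
proof -
 have "(\<lambda>z. if z \<in> - \<real>\<^sub>\<le>\<^sub>0 then Arg z else if z = 0 then 0 else pi) \<in> borel_measurable borel"
 proof (rule measurable_If_restrict_space_iff[THEN iffD2])
  have c: "closed (\<real>\<^sub>\<le>\<^sub>0 :: complex set)" by (rule closed_nonpos_Reals_complex)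
  then have "- \<real>\<^sub>\<le>\<^sub>0 \<in> sets (borel :: complex measure)" by (intro borel_open open_Compl)
  then show "{x \<in> space borel. x \<in> - (\<real>\<^sub>\<le>\<^sub>0 :: complex set)} \<in> sets borel" by (simp add: Compl_eq)
  have "Arg \<in> borel_measurable (restrict_space borel (- \<real>\<^sub>\<le>\<^sub>0))"
   by (intro borel_measurable_continuous_on_restrict continuous_on_Arg)
  moreover have "(\<lambda>z::complex. if z = 0 then 0 else pi) \<in> borel_measurable (restrict_space borel {x. x \<notin> - \<real>\<^sub>\<le>\<^sub>0})"
   by (intro measurable_restrict_space1) measurable
  ultimately show "Arg \<in> borel_measurable (restrict_space borel {x. x \<in> - \<real>\<^sub>\<le>\<^sub>0}) \<and>
   (\<lambda>z::complex. if z = 0 then 0 else pi) \<in> borel_measurable (restrict_space borel {x. x \<notin> - \<real>\<^sub>\<le>\<^sub>0})"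
   by (simp add: Compl_eq)
 qed
 also have "(\<lambda>z. if z \<in> - \<real>\<^sub>\<le>\<^sub>0 then Arg z else if z = 0 then 0 else pi) = Arg"
  by (auto simp: fun_eq_iff Arg_eq_pi_iff complex_nonpos_Reals_iff complex_is_Real_iff Arg_zero
    intro: complex_eqI) (metis Arg_eq_pi complex_eq_iff less_eq_real_def zero_complex.sel)+
 finally show ?thesis .
qed

lemma bm_sin: "F \<in> borel_measurable M \<Longrightarrow> bm M (\<lambda>x. sin (F x :: real))"
 by (rule bmI[where B = 1]) auto

text \<open>The hypothesis describes a convex cone, hence is preserved by integration against a
  nonnegative weight; this is how the bound reaches the argument of a bridge integral.\<close>

lemma abs_Arg_le_pi_quarter:
 assumes "\<bar>Im z\<bar> \<le> Re z"
 shows "\<bar>Arg z\<bar> \<le> pi / 4"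
proof (cases "z = 0")
 case False
 let ?A = "\<bar>Arg z\<bar>"
 have z: "z = of_real (norm z) * exp (\<i> * of_real (Arg z))" using Arg_eq[OF False] .
 have n: "0 < norm z" using False by simp
 have "Re z = norm z * cos (Arg z)" "Im z = norm z * sin (Arg z)"
  by (subst z, simp add: Re_exp Im_exp)+
 with assms n have cs: "\<bar>sin (Arg z)\<bar> \<le> cos (Arg z)"
  by (simp add: abs_mult)
 then have "(sin (Arg z))\<^sup>2 \<le> (cos (Arg z))\<^sup>2" by (simp add: abs_le_square_iff[symmetric])
 then have "1 / 2 \<le> (cos (Arg z))\<^sup>2" using sin_cos_squared_add[of "Arg z"] by linarith
 then have "(sqrt 2 / 2)\<^sup>2 \<le> (cos (Arg z))\<^sup>2" by (simp add: power_divide)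
 then have c: "cos (pi / 4) \<le> cos ?A"
  using cs by (simp add: cos_45)
 have "?A \<le> pi" using mpi_less_Arg[of z] Arg_le_pi[of z] by auto
 then show ?thesis using c cos_mono_le_eq[of "pi / 4" ?A] by auto
qed (simp add: Arg_zero)

context elliptic_chain
begin

context
 fixes f :: "nat \<Rightarrow> 'a \<Rightarrow> 'a \<Rightarrow> real" and K \<theta> :: real
 assumes f: "adm K f"
begin

text \<open>The oscillating mass of the two-step bridges from \<open>x\<close> to \<open>z\<close>.
  If all these bridges had the same phase, its argument would be that phase; with \<open>z\<close>
  on a reference path the argument becomes the function whose coboundary is split off.\<close>

definition kap :: "nat \<Rightarrow> 'a \<Rightarrow> 'a \<Rightarrow> complex" where
 "kap n z x = (\<integral>y. of_real (p n x y * p (Suc n) y z) * exp (\<i> * of_real (\<theta> * (f n x y + f (Suc n) y z))) \<partial>M (Suc n))"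

lemma bm_kap:
 assumes "z \<in> space (M (Suc (Suc n)))" shows "bm (M n) (kap n z)"
 unfolding kap_def
 by (intro bm_integral[OF prob_M] bm_mult bm_of_real bm_exp bm_const bm_p bm_add bm_f[OF f]; use assms in measurable)

lemma kap_le:
 assumes z: "z \<in> space (M (Suc (Suc n)))" and x: "x \<in> space (M n)"
 shows "norm (kap n z x) \<le> p2 n x z"
 unfolding kap_def p2_def
proof (rule bm_integral_norm_le[OF fin_M])
 show "bm (M (Suc n)) (\<lambda>y. of_real (p n x y * p (Suc n) y z) * exp (\<i> * of_real (\<theta> * (f n x y + f (Suc n) y z))))"
  "bm (M (Suc n)) (\<lambda>y. p n x y * p (Suc n) y z)"
  by (intro bm_mult bm_of_real bm_exp bm_const bm_p bm_add bm_f[OF f]; use x z in measurable)+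
qed (simp add: norm_mult p_nonneg)

text \<open>The hexagon \<open>x0, (x1, b), (y1, y2), x3\<close> with the edges \<open>x0 x1\<close>
  and \<open>y2 x3\<close> held fixed: only the midpoints \<open>b\<close> and \<open>y1\<close> of
  the two bridges \<open>x1 x3\<close> and \<open>x0 y2\<close> are integrated, with the weights of
  these bridges alone.\<close>

definition Tin :: "nat \<Rightarrow> 'a \<Rightarrow> 'a \<Rightarrow> 'a \<Rightarrow> 'a \<Rightarrow> real" where
 "Tin n x0 x1 y2 x3 = (\<integral>y1. \<integral>b. (p (Suc n) x1 b * p (Suc (Suc n)) b x3) * (p n x0 y1 * p (Suc n) y1 y2) *
   (1 - cos (\<theta> * (f n x0 x1 - f (Suc (Suc n)) y2 x3) + \<theta> * (f (Suc n) x1 b + f (Suc (Suc n)) b x3)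
    - \<theta> * (f n x0 y1 + f (Suc n) y1 y2))) \<partial>M (Suc (Suc n)) \<partial>M (Suc n))"

lemma Tin_nonneg: "0 \<le> Tin n x0 x1 y2 x3"
 unfolding Tin_def by (intro integral_nonneg_AE AE_I2 mult_nonneg_nonneg p_nonneg) auto

lemma bm_Tin:
 assumes "x0 \<in> measurable N (M n)" "x1 \<in> measurable N (M (Suc n))" "y2 \<in> measurable N (M (Suc (Suc n)))"
  "x3 \<in> measurable N (M (Suc (Suc (Suc n))))"
 shows "bm N (\<lambda>w. Tin n (x0 w) (x1 w) (y2 w) (x3 w))"
 unfolding Tin_def
 by (intro bm_integral[OF prob_M] bm_mult bm_diff bm_const bm_cos borel_measurable_diff borel_measurable_add
   borel_measurable_times borel_measurable_const bm_measurable[OF bm_f[OF f]] bm_p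
   measurable_compose[OF _ assms(1)] measurable_compose[OF _ assms(2)] measurable_compose[OF _ assms(3)]
   measurable_compose[OF _ assms(4)]; measurable)

text \<open>With \<open>P1\<close>, \<open>P2\<close> the masses of the bridges and
  \<open>k1\<close>, \<open>k2\<close> their oscillating masses,
  \<open>Tin = P1 * P2 - |k1| * |k2| * cos t\<close>, where \<open>t\<close> is the phase in the
  claim. As \<open>|k1| * |k2| \<le> P1 * P2\<close>, a nonnegative cosine gives
  \<open>Tin \<ge> P1 * P2 * (1 - cos t)\<close>; a negative one gives
  \<open>Tin \<ge> P1 * P2\<close>, and \<open>1 - cos t \<le> 2\<close>. Finally
  \<open>P1 * P2 \<ge> \<epsilon>\<^sup>2\<close>.\<close>

lemma phase_deviation_le_Tin:
 assumes x0: "x0 \<in> space (M n)" and x1: "x1 \<in> space (M (Suc n))"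
  and y2: "y2 \<in> space (M (Suc (Suc n)))" and x3: "x3 \<in> space (M (Suc (Suc (Suc n))))"
 shows "1 - cos (\<theta> * f n x0 x1 + Arg (kap (Suc n) x3 x1) - Arg (kap n y2 x0) - \<theta> * f (Suc (Suc n)) y2 x3)
  \<le> 2 / \<epsilon>\<^sup>2 * Tin n x0 x1 y2 x3"
proof -
 let ?w = "\<theta> * (f n x0 x1 - f (Suc (Suc n)) y2 x3)"
 let ?k1 = "kap (Suc n) x3 x1" and ?k2 = "kap n y2 x0"
 let ?P1 = "p2 (Suc n) x1 x3" and ?P2 = "p2 n x0 y2"
 define t where "t = \<theta> * f n x0 x1 + Arg ?k1 - Arg ?k2 - \<theta> * f (Suc (Suc n)) y2 x3"
 have b: "bm (M (Suc (Suc n))) (\<lambda>b. p (Suc n) x1 b * p (Suc (Suc n)) b x3)"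
  "bm (M (Suc (Suc n))) (\<lambda>b. \<theta> * (f (Suc n) x1 b + f (Suc (Suc n)) b x3))"
  by (intro bm_mult bm_const bm_p bm_add bm_f[OF f]; use x1 x3 in measurable)+
 have b': "bm (M (Suc n)) (\<lambda>b. p n x0 b * p (Suc n) b y2)"
  "bm (M (Suc n)) (\<lambda>b. \<theta> * (f n x0 b + f (Suc n) b y2))"
  by (intro bm_mult bm_const bm_p bm_add bm_f[OF f]; use x0 y2 in measurable)+
 have T: "Tin n x0 x1 y2 x3 = ?P1 * ?P2 - Re (exp (\<i> * of_real ?w) * ?k1 * cnj ?k2)"
  unfolding Tin_def kap_def p2_def
  by (rule cross_char_integral[OF prob_M b prob_M b'])
 have polar: "of_real (norm z) * exp (\<i> * of_real (Arg z)) = z" for z :: complex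
  using Arg_eq[of z] by (cases "z = 0") auto
 have "exp (\<i> * of_real ?w) * ?k1 * cnj ?k2 =
  exp (\<i> * of_real ?w) * (of_real (norm ?k1) * exp (\<i> * of_real (Arg ?k1))) * cnj (of_real (norm ?k2) * exp (\<i> * of_real (Arg ?k2)))"
  unfolding polar ..
 also have "\<dots> = of_real (norm ?k1 * norm ?k2) * exp (\<i> * of_real t)"
  unfolding t_def by (simp add: exp_add exp_diff exp_minus exp_cnj field_simps)
 finally have Re: "Re (exp (\<i> * of_real ?w) * ?k1 * cnj ?k2) = norm ?k1 * norm ?k2 * cos t"
  by (simp add: Re_exp)
 have P: "\<epsilon> \<le> ?P1" "\<epsilon> \<le> ?P2" by (intro p2_ge' x0 x1 y2 x3)+
 have PP: "\<epsilon>\<^sup>2 \<le> ?P1 * ?P2" unfolding power2_eq_square using P eps by (intro mult_mono) auto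
 have kk: "norm ?k1 * norm ?k2 \<le> ?P1 * ?P2"
  by (intro mult_mono kap_le x0 x1 y2 x3 p2_nonneg) auto
 have "\<epsilon>\<^sup>2 * (1 - cos t) \<le> 2 * Tin n x0 x1 y2 x3"
 proof (cases "0 \<le> cos t")
  case True
  have "norm ?k1 * norm ?k2 * cos t \<le> ?P1 * ?P2 * cos t" using kk True by (rule mult_right_mono)
  then have "?P1 * ?P2 * (1 - cos t) \<le> Tin n x0 x1 y2 x3" unfolding T Re by (simp add: algebra_simps)
  moreover have "\<epsilon>\<^sup>2 * (1 - cos t) \<le> ?P1 * ?P2 * (1 - cos t)" using PP by (intro mult_right_mono) auto
  ultimately show ?thesis using Tin_nonneg[of n x0 x1 y2 x3] by linarith
 next
  case False
  then have "norm ?k1 * norm ?k2 * cos t \<le> 0" by (intro mult_nonneg_nonpos) auto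
  then have "\<epsilon>\<^sup>2 \<le> Tin n x0 x1 y2 x3" unfolding T Re using PP by linarith
  moreover have "\<epsilon>\<^sup>2 * (1 - cos t) \<le> \<epsilon>\<^sup>2 * 2" by (intro mult_left_mono) auto
  ultimately show ?thesis by linarith
 qed
 then show ?thesis unfolding t_def[symmetric] using eps by (simp add: field_simps)
qed

text \<open>The mean error of the edges from time \<open>n\<close> to \<open>n + 1\<close> when
  \<open>y2\<close> and \<open>x3\<close> are taken as the points of the reference path at the times
  \<open>n + 2\<close> and \<open>n + 3\<close>.\<close>

definition err :: "nat \<Rightarrow> 'a \<Rightarrow> 'a \<Rightarrow> real" where
 "err n y2 x3 = (\<integral>x0. \<integral>x1. p n x0 x1 * Tin n x0 x1 y2 x3 \<partial>M (Suc n) \<partial>M n)"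

lemma err_nonneg: "0 \<le> err n y z"
 unfolding err_def by (intro integral_nonneg_AE AE_I2 mult_nonneg_nonneg p_nonneg Tin_nonneg)

lemma bm_err:
 assumes "y2 \<in> measurable N (M (Suc (Suc n)))" "x3 \<in> measurable N (M (Suc (Suc (Suc n))))"
 shows "bm N (\<lambda>w. err n (y2 w) (x3 w))"
 unfolding err_def
 by (intro bm_integral[OF prob_M] bm_mult bm_p bm_Tin measurable_compose[OF _ assms(1)] measurable_compose[OF _ assms(2)]; measurable)

lemma TT_eq_Tin:
 assumes x0: "x0 \<in> space (M n)" and x3: "x3 \<in> space (M (Suc (Suc (Suc n))))"
 shows "TT f \<theta> n x0 x3 = (\<integral>y2. p (Suc (Suc n)) y2 x3 * (\<integral>x1. p n x0 x1 * Tin n x0 x1 y2 x3 \<partial>M (Suc n)) \<partial>M (Suc (Suc n)))"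
proof -
 let ?M1 = "M (Suc n)" and ?M2 = "M (Suc (Suc n))"
 let ?F = "\<lambda>y1 y2 x1 b. wt n x0 (x1, b) x3 * wt n x0 (y1, y2) x3 * (1 - cos (\<theta> * (ph f n x0 (x1, b) x3 - ph f n x0 (y1, y2) x3)))"
 note bs = bm_mult bm_diff bm_const bm_cos borel_measurable_times borel_measurable_diff borel_measurable_const
  bm_wt bm_measurable[OF bm_ph[OF f]] measurable_const[OF x0] measurable_const[OF x3]
 have outer: "bm (?M1 \<Otimes>\<^sub>M ?M2) (\<lambda>s'. \<integral>s. wt n x0 s x3 * wt n x0 s' x3 * (1 - cos (\<theta> * (ph f n x0 s x3 - ph f n x0 s' x3))) \<partial>SS n)"
  by (intro bm_integral[OF prob_SS] bs; unfold SS_def; measurable)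
 have inner: "bm (?M1 \<Otimes>\<^sub>M ?M2) (\<lambda>s. wt n x0 s x3 * wt n x0 s' x3 * (1 - cos (\<theta> * (ph f n x0 s x3 - ph f n x0 s' x3))))"
  if "s' \<in> space (?M1 \<Otimes>\<^sub>M ?M2)" for s'
  by (intro bs measurable_const) (use that in \<open>simp_all add: SS_def\<close>)
 have "TT f \<theta> n x0 x3 = (\<integral>y1. \<integral>y2. (\<integral>s. wt n x0 s x3 * wt n x0 (y1, y2) x3 * (1 - cos (\<theta> * (ph f n x0 s x3 - ph f n x0 (y1, y2) x3))) \<partial>SS n) \<partial>?M2 \<partial>?M1)"
  unfolding TT_def using bm_integral_pair[OF prob_M prob_M outer] by (simp add: SS_def)
 also have "\<dots> = (\<integral>y1. \<integral>y2. \<integral>x1. \<integral>b. ?F y1 y2 x1 b \<partial>?M2 \<partial>?M1 \<partial>?M2 \<partial>?M1)"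
  unfolding SS_def
  by (intro integral_congI bm_integral_pair[OF prob_M prob_M] inner)
    (simp add: space_pair_measure)
 also have "\<dots> = (\<integral>y2. \<integral>y1. \<integral>x1. \<integral>b. ?F y1 y2 x1 b \<partial>?M2 \<partial>?M1 \<partial>?M1 \<partial>?M2)"
  by (rule bm_integral_swap[OF prob_M prob_M])
    (intro bm_integral[OF prob_M] bs; unfold SS_def; measurable)
 also have "\<dots> = (\<integral>y2. \<integral>x1. \<integral>y1. \<integral>b. ?F y1 y2 x1 b \<partial>?M2 \<partial>?M1 \<partial>?M1 \<partial>?M2)"
  by (intro integral_congI bm_integral_swap[OF prob_M prob_M] bm_integral[OF prob_M] bs; unfold SS_def; measurable)
 also have "\<dots> = (\<integral>y2. p (Suc (Suc n)) y2 x3 * (\<integral>x1. p n x0 x1 * Tin n x0 x1 y2 x3 \<partial>?M1) \<partial>?M2)"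
  unfolding Tin_def integral_mult_right_zero[symmetric] wt_def ph_def fst_conv snd_conv
  by (intro integral_congI) (simp add: algebra_simps)
 finally show ?thesis .
qed

text \<open>The order of integration is changed so that \<open>y2\<close> and \<open>x3\<close> come
  last: they are the two points of the hexagon to be frozen on the reference path, and the remaining
  weight \<open>p\<close> is the transition density from one to the other.\<close>

lemma DD_eq_err:
 "DD f \<theta> n = (\<integral>y2. \<integral>x3. p (Suc (Suc n)) y2 x3 * err n y2 x3 \<partial>M (Suc (Suc (Suc n))) \<partial>M (Suc (Suc n)))"
proof -
 let ?M2 = "M (Suc (Suc n))" and ?M3 = "M (Suc (Suc (Suc n)))"
 let ?G = "\<lambda>x0 x3 y2. p (Suc (Suc n)) y2 x3 * (\<integral>x1. p n x0 x1 * Tin n x0 x1 y2 x3 \<partial>M (Suc n))"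
 note bs = bm_mult bm_p bm_Tin bm_integral[OF prob_M]
 have "DD f \<theta> n = (\<integral>x0. \<integral>x3. \<integral>y2. ?G x0 x3 y2 \<partial>?M2 \<partial>?M3 \<partial>M n)"
  unfolding DD_def by (intro integral_congI TT_eq_Tin)
 also have "\<dots> = (\<integral>x0. \<integral>y2. \<integral>x3. ?G x0 x3 y2 \<partial>?M3 \<partial>?M2 \<partial>M n)"
  by (intro integral_congI bm_integral_swap[OF prob_M prob_M] bs; measurable)
 also have "\<dots> = (\<integral>y2. \<integral>x0. \<integral>x3. ?G x0 x3 y2 \<partial>?M3 \<partial>M n \<partial>?M2)"
  by (rule bm_integral_swap[OF prob_M prob_M]) (intro bs; measurable)
 also have "\<dots> = (\<integral>y2. \<integral>x3. \<integral>x0. ?G x0 x3 y2 \<partial>M n \<partial>?M3 \<partial>?M2)"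
  by (intro integral_congI bm_integral_swap[OF prob_M prob_M] bs; measurable)
 finally show ?thesis unfolding err_def by simp
qed

text \<open>The reference path is chosen step by step. The point at time \<open>n + 3\<close> is sampled from
 \<open>p (n + 2) (s n)\<close>; both the error of the \<open>n\<close>-th edge and the conditional mean of the next error
 are then controlled at some sample.\<close>

lemma reference_path:
 obtains s where "\<And>n. s n \<in> space (M (Suc (Suc n)))"
  "\<And>n. err n (s n) (s (Suc n)) \<le> 12 / \<epsilon> * (DD f \<theta> n + (1 / 2) ^ n)"
proof -
 define a where "a n y = (\<integral>z. p (Suc (Suc n)) y z * err n y z \<partial>M (Suc (Suc (Suc n))))" for n y
 have ba: "bm (M (Suc (Suc n))) (a n)" for n
  unfolding a_def by (intro bm_integral[OF prob_M] bm_mult bm_p bm_err; measurable)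
 have a0: "0 \<le> a n y" for n y
  unfolding a_def by (intro integral_nonneg_AE AE_I2 mult_nonneg_nonneg p_nonneg err_nonneg)
 have Da: "DD f \<theta> n = (\<integral>y. a n y \<partial>M (Suc (Suc n)))" for n
  unfolding DD_eq_err a_def ..
 \<comment> \<open>The summand \<open>(1 / 2) ^ n\<close> keeps \<open>d n\<close> positive where
   \<open>DD\<close> vanishes, so that division by it is possible, and it stays summable.\<close>
 define d where "d n = DD f \<theta> n + (1 / 2) ^ n" for n
 have d0: "0 < d n" for n unfolding d_def using DD_nonneg[of f \<theta> n] by (simp add: add_nonneg_pos)
 let ?P = "\<lambda>n y. y \<in> space (M (Suc (Suc n))) \<and> a n y \<le> 3 / \<epsilon> * d n"
 have start: "\<exists>y. ?P 0 y"
 proof (rule ccontr)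
  assume "\<nexists>y. ?P 0 y"
  then have *: "3 / \<epsilon> * d 0 \<le> a 0 y" if "y \<in> space (M (Suc (Suc 0)))" for y using that by force
  have "3 / \<epsilon> * d 0 = (\<integral>y. 3 / \<epsilon> * d 0 \<partial>M (Suc (Suc 0)))"
   using prob_space.prob_space[OF prob_M] by simp
  also have "\<dots> \<le> (\<integral>y. a 0 y \<partial>M (Suc (Suc 0)))"
   by (rule bm_integral_mono[OF fin_M bm_const ba *])
  also have "\<dots> < d 0" unfolding Da[symmetric] d_def by simp
  also have "\<dots> \<le> 3 / \<epsilon> * d 0" using d0[of 0] eps by (simp add: field_simps)
  finally show False by simp
 qed
 have step: "\<exists>z. ?P (Suc n) z \<and> err n y z \<le> 12 / \<epsilon> * d n" if y: "?P n y" for n y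
 proof -
  let ?N = "M (Suc (Suc (Suc n)))" and ?h = "(1 / 2 :: real) ^ n"
  \<comment> \<open>Under the transition density from \<open>y\<close> each of the two quotients has
    mean at most 1, the second one because \<open>p \<le> 1 / \<epsilon>\<close>. Hence
    \<open>g\<close> cannot be at least 3 everywhere, and one point \<open>z\<close> controls both
    the present error and the next conditional mean.\<close>
  define g where "g z = err n y z / (a n y + ?h) + \<epsilon> * a (Suc n) z / d (Suc n)" for z
  have pos: "0 < a n y + ?h" using a0[of n y] by (simp add: add_nonneg_pos)
  have be: "bm ?N (err n y)" using y bm_err[of "\<lambda>_. y" ?N n "\<lambda>z. z"] by simp
  have bp: "bm ?N (p (Suc (Suc n)) y)" using y bm_p_fix by blast
  have bg: "bm ?N g" unfolding g_def by (intro bm_intros be ba)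
  have "\<exists>z\<in>space ?N. g z \<le> 3"
  proof (rule ccontr)
   assume "\<not> (\<exists>z\<in>space ?N. g z \<le> 3)"
   then have *: "3 \<le> g z" if "z \<in> space ?N" for z using that by force
   have "3 = (\<integral>z. p (Suc (Suc n)) y z * 3 \<partial>?N)" using y p_integral by simp
   also have "\<dots> \<le> (\<integral>z. p (Suc (Suc n)) y z * g z \<partial>?N)"
    by (rule bm_integral_mono[OF fin_M bm_mult[OF bp bm_const] bm_mult[OF bp bg]]) (intro mult_left_mono p_nonneg *)
   also have "\<dots> = (\<integral>z. p (Suc (Suc n)) y z * err n y z / (a n y + ?h) + \<epsilon> / d (Suc n) * (p (Suc (Suc n)) y z * a (Suc n) z) \<partial>?N)"
    unfolding g_def by (simp add: algebra_simps)
   also have "\<dots> = a n y / (a n y + ?h) + \<epsilon> / d (Suc n) * (\<integral>z. p (Suc (Suc n)) y z * a (Suc n) z \<partial>?N)"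
    using integrable_M[OF bm_mult[OF bp be]] integrable_M[OF bm_mult[OF bp ba]] by (simp add: a_def[of n y])
   finally have 3: "3 \<le> a n y / (a n y + ?h) + \<epsilon> / d (Suc n) * (\<integral>z. p (Suc (Suc n)) y z * a (Suc n) z \<partial>?N)" .
   have "(\<integral>z. p (Suc (Suc n)) y z * a (Suc n) z \<partial>?N) \<le> (\<integral>z. 1 / \<epsilon> * a (Suc n) z \<partial>?N)"
    by (rule bm_integral_mono[OF fin_M bm_mult[OF bp ba] bm_mult[OF bm_const ba]]) (intro mult_right_mono p_le a0)
   also have "\<dots> = 1 / \<epsilon> * DD f \<theta> (Suc n)" unfolding Da by simp
   finally have "\<epsilon> / d (Suc n) * (\<integral>z. p (Suc (Suc n)) y z * a (Suc n) z \<partial>?N) \<le> \<epsilon> / d (Suc n) * (1 / \<epsilon> * DD f \<theta> (Suc n))"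
    using eps d0[of "Suc n"] by (intro mult_left_mono) auto
   also have "\<dots> \<le> 1"
    using eps d0[of "Suc n"] by (simp add: d_def)
   finally have "3 \<le> a n y / (a n y + ?h) + 1" using 3 by linarith
   moreover have "a n y / (a n y + ?h) \<le> 1" using pos by simp
   ultimately show False by simp
  qed
  then obtain z where z: "z \<in> space ?N" "g z \<le> 3" by blast
  have e0: "0 \<le> err n y z / (a n y + ?h)" using pos err_nonneg by simp
  have a0': "0 \<le> \<epsilon> * a (Suc n) z / d (Suc n)" using eps a0 d0[of "Suc n"] by simp
  have "err n y z / (a n y + ?h) \<le> 3" using z(2) a0' unfolding g_def by linarith
  then have 1: "err n y z \<le> 3 * (a n y + ?h)" using pos by (simp add: pos_divide_le_eq)
  have "\<epsilon> * a (Suc n) z / d (Suc n) \<le> 3" using z(2) e0 unfolding g_def by linarith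
  then have 2: "a (Suc n) z \<le> 3 / \<epsilon> * d (Suc n)" using d0[of "Suc n"] eps by (simp add: field_simps)
  have "?h \<le> d n" unfolding d_def using DD_nonneg by simp
  also have "d n \<le> 1 / \<epsilon> * d n" using eps d0[of n] by (simp add: field_simps)
  finally have "3 * (a n y + ?h) \<le> 3 * (3 / \<epsilon> * d n + 1 / \<epsilon> * d n)" using y by simp
  also have "\<dots> = 12 / \<epsilon> * d n" by (simp add: field_simps)
  finally show ?thesis using 1 2 z(1) by (intro exI[of _ z]) auto
 qed
 from dependent_nat_choice[of ?P "\<lambda>n y z. err n y z \<le> 12 / \<epsilon> * d n", OF start step]
 obtain s where "\<forall>n. ?P n (s n)" "\<forall>n. err n (s n) (s (Suc n)) \<le> 12 / \<epsilon> * d n"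
  by (metis (no_types, lifting))
 then show ?thesis by (intro that[of s]) (auto simp: d_def)
qed

text \<open>For small \<open>\<theta>\<close> all phases lie in the sector of half angle
  \<open>pi / 4\<close>, where the sine is dominated by the cosine; integration preserves this. No
  multiples of \<open>2 * pi\<close> then interfere when phases are converted back into values of
  \<open>f\<close>.\<close>

lemma Arg_kap_small:
 assumes small: "\<bar>\<theta>\<bar> * (2 * K) \<le> pi / 4" and z: "z \<in> space (M (Suc (Suc n)))" and x: "x \<in> space (M n)"
 shows "\<bar>Arg (kap n z x)\<bar> \<le> pi / 4"
proof (rule abs_Arg_le_pi_quarter)
 let ?q = "\<lambda>y. p n x y * p (Suc n) y z" and ?u = "\<lambda>y. \<theta> * (f n x y + f (Suc n) y z)"
 let ?N = "M (Suc n)"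
 have b: "bm ?N ?q" "bm ?N ?u"
  by (intro bm_mult bm_const bm_p bm_add bm_f[OF f]; use x z in measurable)+
 have be: "bm ?N (\<lambda>y. of_real (?q y) * exp (\<i> * of_real (?u y)))" by (intro bm_intros b)
 have bc: "bm ?N (\<lambda>y. ?q y * cos (?u y))" by (intro bm_mult b bm_cos bm_measurable[OF b(2)])
 have u: "\<bar>?u y\<bar> \<le> pi / 4" for y
 proof -
  have "\<bar>f n x y + f (Suc n) y z\<bar> \<le> 2 * K"
   using adm_le[OF f, of n x y] adm_le[OF f, of "Suc n" y z] by linarith
  then have "\<bar>\<theta>\<bar> * \<bar>f n x y + f (Suc n) y z\<bar> \<le> \<bar>\<theta>\<bar> * (2 * K)" by (intro mult_left_mono) auto
  then show ?thesis unfolding abs_mult using small by linarith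
 qed
 have cs: "\<bar>sin (?u y)\<bar> \<le> cos (?u y)" for y
 proof -
  have "cos (pi / 4) \<le> cos \<bar>?u y\<bar>" using u[of y] by (intro cos_monotone_0_pi_le) auto
  then have c: "cos (pi / 4) \<le> cos (?u y)" by simp
  then have "(sqrt 2 / 2)\<^sup>2 \<le> (cos (?u y))\<^sup>2" by (intro power_mono) (auto simp: cos_45)
  then have "(sin (?u y))\<^sup>2 \<le> (cos (?u y))\<^sup>2"
  proof -
   have "(sqrt 2 / 2)\<^sup>2 = (1 / 2 :: real)" by (simp add: power_divide)
   then show ?thesis
    using \<open>(sqrt 2 / 2)\<^sup>2 \<le> (cos (?u y))\<^sup>2\<close> sin_cos_squared_add[of "?u y"] by linarith
  qed
  then have "\<bar>sin (?u y)\<bar> \<le> \<bar>cos (?u y)\<bar>" by (simp add: abs_le_square_iff)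
  moreover have "0 \<le> cos (?u y)" using c cos_45 by (smt (verit) divide_nonneg_nonneg real_sqrt_ge_zero)
  ultimately show ?thesis by simp
 qed
 have Im: "Im (kap n z x) = (\<integral>y. ?q y * sin (?u y) \<partial>?N)" and Re: "Re (kap n z x) = (\<integral>y. ?q y * cos (?u y) \<partial>?N)"
  unfolding kap_def using integral_Im[OF integrable_M[OF be]] integral_Re[OF integrable_M[OF be]]
  by (simp_all add: Im_exp Re_exp)
 have bs: "bm ?N (\<lambda>y. ?q y * sin (?u y))"
 proof -
  have "bm ?N (\<lambda>y. sin (?u y))" by (rule bm_sin[OF bm_measurable[OF b(2)]])
  then show ?thesis by (rule bm_mult[OF b(1)])
 qed
 have "norm (\<integral>y. ?q y * sin (?u y) \<partial>?N) \<le> (\<integral>y. ?q y * cos (?u y) \<partial>?N)"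
  by (rule bm_integral_norm_le[OF fin_M bs bc]) (use cs in \<open>simp add: abs_mult p_nonneg mult_left_mono\<close>)
 then show "\<bar>Im (kap n z x)\<bar> \<le> Re (kap n z x)" unfolding Im Re by simp
qed

text \<open>Along the reference path \<open>s\<close>, the function \<open>b n\<close> is the
  argument of the bridge integral from time \<open>n\<close> to \<open>s n\<close>, and
  \<open>c n\<close> is the value of \<open>f\<close> on the reference edge from \<open>s n\<close>
  to \<open>s (Suc n)\<close>, two time units later than the edge it is compared with. The constant
  multiplies \<open>2 / \<epsilon>\<^sup>2\<close> for an edge by \<open>12 / \<epsilon>\<close>
  from the choice of the path.\<close>

theorem phase_functions:
 obtains b :: "nat \<Rightarrow> 'a \<Rightarrow> real" and c :: "nat \<Rightarrow> real" where
  "\<And>n. b n \<in> borel_measurable (M n)" "\<And>n x. \<bar>b n x\<bar> \<le> pi" "\<And>n. \<bar>c n\<bar> \<le> K"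
  "\<And>n x. \<bar>\<theta>\<bar> * (2 * K) \<le> pi / 4 \<Longrightarrow> x \<in> space (M n) \<Longrightarrow> \<bar>b n x\<bar> \<le> pi / 4"
  "\<And>n. (\<integral>x. \<integral>y. p n x y * (1 - cos (\<theta> * f n x y + b (Suc n) y - b n x - \<theta> * c n)) \<partial>M (Suc n) \<partial>M n)
   \<le> 24 / \<epsilon> ^ 3 * (DD f \<theta> n + (1 / 2) ^ n)"
proof -
 obtain s where s: "\<And>n. s n \<in> space (M (Suc (Suc n)))"
  and e: "\<And>n. err n (s n) (s (Suc n)) \<le> 12 / \<epsilon> * (DD f \<theta> n + (1 / 2) ^ n)"
  using reference_path by blast
 define b where "b n x = Arg (kap n (s n) x)" for n x
 define c where "c n = f (Suc (Suc n)) (s n) (s (Suc n))" for n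
 have bb: "b n \<in> borel_measurable (M n)" for n
  unfolding b_def by (intro measurable_compose[OF bm_measurable[OF bm_kap[OF s]] Arg_measurable])
 show ?thesis
 proof (rule that[of b c])
  show "\<bar>b n x\<bar> \<le> pi" for n x
   unfolding b_def using mpi_less_Arg[of "kap n (s n) x"] Arg_le_pi[of "kap n (s n) x"] by linarith
  show "\<bar>c n\<bar> \<le> K" for n unfolding c_def by (rule adm_le[OF f])
  show "\<bar>b n x\<bar> \<le> pi / 4" if "\<bar>\<theta>\<bar> * (2 * K) \<le> pi / 4" "x \<in> space (M n)" for n x
   unfolding b_def by (rule Arg_kap_small[OF that(1) s that(2)])
  fix n
  let ?u = "\<lambda>x y. \<theta> * f n x y + b (Suc n) y - b n x - \<theta> * c n"
  let ?T = "\<lambda>x y. Tin n x y (s n) (s (Suc n))"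
  have mu: "(\<lambda>w. ?u (x w) (y w)) \<in> borel_measurable N" if "x \<in> measurable N (M n)" "y \<in> measurable N (M (Suc n))" for N :: "'z measure" and x y
   by (intro borel_measurable_diff borel_measurable_add borel_measurable_times borel_measurable_const
     bm_measurable[OF bm_f[OF f]] that measurable_compose[OF _ bb])
  have mu2: "(\<lambda>w. ?u (x w) (y w)) \<in> borel_measurable N" if "x \<in> measurable N (M n)" "y \<in> measurable N (M (Suc n))" for N :: "('a \<times> 'a) measure" and x y
   by (intro borel_measurable_diff borel_measurable_add borel_measurable_times borel_measurable_const
     bm_measurable[OF bm_f[OF f]] that measurable_compose[OF _ bb])
  have mu1: "(\<lambda>w. ?u (x w) (y w)) \<in> borel_measurable N" if "x \<in> measurable N (M n)" "y \<in> measurable N (M (Suc n))" for N :: "'a measure" and x y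
   by (intro borel_measurable_diff borel_measurable_add borel_measurable_times borel_measurable_const
     bm_measurable[OF bm_f[OF f]] that measurable_compose[OF _ bb])
  have bT2: "bm N (\<lambda>w. ?T (x w) (y w))" if "x \<in> measurable N (M n)" "y \<in> measurable N (M (Suc n))" for N :: "('a \<times> 'a) measure" and x y
   using s[of n] s[of "Suc n"] by (intro bm_Tin that) auto
  have bT1: "bm N (\<lambda>w. ?T (x w) (y w))" if "x \<in> measurable N (M n)" "y \<in> measurable N (M (Suc n))" for N :: "'a measure" and x y
   using s[of n] s[of "Suc n"] by (intro bm_Tin that) auto
  have "(\<integral>x. \<integral>y. p n x y * (1 - cos (?u x y)) \<partial>M (Suc n) \<partial>M n) \<le>
   (\<integral>x. \<integral>y. 2 / \<epsilon>\<^sup>2 * (p n x y * ?T x y) \<partial>M (Suc n) \<partial>M n)"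
  proof (rule bm_integral_mono[OF fin_M])
   show "bm (M n) (\<lambda>x. \<integral>y. p n x y * (1 - cos (?u x y)) \<partial>M (Suc n))"
    by (intro bm_integral[OF prob_M] bm_mult bm_p bm_diff bm_const bm_cos mu2; measurable)
   show "bm (M n) (\<lambda>x. \<integral>y. 2 / \<epsilon>\<^sup>2 * (p n x y * ?T x y) \<partial>M (Suc n))"
    by (intro bm_integral[OF prob_M] bm_mult bm_p bm_const bT2; measurable)
   fix x assume x: "x \<in> space (M n)"
   show "(\<integral>y. p n x y * (1 - cos (?u x y)) \<partial>M (Suc n)) \<le> (\<integral>y. 2 / \<epsilon>\<^sup>2 * (p n x y * ?T x y) \<partial>M (Suc n))"
   proof (rule bm_integral_mono[OF fin_M])
    show "bm (M (Suc n)) (\<lambda>y. p n x y * (1 - cos (?u x y)))"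
     by (intro bm_mult bm_p bm_diff bm_const bm_cos mu1; use x in measurable)
    show "bm (M (Suc n)) (\<lambda>y. 2 / \<epsilon>\<^sup>2 * (p n x y * ?T x y))"
     by (intro bm_mult bm_p bm_const bT1; use x in measurable)
    fix y assume y: "y \<in> space (M (Suc n))"
    have "1 - cos (?u x y) \<le> 2 / \<epsilon>\<^sup>2 * ?T x y"
     using phase_deviation_le_Tin[OF x y s[of n] s[of "Suc n"]] unfolding b_def c_def .
    then have "p n x y * (1 - cos (?u x y)) \<le> p n x y * (2 / \<epsilon>\<^sup>2 * ?T x y)" by (intro mult_left_mono p_nonneg)
    then show "p n x y * (1 - cos (?u x y)) \<le> 2 / \<epsilon>\<^sup>2 * (p n x y * ?T x y)" by (simp only: mult.left_commute)
   qed
  qed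
  also have "\<dots> = 2 / \<epsilon>\<^sup>2 * err n (s n) (s (Suc n))" unfolding err_def by simp
  also have "\<dots> \<le> 2 / \<epsilon>\<^sup>2 * (12 / \<epsilon> * (DD f \<theta> n + (1 / 2) ^ n))" by (intro mult_left_mono e) simp
  also have "\<dots> = 24 / \<epsilon> ^ 3 * (DD f \<theta> n + (1 / 2) ^ n)" by (simp add: power3_eq_cube power2_eq_square)
  finally show "(\<integral>x. \<integral>y. p n x y * (1 - cos (?u x y)) \<partial>M (Suc n) \<partial>M n) \<le> 24 / \<epsilon> ^ 3 * (DD f \<theta> n + (1 / 2) ^ n)" .
 qed (rule bb)
qed

end

end

section \<open>Contribution of the frequencies away from zero\<close>

lemma gauss_integral:
 fixes a \<mu> :: real
 assumes a: "0 < a"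
 shows "integrable lborel (\<lambda>t. exp (- a * (t - \<mu>)\<^sup>2))" "(\<integral>t. exp (- a * (t - \<mu>)\<^sup>2) \<partial>lborel) = sqrt (pi / a)"
proof -
 define s where "s = 1 / sqrt (2 * a)"
 have s: "0 < s" using a by (simp add: s_def)
 have s2: "2 * s\<^sup>2 = 1 / a" using a by (simp add: s_def power_divide)
 have eq: "exp (- a * (t - \<mu>)\<^sup>2) = sqrt (pi / a) * normal_density \<mu> s t" for t
 proof -
  have "2 * pi * s\<^sup>2 = pi * (2 * s\<^sup>2)" by simp
  then have "2 * pi * s\<^sup>2 = pi / a" unfolding s2 by simp
  then show ?thesis unfolding normal_density_def s2 using a by simp
 qed
 show "integrable lborel (\<lambda>t. exp (- a * (t - \<mu>)\<^sup>2))"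
  unfolding eq by (intro integrable_mult_right integrable_normal_density s)
 show "(\<integral>t. exp (- a * (t - \<mu>)\<^sup>2) \<partial>lborel) = sqrt (pi / a)"
  unfolding eq using integral_normal_density[OF s, of \<mu>] by simp
qed

text \<open>Only bounded sets of frequencies away from 0 are considered, since the smoothing kernel
  used later has a compactly supported transform. The factor \<open>sqrt (V N)\<close> is the
  normalisation of the local limit.\<close>

definition small_tail :: "(nat \<Rightarrow> real) \<Rightarrow> (nat \<Rightarrow> real \<Rightarrow> real) \<Rightarrow> bool" where
 "small_tail V g \<longleftrightarrow> (\<forall>N. g N \<in> borel_measurable borel) \<and> (\<forall>N \<theta>. 0 \<le> g N \<theta> \<and> g N \<theta> \<le> 1) \<and>
  (\<forall>\<delta>>0. \<forall>T. (\<lambda>N. sqrt (V N) * (\<integral>\<theta>. indicator {\<theta>. \<delta> < \<bar>\<theta>\<bar> \<and> \<bar>\<theta>\<bar> \<le> T} \<theta> * g N \<theta> \<partial>lborel)) \<longlonglongrightarrow> 0)"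

text \<open>On an interval \<open>J\<close> of length at most \<open>r\<close> let \<open>s'\<close> minimise \<open>g N\<close>. Then \<open>g N s \<ge> g N (s - s') / 4\<close>
 on \<open>J\<close>, and the latter dominates a multiple of \<open>V N * (s - s')\<^sup>2\<close>; half of the exponent is kept for
 the minimum itself, which tends to infinity.\<close>

theorem subquadratic_small_tail:
 fixes g :: "nat \<Rightarrow> real \<Rightarrow> real"
 assumes mono: "\<And>N N' s. N \<le> N' \<Longrightarrow> g N s \<le> g N' s" and nonneg: "\<And>N s. 0 \<le> g N s"
  and cont: "\<And>N. continuous_on UNIV (g N)"
  and add: "\<And>N a b. g N (a + b) \<le> 2 * g N a + 2 * g N b" and even: "\<And>N a. g N (- a) = g N a"
  and r: "0 < r" and d: "0 < d" and quad: "\<And>N s. \<bar>s\<bar> \<le> r \<Longrightarrow> d * s\<^sup>2 * g N r \<le> g N s"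
  and inf: "\<And>s. s \<noteq> 0 \<Longrightarrow> filterlim (\<lambda>N. g N s) at_top sequentially"
  and V: "\<forall>\<^sub>F N in sequentially. 0 \<le> V N \<and> V N \<le> C * (g N r + 1)" and C: "0 < C" and c: "0 < c"
 shows "small_tail V (\<lambda>N s. exp (- c * g N s))"
 unfolding small_tail_def
proof (intro conjI allI impI)
 have gm[measurable]: "g N \<in> borel_measurable borel" for N by (rule borel_measurable_continuous_onI[OF cont])
 show "(\<lambda>s. exp (- c * g N s)) \<in> borel_measurable borel" for N by measurable
 show "exp (- c * g N s) \<le> 1" for N s using c nonneg by simp
 fix h T :: real assume h: "0 < h"
 let ?I = "\<lambda>N. \<integral>s. indicator {s. h < \<bar>s\<bar> \<and> \<bar>s\<bar> \<le> T} s * exp (- c * g N s) \<partial>lborel"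
 define S where "S = {-T..-h} \<union> {h..T}"
 have S: "compact S" "0 \<notin> S" using h by (auto simp: S_def)
 \<comment> \<open>As in Dini's theorem, monotonicity in \<open>N\<close> and compactness of
   \<open>S\<close> upgrade pointwise divergence to uniform divergence.\<close>
 have large: "\<forall>\<^sub>F N in sequentially. \<forall>s\<in>S. B \<le> g N s" for B
 proof -
  have o: "open {s. B < g N s}" for N
   by (rule open_Collect_less[OF continuous_on_const cont])
  have cov: "S \<subseteq> (\<Union>N\<in>UNIV. {s. B < g N s})"
  proof
   fix s assume "s \<in> S"
   then have "s \<noteq> 0" using S by auto
   from inf[OF this] have "\<forall>\<^sub>F N in sequentially. B < g N s" unfolding filterlim_at_top_dense by blast
   then obtain N where "B < g N s" using eventually_sequentially by force
   then show "s \<in> (\<Union>N\<in>UNIV. {s. B < g N s})" by blast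
  qed
  obtain C' where C': "C' \<subseteq> UNIV" "finite C'" "S \<subseteq> (\<Union>N\<in>C'. {s. B < g N s})"
   by (rule compactE_image[OF S(1) _ cov]) (use o in auto)
  show ?thesis unfolding eventually_sequentially
  proof (intro exI allI impI ballI)
   fix N s assume N: "Max (insert 0 C') \<le> N" and "s \<in> S"
   then obtain N' where "N' \<in> C'" "B < g N' s" using C' by blast
   moreover have "N' \<le> N" using N \<open>N' \<in> C'\<close> C'(2) by (meson Max_ge finite_insert insertI2 le_trans)
   ultimately show "B \<le> g N s" using mono[of N' N s] by linarith
  qed
 qed
 define n where "n = nat \<lceil>2 * \<bar>T\<bar> / r\<rceil> + 1"
 define J where "J j = {- T + real j * r..- T + real (Suc j) * r}" for j
 have JS: "\<exists>j<n. s \<in> S \<inter> J j" if "h < \<bar>s\<bar>" "\<bar>s\<bar> \<le> T" for s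
 proof -
  define j where "j = nat \<lfloor>(s + T) / r\<rfloor>"
  have q: "0 \<le> (s + T) / r" using that r by simp
  have rj: "real j = of_int \<lfloor>(s + T) / r\<rfloor>" unfolding j_def using q by simp
  have 1: "real j \<le> (s + T) / r" "(s + T) / r < real j + 1" unfolding rj by linarith+
  then have "real j * r \<le> s + T" "s + T < (real j + 1) * r" using r by (simp_all add: field_simps)
  then have "s \<in> J j" by (simp add: J_def algebra_simps)
  moreover have "(s + T) / r \<le> 2 * \<bar>T\<bar> / r" using that r by (intro divide_right_mono) auto
  then have "real j \<le> of_int \<lceil>2 * \<bar>T\<bar> / r\<rceil>" using 1(1) by linarith
  then have "j < n" unfolding n_def by linarith
  ultimately show ?thesis using that by (auto simp: S_def)
 qed
 have bound: "\<forall>\<^sub>F N in sequentially. sqrt (V N) * ?I N \<le> exp (- (c * B / 2)) * (real n * sqrt (16 * pi * C / (c * d)))" for B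
 proof -
  have "\<forall>\<^sub>F N in sequentially. 1 < g N r" using inf[of r] r by (simp add: filterlim_at_top_dense)
  then show ?thesis using large[of B] V
  proof eventually_elim
   case (elim N)
   \<comment> \<open>The coefficient 8 averages two lower bounds for \<open>g N s\<close>: the
     quadratic one, \<open>d * (s - s')\<^sup>2 * g N r / 4\<close>, and the uniform one,
     \<open>B\<close>.\<close>
   define a where "a = c * d * g N r / 8"
   have a: "0 < a" using elim c d by (simp add: a_def)
   have "\<exists>s'. \<forall>s\<in>S \<inter> J j. exp (- c * g N s) \<le> exp (- (c * B / 2)) * exp (- a * (s - s')\<^sup>2)" for j
   proof (cases "S \<inter> J j = {}")
    case False
    have "compact (S \<inter> J j)" using S(1) by (intro compact_Int_closed) (auto simp: J_def)
    from continuous_attains_inf[OF this False continuous_on_subset[OF cont]]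
    obtain s' where s': "s' \<in> S \<inter> J j" and min: "\<And>s. s \<in> S \<inter> J j \<Longrightarrow> g N s' \<le> g N s" by blast
    show ?thesis
    proof (intro exI ballI)
     fix s assume s: "s \<in> S \<inter> J j"
     have "\<bar>s - s'\<bar> \<le> r" using s s' by (auto simp: J_def algebra_simps abs_le_iff)
     from quad[OF this, of N] have "d * (s - s')\<^sup>2 * g N r \<le> g N (s + - s')" by simp
     also have "\<dots> \<le> 2 * g N s + 2 * g N s'" using add[of N s "- s'"] even[of N s'] by linarith
     also have "\<dots> \<le> 4 * g N s" using min[OF s] by simp
     finally have "d * (s - s')\<^sup>2 * g N r / 8 + B / 2 \<le> g N s" using elim(2) s by fastforce
     then have "c * (d * (s - s')\<^sup>2 * g N r / 8 + B / 2) \<le> c * g N s" using c by (intro mult_left_mono) auto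
     then show "exp (- c * g N s) \<le> exp (- (c * B / 2)) * exp (- a * (s - s')\<^sup>2)"
      unfolding exp_add[symmetric] by (simp add: a_def algebra_simps)
    qed
   qed blast
   then obtain t where t: "\<And>j s. s \<in> S \<inter> J j \<Longrightarrow> exp (- c * g N s) \<le> exp (- (c * B / 2)) * exp (- a * (s - t j)\<^sup>2)" by metis
   have "?I N \<le> (\<integral>s. (\<Sum>j<n. exp (- (c * B / 2)) * exp (- a * (s - t j)\<^sup>2)) \<partial>lborel)"
   proof (rule integral_mono')
    show "integrable lborel (\<lambda>s. \<Sum>j<n. exp (- (c * B / 2)) * exp (- a * (s - t j)\<^sup>2))"
     by (intro Bochner_Integration.integrable_sum integrable_mult_right) (rule gauss_integral(1)[OF a])
    show nn: "0 \<le> (\<Sum>j<n. exp (- (c * B / 2)) * exp (- a * (s - t j)\<^sup>2))" for s by (intro sum_nonneg) simp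
    show "indicator {s. h < \<bar>s\<bar> \<and> \<bar>s\<bar> \<le> T} s * exp (- c * g N s) \<le> (\<Sum>j<n. exp (- (c * B / 2)) * exp (- a * (s - t j)\<^sup>2))" for s
    proof (cases "h < \<bar>s\<bar> \<and> \<bar>s\<bar> \<le> T")
     case True
     then obtain j where j: "j < n" "s \<in> S \<inter> J j" using JS by blast
     have "exp (- c * g N s) \<le> exp (- (c * B / 2)) * exp (- a * (s - t j)\<^sup>2)" by (rule t[OF j(2)])
     also have "\<dots> \<le> (\<Sum>j<n. exp (- (c * B / 2)) * exp (- a * (s - t j)\<^sup>2))"
      using j(1) by (intro member_le_sum) auto
     finally show ?thesis using True by simp
    next
     case False
     then show ?thesis using nn[of s] by simp
    qed
   qed
   also have "\<dots> = (\<Sum>j<n. exp (- (c * B / 2)) * sqrt (pi / a))"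
    by (subst Bochner_Integration.integral_sum)
      (simp_all add: gauss_integral[OF a, simplified])
   also have "\<dots> = exp (- (c * B / 2)) * (real n * sqrt (pi / a))" by simp
   finally have I: "?I N \<le> exp (- (c * B / 2)) * (real n * sqrt (pi / a))" .
   have Iv: "0 \<le> ?I N" by (intro integral_nonneg_AE AE_I2) simp
   have "V N \<le> C * (2 * g N r)" using elim C by (smt (verit) mult_left_mono)
   then have "sqrt (V N) * ?I N \<le> sqrt (C * (2 * g N r)) * (exp (- (c * B / 2)) * (real n * sqrt (pi / a)))"
    using I Iv C elim by (intro mult_mono) auto
   also have "\<dots> = exp (- (c * B / 2)) * (real n * sqrt (C * (2 * g N r) * (pi / a)))"
    by (simp only: real_sqrt_mult mult_ac)
   \<comment> \<open>Here \<open>g N r\<close> cancels: the bumps have width of order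
     \<open>1 / sqrt (g N r)\<close>, while \<open>sqrt (V N)\<close> is at most of order
     \<open>sqrt (g N r)\<close>. Only \<open>exp (- (c * B / 2))\<close> is left, with
     \<open>B\<close> arbitrary.\<close>
   also have "C * (2 * g N r) * (pi / a) = 16 * pi * C / (c * d)"
    using elim c d by (simp add: a_def)
   finally show ?case .
  qed
 qed
 show "(\<lambda>N. sqrt (V N) * ?I N) \<longlonglongrightarrow> 0"
 proof (rule tendstoI)
  fix e :: real assume e: "0 < e"
  define k where "k = real n * sqrt (16 * pi * C / (c * d)) + 1"
  have k: "1 \<le> k" using C c d by (simp add: k_def)
  define B where "B = - 2 / c * ln (e / (2 * k))"
  have eB: "exp (- (c * B / 2)) = e / (2 * k)" using c e k by (simp add: B_def)
  have "\<forall>\<^sub>F N in sequentially. 0 \<le> sqrt (V N)" using V by eventually_elim simp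
  with bound[of B] show "\<forall>\<^sub>F N in sequentially. dist (sqrt (V N) * ?I N) 0 < e"
  proof eventually_elim
   case (elim N)
   have "0 \<le> ?I N" by (intro integral_nonneg_AE AE_I2) simp
   then have "0 \<le> sqrt (V N) * ?I N" using elim(2) by simp
   moreover have "sqrt (V N) * ?I N \<le> e / (2 * k) * k"
    using elim(1) unfolding eB by (rule order.trans) (use e k in \<open>intro mult_left_mono; simp add: k_def\<close>)
   ultimately show ?case using e k by simp
  qed
 qed
qed simp

section \<open>Local limits from characteristic functions\<close>

lemma gaussian_integral: "integrable lborel (\<lambda>t::real. exp (- t\<^sup>2 / 2))" "(\<integral>t. exp (- t\<^sup>2 / 2) \<partial>lborel) = sqrt (2 * pi)"
 using gauss_integral[of "1 / 2" 0] by (simp_all add: mult.commute)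

lemma gaussian_quarter_integrable: "integrable lborel (\<lambda>t::real. exp (- t\<^sup>2 / 4))"
 using gauss_integral(1)[of "1 / 4" 0] by simp

text \<open>On \<open>|s| \<le> d\<close> the substitution \<open>s = t / sqrt (V N)\<close> leads
  to dominated convergence towards the Gaussian integral, with majorant a multiple of
  \<open>exp (- t^2 / 4)\<close>. On the rest of the support of \<open>\<kappa>\<close> the bound
  \<open>g\<close> is negligible even after multiplication by \<open>sqrt (V N)\<close>.\<close>

lemma tendsto_integral_kernel:
 fixes q :: "nat \<Rightarrow> real \<Rightarrow> complex" and V :: "nat \<Rightarrow> real" and \<kappa> :: "real \<Rightarrow> complex" and g :: "nat \<Rightarrow> real \<Rightarrow> real"
 assumes V: "filterlim V at_top sequentially"
  and q[measurable]: "\<And>N. q N \<in> borel_measurable borel"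
  and lim: "\<And>t. (\<lambda>N. q N (t / sqrt (V N))) \<longlonglongrightarrow> of_real (exp (- t\<^sup>2 / 2))"
  and d: "0 < d" and near: "\<forall>\<^sub>F N in sequentially. \<forall>s. \<bar>s\<bar> \<le> d \<longrightarrow> norm (q N s) \<le> 3 * exp (- V N * s\<^sup>2 / 4)"
  and g[measurable]: "\<And>N. g N \<in> borel_measurable borel" and g01: "\<And>N s. 0 \<le> g N s" "\<And>N s. g N s \<le> 1"
  and far: "\<forall>\<^sub>F N in sequentially. \<forall>s. norm (q N s) \<le> g N s"
  and small: "(\<lambda>N. sqrt (V N) * (\<integral>s. indicator {s. d < \<bar>s\<bar> \<and> \<bar>s\<bar> \<le> T} s * g N s \<partial>lborel)) \<longlonglongrightarrow> 0"
  and \<kappa>[measurable]: "\<kappa> \<in> borel_measurable borel" and cont: "isCont \<kappa> 0"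
  and B: "\<And>s. norm (\<kappa> s) \<le> B" and supp: "\<And>s. T < \<bar>s\<bar> \<Longrightarrow> \<kappa> s = 0"
 shows "(\<lambda>N. of_real (sqrt (V N)) * (\<integral>s. \<kappa> s * q N s \<partial>lborel)) \<longlonglongrightarrow> \<kappa> 0 * of_real (sqrt (2 * pi))"
proof -
 let ?I = "\<lambda>s. indicator {-d..d} s :: complex"
 let ?J = "\<lambda>s. indicator {s. d < \<bar>s\<bar> \<and> \<bar>s\<bar> \<le> T} s"
 have B0: "0 \<le> B" using B[of 0] norm_ge_zero order_trans by blast
 have I1: "?I s = 1" if "\<bar>s\<bar> \<le> d" for s
  using that by (auto simp: indicator_def abs_le_iff)
 have setm[measurable]: "{s::real. d < \<bar>s\<bar> \<and> \<bar>s\<bar> \<le> T} \<in> sets borel" by measurable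
 have "\<forall>\<^sub>F N in sequentially. 1 \<le> V N" using V by (simp add: filterlim_at_top)
 with near far have "\<forall>\<^sub>F N in sequentially. 1 \<le> V N \<and> (\<forall>s. \<bar>s\<bar> \<le> d \<longrightarrow> norm (q N s) \<le> 3 * exp (- V N * s\<^sup>2 / 4)) \<and> (\<forall>s. norm (q N s) \<le> g N s)"
  by (intro eventually_conj)
 then obtain N0 where N0: "\<And>N. N0 \<le> N \<Longrightarrow> 1 \<le> V N"
  "\<And>N s. N0 \<le> N \<Longrightarrow> \<bar>s\<bar> \<le> d \<Longrightarrow> norm (q N s) \<le> 3 * exp (- V N * s\<^sup>2 / 4)"
  "\<And>N s. N0 \<le> N \<Longrightarrow> norm (q N s) \<le> g N s"
  unfolding eventually_sequentially by blast
 have gT: "integrable lborel (\<lambda>s. ?J s * g N s)" for N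
 proof (rule integrableI_bounded_set[where A = "{-\<bar>T\<bar>..\<bar>T\<bar>}" and B = 1])
  show "AE x in lborel. x \<in> {-\<bar>T\<bar>..\<bar>T\<bar>} \<longrightarrow> norm (?J x * g N x) \<le> 1"
   using g01 by (auto simp: indicator_def)
  show "AE x in lborel. x \<notin> {-\<bar>T\<bar>..\<bar>T\<bar>} \<longrightarrow> ?J x * g N x = 0"
   by (auto simp: indicator_def)
 qed (auto simp: emeasure_lborel_Icc_eq)
 have near_int: "integrable lborel (\<lambda>s. ?I s * (\<kappa> s * q N s))" if "N0 \<le> N" for N
 proof (rule integrableI_bounded_set[where A = "{-d..d}" and B = B])
  show "AE x in lborel. x \<in> {-d..d} \<longrightarrow> norm (?I x * (\<kappa> x * q N x)) \<le> B"
  proof (rule AE_I2, rule impI)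
   fix x assume "x \<in> {-d..d}"
   have "norm (\<kappa> x) * norm (q N x) \<le> B * 1"
    using B N0(3)[OF that, of x] g01(2)[of N x] B0 by (intro mult_mono) auto
   then show "norm (?I x * (\<kappa> x * q N x)) \<le> B" using B0 by (simp add: norm_mult indicator_def)
  qed
 qed (auto simp: emeasure_lborel_Icc_eq)
 have far_le: "norm (\<kappa> s * q N s - ?I s * (\<kappa> s * q N s)) \<le> B * (?J s * g N s)" if "N0 \<le> N" for N s
 proof (cases "d < \<bar>s\<bar> \<and> \<bar>s\<bar> \<le> T")
  case True
  then have "norm (\<kappa> s * q N s - ?I s * (\<kappa> s * q N s)) = norm (\<kappa> s) * norm (q N s)"
   by (auto simp: norm_mult indicator_def)
  also have "\<dots> \<le> B * g N s" using B N0(3)[OF that] B0 by (intro mult_mono) auto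
  finally show ?thesis using True by simp
 next
  case False
  then have "\<kappa> s * q N s - ?I s * (\<kappa> s * q N s) = 0"
   using supp[of s] I1[of s] by (cases "\<bar>s\<bar> \<le> d") auto
  then have "norm (\<kappa> s * q N s - ?I s * (\<kappa> s * q N s)) = 0" by (simp only: norm_zero)
  moreover have "0 \<le> B * (?J s * g N s)" using B0 g01(1)[of N s] by (intro mult_nonneg_nonneg) auto
  ultimately show ?thesis by linarith
 qed
 have far_int: "integrable lborel (\<lambda>s. \<kappa> s * q N s - ?I s * (\<kappa> s * q N s))" if "N0 \<le> N" for N
 proof (rule Bochner_Integration.integrable_bound[OF integrable_mult_right[OF gT, of B N]])
  show "AE s in lborel. norm (\<kappa> s * q N s - ?I s * (\<kappa> s * q N s)) \<le> norm (B * (?J s * g N s))"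
   unfolding real_norm_def by (rule AE_I2) (rule order.trans[OF far_le[OF that] abs_ge_self])
 qed measurable
 define A where "A N = (\<integral>s. ?I s * (\<kappa> s * q N s) \<partial>lborel)" for N
 have A: "(\<lambda>N. of_real (sqrt (V N)) * A N) \<longlonglongrightarrow> \<kappa> 0 * of_real (sqrt (2 * pi))"
 proof -
  define F where "F N t = ?I (t / sqrt (V N)) * (\<kappa> (t / sqrt (V N)) * q N (t / sqrt (V N)))" for N t
  have eq: "of_real (sqrt (V N)) * A N = (\<integral>t. F N t \<partial>lborel)" if "N0 \<le> N" for N
  proof -
   have "0 < sqrt (V N)" using N0(1)[OF that] by simp
   then show ?thesis
    unfolding A_def F_def
    by (subst lborel_integral_real_affine[where c = "1 / sqrt (V N)" and t = 0]) (auto simp: scaleR_conv_of_real)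
  qed
  have sV: "filterlim (\<lambda>N. sqrt (V N)) at_top sequentially"
   by (rule filterlim_compose[OF sqrt_at_top V])
  \<comment> \<open>The index is shifted by \<open>N0\<close> so that the majorant is valid for
    every member of the sequence.\<close>
  have "(\<lambda>N. \<integral>t. F (N + N0) t \<partial>lborel) \<longlonglongrightarrow> (\<integral>t. \<kappa> 0 * of_real (exp (- t\<^sup>2 / 2)) \<partial>lborel)"
  proof (rule integral_dominated_convergence[where w = "\<lambda>t. B * (3 * exp (- t\<^sup>2 / 4))"])
   show "integrable lborel (\<lambda>t. B * (3 * exp (- t\<^sup>2 / 4)))"
    using gaussian_quarter_integrable by simp
   show "AE t in lborel. (\<lambda>N. F (N + N0) t) \<longlonglongrightarrow> \<kappa> 0 * of_real (exp (- t\<^sup>2 / 2))"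
   proof (rule AE_I2)
    fix t
    have t0: "(\<lambda>N. t / sqrt (V N)) \<longlonglongrightarrow> 0"
     using sV by (intro real_tendsto_divide_at_top[of "\<lambda>_. t" t]) auto
    have "\<forall>\<^sub>F N in sequentially. \<bar>t / sqrt (V N)\<bar> < d"
     using tendstoD[OF t0 d] by (simp add: dist_real_def)
    then have "\<forall>\<^sub>F N in sequentially. \<kappa> (t / sqrt (V N)) * q N (t / sqrt (V N)) = F N t"
     by eventually_elim (simp add: F_def I1 less_imp_le)
    moreover have "(\<lambda>N. \<kappa> (t / sqrt (V N)) * q N (t / sqrt (V N))) \<longlonglongrightarrow> \<kappa> 0 * of_real (exp (- t\<^sup>2 / 2))"
     by (intro tendsto_mult lim isCont_tendsto_compose[OF cont t0])
    ultimately have "(\<lambda>N. F N t) \<longlonglongrightarrow> \<kappa> 0 * of_real (exp (- t\<^sup>2 / 2))"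
     by (rule Lim_transform_eventually[rotated])
    then show "(\<lambda>N. F (N + N0) t) \<longlonglongrightarrow> \<kappa> 0 * of_real (exp (- t\<^sup>2 / 2))"
     by (rule LIMSEQ_ignore_initial_segment)
   qed
   show "AE t in lborel. norm (F (N + N0) t) \<le> B * (3 * exp (- t\<^sup>2 / 4))" for N
   proof (rule AE_I2)
    fix t
    let ?s = "t / sqrt (V (N + N0))"
    have V1: "1 \<le> V (N + N0)" by (rule N0) simp
    show "norm (F (N + N0) t) \<le> B * (3 * exp (- t\<^sup>2 / 4))"
    proof (cases "\<bar>?s\<bar> \<le> d")
     case True
     have "norm (F (N + N0) t) \<le> norm (\<kappa> ?s) * norm (q (N + N0) ?s)"
      by (simp add: F_def norm_mult indicator_def)
     also have "\<dots> \<le> B * (3 * exp (- V (N + N0) * ?s\<^sup>2 / 4))"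
      using B B0 N0(2)[OF _ True] by (intro mult_mono) auto
     also have "V (N + N0) * ?s\<^sup>2 = t\<^sup>2" using V1 by (simp add: power_divide)
     then have "- V (N + N0) * ?s\<^sup>2 / 4 = - t\<^sup>2 / 4" by simp
     finally show ?thesis .
    next
     case False
     then have "F (N + N0) t = 0" by (auto simp: F_def indicator_def abs_le_iff)
     then show ?thesis using B0 by simp
    qed
   qed
  qed (simp_all add: F_def)
  also have "(\<integral>t. \<kappa> 0 * of_real (exp (- t\<^sup>2 / 2)) \<partial>lborel) = \<kappa> 0 * of_real (sqrt (2 * pi))"
   by (simp only: integral_mult_right_zero integral_complex_of_real gaussian_integral(2))
  finally have "(\<lambda>N. of_real (sqrt (V (N + N0))) * A (N + N0)) \<longlonglongrightarrow> \<kappa> 0 * of_real (sqrt (2 * pi))"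
   by (simp add: eq)
  then show ?thesis by (rule LIMSEQ_offset)
 qed
 have R: "(\<lambda>N. of_real (sqrt (V N)) * ((\<integral>s. \<kappa> s * q N s \<partial>lborel) - A N)) \<longlonglongrightarrow> 0"
 proof (rule Lim_null_comparison)
  show "\<forall>\<^sub>F N in sequentially. norm (of_real (sqrt (V N)) * ((\<integral>s. \<kappa> s * q N s \<partial>lborel) - A N)) \<le>
   B * (sqrt (V N) * (\<integral>s. ?J s * g N s \<partial>lborel))"
   using eventually_ge_at_top[of N0]
  proof eventually_elim
   case (elim N)
   have "integrable lborel (\<lambda>s. (\<kappa> s * q N s - ?I s * (\<kappa> s * q N s)) + ?I s * (\<kappa> s * q N s))"
    by (rule Bochner_Integration.integrable_add[OF far_int[OF elim] near_int[OF elim]])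
   then have ii: "integrable lborel (\<lambda>s. \<kappa> s * q N s)" by simp
   have "(\<integral>s. \<kappa> s * q N s \<partial>lborel) - A N = (\<integral>s. \<kappa> s * q N s - ?I s * (\<kappa> s * q N s) \<partial>lborel)"
    unfolding A_def by (rule Bochner_Integration.integral_diff[symmetric, OF ii near_int[OF elim]])
   also have "norm \<dots> \<le> (\<integral>s. B * (?J s * g N s) \<partial>lborel)"
    by (rule integral_norm_le_integral[OF far_int[OF elim] integrable_mult_right[OF gT] far_le[OF elim]])
   finally have "norm ((\<integral>s. \<kappa> s * q N s \<partial>lborel) - A N) \<le> B * (\<integral>s. ?J s * g N s \<partial>lborel)" by simp
   then have "sqrt (V N) * norm ((\<integral>s. \<kappa> s * q N s \<partial>lborel) - A N) \<le> sqrt (V N) * (B * (\<integral>s. ?J s * g N s \<partial>lborel))"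
    using N0(1)[OF elim] by (intro mult_left_mono) auto
   then show ?case using N0(1)[OF elim] by (simp add: norm_mult mult.left_commute)
  qed
  show "(\<lambda>N. B * (sqrt (V N) * (\<integral>s. ?J s * g N s \<partial>lborel))) \<longlonglongrightarrow> 0"
   using tendsto_mult_right_zero[OF small] .
 qed
 from tendsto_add[OF A R] show ?thesis by (simp add: algebra_simps)
qed

subsection \<open>The Fejer kernel\<close>

definition tri :: "real \<Rightarrow> real" where
 "tri u = max 0 (1 - \<bar>u\<bar>)"

text \<open>This is \<open>(sin (w / 2) / (w / 2))^2\<close>, the Fourier transform of the triangle
  function \<open>tri\<close>; the value at 0 fills the removable singularity.\<close>

definition fej :: "real \<Rightarrow> real" where
 "fej w = (if w = 0 then 1 else 2 * (1 - cos w) / w\<^sup>2)"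

lemma tri_bounds: "0 \<le> tri u" "tri u \<le> 1" "1 < \<bar>u\<bar> \<Longrightarrow> tri u = 0"
 by (auto simp: tri_def)

lemma tri_measurable [measurable]: "tri \<in> borel_measurable borel"
 unfolding tri_def by measurable

lemma isCont_tri: "isCont tri u"
 unfolding tri_def by (intro continuous_intros)

lemma fej_measurable [measurable]: "fej \<in> borel_measurable borel"
 unfolding fej_def by measurable

lemma jordan_sin:
 assumes "0 \<le> v" "v \<le> pi / 2"
 shows "2 * v / pi \<le> sin v"
proof -
 have "convex_on {0..pi / 2} (\<lambda>x. - sin x)"
 proof (rule f''_ge0_imp_convex[where f' = "\<lambda>x. - cos x" and f'' = sin])
  show "0 \<le> sin x" if "x \<in> {0..pi / 2}" for x using that by (intro sin_ge_zero) auto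
 qed (auto intro!: derivative_eq_intros)
 from convex_onD[OF this, of "2 * v / pi" 0 "pi / 2"] show ?thesis
  using assms by (simp add: field_simps)
qed

lemma one_minus_cos_ge:
 assumes "\<bar>u\<bar> \<le> pi"
 shows "2 * u\<^sup>2 / pi\<^sup>2 \<le> 1 - cos u"
proof -
 have "2 * \<bar>u / 2\<bar> / pi \<le> sin \<bar>u / 2\<bar>" using assms by (intro jordan_sin) auto
 then have "(\<bar>u\<bar> / pi)\<^sup>2 \<le> (sin \<bar>u / 2\<bar>)\<^sup>2" by (intro power_mono) auto
 also have "\<dots> = (sin (u / 2))\<^sup>2" by (cases "0 \<le> u") (auto simp: abs_if)
 finally have "2 * (\<bar>u\<bar> / pi)\<^sup>2 \<le> 2 * (sin (u / 2))\<^sup>2" by simp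
 also have "\<dots> = 1 - cos u" using cos_double_sin[of "u / 2"] by simp
 finally show ?thesis by (simp add: power_divide)
qed

lemma one_minus_cos_le: "1 - cos (w::real) \<le> w\<^sup>2 / 2"
proof -
 have "1 - cos w = 2 * (sin (w / 2))\<^sup>2" using cos_double_sin[of "w / 2"] by simp
 also have "(sin (w / 2))\<^sup>2 \<le> (w / 2)\<^sup>2"
  using abs_sin_x_le_abs_x[of "w / 2"] abs_le_square_iff by blast
 finally show ?thesis by (simp add: power_divide)
qed

lemma fej_bounds: "0 \<le> fej w" "fej w \<le> 1" "fej w \<le> 5 / (1 + w\<^sup>2)"
proof -
 show 0: "0 \<le> fej w" by (simp add: fej_def)
 show 1: "fej w \<le> 1" using one_minus_cos_le[of w] by (auto simp: fej_def divide_le_eq)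
 have "fej w * w\<^sup>2 \<le> 4"
 proof (cases "w = 0")
  case False
  then have "fej w * w\<^sup>2 = 2 * (1 - cos w)" by (simp add: fej_def)
  also have "\<dots> \<le> 4" by (smt (verit) cos_ge_minus_one)
  finally show ?thesis .
 qed simp
 then have "fej w * (1 + w\<^sup>2) \<le> 5" using 1 by (simp add: distrib_left)
 then show "fej w \<le> 5 / (1 + w\<^sup>2)" by (simp add: pos_le_divide_eq add_pos_nonneg)
qed

lemma fej_pos: "\<bar>w\<bar> \<le> 1 \<Longrightarrow> 0 < fej w"
proof (cases "w = 0")
 case False
 assume w: "\<bar>w\<bar> \<le> 1"
 have "cos \<bar>w\<bar> < cos 0" using False w pi_gt3 by (intro cos_monotone_0_pi) auto
 then show ?thesis using False by (simp add: fej_def)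
qed (simp add: fej_def)

lemma fej_lower: "\<bar>w\<bar> \<le> pi \<Longrightarrow> 4 / pi\<^sup>2 \<le> fej w"
proof (cases "w = 0")
 case True
 have "2\<^sup>2 \<le> pi\<^sup>2" using pi_gt3 by (intro power_mono) auto
 then show ?thesis using True by (simp add: fej_def)
next
 case False
 assume "\<bar>w\<bar> \<le> pi"
 from one_minus_cos_ge[OF this] show ?thesis using False by (simp add: fej_def field_simps)
qed

text \<open>Continuity away from 0 suffices where the kernel is used, because weak convergence
  tolerates a null set of discontinuities.\<close>

lemma isCont_fej: "w \<noteq> 0 \<Longrightarrow> isCont fej w"
proof -
 assume w: "w \<noteq> 0"
 have "isCont (\<lambda>w. 2 * (1 - cos w) / w\<^sup>2) w" using w by (intro continuous_intros) auto
 moreover have "\<forall>\<^sub>F x in nhds w. fej x = 2 * (1 - cos x) / x\<^sup>2"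
  using w eventually_nhds_in_open[of "- {0}" w] by (auto simp: fej_def elim!: eventually_mono)
 ultimately show ?thesis by (simp add: isCont_cong)
qed

lemma fej_integrable: "integrable lborel fej"
proof -
 have "set_integrable lborel (einterval (-\<infinity>) \<infinity>) (\<lambda>x::real. inverse (1 + x^2))"
  by (rule integrable_inverse_1_plus_square)
 then have "integrable lborel (\<lambda>x::real. 5 * inverse (1 + x\<^sup>2))"
  by (simp add: set_integrable_def)
 then show ?thesis
  by (rule Bochner_Integration.integrable_bound)
    (use fej_bounds in \<open>auto intro!: AE_I2 simp: divide_inverse\<close>)
qed

lemma tri_integrable: "integrable lborel (\<lambda>u. complex_of_real (tri u) * h u)"
 if [measurable]: "h \<in> borel_measurable borel" and h: "\<And>u. norm (h u) \<le> 1"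
proof (rule integrableI_bounded_set[where A = "{-1..1}" and B = 1])
 show "AE u in lborel. u \<in> {-1..1} \<longrightarrow> norm (complex_of_real (tri u) * h u) \<le> 1"
  using tri_bounds h by (auto intro!: AE_I2 mult_le_one simp: norm_mult)
 show "AE u in lborel. u \<notin> {-1..1} \<longrightarrow> complex_of_real (tri u) * h u = 0"
  by (auto intro!: AE_I2 simp: tri_def)
qed (auto simp: emeasure_lborel_Icc_eq)

lemma fej_eq_integral: "complex_of_real (fej w) = (\<integral>u. of_real (tri u) * iexp (u * w) \<partial>lborel)"
proof -
 let ?h = "\<lambda>u. of_real (tri u) * iexp (u * w) :: complex"
 have int: "integrable lborel ?h" by (rule tri_integrable) auto
 have AE0: "AE u in lborel. u \<noteq> (0::real)" using AE_lborel_singleton by blast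
 have "(\<integral>u. ?h u \<partial>lborel) = (\<integral>u. indicator {-1..0} u *\<^sub>R ?h u + indicator {0..1} u *\<^sub>R ?h u \<partial>lborel)"
  using AE0 by (intro integral_cong_AE; (measurable)?) (auto simp: indicator_def tri_def elim!: eventually_mono)
 also have "\<dots> = (\<integral>u. indicator {-1..0} u *\<^sub>R ?h u \<partial>lborel) + (\<integral>u. indicator {0..1} u *\<^sub>R ?h u \<partial>lborel)"
  by (intro Bochner_Integration.integral_add integrable_mult_indicator int) auto
 finally have split: "(\<integral>u. ?h u \<partial>lborel) = (\<integral>u. indicator {-1..0} u *\<^sub>R ?h u \<partial>lborel) + (\<integral>u. indicator {0..1} u *\<^sub>R ?h u \<partial>lborel)" .
 have conts: "continuous_on A ?h" for A
  unfolding tri_def by (intro continuous_intros)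
 have cp: "(\<integral>u. indicator {0..1} u *\<^sub>R ?h u \<partial>lborel) = F 1 - F 0"
  if "\<And>u. (F has_vector_derivative (of_real (1 - u) * iexp (u * w))) (at u)" for F
 proof (rule integral_FTC_atLeastAtMost[OF _ _ conts])
  fix u :: real assume u: "0 \<le> u" "u \<le> 1"
  then have "?h u = of_real (1 - u) * iexp (u * w)" by (simp add: tri_def)
  then show "(F has_vector_derivative ?h u) (at u within {0..1})"
   using that[of u] has_vector_derivative_at_within by simp
 qed simp
 have cm: "(\<integral>u. indicator {-1..0} u *\<^sub>R ?h u \<partial>lborel) = F 0 - F (-1)"
  if "\<And>u. (F has_vector_derivative (of_real (1 + u) * iexp (u * w))) (at u)" for F
 proof (rule integral_FTC_atLeastAtMost[OF _ _ conts])
  fix u :: real assume u: "-1 \<le> u" "u \<le> 0"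
  then have "?h u = of_real (1 + u) * iexp (u * w)" by (simp add: tri_def)
  then show "(F has_vector_derivative ?h u) (at u within {-1..0})"
   using that[of u] has_vector_derivative_at_within by simp
 qed simp
 show ?thesis
 proof (cases "w = 0")
  case True
  let ?F = "\<lambda>z::complex. z - z\<^sup>2 / 2" and ?G = "\<lambda>z::complex. z + z\<^sup>2 / 2"
  have "(?F has_field_derivative (1 - z)) (at z)" for z
   by (auto intro!: derivative_eq_intros)
  from has_vector_derivative_real_field[OF this]
  have F: "((\<lambda>u. ?F (of_real u)) has_vector_derivative (of_real (1 - u) * iexp (u * w))) (at u)" for u
   using True by simp
  have "(?G has_field_derivative (1 + z)) (at z)" for z
   by (auto intro!: derivative_eq_intros)
  from has_vector_derivative_real_field[OF this]
  have G: "((\<lambda>u. ?G (of_real u)) has_vector_derivative (of_real (1 + u) * iexp (u * w))) (at u)" for u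
   using True by simp
  show ?thesis unfolding split cp[OF F] cm[OF G] using True by (simp add: fej_def)
 next
  case False
  let ?c = "\<i> * of_real w"
  have c0: "?c \<noteq> 0" using False by simp
  let ?F = "\<lambda>z. (1 - z) * exp (?c * z) / ?c + exp (?c * z) / ?c\<^sup>2"
  let ?G = "\<lambda>z. (1 + z) * exp (?c * z) / ?c - exp (?c * z) / ?c\<^sup>2"
  have "(?F has_field_derivative (1 - z) * exp (?c * z)) (at z)" for z
   using c0 by (auto intro!: derivative_eq_intros simp: divide_simps power2_eq_square)
  from has_vector_derivative_real_field[OF this]
  have F: "((\<lambda>u. ?F (of_real u)) has_vector_derivative (of_real (1 - u) * iexp (u * w))) (at u)" for u
   by (simp add: mult_ac)
  have "(?G has_field_derivative (1 + z) * exp (?c * z)) (at z)" for z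
   using c0 by (auto intro!: derivative_eq_intros simp: divide_simps power2_eq_square)
  from has_vector_derivative_real_field[OF this]
  have G: "((\<lambda>u. ?G (of_real u)) has_vector_derivative (of_real (1 + u) * iexp (u * w))) (at u)" for u
   by (simp add: mult_ac)
  have "(\<integral>u. ?h u \<partial>lborel) = (exp ?c + exp (- ?c) - 2) / ?c\<^sup>2"
   unfolding split cp[OF F] cm[OF G] by (simp add: add_divide_distrib diff_divide_distrib)
  also have "exp ?c + exp (- ?c) = 2 * of_real (cos w)"
   by (simp add: exp_Euler cos_of_real sin_of_real exp_minus_Euler)
  also have "(2 * of_real (cos w) - 2) / ?c\<^sup>2 = of_real (fej w)"
   using False by (simp add: fej_def power_mult_distrib divide_simps)
  finally show ?thesis by simp
 qed
qed

text \<open>Weighting a law with the Fejer kernel restricts attention to its characteristic function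
  on the bounded interval of frequencies \<open>u * s + t\<close> with \<open>|u| \<le> 1\<close>,
  which is why no decay at infinity is required of it.\<close>

lemma fej_char:
 assumes "real_distribution R"
 shows "(\<integral>y. of_real (fej (s * y)) * iexp (t * y) \<partial>R) = (\<integral>u. of_real (tri u) * char R (u * s + t) \<partial>lborel)"
proof -
 interpret R: real_distribution R by fact
 interpret pair_sigma_finite R lborel by unfold_locales
 let ?f = "\<lambda>y u. of_real (tri u) * iexp (u * (s * y)) * iexp (t * y) :: complex"
 have int: "integrable (R \<Otimes>\<^sub>M lborel) (\<lambda>(y, u). ?f y u)"
 proof (rule integrableI_bounded_set[where A = "space R \<times> {-1..1}" and B = 1])
  show "emeasure (R \<Otimes>\<^sub>M lborel) (space R \<times> {-1..1::real}) < \<infinity>"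
   by (subst lborel.emeasure_pair_measure_Times) (auto simp: ennreal_mult_less_top R.emeasure_eq_measure)
  show "AE w in R \<Otimes>\<^sub>M lborel. w \<in> space R \<times> {-1..1} \<longrightarrow> norm (case w of (y, u) \<Rightarrow> ?f y u) \<le> 1"
   using tri_bounds by (auto intro!: AE_I2 simp: norm_mult)
  show "AE w in R \<Otimes>\<^sub>M lborel. w \<notin> space R \<times> {-1..1} \<longrightarrow> (case w of (y, u) \<Rightarrow> ?f y u) = 0"
   by (intro AE_I2) (auto simp: space_pair_measure tri_def)
 qed (auto simp: measurable_cong_sets[OF sets_pair_measure_cong[OF R.events_eq_borel refl]])
 have "(\<integral>y. of_real (fej (s * y)) * iexp (t * y) \<partial>R) = (\<integral>y. \<integral>u. ?f y u \<partial>lborel \<partial>R)"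
  unfolding fej_eq_integral by (simp add: integral_mult_left_zero)
 also have "\<dots> = (\<integral>u. \<integral>y. ?f y u \<partial>R \<partial>lborel)"
  by (rule Fubini_integral[symmetric]) (use int in simp)
 also have "\<dots> = (\<integral>u. of_real (tri u) * char R (u * s + t) \<partial>lborel)"
  unfolding char_def integral_mult_right_zero[symmetric]
  by (intro integral_congI)
    (simp add: mult.assoc algebra_simps flip: exp_add)
 finally show ?thesis .
qed

subsection \<open>The local limit theorem for distributions\<close>

text \<open>All \<open>t\<close> are treated at once: the case \<open>t = 0\<close> gives the
  normalising mass of the weighted law, and the quotient by it gives the limit of the characteristic
  functions.\<close>

lemma fej_char_limit:
 fixes R :: "nat \<Rightarrow> real measure" and V :: "nat \<Rightarrow> real"
 assumes R: "\<And>N. real_distribution (R N)" and V: "filterlim V at_top sequentially"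
  and lim: "\<And>t. (\<lambda>N. char (R N) (t / sqrt (V N))) \<longlonglongrightarrow> of_real (exp (- t\<^sup>2 / 2))"
  and d: "0 < d" and near: "\<forall>\<^sub>F N in sequentially. \<forall>h. \<bar>h\<bar> \<le> d \<longrightarrow> norm (char (R N) h) \<le> 3 * exp (- V N * h\<^sup>2 / 4)"
  and g: "small_tail V g" and far: "\<forall>\<^sub>F N in sequentially. \<forall>h. norm (char (R N) h) \<le> g N h"
  and s: "0 < s"
 shows "(\<lambda>N. of_real (sqrt (V N)) * (\<integral>y. of_real (fej (s * y)) * iexp (t * y) \<partial>R N)) \<longlonglongrightarrow>
  of_real (tri (t / s) / s * sqrt (2 * pi))"
proof -
 let ?\<kappa> = "\<lambda>h. complex_of_real (tri ((h - t) / s) / s)"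
 have eq: "(\<integral>y. of_real (fej (s * y)) * iexp (t * y) \<partial>R N) = (\<integral>h. ?\<kappa> h * char (R N) h \<partial>lborel)" for N
 proof -
  have "(\<integral>h. ?\<kappa> h * char (R N) h \<partial>lborel) = \<bar>s\<bar> *\<^sub>R (\<integral>u. ?\<kappa> (t + s * u) * char (R N) (t + s * u) \<partial>lborel)"
   using s by (intro lborel_integral_real_affine) simp
  also have "\<dots> = (\<integral>u. of_real s * (?\<kappa> (t + s * u) * char (R N) (t + s * u)) \<partial>lborel)"
   using s by (simp add: scaleR_conv_of_real)
  also have "\<dots> = (\<integral>u. of_real (tri u) * char (R N) (u * s + t) \<partial>lborel)"
   using s by (intro integral_congI) (simp add: algebra_simps)
  finally show ?thesis using fej_char[OF R] by simp
 qed
 have "(\<lambda>N. of_real (sqrt (V N)) * (\<integral>h. ?\<kappa> h * char (R N) h \<partial>lborel)) \<longlonglongrightarrow> ?\<kappa> 0 * of_real (sqrt (2 * pi))"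
 proof (rule tendsto_integral_kernel[OF V _ lim d near, where g = g and B = "1 / s" and T = "\<bar>t\<bar> + s"])
  show "char (R N) \<in> borel_measurable borel" for N
   by (rule real_distribution.char_measurable[OF R])
  show "g N \<in> borel_measurable borel" "0 \<le> g N h" "g N h \<le> 1" for N h
   using g by (auto simp: small_tail_def)
  show "\<forall>\<^sub>F N in sequentially. \<forall>h. norm (char (R N) h) \<le> g N h" by (rule far)
  show "(\<lambda>N. sqrt (V N) * (\<integral>h. indicator {h. d < \<bar>h\<bar> \<and> \<bar>h\<bar> \<le> \<bar>t\<bar> + s} h * g N h \<partial>lborel)) \<longlonglongrightarrow> 0"
   using g d by (auto simp: small_tail_def)
  show "isCont ?\<kappa> 0"
   using s by (intro continuous_intros isCont_o2[OF _ isCont_tri]) auto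
  show "norm (?\<kappa> h) \<le> 1 / s" for h
   using s tri_bounds by (simp add: norm_divide divide_right_mono)
  show "?\<kappa> h = 0" if "\<bar>t\<bar> + s < \<bar>h\<bar>" for h
  proof -
   have "s < \<bar>h - t\<bar>" using that by linarith
   then have "1 < \<bar>(h - t) / s\<bar>" using s by (simp add: abs_divide)
   then show ?thesis by (simp add: tri_bounds(3))
  qed
 qed measurable
 moreover have "tri (- t / s) = tri (t / s)" by (simp add: tri_def)
 then have "?\<kappa> 0 * of_real (sqrt (2 * pi)) = of_real (tri (t / s) / s * sqrt (2 * pi))" by simp
 ultimately show ?thesis by (simp only: eq)
qed

lemma char_scaled_normal:
 assumes "R = distr std_normal_distribution borel (\<lambda>x. c * x)"
 shows "real_distribution R" "char R t = of_real (exp (- (c * t)\<^sup>2 / 2))"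
proof -
 interpret S: real_distribution std_normal_distribution by (rule real_dist_normal_dist)
 show "real_distribution R" unfolding assms
  by (intro real_distribution.intro S.prob_space_distr) (auto simp: real_distribution_axioms_def)
 have "char R t = char std_normal_distribution (c * t)"
  unfolding assms char_def by (subst integral_distr) (auto simp: mult_ac)
 then show "char R t = of_real (exp (- (c * t)\<^sup>2 / 2))"
  by (simp add: char_std_normal_distribution)
qed

text \<open>Fourier inversion for the Fejer kernel, read off from the local limit of normal laws of
  variance \<open>N + 1\<close>. Their densities multiplied by \<open>sqrt (2 * pi * V N)\<close>
  increase to 1, so the limit computed through characteristic functions must agree with the integral
  against Lebesgue measure.\<close>

lemma fej_fourier:
 assumes s: "0 < s"
 shows "(\<integral>y. of_real (fej (s * y)) * iexp (t * y) \<partial>lborel) = of_real (2 * pi * tri (t / s) / s)"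
proof -
 define V where "V N = real (Suc N)" for N
 define R where "R N = distr std_normal_distribution borel (\<lambda>x. sqrt (V N) * x)" for N
 have V0: "0 < V N" for N by (simp add: V_def)
 note R = char_scaled_normal[OF R_def]
 have char: "char (R N) h = of_real (exp (- V N * h\<^sup>2 / 2))" for N h
  unfolding R(2) using V0[of N] by (simp add: power_mult_distrib)
 have V: "filterlim V at_top sequentially"
  unfolding V_def by (rule filterlim_compose[OF filterlim_real_sequentially filterlim_Suc])
 let ?f = "\<lambda>y. of_real (fej (s * y)) * iexp (t * y) :: complex"
 have intf: "integrable lborel (\<lambda>y. fej (s * y))"
  using lborel_integrable_real_affine[OF fej_integrable, of s 0] s by simp
 have g: "small_tail V (\<lambda>N h. exp (- (1 / 2) * (V N * h\<^sup>2)))"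
 proof (rule subquadratic_small_tail[where r = 1 and d = 1 and C = 1])
  show "V N * (u + v)\<^sup>2 \<le> 2 * (V N * u\<^sup>2) + 2 * (V N * v\<^sup>2)" for N u v
  proof -
   have "(u + v)\<^sup>2 \<le> 2 * u\<^sup>2 + 2 * v\<^sup>2" using sum_squares_bound[of u v] by (simp add: power2_sum)
   from mult_left_mono[OF this less_imp_le[OF V0[of N]]] show ?thesis by (simp add: algebra_simps)
  qed
  show "filterlim (\<lambda>N. V N * u\<^sup>2) at_top sequentially" if "u \<noteq> 0" for u
   using filterlim_tendsto_pos_mult_at_top[OF tendsto_const[of "u\<^sup>2"] _ V] that by (simp add: mult.commute)
 qed (use V0 in \<open>auto simp: V_def intro!: continuous_intros mult_right_mono\<close>)
 have 1: "(\<lambda>N. of_real (sqrt (V N)) * (\<integral>y. ?f y \<partial>R N)) \<longlonglongrightarrow> of_real (tri (t / s) / s * sqrt (2 * pi))"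
 proof (rule fej_char_limit[OF R(1) V _ zero_less_one _ g _ s])
  show "(\<lambda>N. char (R N) (t / sqrt (V N))) \<longlonglongrightarrow> of_real (exp (- t\<^sup>2 / 2))" for t
   unfolding char using V0 by (simp add: power_divide less_imp_le order_less_imp_not_eq2)
  show "\<forall>\<^sub>F N in sequentially. \<forall>h. \<bar>h\<bar> \<le> 1 \<longrightarrow> norm (char (R N) h) \<le> 3 * exp (- V N * h\<^sup>2 / 4)"
  proof (intro always_eventually allI impI)
   fix N h
   have "exp (- V N * h\<^sup>2 / 2) \<le> 1 * exp (- V N * h\<^sup>2 / 4)" using V0[of N] by simp
   also have "\<dots> \<le> 3 * exp (- V N * h\<^sup>2 / 4)" by (intro mult_right_mono) auto
   finally show "norm (char (R N) h) \<le> 3 * exp (- V N * h\<^sup>2 / 4)" unfolding char by simp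
  qed
  show "\<forall>\<^sub>F N in sequentially. \<forall>h. norm (char (R N) h) \<le> exp (- (1 / 2) * (V N * h\<^sup>2))"
   unfolding char by simp
 qed
 have 2: "of_real (sqrt (V N)) * (\<integral>y. ?f y \<partial>R N) = of_real (1 / sqrt (2 * pi)) * (\<integral>y. of_real (exp (- y\<^sup>2 / (2 * V N))) * ?f y \<partial>lborel)" for N
 proof -
  let ?r = "sqrt (V N)"
  have r0: "0 < ?r" using V0[of N] by simp
  have "(\<integral>y. ?f y \<partial>R N) = (\<integral>x. ?f (?r * x) \<partial>std_normal_distribution)"
   unfolding R_def by (subst integral_distr) auto
  also have "\<dots> = (\<integral>x. std_normal_density x *\<^sub>R ?f (?r * x) \<partial>lborel)"
   by (subst integral_density) auto
  also have "\<dots> = \<bar>1 / ?r\<bar> *\<^sub>R (\<integral>y. std_normal_density (0 + 1 / ?r * y) *\<^sub>R ?f (?r * (0 + 1 / ?r * y)) \<partial>lborel)"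
   by (rule lborel_integral_real_affine) (use r0 in simp)
  also have "\<dots> = of_real (1 / ?r) * (\<integral>y. of_real (1 / sqrt (2 * pi)) * (of_real (exp (- y\<^sup>2 / (2 * V N))) * ?f y) \<partial>lborel)"
  proof -
   have "std_normal_density (0 + 1 / ?r * y) *\<^sub>R ?f (?r * (0 + 1 / ?r * y)) =
    of_real (1 / sqrt (2 * pi)) * (of_real (exp (- y\<^sup>2 / (2 * V N))) * ?f y)" for y
    using r0 V0[of N] by (simp add: scaleR_conv_of_real std_normal_density_def power_divide mult.commute[of "V N" 2])
   then show ?thesis using r0 by (simp only: scaleR_conv_of_real abs_of_pos zero_less_divide_1_iff)
  qed
  finally show ?thesis using r0 by simp
 qed
 have "(\<lambda>N. \<integral>y. of_real (exp (- y\<^sup>2 / (2 * V N))) * ?f y \<partial>lborel) \<longlonglongrightarrow> (\<integral>y. ?f y \<partial>lborel)"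
 proof (rule integral_dominated_convergence[OF _ _ intf])
  show "AE y in lborel. (\<lambda>N. of_real (exp (- y\<^sup>2 / (2 * V N))) * ?f y) \<longlonglongrightarrow> ?f y"
  proof (rule AE_I2)
   fix y :: real
   have "((\<lambda>v::real. exp (- y\<^sup>2 / (2 * v))) \<longlongrightarrow> 1) at_top" by real_asymp
   from filterlim_compose[OF this V] have "(\<lambda>N. of_real (exp (- y\<^sup>2 / (2 * V N))) * ?f y) \<longlonglongrightarrow> of_real 1 * ?f y"
    by (intro tendsto_mult tendsto_of_real tendsto_const)
   then show "(\<lambda>N. of_real (exp (- y\<^sup>2 / (2 * V N))) * ?f y) \<longlonglongrightarrow> ?f y" by simp
  qed
  show "AE y in lborel. norm (of_real (exp (- y\<^sup>2 / (2 * V N))) * ?f y) \<le> fej (s * y)" for N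
   using fej_bounds(1) V0[of N] by (intro AE_I2) (simp add: norm_mult mult_left_le_one_le)
 qed measurable
 from tendsto_mult[OF tendsto_const[of "of_real (1 / sqrt (2 * pi))"] this]
 have "(\<lambda>N. of_real (sqrt (V N)) * (\<integral>y. ?f y \<partial>R N)) \<longlonglongrightarrow> of_real (1 / sqrt (2 * pi)) * (\<integral>y. ?f y \<partial>lborel)"
  by (simp only: 2)
 from LIMSEQ_unique[OF this 1]
 have "of_real (1 / sqrt (2 * pi)) * (\<integral>y. ?f y \<partial>lborel) = of_real (tri (t / s) / s * sqrt (2 * pi))" .
 then have "of_real (sqrt (2 * pi)) * (of_real (1 / sqrt (2 * pi)) * (\<integral>y. ?f y \<partial>lborel)) =
   of_real (sqrt (2 * pi)) * complex_of_real (tri (t / s) / s * sqrt (2 * pi))" by simp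
 then have "(\<integral>y. ?f y \<partial>lborel) = complex_of_real (sqrt (2 * pi) * (tri (t / s) / s * sqrt (2 * pi)))"
  by (simp flip: of_real_mult mult.assoc)
 also have "sqrt (2 * pi) * (tri (t / s) / s * sqrt (2 * pi)) = 2 * pi * tri (t / s) / s"
  by (simp add: mult_ac flip: real_sqrt_mult)
 finally show ?thesis .
qed

lemma emeasure_density_space:
 "f \<in> borel_measurable M \<Longrightarrow> emeasure (density M f) (space M) = (\<integral>\<^sup>+x. f x \<partial>M)"
 by (subst emeasure_density) (auto intro!: nn_integral_cong)

lemma prob_space_density_real:
 assumes f: "integrable N f" "\<And>y. 0 \<le> f y" and 1: "(\<integral>y. f y \<partial>N) = 1"
 shows "prob_space (density N (\<lambda>y. ennreal (f y)))"
proof (rule prob_spaceI)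
 have "emeasure (density N (\<lambda>y. ennreal (f y))) (space (density N (\<lambda>y. ennreal (f y)))) = (\<integral>\<^sup>+y. ennreal (f y) \<partial>N)"
  unfolding space_density using borel_measurable_integrable[OF f(1)] by (intro emeasure_density_space) measurable
 also have "\<dots> = ennreal (\<integral>y. f y \<partial>N)" using f by (intro nn_integral_eq_integral) auto
 finally show "emeasure (density N (\<lambda>y. ennreal (f y))) (space (density N (\<lambda>y. ennreal (f y)))) = 1" using 1 by simp
qed

text \<open>The laws weighted with \<open>fej (s * y)\<close> and normalised are probability
  measures whose characteristic functions converge to \<open>tri (t / s)\<close>, that of Lebesgue
  measure with the same weight. Levy's theorem gives weak convergence, and integrating the indicator
  of the interval divided by the weight removes the weight again.\<close>

theorem local_limit:
 fixes R :: "nat \<Rightarrow> real measure" and V :: "nat \<Rightarrow> real"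
 assumes R: "\<And>N. real_distribution (R N)" and V: "filterlim V at_top sequentially"
  and lim: "\<And>t. (\<lambda>N. char (R N) (t / sqrt (V N))) \<longlonglongrightarrow> of_real (exp (- t\<^sup>2 / 2))"
  and d: "0 < d" and near: "\<forall>\<^sub>F N in sequentially. \<forall>\<theta>. \<bar>\<theta>\<bar> \<le> d \<longrightarrow> norm (char (R N) \<theta>) \<le> 3 * exp (- V N * \<theta>\<^sup>2 / 4)"
  and g: "small_tail V g" and far: "\<forall>\<^sub>F N in sequentially. \<forall>\<theta>. norm (char (R N) \<theta>) \<le> g N \<theta>"
  and ab: "a < b"
 shows "(\<lambda>N. sqrt (V N) * measure (R N) {a<..<b}) \<longlonglongrightarrow> (b - a) / sqrt (2 * pi)"
proof -
 \<comment> \<open>This makes \<open>|s * y| \<le> 1\<close> on the interval, where the kernel is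
   bounded below by \<open>4 / pi\<^sup>2\<close>, so that dividing by it is safe.\<close>
 define s where "s = 1 / (1 + \<bar>a\<bar> + \<bar>b\<bar>)"
 have s: "0 < s" unfolding s_def by (intro divide_pos_pos) auto
 note lim' = fej_char_limit[OF R V lim d near g far s]
 define Z where "Z N = (\<integral>y. fej (s * y) \<partial>R N)" for N
 have ifej: "integrable (R N) (\<lambda>y. fej (s * y))" for N
 proof -
  interpret real_distribution "R N" by (rule R)
  show ?thesis using fej_bounds by (intro integrable_const_bound[of _ 1]) auto
 qed
 have Zc: "(\<integral>y. of_real (fej (s * y)) \<partial>R N) = complex_of_real (Z N)" for N
  unfolding Z_def by (rule integral_complex_of_real)
 have Z0: "0 \<le> Z N" for N unfolding Z_def by (intro integral_nonneg_AE AE_I2 fej_bounds)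
 have Zlim: "(\<lambda>N. sqrt (V N) * Z N) \<longlonglongrightarrow> sqrt (2 * pi) / s"
 proof -
  have "(\<lambda>N. complex_of_real (sqrt (V N) * Z N)) \<longlonglongrightarrow> complex_of_real (sqrt (2 * pi) / s)"
   using lim'[of 0] by (simp add: Zc Z_def[symmetric] tri_def)
  then show ?thesis by (simp only: tendsto_of_real_iff)
 qed
 have "\<forall>\<^sub>F N in sequentially. 0 < sqrt (V N) * Z N"
  using order_tendstoD(1)[OF Zlim, of 0] s by simp
 then obtain N0 where N0: "\<And>N. N0 \<le> N \<Longrightarrow> 0 < sqrt (V N) * Z N"
  unfolding eventually_sequentially by blast
 have Zpos: "0 < Z (N + N0)" "sqrt (V (N + N0)) \<noteq> 0" for N
  using N0[of "N + N0"] Z0[of "N + N0"] by (auto simp: zero_less_mult_iff)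
 define \<mu> where "\<mu> N = density (R (N + N0)) (\<lambda>y. ennreal (fej (s * y) / Z (N + N0)))" for N
 define \<mu>' where "\<mu>' = density lborel (\<lambda>y. ennreal (s * fej (s * y) / (2 * pi)))"
 have sets_R[measurable_cong]: "sets (R N) = sets borel" for N
  using real_distribution.events_eq_borel[OF R] .
 have \<mu>: "real_distribution (\<mu> N)" for N
 proof (intro real_distribution.intro)
  show "prob_space (\<mu> N)" unfolding \<mu>_def
   using fej_bounds(1) Z0 ifej Zpos(1)[of N] by (intro prob_space_density_real) (auto simp: Z_def[symmetric])
 qed (auto simp: real_distribution_axioms_def \<mu>_def sets_R sets_eq_imp_space_eq[OF sets_R])
 have intf: "integrable lborel (\<lambda>y. fej (s * y))"
  using lborel_integrable_real_affine[OF fej_integrable, of s 0] s by simp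
 have \<mu>': "real_distribution \<mu>'"
 proof (intro real_distribution.intro)
  have "complex_of_real (\<integral>y. fej (s * y) \<partial>lborel) = of_real (2 * pi / s)"
   using fej_fourier[OF s, of 0] by (simp add: tri_def)
  then have i: "(\<integral>y. fej (s * y) \<partial>lborel) = 2 * pi / s" by (simp only: of_real_eq_iff)
  show "prob_space \<mu>'" unfolding \<mu>'_def
   using fej_bounds(1) s intf i by (intro prob_space_density_real) auto
 qed (auto simp: real_distribution_axioms_def \<mu>'_def)
 have char\<mu>: "char (\<mu> N) t = of_real (1 / Z (N + N0)) * (\<integral>y. of_real (fej (s * y)) * iexp (t * y) \<partial>R (N + N0))" for N t
 proof -
  have "char (\<mu> N) t = (\<integral>y. (fej (s * y) / Z (N + N0)) *\<^sub>R iexp (t * y) \<partial>R (N + N0))"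
   unfolding char_def \<mu>_def using fej_bounds(1) Z0
   by (intro integral_density) auto
  also have "\<dots> = (\<integral>y. of_real (1 / Z (N + N0)) * (of_real (fej (s * y)) * iexp (t * y)) \<partial>R (N + N0))"
   by (intro integral_congI) (simp add: scaleR_conv_of_real)
  also have "\<dots> = of_real (1 / Z (N + N0)) * (\<integral>y. of_real (fej (s * y)) * iexp (t * y) \<partial>R (N + N0))"
   by (rule integral_mult_right_zero)
  finally show ?thesis .
 qed
 have char\<mu>': "char \<mu>' t = of_real (tri (t / s))" for t
 proof -
  have "char \<mu>' t = (\<integral>y. (s * fej (s * y) / (2 * pi)) *\<^sub>R iexp (t * y) \<partial>lborel)"
   unfolding char_def \<mu>'_def using fej_bounds(1) s
   by (intro integral_density) auto
  also have "\<dots> = (\<integral>y. of_real (s / (2 * pi)) * (of_real (fej (s * y)) * iexp (t * y)) \<partial>lborel)"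
   by (intro integral_congI) (simp add: scaleR_conv_of_real)
  also have "\<dots> = of_real (s / (2 * pi)) * of_real (2 * pi * tri (t / s) / s)"
   using fej_fourier[OF s, of t] by simp
  finally show ?thesis using s by simp
 qed
 have "(\<lambda>N. char (\<mu> N) t) \<longlonglongrightarrow> char \<mu>' t" for t
 proof -
  have "(\<lambda>N. (of_real (sqrt (V N)) * (\<integral>y. of_real (fej (s * y)) * iexp (t * y) \<partial>R N)) / of_real (sqrt (V N) * Z N))
    \<longlonglongrightarrow> of_real (tri (t / s) / s * sqrt (2 * pi)) / complex_of_real (sqrt (2 * pi) / s)"
   using s by (intro tendsto_divide lim' tendsto_of_real Zlim) auto
  from LIMSEQ_ignore_initial_segment[OF this, of N0] show ?thesis
   using s Zpos by (simp add: char\<mu> char\<mu>')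
 qed
 then have weak: "weak_conv_m \<mu> \<mu>'" by (rule levy_continuity[OF \<mu> \<mu>'])
 let ?h = "\<lambda>y. indicator {a<..<b} y / fej (s * y) :: real"
 have sy: "\<bar>s * y\<bar> \<le> 1" if "y \<in> {a<..<b}" for y
 proof -
  have "\<bar>y\<bar> \<le> 1 + \<bar>a\<bar> + \<bar>b\<bar>" using that by auto
  then show ?thesis using s unfolding abs_mult by (simp add: s_def divide_le_eq)
 qed
 have fpos: "0 < fej (s * y)" if "y \<in> {a<..<b}" for y by (rule fej_pos[OF sy[OF that]])
 have fpos': "fej (s * y) \<noteq> 0" if "a < y" "y < b" for y using fpos[of y] that by simp
 have "(\<lambda>N. integral\<^sup>L (\<mu> N) ?h) \<longlonglongrightarrow> integral\<^sup>L \<mu>' ?h"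
 proof (rule weak_conv_imp_bdd_ae_continuous_conv[OF \<mu> \<mu>' weak])
  \<comment> \<open>The point 0 is listed because of the kernel, the endpoints because of the
    indicator; together they form a null set of the limit law.\<close>
  have "{y. \<not> isCont ?h y} \<subseteq> {a, b, 0}"
  proof
   fix y assume y: "y \<in> {y. \<not> isCont ?h y}"
   show "y \<in> {a, b, 0}"
   proof (rule ccontr)
    assume n: "y \<notin> {a, b, 0}"
    consider "y \<in> {a<..<b}" | "y \<notin> {a..b}" using n by fastforce
    then have "isCont ?h y"
    proof cases
     case 1
     have "isCont (\<lambda>y. 1 / fej (s * y)) y"
      using fpos[OF 1] n s by (intro continuous_intros isCont_o2[OF _ isCont_fej]) auto
     moreover have "\<forall>\<^sub>F x in nhds y. ?h x = 1 / fej (s * x)"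
      using eventually_nhds_in_open[OF _ 1] by (auto elim!: eventually_mono)
     ultimately show ?thesis by (subst isCont_cong)
    next
     case 2
     have "isCont (\<lambda>y. 0::real) y" by simp
     moreover have "\<forall>\<^sub>F x in nhds y. x \<in> - {a..b}"
      using 2 by (intro eventually_nhds_in_open open_Compl) auto
     then have "\<forall>\<^sub>F x in nhds y. ?h x = 0"
      by (rule eventually_mono) (auto simp: indicator_def)
     ultimately show ?thesis by (subst isCont_cong)
    qed
    with y show False by simp
   qed
  qed
  moreover have "emeasure \<mu>' {a, b, 0} = 0"
  proof -
   have "{a, b, 0} \<in> null_sets lborel" by (rule finite_imp_null_set_lborel) simp
   then show ?thesis unfolding \<mu>'_def
    by (subst emeasure_density) (auto intro!: nn_integral_null_set)
  qed
  moreover have "{a, b, 0} \<in> sets \<mu>'" by (simp add: \<mu>'_def)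
  ultimately show "emeasure \<mu>' {y. \<not> isCont ?h y} = 0"
   by (metis emeasure_mono le_zero_eq)
  show "norm (?h y) \<le> pi\<^sup>2 / 4" for y
  proof (cases "y \<in> {a<..<b}")
   case True
   have "4 / pi\<^sup>2 \<le> fej (s * y)" using sy[OF True] pi_gt3 by (intro fej_lower) auto
   then have "1 / fej (s * y) \<le> 1 / (4 / pi\<^sup>2)" using fpos[OF True] by (intro divide_left_mono mult_pos_pos) auto
   then show ?thesis using True fpos[OF True] by simp
  qed simp
 qed measurable
 moreover have "integral\<^sup>L \<mu>' ?h = s * (b - a) / (2 * pi)"
 proof -
  have "integral\<^sup>L \<mu>' ?h = (\<integral>y. (s * fej (s * y) / (2 * pi)) *\<^sub>R ?h y \<partial>lborel)"
   unfolding \<mu>'_def using fej_bounds(1) s by (intro integral_density) auto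
  also have "\<dots> = (\<integral>y. s / (2 * pi) * indicator {a<..<b} y \<partial>lborel)"
   by (intro integral_congI) (use fpos' in \<open>auto simp: indicator_def\<close>)
  also have "\<dots> = s * (b - a) / (2 * pi)" using ab by simp
  finally show ?thesis .
 qed
 moreover have "integral\<^sup>L (\<mu> N) ?h = measure (R (N + N0)) {a<..<b} / Z (N + N0)" for N
 proof -
  have "integral\<^sup>L (\<mu> N) ?h = (\<integral>y. (fej (s * y) / Z (N + N0)) *\<^sub>R ?h y \<partial>R (N + N0))"
   unfolding \<mu>_def using fej_bounds(1) Z0 by (intro integral_density) auto
  also have "\<dots> = (\<integral>y. 1 / Z (N + N0) * indicator {a<..<b} y \<partial>R (N + N0))"
   by (intro integral_congI) (use fpos' in \<open>auto simp: indicator_def\<close>)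
  also have "\<dots> = measure (R (N + N0)) {a<..<b} / Z (N + N0)"
   by (simp add: sets_eq_imp_space_eq[OF sets_R])
  finally show ?thesis .
 qed
 ultimately have "(\<lambda>N. measure (R (N + N0)) {a<..<b} / Z (N + N0)) \<longlonglongrightarrow> s * (b - a) / (2 * pi)" by simp
 from tendsto_mult[OF LIMSEQ_ignore_initial_segment[OF Zlim, of N0] this]
 have "(\<lambda>N. sqrt (V (N + N0)) * measure (R (N + N0)) {a<..<b}) \<longlonglongrightarrow> sqrt (2 * pi) / s * (s * (b - a) / (2 * pi))"
  using Zpos by (simp add: less_imp_neq[THEN not_sym])
 also have "sqrt (2 * pi) / s * (s * (b - a) / (2 * pi)) = (b - a) / sqrt (2 * pi)"
 proof -
  have "sqrt (2 * pi) * sqrt (2 * pi) = 2 * pi" by simp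
  then have "sqrt (2 * pi) / (2 * pi) = 1 / sqrt (2 * pi)"
   by (simp only: divide_eq_eq eq_divide_eq) (auto simp: field_simps)
  then show ?thesis using s by (simp add: field_simps)
 qed
 finally show ?thesis by (rule LIMSEQ_offset)
qed

section \<open>Logarithms of moment generating functions\<close>

lemma mgf_has_derivative:
 fixes T g :: "'b \<Rightarrow> real"
 assumes fin: "finite_measure P" and T: "bm P T" and g: "bm P g"
 shows "((\<lambda>s. \<integral>w. of_real (g w) * exp (s * of_real (T w)) \<partial>P) has_field_derivative
  (\<integral>w. of_real (g w * T w) * exp (s * of_real (T w)) \<partial>P)) (at (s::complex))"
proof -
 obtain B where B: "0 \<le> B" "\<And>w. w \<in> space P \<Longrightarrow> norm (T w) \<le> B" using bmE[OF T] by blast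
 let ?e = "\<lambda>s w. of_real (g w) * exp (s * of_real (T w)) :: complex"
 let ?d = "\<lambda>w. of_real (g w * T w) * exp (s * of_real (T w)) :: complex"
 let ?F = "\<lambda>s. \<integral>w. ?e s w \<partial>P"
 have ie: "bm P (?e s)" for s by (intro bm_intros T g)
 have id: "bm P ?d" by (intro bm_intros T g)
 define C where "C = (\<integral>w. norm (?e s w) * (3 * B\<^sup>2) \<partial>P)"
 have bC: "bm P (\<lambda>w. norm (?e s w) * (3 * B\<^sup>2))" by (intro bm_intros T g)
 have est: "norm ((?F (s + h) - ?F s) / h - (\<integral>w. ?d w \<partial>P)) \<le> C * norm h" if h: "h \<noteq> 0" "norm h * B \<le> 1" for h
 proof -
  have eq: "(?F (s + h) - ?F s) / h - (\<integral>w. ?d w \<partial>P) = (\<integral>w. (?e (s + h) w - ?e s w) / h - ?d w \<partial>P)"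
   using bm_integrable[OF fin ie] bm_integrable[OF fin id] by simp
  have le: "norm (\<integral>w. (?e (s + h) w - ?e s w) / h - ?d w \<partial>P) \<le> (\<integral>w. norm (?e s w) * (3 * B\<^sup>2) * norm h \<partial>P)"
  proof (rule bm_integral_norm_le[OF fin])
   show "bm P (\<lambda>w. (?e (s + h) w - ?e s w) / h - ?d w)" by (intro bm_diff bm_divide_const ie id)
   show "bm P (\<lambda>w. norm (?e s w) * (3 * B\<^sup>2) * norm h)" by (rule bm_mult[OF bC bm_const])
   fix w assume w: "w \<in> space P"
   let ?t = "complex_of_real (T w)"
   have "norm (h * ?t) \<le> norm h * B" unfolding norm_mult using B(2)[OF w] by (intro mult_left_mono) auto
   then have ht: "norm (h * ?t) \<le> 1" using h(2) by linarith
   have "?e (s + h) w = ?e s w * exp (h * ?t)" by (simp add: distrib_right exp_add)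
   moreover have "?d w = ?e s w * (h * ?t) / h" using h(1) by simp
   ultimately have "(?e (s + h) w - ?e s w) / h - ?d w = ?e s w * ((exp (h * ?t) - 1 - h * ?t) / h)"
    by (simp only: right_diff_distrib diff_divide_distrib times_divide_eq_right mult_1_right)
   also have "norm \<dots> = norm (?e s w) * (norm (exp (h * ?t) - 1 - h * ?t) / norm h)"
    by (simp only: norm_mult norm_divide)
   also have "\<dots> \<le> norm (?e s w) * (3 * (norm (h * ?t))\<^sup>2 / norm h)"
    by (intro mult_left_mono divide_right_mono exp_minus_1_le(2)[OF ht]) auto
   also have "\<dots> = norm (?e s w) * (3 * (norm ?t)\<^sup>2 * norm h)"
    using h(1) by (simp add: norm_mult power2_eq_square)
   also have "\<dots> \<le> norm (?e s w) * (3 * B\<^sup>2 * norm h)"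
    using B(2)[OF w] by (intro mult_left_mono mult_right_mono power_mono) auto
   finally show "norm ((?e (s + h) w - ?e s w) / h - ?d w) \<le> norm (?e s w) * (3 * B\<^sup>2) * norm h"
    by (simp only: mult.assoc)
  qed
  have "(\<integral>w. norm (?e s w) * (3 * B\<^sup>2) * norm h \<partial>P) = C * norm h" unfolding C_def by (rule integral_mult_left_zero)
  with le show ?thesis unfolding eq by (simp only:)
 qed
 have "((\<lambda>h. (?F (s + h) - ?F s) / h - (\<integral>w. ?d w \<partial>P)) \<longlongrightarrow> 0) (at 0)"
 proof (rule Lim_null_comparison)
  show "\<forall>\<^sub>F h in at 0. norm ((?F (s + h) - ?F s) / h - (\<integral>w. ?d w \<partial>P)) \<le> C * norm h"
   unfolding eventually_at
  proof (intro exI conjI ballI impI)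
   show "0 < 1 / (B + 1)" using B(1) by simp
   fix h :: complex assume "h \<noteq> 0 \<and> dist h 0 < 1 / (B + 1)"
   then have h: "h \<noteq> 0" "norm h * (B + 1) < 1" using B(1) by (auto simp: field_simps)
   have "norm h * B \<le> norm h * (B + 1)" by (intro mult_left_mono) auto
   then show "norm ((?F (s + h) - ?F s) / h - (\<integral>w. ?d w \<partial>P)) \<le> C * norm h" using h by (intro est) linarith+
  qed
  show "((\<lambda>h. C * norm h) \<longlongrightarrow> 0) (at (0::complex))" by (auto intro!: tendsto_eq_intros)
 qed
 then show ?thesis unfolding DERIV_def by (rule LIM_zero_cancel)
qed

text \<open>The Schwarz lemma applied to \<open>L / (4 * A - L)\<close>, rescaled to the unit disc.
  Using \<open>2 * A\<close> where \<open>A\<close> would be the sharp bound makes the quotient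
  strictly smaller than 1 in modulus; at half the radius it is at most \<open>1 / 2\<close>, and
  solving for \<open>L\<close> gives \<open>4 * A\<close>.\<close>

lemma Borel_Caratheodory_half:
 assumes L: "L holomorphic_on ball 0 r" "L 0 = 0" and r: "0 < r" and A: "0 < A"
  and Re: "\<And>z. norm z < r \<Longrightarrow> Re (L z) \<le> A" and z: "norm z \<le> r / 2"
 shows "norm (L z) \<le> 4 * A"
proof -
 define h where "h w = L (of_real r * w) / (2 * of_real (2 * A) - L (of_real r * w))" for w
 have den: "2 * of_real (2 * A) - L (of_real r * w) \<noteq> 0" and hlt: "norm (h w) < 1" if w: "norm w < 1" for w
 proof -
  let ?l = "L (of_real r * w)"
  have "norm (of_real r * w) < r" using w r by (simp add: norm_mult)
  from Re[OF this] have l: "Re ?l \<le> A" .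
  then have "Re (2 * of_real (2 * A) - ?l) \<noteq> 0" using A by simp
  then show d: "2 * of_real (2 * A) - ?l \<noteq> 0" by (metis zero_complex.sel(1))
  have "(norm ?l)\<^sup>2 < (norm (2 * of_real (2 * A) - ?l))\<^sup>2"
   unfolding cmod_power2 using l A by (simp add: power2_eq_square algebra_simps)
  then have "norm ?l < norm (2 * of_real (2 * A) - ?l)" by (rule power_less_imp_less_base) simp
  then show "norm (h w) < 1" unfolding h_def norm_divide using d by simp
 qed
 have "h holomorphic_on ball 0 1"
 proof -
  have c: "(\<lambda>w. L (of_real r * w)) holomorphic_on ball 0 1"
   by (rule holomorphic_on_compose_gen[OF _ L(1), unfolded o_def])
     (use r in \<open>auto intro!: holomorphic_intros simp: norm_mult\<close>)
  show ?thesis unfolding h_def using den by (intro holomorphic_intros c) auto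
 qed
 moreover have "h 0 = 0" by (simp add: h_def L(2))
 ultimately have sch: "norm (h w) \<le> norm w" if "norm w < 1" for w
  using Schwarz_Lemma(1)[of h w] hlt that by blast
 let ?w = "z / of_real r"
 have w: "norm ?w \<le> 1 / 2" using z r by (simp add: norm_divide field_simps)
 then have w1: "norm ?w < 1" by linarith
 have hz: "norm (h ?w) \<le> 1 / 2" using sch[OF w1] w by linarith
 have rw: "of_real r * ?w = z" using r by simp
 have "L z = h ?w * (2 * of_real (2 * A) - L z)"
  using den[OF w1] unfolding h_def rw by simp
 then have "norm (L z) = norm (h ?w) * norm (2 * of_real (2 * A) - L z)"
  by (metis norm_mult)
 also have "\<dots> \<le> 1 / 2 * (4 * A + norm (L z))"
 proof (intro mult_mono hz)
  show "norm (2 * of_real (2 * A) - L z) \<le> 4 * A + norm (L z)"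
   using norm_triangle_ineq4[of "2 * of_real (2 * A)" "L z"] A by (simp add: norm_mult)
 qed (use A in auto)
 finally show ?thesis by simp
qed

text \<open>All errors must be proportional to \<open>V\<close>, uniformly in the underlying law.
  The bound on the centred moment generating function says \<open>Re L \<le> C * V\<close>.
  Borel-Caratheodory makes this \<open>|L| \<le> 4 * C * V\<close> on the half disc, and Cauchy's
  inequality with radius \<open>r / 4\<close> bounds the third derivative by
  \<open>3! * 4 * C * V / (r / 4)^3 = D * V\<close>. Taylor expansions of \<open>L\<close>,
  \<open>L'\<close> and \<open>L''\<close> give the claims, with \<open>l\<close> the restriction of
  \<open>L'\<close> to the real axis.\<close>

lemma mgf_log_expansion:
 fixes T :: "'b \<Rightarrow> real"
 assumes P: "prob_space P" and T: "bm P T"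
  and m: "m = (\<integral>v. T v \<partial>P)" and V: "V = (\<integral>v. (T v - m)\<^sup>2 \<partial>P)" and V0: "0 < V"
  and H: "\<And>s. H s = (\<integral>v. exp (s * of_real (T v)) \<partial>P)"
  and r: "0 < r" and C: "0 < C"
  and nz: "\<And>s. norm s < r \<Longrightarrow> H s \<noteq> 0"
  and bnd: "\<And>s. norm s < r \<Longrightarrow> norm (H s * exp (- s * of_real m)) \<le> exp (C * V)"
  and D: "D = 1536 * C / r ^ 3"
 obtains L :: "complex \<Rightarrow> complex" and l :: "real \<Rightarrow> real" where
  "\<And>s. norm s < r \<Longrightarrow> H s = exp (L s + s * of_real m)"
  "\<And>\<xi> t. \<bar>\<xi>\<bar> \<le> r / 8 \<Longrightarrow> \<bar>t\<bar> \<le> r / 8 \<Longrightarrow>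
   norm (L (Complex \<xi> t) - L (of_real \<xi>) - \<i> * of_real (t * l \<xi>) + of_real (V * t\<^sup>2 / 2)) \<le> D * V * (\<bar>\<xi>\<bar> * t\<^sup>2 + \<bar>t\<bar> ^ 3)"
  "\<And>\<xi>. \<bar>\<xi>\<bar> \<le> r / 8 \<Longrightarrow> \<bar>l \<xi> - V * \<xi>\<bar> \<le> D * V * \<xi>\<^sup>2"
  "\<And>\<xi>. \<bar>\<xi>\<bar> \<le> r / 8 \<Longrightarrow> \<bar>Re (L (of_real \<xi>)) - V * \<xi>\<^sup>2 / 2\<bar> \<le> D * V * \<bar>\<xi>\<bar> ^ 3"
  "continuous_on {- r / 8..r / 8} l"
  "\<And>\<xi>. \<bar>\<xi>\<bar> \<le> r / 8 \<Longrightarrow> (\<integral>v. T v * exp (\<xi> * T v) \<partial>P) = (l \<xi> + m) * (\<integral>v. exp (\<xi> * T v) \<partial>P)"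
proof -
 interpret prob_space P by fact
 have fin: "finite_measure P" by unfold_locales
 define U where "U v = T v - m" for v
 have U: "bm P U" unfolding U_def by (intro bm_intros T)
 define F where "F k s = (\<integral>v. of_real (U v ^ k) * exp (s * of_real (U v)) \<partial>P)" for k :: nat and s :: complex
 have F': "(F k has_field_derivative F (Suc k) s) (at s)" for k s
  unfolding F_def using mgf_has_derivative[OF fin U bm_power[OF U, of k], of s] by (simp add: mult.commute)
 have FH: "F 0 s = H s * exp (- s * of_real m)" for s
  unfolding F_def U_def H by (simp add: right_diff_distrib exp_diff exp_minus divide_inverse)
 have F00: "F 0 0 = 1" "F 1 0 = 0" "F 2 0 = of_real V"
 proof -
  show "F 0 0 = 1" by (simp add: F_def prob_space)
  have "(\<integral>v. U v \<partial>P) = 0" unfolding U_def using bm_integrable[OF fin T] by (simp add: m prob_space)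
  then show "F 1 0 = 0" by (simp add: F_def)
  show "F 2 0 = of_real V" by (simp add: F_def V U_def flip: of_real_power)
 qed
 have Fhol: "F k holomorphic_on S" for k S
  unfolding holomorphic_on_def field_differentiable_def using has_field_derivative_at_within[OF F'] by blast
 have nzF: "F 0 z \<noteq> 0" if "z \<in> ball 0 r" for z using nz[of z] that by (simp add: FH)
 obtain L0 where L0: "L0 holomorphic_on ball 0 r" "\<And>z. z \<in> ball 0 r \<Longrightarrow> exp (L0 z) = F 0 z"
 proof -
  have "(0::complex) \<in> ball 0 r" using r by simp
  from holomorphic_logarithm_exists[OF convex_ball open_ball Fhol nzF this] that show thesis by blast
 qed
 define L where "L z = L0 z - L0 0" for z
 have Lhol: "L holomorphic_on ball 0 r" unfolding L_def by (intro holomorphic_intros L0)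
 have Lexp: "exp (L z) = F 0 z" if "norm z < r" for z
  unfolding L_def exp_diff using L0(2)[of z] L0(2)[of 0] that r F00 by simp
 have L00: "L 0 = 0" by (simp add: L_def)
 have ReL: "Re (L z) \<le> C * V" if "norm z < r" for z
 proof -
  have "exp (Re (L z)) = norm (F 0 z)" using Lexp[OF that] norm_exp_eq_Re[of "L z"] by simp
  also have "\<dots> \<le> exp (C * V)" unfolding FH by (rule bnd[OF that])
  finally show ?thesis by simp
 qed
 have CV: "0 < C * V" using C V0 by simp
 have Lbd: "norm (L z) \<le> 4 * (C * V)" if "norm z \<le> r / 2" for z
  by (rule Borel_Caratheodory_half[OF Lhol L00 r CV ReL that])
 let ?S = "cball (0::complex) (r / 4)"
 define f where "f k = (deriv ^^ k) L" for k
 have fhol: "f k holomorphic_on ball 0 r" for k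
  unfolding f_def by (rule holomorphic_higher_deriv[OF Lhol open_ball])
 have fder: "(f k has_field_derivative f (Suc k) z) (at z)" if "norm z < r" for k z
 proof -
  have "f (Suc k) z = deriv (f k) z" by (simp add: f_def)
  then show ?thesis using holomorphic_derivI[OF fhol[of k] open_ball, of z] that by (simp only: mem_ball_0)
 qed
 have fderS: "(f k has_field_derivative f (Suc k) z) (at z within ?S)" if "z \<in> ?S" for k z
 proof -
  have "norm z < r" using that r by simp
  from fder[OF this] show ?thesis by (rule has_field_derivative_at_within)
 qed
 have f3: "norm (f 3 z) \<le> D * V" if z: "z \<in> ?S" for z
 proof -
  have sub: "cball z (r / 4) \<subseteq> ball 0 r" "norm w \<le> r / 2" if "norm (z - w) \<le> r / 4" for w
  proof -
   show "cball z (r / 4) \<subseteq> ball 0 r"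
   proof
    fix w assume "w \<in> cball z (r / 4)"
    then have "norm w \<le> r / 2" using z norm_triangle_sub[of w z] by (simp add: dist_norm norm_minus_commute)
    then show "w \<in> ball 0 r" using r by simp
   qed
   show "norm w \<le> r / 2" using z that norm_triangle_sub[of w z] by (simp add: norm_minus_commute)
  qed
  have s1: "cball z (r / 4) \<subseteq> ball 0 r" using sub(1)[of z] r by simp
  have "norm ((deriv ^^ 3) L z) \<le> fact 3 * (4 * (C * V)) / (r / 4) ^ 3"
  proof (rule Cauchy_inequality)
   show "L holomorphic_on ball z (r / 4)"
    using s1 ball_subset_cball by (intro holomorphic_on_subset[OF Lhol]) blast
   show "continuous_on (cball z (r / 4)) L"
    using s1 by (intro holomorphic_on_imp_continuous_on holomorphic_on_subset[OF Lhol])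
   show "norm (L x) \<le> 4 * (C * V)" if "norm (z - x) = r / 4" for x
    using that by (intro Lbd sub(2)) simp
  qed (use r in simp)
  also have "\<dots> = D * V" unfolding D power_divide by (simp add: fact_numeral)
  finally show ?thesis by (simp add: f_def)
 qed
 have conv: "convex ?S" by (rule convex_cball)
 have DV0: "0 \<le> D * V" using r C V0 by (simp add: D)
 have S0: "0 \<in> ?S" using r by simp
 have f0: "f 0 = L" by (simp add: f_def)
 \<comment> \<open>Since \<open>F 0 = exp L\<close>, this is the logarithmic derivative. Evaluating
   it and its derivative at 0 turns mean zero and variance \<open>V\<close> into
   \<open>f 1 0 = 0\<close> and \<open>f 2 0 = V\<close>.\<close>
 have f1eq: "f 1 z * F 0 z = F 1 z" if z: "norm z < r" for z
 proof -
  have "((\<lambda>w. exp (L w)) has_field_derivative exp (L z) * f 1 z) (at z)"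
   using fder[OF z, of 0] unfolding f0 by (auto intro!: derivative_eq_intros)
  moreover have "((\<lambda>w. exp (L w)) has_field_derivative F 1 z) (at z)"
  proof (rule has_field_derivative_transform_within_open[OF F'[of 0 z, folded One_nat_def], of "ball 0 r"])
   show "F 0 w = exp (L w)" if "w \<in> ball 0 r" for w using Lexp[of w] that by simp
  qed (use z in auto)
  ultimately have "exp (L z) * f 1 z = F 1 z" by (rule DERIV_unique)
  then show ?thesis using Lexp[OF z] by (simp add: mult.commute)
 qed
 have f10: "f 1 0 = 0" using f1eq[of 0] r F00 by simp
 have f20: "f 2 0 = of_real V"
 proof -
  have "((\<lambda>w. f 1 w * F 0 w) has_field_derivative f 2 0 * F 0 0 + f 1 0 * F 1 0) (at 0)"
   using DERIV_mult[OF fder[of 0 1] F'[of 0 0]] r by (simp add: numeral_2_eq_2 mult_ac add_ac)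
  moreover have "((\<lambda>w. f 1 w * F 0 w) has_field_derivative F 2 0) (at 0)"
  proof (rule has_field_derivative_transform_within_open[OF F'[of 1 0], of "ball 0 r", unfolded Suc_1])
   show "F 1 w = f 1 w * F 0 w" if "w \<in> ball 0 r" for w using f1eq[of w] that by simp
  qed (use r in auto)
  ultimately have "f 2 0 * F 0 0 + f 1 0 * F 1 0 = F 2 0" by (rule DERIV_unique)
  then show ?thesis using F00 f10 by simp
 qed
 have T2: "norm (f 2 z - f 2 w) \<le> D * V * norm (z - w)" if "z \<in> ?S" "w \<in> ?S" for z w
  using complex_Taylor[OF conv, of 0 "\<lambda>i. f (2 + i)" "D * V" w z] fderS f3 that
  by (simp add: eval_nat_numeral)
 have T1: "norm (f 1 z - f 2 0 * z) \<le> D * V * (norm z)\<^sup>2" if "z \<in> ?S" for z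
  using complex_Taylor[OF conv, of 1 "\<lambda>i. f (1 + i)" "D * V" 0 z] fderS f3 that S0 f10
  by (simp add: eval_nat_numeral)
 have T0: "norm (f 0 z - (f 0 w + f 1 w * (z - w) + f 2 w * (z - w)\<^sup>2 / 2)) \<le> D * V * norm (z - w) ^ 3 / 2"
  if "z \<in> ?S" "w \<in> ?S" for z w
  using complex_Taylor[OF conv, of 2 f "D * V" w z] fderS f3 that
  by (simp add: eval_nat_numeral)
 define l where "l \<xi> = Re (f 1 (of_real \<xi>))" for \<xi> :: real
 have Freal: "F k (of_real \<xi>) = of_real (\<integral>v. U v ^ k * exp (\<xi> * U v) \<partial>P)" for k \<xi>
  unfolding F_def integral_complex_of_real'[symmetric] by (simp add: exp_of_real flip: of_real_mult of_real_power)
 have rS: "of_real \<xi> \<in> ?S" "norm (complex_of_real \<xi>) < r" if "\<bar>\<xi>\<bar> \<le> r / 8" for \<xi> using that r by auto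
 have f1real: "f 1 (of_real \<xi>) = of_real (l \<xi>)" if \<xi>: "\<bar>\<xi>\<bar> \<le> r / 8" for \<xi>
 proof -
  have "f 1 (of_real \<xi>) = F 1 (of_real \<xi>) / F 0 (of_real \<xi>)"
   using f1eq[OF rS(2)[OF \<xi>]] nzF[of "of_real \<xi>"] rS(2)[OF \<xi>] by (simp add: field_simps)
  then have "Im (f 1 (of_real \<xi>)) = 0" unfolding Freal by (simp flip: of_real_divide)
  then show ?thesis by (simp add: l_def complex_eq_iff)
 qed
 show ?thesis
 proof (rule that[of L l])
  show "H s = exp (L s + s * of_real m)" if "norm s < r" for s
   using Lexp[OF that] by (simp add: FH exp_add exp_minus)
  show "norm (L (Complex \<xi> t) - L (of_real \<xi>) - \<i> * of_real (t * l \<xi>) + of_real (V * t\<^sup>2 / 2)) \<le> D * V * (\<bar>\<xi>\<bar> * t\<^sup>2 + \<bar>t\<bar> ^ 3)"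
   if \<xi>: "\<bar>\<xi>\<bar> \<le> r / 8" and t: "\<bar>t\<bar> \<le> r / 8" for \<xi> t
  proof -
   let ?z = "Complex \<xi> t" and ?w = "complex_of_real \<xi>"
   have zw: "?z - ?w = \<i> * of_real t" by (simp add: complex_eq_iff)
   have nz: "norm ?z \<le> r / 4" using cmod_le[of ?z] \<xi> t by simp
   then have zS: "?z \<in> ?S" by simp
   have eq: "L ?z - L ?w - \<i> * of_real (t * l \<xi>) + of_real (V * t\<^sup>2 / 2) =
     (f 0 ?z - (f 0 ?w + f 1 ?w * (?z - ?w) + f 2 ?w * (?z - ?w)\<^sup>2 / 2)) - (f 2 ?w - f 2 0) * of_real (t\<^sup>2) / 2"
    unfolding zw f0 f1real[OF \<xi>] f20 by (simp add: power_mult_distrib field_simps)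
   have "norm (L ?z - L ?w - \<i> * of_real (t * l \<xi>) + of_real (V * t\<^sup>2 / 2)) \<le> D * V * norm (?z - ?w) ^ 3 / 2 + D * V * norm (?w - 0) * t\<^sup>2 / 2"
    unfolding eq
   proof (rule order.trans[OF norm_triangle_ineq4 add_mono])
    show "norm (f 0 ?z - (f 0 ?w + f 1 ?w * (?z - ?w) + f 2 ?w * (?z - ?w)\<^sup>2 / 2)) \<le> D * V * norm (?z - ?w) ^ 3 / 2"
     by (rule T0[OF zS rS(1)[OF \<xi>]])
    show "norm ((f 2 ?w - f 2 0) * of_real (t\<^sup>2) / 2) \<le> D * V * norm (?w - 0) * t\<^sup>2 / 2"
     using mult_right_mono[OF T2[OF rS(1)[OF \<xi>] S0], of "t\<^sup>2"] by (simp add: norm_mult norm_power)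
   qed
   also have "\<dots> = D * V * (\<bar>\<xi>\<bar> * t\<^sup>2 + \<bar>t\<bar> ^ 3) / 2"
    unfolding zw by (simp add: norm_mult algebra_simps)
   also have "\<dots> \<le> D * V * (\<bar>\<xi>\<bar> * t\<^sup>2 + \<bar>t\<bar> ^ 3)"
    using mult_nonneg_nonneg[OF DV0, of "\<bar>\<xi>\<bar> * t\<^sup>2 + \<bar>t\<bar> ^ 3"] by simp
   finally show ?thesis .
  qed
  show "\<bar>l \<xi> - V * \<xi>\<bar> \<le> D * V * \<xi>\<^sup>2" if \<xi>: "\<bar>\<xi>\<bar> \<le> r / 8" for \<xi>
  proof -
   have "complex_of_real (l \<xi> - V * \<xi>) = f 1 (of_real \<xi>) - f 2 0 * of_real \<xi>"
    using f1real[OF \<xi>] f20 by simp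
   then have "\<bar>l \<xi> - V * \<xi>\<bar> = norm (f 1 (of_real \<xi>) - f 2 0 * of_real \<xi>)"
    by (metis norm_of_real)
   also have "\<dots> \<le> D * V * \<xi>\<^sup>2" using T1[OF rS(1)[OF \<xi>]] by simp
   finally show ?thesis .
  qed
  show "\<bar>Re (L (of_real \<xi>)) - V * \<xi>\<^sup>2 / 2\<bar> \<le> D * V * \<bar>\<xi>\<bar> ^ 3" if \<xi>: "\<bar>\<xi>\<bar> \<le> r / 8" for \<xi>
  proof -
   have "Re (L (of_real \<xi>)) - V * \<xi>\<^sup>2 / 2 = Re (f 0 (of_real \<xi>) - (f 0 0 + f 1 0 * (of_real \<xi> - 0) + f 2 0 * (of_real \<xi> - 0)\<^sup>2 / 2))"
    by (simp add: f0 f10 f20 L00 del: One_nat_def flip: of_real_power of_real_mult)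
   then have "\<bar>Re (L (of_real \<xi>)) - V * \<xi>\<^sup>2 / 2\<bar> \<le> norm (f 0 (of_real \<xi>) - (f 0 0 + f 1 0 * (of_real \<xi> - 0) + f 2 0 * (of_real \<xi> - 0)\<^sup>2 / 2))"
    by (metis abs_Re_le_cmod)
   also have "\<dots> \<le> D * V * \<bar>\<xi>\<bar> ^ 3 / 2" using T0[OF rS(1)[OF \<xi>] S0] by simp
   also have "\<dots> \<le> D * V * \<bar>\<xi>\<bar> ^ 3" using mult_nonneg_nonneg[OF DV0, of "\<bar>\<xi>\<bar> ^ 3"] by simp
   finally show ?thesis .
  qed
  show "continuous_on {- r / 8..r / 8} l"
  proof -
   have c: "continuous_on (ball 0 r) (f 1)" by (rule holomorphic_on_imp_continuous_on[OF fhol])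
   have "of_real ` {- r / 8..r / 8} \<subseteq> ball (0::complex) r"
   proof (intro image_subsetI)
    fix x assume "x \<in> {- r / 8..r / 8}"
    then show "complex_of_real x \<in> ball 0 r" using r by (simp add: abs_less_iff)
   qed
   from continuous_on_compose2[OF c continuous_on_of_real_id this] show ?thesis
    unfolding l_def by (rule continuous_on_Re)
  qed
  show "(\<integral>v. T v * exp (\<xi> * T v) \<partial>P) = (l \<xi> + m) * (\<integral>v. exp (\<xi> * T v) \<partial>P)" if \<xi>: "\<bar>\<xi>\<bar> \<le> r / 8" for \<xi>
  proof -
   have "complex_of_real (\<integral>v. U v * exp (\<xi> * U v) \<partial>P) = of_real (l \<xi> * (\<integral>v. exp (\<xi> * U v) \<partial>P))"
    using f1eq[OF rS(2)[OF \<xi>]] f1real[OF \<xi>] Freal[of 0] Freal[of 1] by simp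
   then have U1: "(\<integral>v. U v * exp (\<xi> * U v) \<partial>P) = l \<xi> * (\<integral>v. exp (\<xi> * U v) \<partial>P)"
    by (simp only: of_real_eq_iff)
   have e: "exp (\<xi> * U v) = exp (- \<xi> * m) * exp (\<xi> * T v)" for v
    by (simp add: U_def right_diff_distrib exp_diff exp_minus divide_inverse mult.commute)
   have "U v * exp (\<xi> * U v) = exp (- \<xi> * m) * (U v * exp (\<xi> * T v))" for v
    unfolding e by (rule mult.left_commute)
   then have "(\<integral>v. U v * exp (\<xi> * U v) \<partial>P) = exp (- \<xi> * m) * (\<integral>v. U v * exp (\<xi> * T v) \<partial>P)"
    by (simp only: integral_mult_right_zero)
   moreover have "l \<xi> * (\<integral>v. exp (\<xi> * U v) \<partial>P) = exp (- \<xi> * m) * (l \<xi> * (\<integral>v. exp (\<xi> * T v) \<partial>P))"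
    unfolding e integral_mult_right_zero by (rule mult.left_commute)
   ultimately have "exp (- \<xi> * m) * (\<integral>v. U v * exp (\<xi> * T v) \<partial>P) = exp (- \<xi> * m) * (l \<xi> * (\<integral>v. exp (\<xi> * T v) \<partial>P))"
    using U1 by (simp only:)
   then have "(\<integral>v. U v * exp (\<xi> * T v) \<partial>P) = l \<xi> * (\<integral>v. exp (\<xi> * T v) \<partial>P)" by simp
   moreover have "(\<integral>v. U v * exp (\<xi> * T v) \<partial>P) = (\<integral>v. T v * exp (\<xi> * T v) \<partial>P) - m * (\<integral>v. exp (\<xi> * T v) \<partial>P)"
   proof -
    have "bm P (\<lambda>v. T v * exp (\<xi> * T v))" "bm P (\<lambda>v. exp (\<xi> * T v))" by (intro bm_intros T)+
    from bm_integrable[OF fin this(1)] bm_integrable[OF fin this(2)] show ?thesis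
     unfolding U_def by (simp add: left_diff_distrib)
   qed
   ultimately show ?thesis by (simp add: algebra_simps)
  qed
 qed
qed

section \<open>Local limits in the moderate deviation regime\<close>

lemma tilted_distribution:
 fixes T :: "'b \<Rightarrow> real" and \<xi> z :: real
 assumes Q: "prob_space Q" and T: "bm Q T"
 defines "Z \<equiv> (\<integral>w. exp (\<xi> * T w) \<partial>Q)"
 defines "R \<equiv> distr (density Q (\<lambda>w. ennreal (exp (\<xi> * T w) / Z))) borel (\<lambda>w. T w - z)"
 shows "0 < Z" "real_distribution R"
  "char R t = (\<integral>w. exp (Complex \<xi> t * of_real (T w)) \<partial>Q) * iexp (- t * z) / of_real Z"
  "measure Q {w\<in>space Q. T w - z \<in> {a<..<b}} = Z * exp (- \<xi> * z) * (\<integral>y. indicator {a<..<b} y * exp (- \<xi> * y) \<partial>R)"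
proof -
 interpret prob_space Q by fact
 have fin: "finite_measure Q" by unfold_locales
 have Tm[measurable]: "T \<in> borel_measurable Q" by (rule bm_measurable[OF T])
 have be: "bm Q (\<lambda>w. exp (\<xi> * T w))" by (intro bm_intros T)
 obtain B where B: "0 \<le> B" "\<And>w. w \<in> space Q \<Longrightarrow> norm (T w) \<le> B" using bmE[OF T] by blast
 have "exp (- (\<bar>\<xi>\<bar> * B)) = (\<integral>w. exp (- (\<bar>\<xi>\<bar> * B)) \<partial>Q)" by (simp add: prob_space)
 also have "\<dots> \<le> Z" unfolding Z_def
 proof (rule bm_integral_mono[OF fin bm_const be])
  fix w assume "w \<in> space Q"
  then have "\<bar>\<xi> * T w\<bar> \<le> \<bar>\<xi>\<bar> * B" unfolding abs_mult using B(2) by (intro mult_left_mono) auto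
  then show "exp (- (\<bar>\<xi>\<bar> * B)) \<le> exp (\<xi> * T w)" by auto
 qed
 finally show Z0: "0 < Z" using exp_gt_zero less_le_trans by blast
 let ?D = "density Q (\<lambda>w. ennreal (exp (\<xi> * T w) / Z))"
 have dens: "integral\<^sup>L ?D F = (\<integral>w. (exp (\<xi> * T w) / Z) *\<^sub>R F w \<partial>Q)"
  if "F \<in> borel_measurable Q" for F :: "'b \<Rightarrow> 'c::{banach,second_countable_topology}"
  using that Z0 by (intro integral_density) auto
 have dR: "integral\<^sup>L R F = (\<integral>w. (exp (\<xi> * T w) / Z) *\<^sub>R F (T w - z) \<partial>Q)"
  if [measurable]: "F \<in> borel_measurable borel" for F :: "real \<Rightarrow> 'c::{banach,second_countable_topology}"
 proof -
  have "integral\<^sup>L R F = (\<integral>w. F (T w - z) \<partial>?D)" unfolding R_def by (intro integral_distr) auto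
  also have "\<dots> = (\<integral>w. (exp (\<xi> * T w) / Z) *\<^sub>R F (T w - z) \<partial>Q)" by (intro dens) measurable
  finally show ?thesis .
 qed
 have "prob_space ?D"
  using Z0 bm_integrable[OF fin be] by (intro prob_space_density_real) (auto simp: Z_def[symmetric])
 then show "real_distribution R" unfolding R_def
  by (intro real_distribution.intro prob_space.prob_space_distr) (auto simp: real_distribution_axioms_def)
 have "char R t = (\<integral>w. (exp (\<xi> * T w) / Z) *\<^sub>R iexp (t * (T w - z)) \<partial>Q)"
  unfolding char_def by (rule dR) measurable
 also have "\<dots> = (\<integral>w. exp (Complex \<xi> t * of_real (T w)) * (iexp (- t * z) / of_real Z) \<partial>Q)"
 proof (intro integral_congI)
  fix w
  have 1: "Complex \<xi> t * of_real (T w) = of_real (\<xi> * T w) + \<i> * of_real (t * T w)" by (simp add: complex_eq_iff)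
  have 2: "\<i> * complex_of_real (t * (T w - z)) = \<i> * of_real (t * T w) + \<i> * of_real (- t * z)" by (simp add: algebra_simps)
  show "(exp (\<xi> * T w) / Z) *\<^sub>R iexp (t * (T w - z)) = exp (Complex \<xi> t * of_real (T w)) * (iexp (- t * z) / of_real Z)"
   unfolding 1 2 exp_add by (simp add: scaleR_conv_of_real exp_of_real del: of_real_mult)
 qed
 finally show "char R t = (\<integral>w. exp (Complex \<xi> t * of_real (T w)) \<partial>Q) * iexp (- t * z) / of_real Z"
  by simp
 have "(\<integral>y. indicator {a<..<b} y * exp (- \<xi> * y) \<partial>R) = (\<integral>w. (exp (\<xi> * T w) / Z) *\<^sub>R (indicator {a<..<b} (T w - z) * exp (- \<xi> * (T w - z))) \<partial>Q)"
  by (rule dR) measurable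
 also have "\<dots> = (\<integral>w. exp (\<xi> * z) / Z * indicator {w\<in>space Q. T w - z \<in> {a<..<b}} w \<partial>Q)"
 proof (intro integral_congI)
  fix w assume "w \<in> space Q"
  moreover have "exp (\<xi> * T w) * exp (- \<xi> * (T w - z)) = exp (\<xi> * z)" by (simp add: algebra_simps flip: exp_add)
  ultimately show "(exp (\<xi> * T w) / Z) *\<^sub>R (indicator {a<..<b} (T w - z) * exp (- \<xi> * (T w - z))) =
   exp (\<xi> * z) / Z * indicator {w\<in>space Q. T w - z \<in> {a<..<b}} w"
   by (auto simp: indicator_def)
 qed
 also have "\<dots> = exp (\<xi> * z) / Z * measure Q {w\<in>space Q. T w - z \<in> {a<..<b}}" by simp
 finally show "measure Q {w\<in>space Q. T w - z \<in> {a<..<b}} = Z * exp (- \<xi> * z) * (\<integral>y. indicator {a<..<b} y * exp (- \<xi> * y) \<partial>R)"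
  using Z0 by (simp add: exp_minus)
qed

text \<open>With \<open>h = z - m\<close> and \<open>l \<xi> = h\<close>, the exponent \<open>Re L - \<xi> h\<close> is \<open>- h\<^sup>2 / (2 V)\<close> up to a relative error of order \<open>\<xi>\<close>.\<close>

lemma legendre_quadratic:
 fixes V D \<xi> h w :: real
 assumes V: "0 < V" and D: "0 \<le> D" and h: "\<bar>h - V * \<xi>\<bar> \<le> D * V * \<xi>\<^sup>2" and w: "\<bar>w - V * \<xi>\<^sup>2 / 2\<bar> \<le> D * V * \<bar>\<xi>\<bar> ^ 3"
  and \<xi>: "D * \<bar>\<xi>\<bar> \<le> 1 / 2" "\<xi> \<noteq> 0"
 shows "V * \<bar>\<xi>\<bar> / 2 \<le> \<bar>h\<bar>" "\<bar>- 2 * V * (w - \<xi> * h) / h\<^sup>2 - 1\<bar> \<le> 12 * D * \<bar>\<xi>\<bar>"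
proof -
 have "D * V * \<xi>\<^sup>2 = (D * \<bar>\<xi>\<bar>) * (V * \<bar>\<xi>\<bar>)" by (simp add: power2_eq_square flip: abs_mult)
 also have "\<dots> \<le> 1 / 2 * (V * \<bar>\<xi>\<bar>)" using \<xi> V by (intro mult_right_mono) auto
 finally have "D * V * \<xi>\<^sup>2 \<le> V * \<bar>\<xi>\<bar> / 2" by simp
 then have e: "\<bar>h - V * \<xi>\<bar> \<le> V * \<bar>\<xi>\<bar> / 2" using h by linarith
 have "\<bar>V * \<xi>\<bar> = V * \<bar>\<xi>\<bar>" using V by (simp add: abs_mult)
 then show hl: "V * \<bar>\<xi>\<bar> / 2 \<le> \<bar>h\<bar>" using e abs_triangle_ineq2[of "V * \<xi>" h] by (simp add: abs_minus_commute)
 have V\<xi>: "0 < V * \<bar>\<xi>\<bar>" using V \<xi> by simp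
 then have h0: "h \<noteq> 0" using hl by auto
 have h2: "V\<^sup>2 * \<xi>\<^sup>2 / 4 \<le> h\<^sup>2"
 proof -
  have "(V * \<bar>\<xi>\<bar> / 2)\<^sup>2 \<le> \<bar>h\<bar>\<^sup>2" using hl V\<xi> by (intro power_mono) auto
  then show ?thesis by (simp add: power_mult_distrib power_divide)
 qed
 let ?e = "h - V * \<xi>" and ?e' = "w - V * \<xi>\<^sup>2 / 2"
 have "- 2 * V * (w - \<xi> * h) - h\<^sup>2 = - 2 * V * ?e' - ?e\<^sup>2" by (simp add: power2_eq_square algebra_simps)
 then have "\<bar>- 2 * V * (w - \<xi> * h) - h\<^sup>2\<bar> \<le> 2 * V * \<bar>?e'\<bar> + ?e\<^sup>2"
  using V abs_triangle_ineq4[of "- 2 * V * ?e'" "?e\<^sup>2"] by (simp add: abs_mult)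
 also have "\<dots> \<le> 2 * V * (D * V * \<bar>\<xi>\<bar> ^ 3) + (D * V * \<xi>\<^sup>2) * (V * \<bar>\<xi>\<bar> / 2)"
 proof (intro add_mono mult_left_mono w)
  have "?e\<^sup>2 = \<bar>?e\<bar> * \<bar>?e\<bar>" by (simp add: power2_eq_square)
  also have "\<dots> \<le> (D * V * \<xi>\<^sup>2) * (V * \<bar>\<xi>\<bar> / 2)" using h e D V by (intro mult_mono) auto
  finally show "?e\<^sup>2 \<le> (D * V * \<xi>\<^sup>2) * (V * \<bar>\<xi>\<bar> / 2)" .
 qed (use V in simp)
 also have "\<dots> = 10 * D * \<bar>\<xi>\<bar> * (V\<^sup>2 * \<xi>\<^sup>2 / 4)"
  by (simp add: power2_eq_square power3_eq_cube field_simps)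
 also have "\<dots> \<le> 10 * D * \<bar>\<xi>\<bar> * h\<^sup>2" using D by (intro mult_left_mono h2) auto
 also have "\<dots> \<le> 12 * D * \<bar>\<xi>\<bar> * h\<^sup>2" using D by (intro mult_right_mono) auto
 finally have "\<bar>- 2 * V * (w - \<xi> * h) - h\<^sup>2\<bar> / h\<^sup>2 \<le> 12 * D * \<bar>\<xi>\<bar>" using h0 by (simp add: pos_divide_le_eq)
 moreover have "- 2 * V * (w - \<xi> * h) / h\<^sup>2 - 1 = (- 2 * V * (w - \<xi> * h) - h\<^sup>2) / h\<^sup>2"
  using h0 by (simp add: diff_divide_distrib)
 ultimately show "\<bar>- 2 * V * (w - \<xi> * h) / h\<^sup>2 - 1\<bar> \<le> 12 * D * \<bar>\<xi>\<bar>" by (simp only: abs_divide abs_power2)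
qed

text \<open>The point \<open>\<xi>\<close> at which the tilted mean of \<open>T\<close> is \<open>z\<close>, the exponent \<open>w\<close> and the errors in the
 expansion of the characteristic function of the tilted law of \<open>T' - z\<close>, where \<open>q\<close> bounds \<open>\<bar>z - m\<bar> / V\<close>.\<close>

definition tilt_estimates ::
  "'b measure \<Rightarrow> 'c measure \<Rightarrow> ('b \<Rightarrow> real) \<Rightarrow> ('c \<Rightarrow> real) \<Rightarrow> real \<Rightarrow> real \<Rightarrow> real \<Rightarrow> real \<Rightarrow> real \<Rightarrow> real \<Rightarrow> real \<Rightarrow> real \<Rightarrow> real \<Rightarrow> bool" where
 "tilt_estimates P Q T T' m V r C D z q \<xi> w \<longleftrightarrow> \<bar>\<xi>\<bar> \<le> 2 * q \<and>
  (\<integral>\<omega>. T \<omega> * exp (\<xi> * T \<omega>) \<partial>P) = z * (\<integral>\<omega>. exp (\<xi> * T \<omega>) \<partial>P) \<and>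
  exp w = exp (- \<xi> * z) * (\<integral>\<omega>. exp (\<xi> * T \<omega>) \<partial>P) \<and>
  (z = m \<longrightarrow> w = 0) \<and> (z \<noteq> m \<longrightarrow> \<bar>- 2 * V * w / (z - m)\<^sup>2 - 1\<bar> \<le> 24 * D * q) \<and>
  \<bar>(\<integral>\<omega>. exp (\<xi> * T' \<omega>) \<partial>Q) / (\<integral>\<omega>. exp (\<xi> * T \<omega>) \<partial>P) - 1\<bar> \<le> 2 * C * q \<and>
  (\<forall>\<theta>. \<bar>\<theta>\<bar> \<le> r / 8 \<longrightarrow> (\<exists>e \<rho>. norm e \<le> D * V * (2 * q * \<theta>\<^sup>2 + \<bar>\<theta>\<bar> ^ 3) \<and> norm \<rho> \<le> 2 * C * (4 * q + \<bar>\<theta>\<bar>) \<and>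
   (\<integral>\<omega>. exp (Complex \<xi> \<theta> * of_real (T' \<omega>)) \<partial>Q) * iexp (- \<theta> * z) / of_real (\<integral>\<omega>. exp (\<xi> * T' \<omega>) \<partial>Q) =
    exp (of_real (- V * \<theta>\<^sup>2 / 2) + e) * (1 + \<rho>)))"

text \<open>The tilt is found from \<open>T\<close> by the intermediate value theorem:
  \<open>l\<close> is close to \<open>V * \<xi>\<close>, so its values at \<open>- 2 * q\<close> and
  \<open>2 * q\<close> enclose \<open>z - m\<close>. The other variable \<open>T'\<close> is tilted
  by the same \<open>\<xi>\<close>; its mean is then not exactly \<open>z\<close>, but its moment
  generating function differs from that of \<open>T\<close> by a factor close to 1.\<close>

lemma moderate_tilt:
 fixes T :: "'b \<Rightarrow> real" and T' :: "'c \<Rightarrow> real" and F G :: "complex \<Rightarrow> complex"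
 assumes P: "prob_space P" and T: "bm P T" and Q: "prob_space Q" and T': "bm Q T'"
  and m: "m = (\<integral>v. T v \<partial>P)" and V: "V = (\<integral>v. (T v - m)\<^sup>2 \<partial>P)" and V0: "0 < V"
  and F: "\<And>s. F s = (\<integral>v. exp (s * of_real (T v)) \<partial>P)"
  and G: "\<And>s. G s = (\<integral>v. exp (s * of_real (T' v)) \<partial>Q)"
  and r: "0 < r" and C: "0 < C"
  and nz: "\<And>s. norm s < r \<Longrightarrow> F s \<noteq> 0"
  and bnd: "\<And>s. norm s < r \<Longrightarrow> norm (F s * exp (- s * of_real m)) \<le> exp (C * V)"
  and comp: "\<And>s. norm s < r \<Longrightarrow> norm (G s - F s) \<le> C * norm s * norm (F s)"
  and D: "D = 1536 * C / r ^ 3"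
  and q: "\<bar>z - m\<bar> \<le> q * V" "q \<le> r / 16" "D * q \<le> 1 / 4" "C * q \<le> 1 / 4"
 shows "\<exists>\<xi> w. tilt_estimates P Q T T' m V r C D z q \<xi> w"
proof -
 obtain L l where L: "\<And>s. norm s < r \<Longrightarrow> F s = exp (L s + s * of_real m)"
  and Lt: "\<And>\<xi> t. \<bar>\<xi>\<bar> \<le> r / 8 \<Longrightarrow> \<bar>t\<bar> \<le> r / 8 \<Longrightarrow>
   norm (L (Complex \<xi> t) - L (of_real \<xi>) - \<i> * of_real (t * l \<xi>) + of_real (V * t\<^sup>2 / 2)) \<le> D * V * (\<bar>\<xi>\<bar> * t\<^sup>2 + \<bar>t\<bar> ^ 3)"
  and l1: "\<And>\<xi>. \<bar>\<xi>\<bar> \<le> r / 8 \<Longrightarrow> \<bar>l \<xi> - V * \<xi>\<bar> \<le> D * V * \<xi>\<^sup>2"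
  and L0: "\<And>\<xi>. \<bar>\<xi>\<bar> \<le> r / 8 \<Longrightarrow> \<bar>Re (L (of_real \<xi>)) - V * \<xi>\<^sup>2 / 2\<bar> \<le> D * V * \<bar>\<xi>\<bar> ^ 3"
  and lc: "continuous_on {- r / 8..r / 8} l"
  and ET: "\<And>\<xi>. \<bar>\<xi>\<bar> \<le> r / 8 \<Longrightarrow> (\<integral>v. T v * exp (\<xi> * T v) \<partial>P) = (l \<xi> + m) * (\<integral>v. exp (\<xi> * T v) \<partial>P)"
  using mgf_log_expansion[OF P T m V V0 F r C nz bnd D] by blast
 have D0: "0 < D" using C r by (simp add: D)
 have q0: "0 \<le> q" using q(1) V0 by (meson abs_ge_zero dual_order.trans zero_le_mult_iff not_le)
 have s1: "2 * q \<le> r / 8" using q by simp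
 have quad: "D * V * (2 * q)\<^sup>2 \<le> V * q"
 proof -
  have "D * V * (2 * q)\<^sup>2 = (D * q) * (4 * (V * q))" by (simp add: power2_eq_square)
  also have "\<dots> \<le> 1 / 4 * (4 * (V * q))" using V0 q0 by (intro mult_right_mono q) auto
  finally show ?thesis by simp
 qed
 \<comment> \<open>At \<open>2 * q\<close> the main term is \<open>2 * V * q\<close>, and the error
   is at most \<open>V * q\<close> by \<open>quad\<close>, which leaves at least
   \<open>V * q \<ge> |z - m|\<close>.\<close>
 have hi: "z - m \<le> l (2 * q)" using l1[of "2 * q"] s1 q0 q(1) quad by (simp add: algebra_simps abs_le_iff)
 have lo: "l (- (2 * q)) \<le> z - m" using l1[of "- (2 * q)"] s1 q0 q(1) quad by (simp add: algebra_simps abs_le_iff)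
 have "continuous_on {- (2 * q)..2 * q} l" using s1 by (intro continuous_on_subset[OF lc]) auto
 from IVT'[OF lo hi _ this] obtain \<xi> where "- (2 * q) \<le> \<xi>" "\<xi> \<le> 2 * q" and \<xi>2: "l \<xi> = z - m"
  using q0 by auto
 then have "\<bar>\<xi>\<bar> \<le> 2 * q" by linarith
 note \<xi> = this \<xi>2
 have \<xi>8: "\<bar>\<xi>\<bar> \<le> r / 8" using \<xi>(1) s1 by simp
 then have \<xi>r: "norm (complex_of_real \<xi>) < r" using r by simp
 define w where "w = Re (L (of_real \<xi>)) - \<xi> * (z - m)"
 let ?Z = "\<integral>v. exp (\<xi> * T v) \<partial>P" and ?Z' = "\<integral>v. exp (\<xi> * T' v) \<partial>Q"
 have F\<xi>: "F (of_real \<xi>) = of_real ?Z" unfolding F integral_complex_of_real'[symmetric]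
  by (simp add: exp_of_real flip: of_real_mult)
 have G\<xi>: "G (of_real \<xi>) = of_real ?Z'" unfolding G integral_complex_of_real'[symmetric]
  by (simp add: exp_of_real flip: of_real_mult)
 have Z0: "0 < ?Z" using tilted_distribution(1)[OF P T] .
 have Z0': "0 < ?Z'" using tilted_distribution(1)[OF Q T'] .
 have ZL: "?Z = exp (Re (L (of_real \<xi>)) + \<xi> * m)"
 proof -
  have "norm (F (of_real \<xi>)) = exp (Re (L (of_real \<xi>)) + \<xi> * m)" unfolding L[OF \<xi>r] norm_exp_eq_Re by simp
  then show ?thesis using Z0 unfolding F\<xi> by simp
 qed
 have w: "exp w = exp (- \<xi> * z) * ?Z"
  unfolding ZL w_def by (simp add: algebra_simps flip: exp_add)
 have l\<xi>: "\<bar>(z - m) - V * \<xi>\<bar> \<le> D * V * \<xi>\<^sup>2" using l1[OF \<xi>8] \<xi>(2) by simp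
 have D\<xi>: "D * \<bar>\<xi>\<bar> \<le> 1 / 2" using mult_left_mono[OF \<xi>(1) less_imp_le[OF D0]] q(3) by linarith
 have w0: "w = 0" if "z = m"
 proof -
  have "\<xi> = 0"
  proof (rule ccontr)
   assume "\<xi> \<noteq> 0"
   from legendre_quadratic(1)[OF V0 less_imp_le[OF D0] l\<xi> L0[OF \<xi>8] D\<xi> this] that V0 \<open>\<xi> \<noteq> 0\<close> show False
    by (simp add: zero_less_mult_iff mult_le_0_iff)
  qed
  then show ?thesis using L0[of 0] r by (simp add: w_def)
 qed
 have w1: "\<bar>- 2 * V * w / (z - m)\<^sup>2 - 1\<bar> \<le> 24 * D * q" if "z \<noteq> m"
 proof -
  have "\<xi> \<noteq> 0" using l\<xi> that by auto
  from legendre_quadratic(2)[OF V0 less_imp_le[OF D0] l\<xi> L0[OF \<xi>8] D\<xi> this]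
  have "\<bar>- 2 * V * w / (z - m)\<^sup>2 - 1\<bar> \<le> 12 * D * \<bar>\<xi>\<bar>" by (simp only: w_def)
  also have "\<dots> \<le> 12 * D * (2 * q)" using \<xi> D0 by (intro mult_left_mono) auto
  finally show ?thesis by simp
 qed
 \<comment> \<open>The relative effect of replacing \<open>T\<close> by \<open>T'\<close>. It is of
   order \<open>|s|\<close>, so it is small at the tilt and contributes only a factor
   \<open>1 + \<rho>\<close> to the characteristic function.\<close>
 define h0 where "h0 s = G s / F s - 1" for s
 have h0: "norm (h0 s) \<le> C * norm s" "G s = F s * (1 + h0 s)" if "norm s < r" for s
 proof -
  have "h0 s = (G s - F s) / F s" using nz[OF that] by (simp add: h0_def diff_divide_distrib)
  then show "norm (h0 s) \<le> C * norm s" using comp[OF that] nz[OF that] by (simp add: norm_divide divide_le_eq)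
  show "G s = F s * (1 + h0 s)" using nz[OF that] by (simp add: h0_def)
 qed
 have C\<xi>: "C * \<bar>\<xi>\<bar> \<le> 2 * C * q" using mult_left_mono[OF \<xi>(1), of C] C by simp
 have h\<xi>: "norm (h0 (of_real \<xi>)) \<le> C * \<bar>\<xi>\<bar>" using h0(1)[OF \<xi>r] by simp
 have h\<xi>': "norm (h0 (of_real \<xi>)) \<le> 1 / 2" using h\<xi> C\<xi> q(4) by simp
 have Zr: "\<bar>?Z' / ?Z - 1\<bar> \<le> 2 * C * q"
 proof -
  have "h0 (of_real \<xi>) = of_real (?Z' / ?Z - 1)" unfolding h0_def F\<xi> G\<xi> by simp
  then have "norm (h0 (of_real \<xi>)) = \<bar>?Z' / ?Z - 1\<bar>" by (simp only: norm_of_real)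
  then show ?thesis using h\<xi> C\<xi> by linarith
 qed
 have ch: "\<exists>e h. norm e \<le> D * V * (2 * q * t\<^sup>2 + \<bar>t\<bar> ^ 3) \<and> norm h \<le> 2 * C * (4 * q + \<bar>t\<bar>) \<and>
   G (Complex \<xi> t) * iexp (- t * z) / of_real ?Z' = exp (of_real (- V * t\<^sup>2 / 2) + e) * (1 + h)"
  if t: "\<bar>t\<bar> \<le> r / 8" for t
 proof -
  let ?s = "Complex \<xi> t" and ?x = "complex_of_real \<xi>"
  have ns: "norm ?s \<le> \<bar>\<xi>\<bar> + \<bar>t\<bar>" using cmod_le[of ?s] by simp
  have sr: "norm ?s < r" using ns \<xi>8 t r by linarith
  define e where "e = L ?s - L ?x - \<i> * of_real (t * l \<xi>) + of_real (V * t\<^sup>2 / 2)"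
  define h where "h = (h0 ?s - h0 ?x) / (1 + h0 ?x)"
  have n1: "1 / 2 \<le> norm (1 + h0 ?x)" using norm_triangle_ineq4[of "1 + h0 ?x" "h0 ?x"] h\<xi>' by simp
  have ne: "1 + h0 ?x \<noteq> 0" using n1 by auto
  have "norm e \<le> D * V * (\<bar>\<xi>\<bar> * t\<^sup>2 + \<bar>t\<bar> ^ 3)" unfolding e_def by (rule Lt[OF \<xi>8 t])
  also have "\<dots> \<le> D * V * (2 * q * t\<^sup>2 + \<bar>t\<bar> ^ 3)"
   using \<xi>(1) D0 V0 by (intro mult_left_mono add_right_mono mult_right_mono) auto
  finally have 1: "norm e \<le> D * V * (2 * q * t\<^sup>2 + \<bar>t\<bar> ^ 3)" .
  have "norm (h0 ?s - h0 ?x) \<le> C * norm ?s + C * \<bar>\<xi>\<bar>"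
   using norm_triangle_ineq4[of "h0 ?s" "h0 ?x"] h0(1)[OF sr] h\<xi> by linarith
  also have "\<dots> \<le> C * (4 * q + \<bar>t\<bar>)"
   unfolding distrib_left[symmetric] using ns \<xi>(1) C by (intro mult_left_mono) auto
  finally have "norm (h0 ?s - h0 ?x) / norm (1 + h0 ?x) \<le> C * (4 * q + \<bar>t\<bar>) / (1 / 2)"
   using n1 C q0 by (intro frac_le) auto
  then have 2: "norm h \<le> 2 * C * (4 * q + \<bar>t\<bar>)" unfolding h_def norm_divide by simp
  have "G ?s * iexp (- t * z) / of_real ?Z' = (F ?s * iexp (- t * z) / F ?x) * ((1 + h0 ?s) / (1 + h0 ?x))"
   unfolding G\<xi>[symmetric] h0(2)[OF sr] h0(2)[OF \<xi>r] by simp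
  also have "(1 + h0 ?s) / (1 + h0 ?x) = 1 + h" using ne by (simp add: h_def field_simps)
  also have "F ?s * iexp (- t * z) / F ?x = exp ((L ?s + ?s * of_real m) + \<i> * of_real (- t * z) - (L ?x + ?x * of_real m))"
   unfolding L[OF sr] L[OF \<xi>r] exp_diff exp_add ..
  also have "(L ?s + ?s * of_real m) + \<i> * of_real (- t * z) - (L ?x + ?x * of_real m) = of_real (- V * t\<^sup>2 / 2) + e"
  proof -
   have "?s = ?x + \<i> * of_real t" by (simp add: complex_eq_iff)
   then have "?s * of_real m = ?x * of_real m + \<i> * of_real t * of_real m" by (simp add: distrib_right)
   then show ?thesis unfolding e_def \<xi>(2) by (simp add: algebra_simps)
  qed
  finally show ?thesis using 1 2 by blast
 qed
 have ET': "(\<integral>v. T v * exp (\<xi> * T v) \<partial>P) = z * ?Z" using ET[OF \<xi>8] \<xi>(2) by simp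
 have "tilt_estimates P Q T T' m V r C D z q \<xi> w"
  unfolding tilt_estimates_def using \<xi>(1) ET' w w0 w1 Zr ch unfolding G by (intro conjI impI allI)
 then show ?thesis by blast
qed

text \<open>The probability in question is \<open>exp (w N)\<close>, times the ratio of the two
  normalisations, times an integral under the tilted law. The ratio tends to 1 and the local limit
  theorem handles the integral, so the whole exponential cost sits in \<open>w\<close>, which
  depends on \<open>T\<close> and not on \<open>T'\<close>.\<close>

theorem moderate_local_limit:
 fixes T :: "nat \<Rightarrow> 'b \<Rightarrow> real" and T' :: "nat \<Rightarrow> 'c \<Rightarrow> real" and V m z :: "nat \<Rightarrow> real"
 assumes P: "prob_space P" and T: "\<And>N. bm P (T N)" and Q: "prob_space Q" and T': "\<And>N. bm Q (T' N)"
  and m: "\<And>N. m N = (\<integral>v. T N v \<partial>P)" and V: "\<And>N. V N = (\<integral>v. (T N v - m N)\<^sup>2 \<partial>P)" and Vinf: "filterlim V at_top sequentially"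
  and H: "\<And>N \<zeta>. H N \<zeta> = (\<integral>v. exp (\<zeta> * of_real (T N v)) \<partial>P)"
  and G: "\<And>N \<zeta>. G N \<zeta> = (\<integral>v. exp (\<zeta> * of_real (T' N v)) \<partial>Q)"
  and r: "0 < r" and C: "0 < C"
  and nz: "\<forall>\<^sub>F N in sequentially. \<forall>\<zeta>. norm \<zeta> < r \<longrightarrow> H N \<zeta> \<noteq> 0 \<and> norm (H N \<zeta> * exp (- \<zeta> * of_real (m N))) \<le> exp (C * V N)"
  and comp: "\<forall>\<^sub>F N in sequentially. \<forall>\<zeta>. norm \<zeta> < r \<longrightarrow> norm (G N \<zeta> - H N \<zeta>) \<le> C * norm \<zeta> * norm (H N \<zeta>)"
  and tail: "small_tail V g"
  and far: "\<forall>\<^sub>F N in sequentially. \<forall>\<xi> s. \<bar>\<xi>\<bar> \<le> 1 \<longrightarrow> norm (G N (Complex \<xi> s)) \<le> g N s * norm (G N (of_real \<xi>))"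
  and zm: "(\<lambda>N. (z N - m N) / V N) \<longlonglongrightarrow> 0" and ab: "a < b"
 obtains \<xi> w h where "\<xi> \<longlonglongrightarrow> 0" "h \<longlonglongrightarrow> 0"
  "\<forall>\<^sub>F N in sequentially. (\<integral>v. T N v * exp (\<xi> N * T N v) \<partial>P) = z N * (\<integral>v. exp (\<xi> N * T N v) \<partial>P)"
  "\<forall>\<^sub>F N in sequentially. exp (w N) = exp (- \<xi> N * z N) * (\<integral>v. exp (\<xi> N * T N v) \<partial>P)"
  "\<forall>\<^sub>F N in sequentially. w N = - (1 + h N) / 2 * ((z N - m N) / sqrt (V N))\<^sup>2"
  "(\<lambda>N. measure Q {v\<in>space Q. T' N v - z N \<in> {a<..<b}}) \<sim>[sequentially] (\<lambda>N. (b - a) / sqrt (2 * pi * V N) * exp (w N))"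
proof -
 define D where "D = 1536 * C / r ^ 3"
 have D0: "0 < D" using C r by (simp add: D_def)
 define q where "q N = \<bar>(z N - m N) / V N\<bar>" for N
 have q: "q \<longlonglongrightarrow> 0" unfolding q_def by (rule tendsto_rabs_zero[OF zm])
 have q0: "0 \<le> q N" for N by (simp add: q_def)
 have Vpos: "\<forall>\<^sub>F N in sequentially. 0 < V N" using Vinf by (simp add: filterlim_at_top_dense)
 define q1 where "q1 = min (min (r / 16) (1 / (16 * D))) (1 / (16 * C))"
 have q1: "0 < q1" "q1 \<le> r / 16" "q1 \<le> 1 / (16 * D)" "q1 \<le> 1 / (16 * C)" using r D0 C by (auto simp: q1_def)
 have "\<forall>\<^sub>F N in sequentially. q N < q1" by (rule order_tendstoD(2)[OF q q1(1)])
 \<comment> \<open>The eventual conditions are gathered in one predicate so that the tilt and the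
   exponent can be chosen for each single \<open>N\<close>.\<close>
 define ok where "ok N \<longleftrightarrow> 0 < V N \<and> q N < q1 \<and>
  (\<forall>\<zeta>. norm \<zeta> < r \<longrightarrow> H N \<zeta> \<noteq> 0 \<and> norm (H N \<zeta> * exp (- \<zeta> * of_real (m N))) \<le> exp (C * V N)) \<and>
  (\<forall>\<zeta>. norm \<zeta> < r \<longrightarrow> norm (G N \<zeta> - H N \<zeta>) \<le> C * norm \<zeta> * norm (H N \<zeta>)) \<and>
  (\<forall>\<xi> s. \<bar>\<xi>\<bar> \<le> 1 \<longrightarrow> norm (G N (Complex \<xi> s)) \<le> g N s * norm (G N (of_real \<xi>)))" for N
 have ok: "\<forall>\<^sub>F N in sequentially. ok N"
  unfolding ok_def by (intro eventually_conj Vpos order_tendstoD(2)[OF q q1(1)] nz comp far)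
 let ?Z = "\<lambda>N \<xi>. \<integral>v. exp (\<xi> * T N v) \<partial>P" and ?Z' = "\<lambda>N \<xi>. \<integral>v. exp (\<xi> * T' N v) \<partial>Q"
 define good where "good N = tilt_estimates P Q (T N) (T' N) (m N) (V N) r C D (z N) (q N)" for N
 note good_def = good_def tilt_estimates_def
 have "\<exists>\<xi> w. ok N \<longrightarrow> good N \<xi> w" for N
 proof (cases "ok N")
  case True
  then have V0: "0 < V N" and qN: "q N < q1"
   and nz: "\<And>\<zeta>. norm \<zeta> < r \<Longrightarrow> H N \<zeta> \<noteq> 0" "\<And>\<zeta>. norm \<zeta> < r \<Longrightarrow> norm (H N \<zeta> * exp (- \<zeta> * of_real (m N))) \<le> exp (C * V N)"
   and comp: "\<And>\<zeta>. norm \<zeta> < r \<Longrightarrow> norm (G N \<zeta> - H N \<zeta>) \<le> C * norm \<zeta> * norm (H N \<zeta>)"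
   unfolding ok_def by blast+
  have z1: "\<bar>z N - m N\<bar> \<le> q N * V N" using V0 by (simp add: q_def)
  have z2: "q N \<le> r / 16" using qN q1(2) by simp
  have "q N \<le> 1 / (16 * D)" using qN q1(3) by simp
  then have z3: "D * q N \<le> 1 / 4" using D0 by (simp add: field_simps)
  have "q N \<le> 1 / (16 * C)" using qN q1(4) by simp
  then have z4: "C * q N \<le> 1 / 4" using C by (simp add: field_simps)
  have "\<exists>\<xi> w. good N \<xi> w" unfolding good_def(1)
   by (rule moderate_tilt[OF P T Q T' m V V0 H G r C nz comp D_def z1 z2 z3 z4])
  then show ?thesis by blast
 next
  case False then show ?thesis by blast
 qed
 then obtain \<xi> w where g: "\<And>N. ok N \<Longrightarrow> good N (\<xi> N) (w N)" by metis
 define h where "h N = (if z N = m N then 0 else - 2 * V N * w N / (z N - m N)\<^sup>2 - 1)" for N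
 have \<xi>0: "\<xi> \<longlonglongrightarrow> 0"
 proof (rule Lim_null_comparison)
  show "\<forall>\<^sub>F N in sequentially. norm (\<xi> N) \<le> 2 * q N" using ok by eventually_elim (use g in \<open>auto simp: good_def\<close>)
  show "(\<lambda>N. 2 * q N) \<longlonglongrightarrow> 0" using tendsto_mult_right_zero[OF q, of 2] by simp
 qed
 have h0: "h \<longlonglongrightarrow> 0"
 proof (rule Lim_null_comparison)
  show "\<forall>\<^sub>F N in sequentially. norm (h N) \<le> 24 * D * q N" using ok
  proof eventually_elim
   case (elim N)
   from g[OF elim] show ?case using D0 q0[of N] by (auto simp: good_def h_def)
  qed
  show "(\<lambda>N. 24 * D * q N) \<longlonglongrightarrow> 0" using tendsto_mult_right_zero[OF q, of "24 * D"] by simp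
 qed
 have wh: "\<forall>\<^sub>F N in sequentially. w N = - (1 + h N) / 2 * ((z N - m N) / sqrt (V N))\<^sup>2" using ok
 proof eventually_elim
  case (elim N)
  have V0: "0 < V N" using elim by (simp add: ok_def)
  show ?case
  proof (cases "z N = m N")
   case True then show ?thesis using g[OF elim] by (simp add: good_def)
  next
   case False
   then have "(z N - m N)\<^sup>2 \<noteq> 0" by simp
   then show ?thesis using V0 False by (simp add: h_def power_divide field_simps)
  qed
 qed
 define R where "R N = distr (density Q (\<lambda>v. ennreal (exp (\<xi> N * T' N v) / ?Z' N (\<xi> N)))) borel (\<lambda>v. T' N v - z N)" for N
 have tilt1: "0 < ?Z' N (\<xi> N)" for N by (rule tilted_distribution(1)[OF Q T'])
 have tilt2: "real_distribution (R N)" for N unfolding R_def by (rule tilted_distribution(2)[OF Q T'])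
 have ch: "char (R N) s = G N (Complex (\<xi> N) s) * iexp (- s * z N) / of_real (?Z' N (\<xi> N))" for N s
  unfolding G R_def by (rule tilted_distribution(3)[OF Q T'])
 have che: "\<exists>e \<rho>. norm e \<le> D * V N * (2 * q N * s\<^sup>2 + \<bar>s\<bar> ^ 3) \<and> norm \<rho> \<le> 2 * C * (4 * q N + \<bar>s\<bar>) \<and>
   char (R N) s = exp (of_real (- V N * s\<^sup>2 / 2) + e) * (1 + \<rho>)" if "ok N" "\<bar>s\<bar> \<le> r / 8" for N s
  using g[OF that(1)] that(2) unfolding ch good_def G by blast
 \<comment> \<open>For such frequencies the error in the exponent is at most half of
   \<open>V * s\<^sup>2 / 2\<close>, and \<open>|\<rho>| \<le> 2\<close>; this produces the quarter
   and the factor 3 in the bound below.\<close>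
 define d where "d = min (min (r / 8) (1 / (8 * D))) (1 / (2 * C))"
 have d: "0 < d" "d \<le> r / 8" "d \<le> 1 / (8 * D)" "d \<le> 1 / (2 * C)" using r D0 C by (auto simp: d_def)
 have loc: "(\<lambda>N. sqrt (V N) * measure (R N) {a<..<b}) \<longlonglongrightarrow> (b - a) / sqrt (2 * pi)"
 proof (rule local_limit[OF _ Vinf _ d(1) _ tail _ ab])
  show "real_distribution (R N)" for N by (rule tilt2)
  show "\<forall>\<^sub>F N in sequentially. \<forall>s. norm (char (R N) s) \<le> g N s"
   using ok order_tendstoD(2)[OF tendsto_rabs_zero[OF \<xi>0] zero_less_one]
  proof eventually_elim
   case (elim N)
   show ?case
   proof
    fix s
    have Z: "0 < ?Z' N (\<xi> N)" by (rule tilt1)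
    have "G N (of_real (\<xi> N)) = of_real (?Z' N (\<xi> N))" unfolding G integral_complex_of_real'[symmetric]
     by (simp add: exp_of_real flip: of_real_mult)
    moreover have "norm (G N (Complex (\<xi> N) s)) \<le> g N s * norm (G N (of_real (\<xi> N)))"
     using elim unfolding ok_def by simp
    ultimately have "norm (G N (Complex (\<xi> N) s)) \<le> g N s * ?Z' N (\<xi> N)"
     using Z by simp
    then show "norm (char (R N) s) \<le> g N s" unfolding ch using Z by (simp add: norm_divide norm_mult divide_le_eq)
   qed
  qed
  show "\<forall>\<^sub>F N in sequentially. \<forall>s. \<bar>s\<bar> \<le> d \<longrightarrow> norm (char (R N) s) \<le> 3 * exp (- V N * s\<^sup>2 / 4)"
   using ok
  proof eventually_elim
   case (elim N)
   have V0: "0 < V N" and qN: "q N < q1" using elim by (auto simp: ok_def)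
   show ?case
   proof (intro allI impI)
    fix s :: real assume s: "\<bar>s\<bar> \<le> d"
    then have "\<bar>s\<bar> \<le> r / 8" using d(2) by simp
    from che[OF elim this] obtain e \<rho> where e: "norm e \<le> D * V N * (2 * q N * s\<^sup>2 + \<bar>s\<bar> ^ 3)"
     and \<rho>: "norm \<rho> \<le> 2 * C * (4 * q N + \<bar>s\<bar>)" and c: "char (R N) s = exp (of_real (- V N * s\<^sup>2 / 2) + e) * (1 + \<rho>)" by blast
    have "2 * q N + \<bar>s\<bar> \<le> 2 * (1 / (16 * D)) + 1 / (8 * D)" using qN q1(3) s d(3) by (intro add_mono) auto
    then have "D * (2 * q N + \<bar>s\<bar>) \<le> 1 / 4" using D0 by (simp add: field_simps)
    then have "D * (2 * q N + \<bar>s\<bar>) * (V N * s\<^sup>2) \<le> 1 / 4 * (V N * s\<^sup>2)" using V0 by (intro mult_right_mono) auto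
    moreover have "D * V N * (2 * q N * s\<^sup>2 + \<bar>s\<bar> ^ 3) = D * (2 * q N + \<bar>s\<bar>) * (V N * s\<^sup>2)"
    proof -
     have "\<bar>s\<bar> ^ 3 = \<bar>s\<bar> * s\<^sup>2" by (simp add: power2_eq_square power3_eq_cube)
     then show ?thesis by (simp add: algebra_simps)
    qed
    ultimately have ne: "norm e \<le> V N * s\<^sup>2 / 4" using e by linarith
    have "4 * q N + \<bar>s\<bar> \<le> 4 * (1 / (16 * C)) + 1 / (2 * C)" using qN q1(4) s d(4) by (intro add_mono) auto
    then have "2 * C * (4 * q N + \<bar>s\<bar>) \<le> 2" using C by (simp add: field_simps)
    then have n\<rho>: "norm (1 + \<rho>) \<le> 3" using \<rho> norm_triangle_ineq[of 1 \<rho>] by simp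
    have "norm (char (R N) s) = exp (- V N * s\<^sup>2 / 2 + Re e) * norm (1 + \<rho>)"
     unfolding c norm_mult norm_exp_eq_Re by simp
    also have "\<dots> \<le> exp (- V N * s\<^sup>2 / 4) * 3"
     using ne abs_Re_le_cmod[of e] by (intro mult_mono n\<rho>) (auto simp: abs_le_iff)
    finally show "norm (char (R N) s) \<le> 3 * exp (- V N * s\<^sup>2 / 4)" by simp
   qed
  qed
  show "(\<lambda>N. char (R N) (t / sqrt (V N))) \<longlonglongrightarrow> of_real (exp (- t\<^sup>2 / 2))" for t
  proof -
   let ?s = "\<lambda>N. t / sqrt (V N)"
   have sV: "filterlim (\<lambda>N. sqrt (V N)) at_top sequentially" by (rule filterlim_compose[OF sqrt_at_top Vinf])
   have th0: "?s \<longlonglongrightarrow> 0" by (rule real_tendsto_divide_at_top[OF tendsto_const sV])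
   have "\<forall>\<^sub>F N in sequentially. \<bar>?s N\<bar> < r / 8" by (rule order_tendstoD(2)[OF tendsto_rabs_zero[OF th0]]) (use r in simp)
   then have "\<forall>\<^sub>F N in sequentially. \<exists>e \<rho>. norm e \<le> D * (2 * q N * t\<^sup>2 + t\<^sup>2 * \<bar>?s N\<bar>) \<and> norm \<rho> \<le> 2 * C * (4 * q N + \<bar>?s N\<bar>) \<and>
    char (R N) (?s N) = exp (of_real (- t\<^sup>2 / 2) + e) * (1 + \<rho>)" using ok
   proof eventually_elim
    case (elim N)
    have V0: "0 < V N" using elim(2) by (simp add: ok_def)
    then have 1: "V N * (?s N)\<^sup>2 = t\<^sup>2" by (simp add: power_divide)
    have "V N * (2 * q N * (?s N)\<^sup>2 + \<bar>?s N\<bar> ^ 3) = 2 * q N * (V N * (?s N)\<^sup>2) + V N * (?s N)\<^sup>2 * \<bar>?s N\<bar>"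
     by (simp only: power2_eq_square power3_eq_cube abs_mult_self_eq distrib_left mult_ac)
    also have "\<dots> = 2 * q N * t\<^sup>2 + t\<^sup>2 * \<bar>?s N\<bar>" unfolding 1 ..
    finally have 2: "D * V N * (2 * q N * (?s N)\<^sup>2 + \<bar>?s N\<bar> ^ 3) = D * (2 * q N * t\<^sup>2 + t\<^sup>2 * \<bar>?s N\<bar>)"
     by (simp only: mult.assoc)
    have 3: "- V N * (?s N)\<^sup>2 / 2 = - t\<^sup>2 / 2" using 1 by simp
    show ?case using che[OF elim(2) less_imp_le[OF elim(1)]] unfolding 2 3 .
   qed
   then obtain e \<rho> where e: "\<forall>\<^sub>F N in sequentially. norm (e N) \<le> D * (2 * q N * t\<^sup>2 + t\<^sup>2 * \<bar>?s N\<bar>) \<and> norm (\<rho> N) \<le> 2 * C * (4 * q N + \<bar>?s N\<bar>) \<and>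
    char (R N) (?s N) = exp (of_real (- t\<^sup>2 / 2) + e N) * (1 + \<rho> N)"
    unfolding eventually_ex by blast
   have "e \<longlonglongrightarrow> 0"
   proof (rule Lim_null_comparison)
    show "\<forall>\<^sub>F N in sequentially. norm (e N) \<le> D * (2 * q N * t\<^sup>2 + t\<^sup>2 * \<bar>?s N\<bar>)" using e by eventually_elim blast
    show "(\<lambda>N. D * (2 * q N * t\<^sup>2 + t\<^sup>2 * \<bar>?s N\<bar>)) \<longlonglongrightarrow> 0"
     by (rule tendsto_eq_intros q tendsto_rabs_zero[OF th0] refl | simp)+
   qed
   moreover have "\<rho> \<longlonglongrightarrow> 0"
   proof (rule Lim_null_comparison)
    show "\<forall>\<^sub>F N in sequentially. norm (\<rho> N) \<le> 2 * C * (4 * q N + \<bar>?s N\<bar>)" using e by eventually_elim blast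
    show "(\<lambda>N. 2 * C * (4 * q N + \<bar>?s N\<bar>)) \<longlonglongrightarrow> 0"
     by (rule tendsto_eq_intros q tendsto_rabs_zero[OF th0] refl | simp)+
   qed
   ultimately have "(\<lambda>N. exp (of_real (- t\<^sup>2 / 2) + e N) * (1 + \<rho> N)) \<longlonglongrightarrow> exp (of_real (- t\<^sup>2 / 2) + 0) * (1 + 0)"
    by (intro tendsto_intros)
   then have "(\<lambda>N. exp (of_real (- t\<^sup>2 / 2) + e N) * (1 + \<rho> N)) \<longlonglongrightarrow> of_real (exp (- t\<^sup>2 / 2))"
    by (simp only: add_0_right mult_1_right exp_of_real)
   then show ?thesis by (rule Lim_transform_eventually) (use e in eventually_elim, simp)
  qed
 qed
 \<comment> \<open>On the bounded interval the factor \<open>exp (- \<xi> N * y)\<close> lies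
   between \<open>exp (- |\<xi> N| * B)\<close> and \<open>exp (|\<xi> N| * B)\<close>. As
   \<open>\<xi>\<close> tends to 0, it does not affect the limit.\<close>
 define I where "I N = (\<integral>y. indicator {a<..<b} y * exp (- \<xi> N * y) \<partial>R N)" for N
 have Ilim: "(\<lambda>N. sqrt (V N) * I N) \<longlonglongrightarrow> (b - a) / sqrt (2 * pi)"
 proof -
  define B where "B = max \<bar>a\<bar> \<bar>b\<bar>"
  have bd: "exp (- (\<bar>\<xi> N\<bar> * B)) * measure (R N) {a<..<b} \<le> I N \<and> I N \<le> exp (\<bar>\<xi> N\<bar> * B) * measure (R N) {a<..<b}" for N
  proof -
   interpret real_distribution "R N" by (rule tilt2)
   have e: "exp (- (\<bar>\<xi> N\<bar> * B)) \<le> exp (- \<xi> N * y)" "exp (- \<xi> N * y) \<le> exp (\<bar>\<xi> N\<bar> * B)" if "y \<in> {a<..<b}" for y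
   proof -
    have "\<bar>y\<bar> \<le> B" using that by (auto simp: B_def)
    then have "\<bar>\<xi> N * y\<bar> \<le> \<bar>\<xi> N\<bar> * B" unfolding abs_mult by (intro mult_left_mono) auto
    then show "exp (- (\<bar>\<xi> N\<bar> * B)) \<le> exp (- \<xi> N * y)" "exp (- \<xi> N * y) \<le> exp (\<bar>\<xi> N\<bar> * B)" by auto
   qed
   have i0: "integrable (R N) (\<lambda>y. indicator {a<..<b} y * exp (- \<xi> N * y))"
    by (rule integrable_const_bound[of _ "exp (\<bar>\<xi> N\<bar> * B)"]) (use e in \<open>auto simp: indicator_def\<close>)
   have ii: "integrable (R N) (\<lambda>y. c * indicator {a<..<b} y)" for c :: real
    by (rule integrable_const_bound[of _ "\<bar>c\<bar>"]) (auto simp: indicator_def)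
   have "(\<integral>y. exp (- (\<bar>\<xi> N\<bar> * B)) * indicator {a<..<b} y \<partial>R N) \<le> I N"
    unfolding I_def using e by (intro integral_mono ii i0) (auto simp: indicator_def)
   moreover have "I N \<le> (\<integral>y. exp (\<bar>\<xi> N\<bar> * B) * indicator {a<..<b} y \<partial>R N)"
    unfolding I_def using e by (intro integral_mono ii i0) (auto simp: indicator_def)
   ultimately show ?thesis by simp
  qed
  have e0: "(\<lambda>N. exp (\<bar>\<xi> N\<bar> * B)) \<longlonglongrightarrow> 1" "(\<lambda>N. exp (- (\<bar>\<xi> N\<bar> * B))) \<longlonglongrightarrow> 1"
  proof -
   have "(\<lambda>N. \<bar>\<xi> N\<bar> * B) \<longlonglongrightarrow> 0" by (rule tendsto_mult_left_zero[OF tendsto_rabs_zero[OF \<xi>0]])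
   from tendsto_exp[OF this] tendsto_exp[OF tendsto_minus[OF this]]
   show "(\<lambda>N. exp (\<bar>\<xi> N\<bar> * B)) \<longlonglongrightarrow> 1" "(\<lambda>N. exp (- (\<bar>\<xi> N\<bar> * B))) \<longlonglongrightarrow> 1" by simp_all
  qed
  show ?thesis
  proof (rule tendsto_sandwich)
   show "(\<lambda>N. exp (- (\<bar>\<xi> N\<bar> * B)) * (sqrt (V N) * measure (R N) {a<..<b})) \<longlonglongrightarrow> (b - a) / sqrt (2 * pi)"
    using tendsto_mult[OF e0(2) loc] by simp
   show "(\<lambda>N. exp (\<bar>\<xi> N\<bar> * B) * (sqrt (V N) * measure (R N) {a<..<b})) \<longlonglongrightarrow> (b - a) / sqrt (2 * pi)"
    using tendsto_mult[OF e0(1) loc] by simp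
   show "\<forall>\<^sub>F N in sequentially. exp (- (\<bar>\<xi> N\<bar> * B)) * (sqrt (V N) * measure (R N) {a<..<b}) \<le> sqrt (V N) * I N" using Vpos
   proof eventually_elim
    case (elim N) then show ?case using mult_left_mono[OF conjunct1[OF bd[of N]], of "sqrt (V N)"] by (simp add: mult_ac)
   qed
   show "\<forall>\<^sub>F N in sequentially. sqrt (V N) * I N \<le> exp (\<bar>\<xi> N\<bar> * B) * (sqrt (V N) * measure (R N) {a<..<b})" using Vpos
   proof eventually_elim
    case (elim N) then show ?case using mult_left_mono[OF conjunct2[OF bd[of N]], of "sqrt (V N)"] by (simp add: mult_ac)
   qed
  qed
 qed
 have Zlim: "(\<lambda>N. ?Z' N (\<xi> N) / ?Z N (\<xi> N)) \<longlonglongrightarrow> 1"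
 proof -
  have "(\<lambda>N. ?Z' N (\<xi> N) / ?Z N (\<xi> N) - 1) \<longlonglongrightarrow> 0"
  proof (rule Lim_null_comparison)
   show "\<forall>\<^sub>F N in sequentially. norm (?Z' N (\<xi> N) / ?Z N (\<xi> N) - 1) \<le> 2 * C * q N" using ok
   proof eventually_elim
    case (elim N) then show ?case using g[OF elim] by (simp add: good_def)
   qed
   show "(\<lambda>N. 2 * C * q N) \<longlonglongrightarrow> 0" using tendsto_mult_right_zero[OF q, of "2 * C"] by simp
  qed
  then show ?thesis by (rule LIM_zero_cancel)
 qed
 have lim1: "(\<lambda>N. (?Z' N (\<xi> N) / ?Z N (\<xi> N)) * (sqrt (V N) * I N) / ((b - a) / sqrt (2 * pi))) \<longlonglongrightarrow> 1"
  using tendsto_divide[OF tendsto_mult[OF Zlim Ilim] tendsto_const, of "(b - a) / sqrt (2 * pi)"] ab by simp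
 have asym: "(\<lambda>N. measure Q {v\<in>space Q. T' N v - z N \<in> {a<..<b}}) \<sim>[sequentially] (\<lambda>N. (b - a) / sqrt (2 * pi * V N) * exp (w N))"
 proof (rule asymp_equivI', rule Lim_transform_eventually[OF lim1])
  show "\<forall>\<^sub>F N in sequentially. (?Z' N (\<xi> N) / ?Z N (\<xi> N)) * (sqrt (V N) * I N) / ((b - a) / sqrt (2 * pi)) =
    measure Q {v\<in>space Q. T' N v - z N \<in> {a<..<b}} / ((b - a) / sqrt (2 * pi * V N) * exp (w N))" using ok
  proof eventually_elim
   case (elim N)
   have V0: "0 < V N" using elim by (simp add: ok_def)
   have Z: "0 < ?Z N (\<xi> N)" by (rule tilted_distribution(1)[OF P T])
   have ew: "exp (w N) = exp (- \<xi> N * z N) * ?Z N (\<xi> N)" using g[OF elim] by (simp add: good_def)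
   have "measure Q {v\<in>space Q. T' N v - z N \<in> {a<..<b}} = ?Z' N (\<xi> N) * exp (- \<xi> N * z N) * I N"
    unfolding I_def R_def by (rule tilted_distribution(4)[OF Q T'])
   then show ?case unfolding ew real_sqrt_mult using Z V0 ab by (simp add: divide_simps)
  qed
 qed
 show ?thesis
 proof (rule that[OF \<xi>0 h0 _ _ wh asym])
  show "\<forall>\<^sub>F N in sequentially. (\<integral>v. T N v * exp (\<xi> N * T N v) \<partial>P) = z N * ?Z N (\<xi> N)"
   using ok by eventually_elim (use g in \<open>simp add: good_def\<close>)
  show "\<forall>\<^sub>F N in sequentially. exp (w N) = exp (- \<xi> N * z N) * ?Z N (\<xi> N)"
   using ok by eventually_elim (use g in \<open>simp add: good_def\<close>)
 qed
qed

section \<open>Dependence of the hexagon quantities on the frequency\<close>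

context elliptic_chain
begin

text \<open>Writing \<open>DD\<close> for all frequencies as an integral over one fixed probability
  space, with one weight and one phase function, lets elementary inequalities between cosines be
  integrated. A hexagon has six edges, hence the bounds \<open>1 / \<epsilon> ^ 6\<close> and
  \<open>6 * K\<close>.\<close>

lemma DD_representation:
 assumes f: "adm K f"
 obtains H :: "(('a \<times> 'a) \<times> (('a \<times> 'a) \<times> ('a \<times> 'a))) measure" and w G where "prob_space H" "bm H w" "bm H G"
  "\<And>u. 0 \<le> w u" "\<And>u. w u \<le> 1 / \<epsilon> ^ 6" "\<And>u. \<bar>G u\<bar> \<le> 6 * K"
  "\<And>t. DD f t n = (\<integral>u. w u * (1 - cos (t * G u)) \<partial>H)"
proof -
 let ?X = "M n \<Otimes>\<^sub>M M (Suc (Suc (Suc n)))" and ?S = "SS n \<Otimes>\<^sub>M SS n"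
 let ?H = "?X \<Otimes>\<^sub>M ?S"
 define w where "w u = wt n (fst (fst u)) (snd (snd u)) (snd (fst u)) * wt n (fst (fst u)) (fst (snd u)) (snd (fst u))" for u
 define G where "G u = ph f n (fst (fst u)) (snd (snd u)) (snd (fst u)) - ph f n (fst (fst u)) (fst (snd u)) (snd (fst u))" for u
 note prob = prob_M prob_SS prob_space_pair
 have bw: "bm ?H w" unfolding w_def by (intro bm_mult bm_wt) measurable
 have bG: "bm ?H G" unfolding G_def by (intro bm_diff bm_ph[OF f]) measurable
 have bF: "bm ?H (\<lambda>u. w u * (1 - cos (t * G u)))" for t
  by (intro bm_mult bm_diff bm_const bm_cos bw bm_measurable[OF bm_mult[OF bm_const bG]])
 have wt1: "wt n x s z \<le> (1 / \<epsilon>) ^ 3" for x s z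
 proof -
  have "wt n x s z \<le> 1 / \<epsilon> * (1 / \<epsilon>) * (1 / \<epsilon>)"
   unfolding wt_def using eps by (intro mult_mono mult_nonneg_nonneg p_nonneg p_le) auto
  then show ?thesis by (simp add: power3_eq_cube)
 qed
 show ?thesis
 proof (rule that[OF _ bw bG])
  show "prob_space ?H" by (intro prob)
  show "0 \<le> w u" for u unfolding w_def by (intro mult_nonneg_nonneg wt_nonneg)
  show "w u \<le> 1 / \<epsilon> ^ 6" for u
  proof -
   have "w u \<le> (1 / \<epsilon>) ^ 3 * (1 / \<epsilon>) ^ 3" unfolding w_def using eps by (intro mult_mono wt1 wt_nonneg) auto
   then show ?thesis by (simp add: power_one_over flip: power_add)
  qed
  show "\<bar>G u\<bar> \<le> 6 * K" for u
   unfolding G_def using ph_le[OF f, of n "fst (fst u)" "snd (snd u)" "snd (fst u)"] ph_le[OF f, of n "fst (fst u)" "fst (snd u)" "snd (fst u)"]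
   by linarith
  show "DD f t n = (\<integral>u. w u * (1 - cos (t * G u)) \<partial>?H)" for t
  proof -
   let ?F = "\<lambda>u. w u * (1 - cos (t * G u))"
   have "(\<integral>u. ?F u \<partial>?H) = (\<integral>v. \<integral>s. ?F (v, s) \<partial>?S \<partial>?X)"
    by (rule bm_integral_pair[OF _ _ bF]) (intro prob)+
   also have "\<dots> = (\<integral>v. TT f t n (fst v) (snd v) \<partial>?X)"
   proof (rule Bochner_Integration.integral_cong[OF refl])
    fix v assume v: "v \<in> space ?X"
    have "bm ?S (\<lambda>s. ?F (v, s))" by (rule bm_comp[OF bF]) (use v in measurable)
    from bm_integral_pair[OF prob_SS prob_SS this] show "(\<integral>s. ?F (v, s) \<partial>?S) = TT f t n (fst v) (snd v)"
     unfolding TT_def w_def G_def by simp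
   qed
   also have "\<dots> = (\<integral>x. \<integral>z. TT f t n (fst (x, z)) (snd (x, z)) \<partial>M (Suc (Suc (Suc n))) \<partial>M n)"
    by (intro bm_integral_pair[OF prob_M prob_M] bm_TT[OF f]) measurable
   finally show ?thesis unfolding DD_def by simp
  qed
 qed
qed

lemma DD_comb:
 assumes f: "adm K f" and le: "\<And>u. \<bar>u\<bar> \<le> 6 * K \<Longrightarrow> 1 - cos (t1 * u) \<le> a * (1 - cos (t2 * u)) + b * (1 - cos (t3 * u)) + e"
 shows "DD f t1 n \<le> a * DD f t2 n + b * DD f t3 n + \<bar>e\<bar> / \<epsilon> ^ 6"
proof -
 obtain H :: "(('a \<times> 'a) \<times> (('a \<times> 'a) \<times> ('a \<times> 'a))) measure" and w G
  where H: "prob_space H" and w: "bm H w" and G: "bm H G"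
  and wb: "\<And>u. 0 \<le> w u" "\<And>u. w u \<le> 1 / \<epsilon> ^ 6" and Gb: "\<And>u. \<bar>G u\<bar> \<le> 6 * K"
  and D: "\<And>t. DD f t n = (\<integral>u. w u * (1 - cos (t * G u)) \<partial>H)"
  using DD_representation[OF f, of n] by blast
 interpret prob_space H by fact
 have fin: "finite_measure H" by unfold_locales
 let ?F = "\<lambda>t u. w u * (1 - cos (t * G u))"
 have bF: "bm H (?F t)" for t
  by (intro bm_mult bm_diff bm_const bm_cos w bm_measurable[OF bm_mult[OF bm_const G]])
 note iF = bm_integrable[OF fin bF]
 have "DD f t1 n \<le> (\<integral>u. a * ?F t2 u + b * ?F t3 u + \<bar>e\<bar> / \<epsilon> ^ 6 \<partial>H)" unfolding D
 proof (rule bm_integral_mono[OF fin bF])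
  show "bm H (\<lambda>u. a * ?F t2 u + b * ?F t3 u + \<bar>e\<bar> / \<epsilon> ^ 6)" by (intro bm_add bm_mult[OF bm_const bF] bm_const)
  fix u
  have "?F t1 u \<le> w u * (a * (1 - cos (t2 * G u)) + b * (1 - cos (t3 * G u)) + e)"
   by (intro mult_left_mono le Gb wb)
  also have "\<dots> = a * ?F t2 u + b * ?F t3 u + w u * e" by (simp add: algebra_simps)
  also have "w u * e \<le> 1 / \<epsilon> ^ 6 * \<bar>e\<bar>"
  proof -
   have "w u * e \<le> w u * \<bar>e\<bar>" using wb(1) by (intro mult_left_mono) auto
   also have "\<dots> \<le> 1 / \<epsilon> ^ 6 * \<bar>e\<bar>" using wb(2) by (intro mult_right_mono) auto
   finally show ?thesis .
  qed
  finally show "?F t1 u \<le> a * ?F t2 u + b * ?F t3 u + \<bar>e\<bar> / \<epsilon> ^ 6" by simp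
 qed
 also have "\<dots> = a * DD f t2 n + b * DD f t3 n + \<bar>e\<bar> / \<epsilon> ^ 6"
  unfolding D using iF by (simp add: prob_space)
 finally show ?thesis .
qed

lemma DD_even: "DD f (- t) n = DD f t n"
 unfolding DD_def TT_def by simp

lemma DD_subadd: "adm K f \<Longrightarrow> DD f (h + k) n \<le> 2 * DD f h n + 2 * DD f k n"
proof -
 assume f: "adm K f"
 have "1 - cos (x + y) \<le> 2 * (1 - cos x) + 2 * (1 - cos y)" for x y :: real
 proof -
  have s: "1 - cos t = 2 * (sin (t / 2))\<^sup>2" for t :: real using cos_double_sin[of "t / 2"] by simp
  have "sin ((x + y) / 2) = sin (x / 2) * cos (y / 2) + cos (x / 2) * sin (y / 2)"
   by (simp add: add_divide_distrib sin_add)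
  then have "\<bar>sin ((x + y) / 2)\<bar> \<le> \<bar>sin (x / 2)\<bar> * \<bar>cos (y / 2)\<bar> + \<bar>cos (x / 2)\<bar> * \<bar>sin (y / 2)\<bar>"
   by (metis abs_mult abs_triangle_ineq)
  also have "\<dots> \<le> \<bar>sin (x / 2)\<bar> * 1 + 1 * \<bar>sin (y / 2)\<bar>"
   by (intro add_mono mult_mono abs_cos_le_one) auto
  finally have "\<bar>sin ((x + y) / 2)\<bar>\<^sup>2 \<le> (\<bar>sin (x / 2)\<bar> + \<bar>sin (y / 2)\<bar>)\<^sup>2" by (intro power_mono) auto
  also have "\<dots> \<le> 2 * (sin (x / 2))\<^sup>2 + 2 * (sin (y / 2))\<^sup>2"
   using sum_squares_bound[of "\<bar>sin (x / 2)\<bar>" "\<bar>sin (y / 2)\<bar>"] by (simp add: power2_sum)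
  finally show ?thesis unfolding s by simp
 qed
 then show ?thesis using DD_comb[OF f, of "h + k" 2 h 2 k 0 n] by (simp add: distrib_right)
qed

lemma DD_Lipschitz: "adm K f \<Longrightarrow> \<bar>DD f t n - DD f h n\<bar> \<le> 6 * K / \<epsilon> ^ 6 * \<bar>t - h\<bar>"
proof -
 assume f: "adm K f"
 have "DD f t n \<le> DD f h n + 6 * K / \<epsilon> ^ 6 * \<bar>t - h\<bar>" for t h
 proof -
  have "1 - cos (t * u) \<le> 1 * (1 - cos (h * u)) + 0 * (1 - cos (0 * u)) + 6 * K * \<bar>t - h\<bar>" if "\<bar>u\<bar> \<le> 6 * K" for u
  proof -
   have "\<bar>cos (h * u) - cos (t * u)\<bar> = 2 * (\<bar>sin ((h * u + t * u) / 2)\<bar> * \<bar>sin ((t * u - h * u) / 2)\<bar>)"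
    unfolding cos_diff_cos by (simp add: abs_mult)
   also have "\<dots> \<le> 2 * (1 * \<bar>(t * u - h * u) / 2\<bar>)"
    by (intro mult_left_mono mult_mono abs_sin_le_one abs_sin_x_le_abs_x) auto
   finally have "\<bar>cos (h * u) - cos (t * u)\<bar> \<le> \<bar>h * u - t * u\<bar>" by simp
   also have "\<dots> = \<bar>u\<bar> * \<bar>t - h\<bar>" by (simp add: abs_mult[symmetric] algebra_simps abs_minus_commute)
   also have "\<dots> \<le> 6 * K * \<bar>t - h\<bar>" using that by (intro mult_right_mono) auto
   finally show ?thesis by simp
  qed
  from DD_comb[OF f this, of n] show ?thesis using adm_nonneg[OF f] by simp
 qed
 from this[of t h] this[of h t] show ?thesis by (simp add: abs_minus_commute abs_le_iff)
qed

text \<open>The condition on \<open>t0\<close> keeps \<open>t * u\<close> within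
  \<open>[- pi, pi]\<close>, where \<open>1 - cos\<close> dominates a parabola. Comparing
  \<open>2 * (t * u)\<^sup>2 / pi\<^sup>2\<close> with the upper bound
  \<open>(t0 * u)\<^sup>2 / 2\<close> gives the constant.\<close>

lemma DD_quadratic:
 assumes f: "adm K f" and t0: "0 < t0" "t0 * (6 * K) \<le> pi" and t: "\<bar>t\<bar> \<le> t0"
 shows "4 / (pi * t0)\<^sup>2 * t\<^sup>2 * DD f t0 n \<le> DD f t n"
proof (cases "t = 0")
 case False
 let ?a = "(pi * t0)\<^sup>2 / (4 * t\<^sup>2)"
 have a: "0 < ?a" using False t0 by simp
 have "1 - cos (t0 * u) \<le> ?a * (1 - cos (t * u)) + 0 * (1 - cos (0 * u)) + 0" if u: "\<bar>u\<bar> \<le> 6 * K" for u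
 proof -
  have "\<bar>t * u\<bar> \<le> t0 * (6 * K)" unfolding abs_mult using u t t0 by (intro mult_mono) auto
  then have "\<bar>t * u\<bar> \<le> pi" using t0 by linarith
  then have "2 * (t * u)\<^sup>2 / pi\<^sup>2 \<le> 1 - cos (t * u)" by (rule one_minus_cos_ge)
  then have "?a * (2 * (t * u)\<^sup>2 / pi\<^sup>2) \<le> ?a * (1 - cos (t * u))" using a by (intro mult_left_mono) auto
  moreover have "?a * (2 * (t * u)\<^sup>2 / pi\<^sup>2) = (t0 * u)\<^sup>2 / 2" using False by (simp add: power_mult_distrib)
  moreover have "1 - cos (t0 * u) \<le> (t0 * u)\<^sup>2 / 2" by (rule one_minus_cos_le)
  ultimately show ?thesis by simp
 qed
 from DD_comb[OF f this, of n] have "DD f t0 n \<le> ?a * DD f t n" by simp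
 then have "4 / (pi * t0)\<^sup>2 * t\<^sup>2 * DD f t0 n \<le> 4 / (pi * t0)\<^sup>2 * t\<^sup>2 * (?a * DD f t n)"
  by (intro mult_left_mono) auto
 also have "\<dots> = DD f t n" using False t0 by simp
 finally show ?thesis .
qed (simp add: DD_nonneg)

text \<open>The range consists of the hexagons that the five-step blocks of
  \<open>char_decay\<close> reach within \<open>N\<close> steps.\<close>

definition psi :: "(nat \<Rightarrow> 'a \<Rightarrow> 'a \<Rightarrow> real) \<Rightarrow> nat \<Rightarrow> real \<Rightarrow> real" where
 "psi f N \<theta> = (\<Sum>n\<in>{2..<N - 2}. DD f \<theta> n)"

lemma psi_nonneg: "0 \<le> psi f N t"
 unfolding psi_def by (intro sum_nonneg DD_nonneg)

lemma psi_quadratic: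
 assumes "adm K f" "0 < t0" "t0 * (6 * K) \<le> pi" "\<bar>t\<bar> \<le> t0"
 shows "4 / (pi * t0)\<^sup>2 * t\<^sup>2 * psi f N t0 \<le> psi f N t"
 unfolding psi_def sum_distrib_left by (intro sum_mono DD_quadratic[OF assms])

end

text \<open>The added differences telescope along every path. As \<open>u\<close> vanishes at the
  final time, what is left depends on the starting point alone and comes out of the expectation,
  together with the constants \<open>d\<close>.\<close>

lemma (in elliptic_chain) HH_gauge:
 assumes F: "\<And>n x y. F n x y = f n x y + u (Suc n) y - u n x - d n" and u: "\<And>x. u (n + k) x = 0"
 shows "HH F c k n x = exp (- c * of_real (u n x + (\<Sum>i\<in>{n..<n + k}. d i))) * HH f c k n x"
 using u
proof (induction k arbitrary: n x)
 case (Suc k)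
 let ?s = "\<Sum>i\<in>{n..<n + Suc k}. d i"
 have s: "?s = d n + (\<Sum>i\<in>{Suc n..<Suc n + k}. d i)" by (subst sum.atLeast_Suc_lessThan) auto
 have IH: "HH F c k (Suc n) y = exp (- c * of_real (u (Suc n) y + (\<Sum>i\<in>{Suc n..<Suc n + k}. d i))) * HH f c k (Suc n) y" for y
  using Suc.prems by (intro Suc.IH) simp
 have e: "exp (c * of_real (F n x y)) * exp (- c * of_real (u (Suc n) y + (\<Sum>i\<in>{Suc n..<Suc n + k}. d i))) =
  exp (- c * of_real (u n x + ?s)) * exp (c * of_real (f n x y))" for y
  unfolding F s by (simp add: algebra_simps flip: exp_add)
 have "HH F c (Suc k) n x = (\<integral>y. exp (- c * of_real (u n x + ?s)) * (of_real (p n x y) * (exp (c * of_real (f n x y)) * HH f c k (Suc n) y)) \<partial>M (Suc n))"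
  unfolding HH.simps LL_def
 proof (intro integral_congI)
  fix y
  have "exp (c * of_real (F n x y)) * HH F c k (Suc n) y = exp (- c * of_real (u n x + ?s)) * (exp (c * of_real (f n x y)) * HH f c k (Suc n) y)"
   unfolding IH mult.assoc[symmetric] e ..
  then show "of_real (p n x y) * (exp (c * of_real (F n x y)) * HH F c k (Suc n) y) =
    exp (- c * of_real (u n x + ?s)) * (of_real (p n x y) * (exp (c * of_real (f n x y)) * HH f c k (Suc n) y))"
   by (simp only: mult.left_commute)
 qed
 also have "\<dots> = exp (- c * of_real (u n x + ?s)) * HH f c (Suc k) n x"
  unfolding integral_mult_right_zero HH.simps LL_def ..
 finally show ?case .
qed simp

section \<open>Gauge transformations and second moments\<close>

context chain_law
begin

text \<open>One step gives the law a density of at most \<open>1 / \<epsilon>\<close>. The law at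
  time 0 need not have a density, so edges starting there are always treated apart.\<close>

lemma nu_le_M:
 assumes g: "bm (M (Suc n)) g" and nn: "\<And>y. y \<in> space (M (Suc n)) \<Longrightarrow> 0 \<le> (g y :: real)"
 shows "(\<integral>y. g y \<partial>\<nu> (Suc n)) \<le> 1 / \<epsilon> * (\<integral>y. g y \<partial>M (Suc n))"
proof -
 have "(\<integral>y. g y \<partial>\<nu> (Suc n)) = (\<integral>x. \<integral>y. p n x y * g y \<partial>M (Suc n) \<partial>\<nu> n)" by (rule nu_inv_real[OF g, symmetric])
 also have "\<dots> \<le> (\<integral>x. 1 / \<epsilon> * (\<integral>y. g y \<partial>M (Suc n)) \<partial>\<nu> n)"
 proof (rule nu_mono)
  show "bm (M n) (\<lambda>x. \<integral>y. p n x y * g y \<partial>M (Suc n))" by (intro bm_intros prob_M bm_comp[OF g]; measurable)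
  show "bm (M n) (\<lambda>x. 1 / \<epsilon> * (\<integral>y. g y \<partial>M (Suc n)))" by (rule bm_const)
  fix x assume x: "x \<in> space (M n)"
  have "(\<integral>y. p n x y * g y \<partial>M (Suc n)) \<le> (\<integral>y. 1 / \<epsilon> * g y \<partial>M (Suc n))"
   by (intro bm_integral_mono[OF fin_M] bm_mult[OF bm_p_fix[OF x] g] bm_mult[OF bm_const g] mult_right_mono p_le nn)
  then show "(\<integral>y. p n x y * g y \<partial>M (Suc n)) \<le> 1 / \<epsilon> * (\<integral>y. g y \<partial>M (Suc n))" by simp
 qed
 also have "\<dots> = 1 / \<epsilon> * (\<integral>y. g y \<partial>M (Suc n))" by simp
 finally show ?thesis .
qed

lemma EE_le_M:
 assumes F: "bm (M (Suc n) \<Otimes>\<^sub>M M (Suc (Suc n))) (\<lambda>w. F (fst w) (snd w))" and nn: "\<And>x y. 0 \<le> F x y"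
 shows "EE (Suc n) F \<le> 1 / \<epsilon> * (\<integral>x. \<integral>y. p (Suc n) x y * F x y \<partial>M (Suc (Suc n)) \<partial>M (Suc n))"
 unfolding EE_def
 by (intro nu_le_M bm_integral[OF prob_M] bm_mult F bm_p integral_nonneg_AE AE_I2 mult_nonneg_nonneg p_nonneg nn) auto

lemma ww_centered_le:
 assumes G: "bm (M n \<Otimes>\<^sub>M M (Suc n)) (\<lambda>w. G (fst w) (snd w))"
 shows "EE n (\<lambda>x y. (G x y - EE n G)\<^sup>2) \<le> EE n (\<lambda>x y. (G x y - c)\<^sup>2)"
proof -
 let ?d = "EE n G"
 have b2: "bm (M n \<Otimes>\<^sub>M M (Suc n)) (\<lambda>w. (G (fst w) (snd w) - e)\<^sup>2)" for e by (intro bm_power bm_diff G bm_const)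
 have b1: "bm (M n \<Otimes>\<^sub>M M (Suc n)) (\<lambda>w. (\<lambda>x y. 2 * (?d - c) * G x y + ((c\<^sup>2 - ?d\<^sup>2)) * 1) (fst w) (snd w))"
  by (intro bm_add bm_mult G bm_const)
 have "(\<lambda>x y. (G x y - c)\<^sup>2) = (\<lambda>x y. 1 * (G x y - ?d)\<^sup>2 + 1 * (2 * (?d - c) * G x y + (c\<^sup>2 - ?d\<^sup>2) * 1))"
  by (simp add: fun_eq_iff power2_eq_square algebra_simps)
 then have "EE n (\<lambda>x y. (G x y - c)\<^sup>2) = EE n (\<lambda>x y. (G x y - ?d)\<^sup>2) + EE n (\<lambda>x y. 2 * (?d - c) * G x y + (c\<^sup>2 - ?d\<^sup>2) * 1)"
  using EE_lincomb[OF b2[of ?d] b1, where a = 1 and b = 1] by (simp only: mult_1_left)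
 also have "EE n (\<lambda>x y. 2 * (?d - c) * G x y + (c\<^sup>2 - ?d\<^sup>2) * 1) = (?d - c)\<^sup>2"
  using EE_lincomb[OF G bm_const[of _ 1], where a = "2 * (?d - c)" and b = "c\<^sup>2 - ?d\<^sup>2"] by (simp add: power2_eq_square algebra_simps)
 finally show ?thesis by simp
qed

text \<open>For \<open>|t * e| \<le> pi\<close> the square of \<open>e\<close> is at most
  \<open>pi\<^sup>2 / (2 * t\<^sup>2)\<close> times \<open>1 - cos (t * e)\<close>. The cosine does
  not notice multiples of \<open>2 * pi\<close>, so \<open>h\<close> may be the original phase while
  \<open>t * e\<close> is its representative near zero. The factor \<open>1 / \<epsilon>\<close>
  passes from the reference measure to the law of the chain.\<close>

lemma second_moment_le_phase:
 assumes n: "n = Suc j" and t: "t \<noteq> 0" and e: "bm (M n \<Otimes>\<^sub>M M (Suc n)) (\<lambda>w. e (fst w) (snd w))"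
  and pi: "\<And>x y. \<bar>t * e x y\<bar> \<le> pi"
  and cos: "\<And>x y. x \<in> space (M n) \<Longrightarrow> y \<in> space (M (Suc n)) \<Longrightarrow> cos (t * e x y) = cos (h x y)"
  and R: "(\<integral>x. \<integral>y. p n x y * (1 - cos (h x y)) \<partial>M (Suc n) \<partial>M n) \<le> R"
 shows "EE n (\<lambda>x y. (e x y)\<^sup>2) \<le> pi\<^sup>2 / (2 * t\<^sup>2) * (1 / \<epsilon> * R)"
proof -
 let ?a = "pi\<^sup>2 / (2 * t\<^sup>2)" and ?c = "\<lambda>x y. 1 - cos (t * e x y)"
 have bc: "bm (M n \<Otimes>\<^sub>M M (Suc n)) (\<lambda>w. ?c (fst w) (snd w))"
  by (intro bm_diff bm_const bm_cos borel_measurable_times borel_measurable_const bm_measurable[OF e])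
 have "EE n (\<lambda>x y. (e x y)\<^sup>2) \<le> EE n (\<lambda>x y. ?a * ?c x y + 0 * 0)"
 proof (rule EE_mono)
  show "bm (M n \<Otimes>\<^sub>M M (Suc n)) (\<lambda>w. (e (fst w) (snd w))\<^sup>2)" by (rule bm_power[OF e])
  show "bm (M n \<Otimes>\<^sub>M M (Suc n)) (\<lambda>w. ?a * ?c (fst w) (snd w) + 0 * 0)" by (intro bm_add bm_const bm_mult[OF bm_const] bc)
  show "(e x y)\<^sup>2 \<le> ?a * ?c x y + 0 * 0" for x y
  proof -
   have "?a * (2 * (t * e x y)\<^sup>2 / pi\<^sup>2) \<le> ?a * ?c x y" by (intro mult_left_mono one_minus_cos_ge pi) simp
   moreover have "?a * (2 * (t * e x y)\<^sup>2 / pi\<^sup>2) = (e x y)\<^sup>2" using t by (simp add: power_mult_distrib)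
   ultimately show ?thesis by simp
  qed
 qed
 also have "\<dots> = ?a * EE n ?c"
  using EE_lincomb[OF bc bm_const[of _ 0], where a = ?a and b = 0] by (simp only: EE_const mult_zero_left add_0_right)
 also have "\<dots> \<le> ?a * (1 / \<epsilon> * R)"
 proof (rule mult_left_mono)
  have "EE n ?c \<le> 1 / \<epsilon> * (\<integral>x. \<integral>y. p n x y * ?c x y \<partial>M (Suc n) \<partial>M n)"
   using EE_le_M[of j ?c, folded n, OF bc] by simp
  also have "(\<integral>x. \<integral>y. p n x y * ?c x y \<partial>M (Suc n) \<partial>M n) = (\<integral>x. \<integral>y. p n x y * (1 - cos (h x y)) \<partial>M (Suc n) \<partial>M n)"
   by (intro integral_congI) (simp add: cos)
  also have "1 / \<epsilon> * \<dots> \<le> 1 / \<epsilon> * R" using eps by (intro mult_left_mono R) auto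
  finally show "EE n ?c \<le> 1 / \<epsilon> * R" .
 qed simp
 finally show ?thesis .
qed

lemma adm_gauge:
 assumes f: "adm K f" and u: "\<And>n. u n \<in> borel_measurable (M n)" "\<And>n x. \<bar>u n x\<bar> \<le> B"
 defines "G \<equiv> \<lambda>n x y. f n x y + u (Suc n) y - u n x"
 shows "adm (2 * (K + 2 * B)) (\<lambda>n x y. G n x y - EE n (G n))" "edge_centered (\<lambda>n x y. G n x y - EE n (G n))"
  "bm (M n \<Otimes>\<^sub>M M (Suc n)) (\<lambda>w. G n (fst w) (snd w))"
proof -
 have bu: "bm (M n) (u n)" for n by (rule bmI[OF u(1)]) (use u(2) in simp)
 have GB: "\<bar>G n x y\<bar> \<le> K + 2 * B" for n x y
  unfolding G_def using adm_le[OF f, of n x y] u(2)[of "Suc n" y] u(2)[of n x] by linarith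
 have bG: "bm (M n \<Otimes>\<^sub>M M (Suc n)) (\<lambda>w. G n (fst w) (snd w))" for n
  unfolding G_def by (intro bm_diff bm_add bm_f_pair[OF f] bm_comp[OF bu]) measurable
 then show "bm (M n \<Otimes>\<^sub>M M (Suc n)) (\<lambda>w. G n (fst w) (snd w))" .
 have EB: "\<bar>EE n (G n)\<bar> \<le> K + 2 * B" for n
 proof -
  have GB': "- (K + 2 * B) \<le> G n x y" for x y using GB[of n x y] unfolding abs_le_iff by linarith
  have "EE n (\<lambda>x y. - (K + 2 * B)) \<le> EE n (G n)" by (rule EE_mono[OF bm_const bG GB'])
  moreover have "EE n (G n) \<le> EE n (\<lambda>x y. K + 2 * B)" by (rule EE_mono[OF bG bm_const]) (use GB in \<open>simp add: abs_le_iff\<close>)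
  ultimately show ?thesis unfolding EE_const by linarith
 qed
 show "adm (2 * (K + 2 * B)) (\<lambda>n x y. G n x y - EE n (G n))"
  unfolding adm_def
 proof (intro conjI allI)
  show "(\<lambda>w. G n (fst w) (snd w) - EE n (G n)) \<in> borel_measurable (M n \<Otimes>\<^sub>M M (Suc n))" for n
   using bm_measurable[OF bG] by measurable
  show "\<bar>G n x y - EE n (G n)\<bar> \<le> 2 * (K + 2 * B)" for n x y
   by (rule order.trans[OF abs_triangle_ineq4]) (use add_mono[OF GB[of n x y] EB[of n]] in simp)
 qed
 show "edge_centered (\<lambda>n x y. G n x y - EE n (G n))"
  unfolding edge_centered_def
 proof
  fix n
  show "EE n (\<lambda>x y. G n x y - EE n (G n)) = 0"
   using EE_lincomb[OF bG bm_const[of _ 1], where a = 1 and b = "- EE n (G n)"] by simp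
 qed
qed

text \<open>The phases \<open>\<beta>\<close> at a small frequency \<open>t0\<close> give a gauge transformation after which the second moments
 are bounded in terms of the hexagon quantities; the boundary terms are left out so that the sum is unchanged.\<close>

theorem centered_gauge:
 assumes f: "adm K f" and K: "0 < K" and t0: "0 < t0" "t0 * (8 * K) \<le> pi"
 obtains K' C F d where "0 < K'" "0 < C" "\<And>N. adm K' (F N)" "\<And>N. edge_centered (F N)"
  "\<And>N s x. HH (F N) s N 0 x = exp (- s * of_real (d N)) * HH f s N 0 x"
  "\<And>N. 4 \<le> N \<Longrightarrow> (\<Sum>n<N. ww (F N) n) \<le> C * (psi f N t0 + 1)"
proof -
 obtain h c where hm: "\<And>n. h n \<in> borel_measurable (M n)" and "\<And>n x. \<bar>h n x\<bar> \<le> pi"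
  and c: "\<And>n. \<bar>c n\<bar> \<le> K"
  and hs: "\<And>n x. \<bar>t0\<bar> * (2 * K) \<le> pi / 4 \<Longrightarrow> x \<in> space (M n) \<Longrightarrow> \<bar>h n x\<bar> \<le> pi / 4"
  and D: "\<And>n. (\<integral>x. \<integral>y. p n x y * (1 - cos (t0 * f n x y + h (Suc n) y - h n x - t0 * c n)) \<partial>M (Suc n) \<partial>M n)
   \<le> 24 / \<epsilon> ^ 3 * (DD f t0 n + (1 / 2) ^ n)"
  by (rule phase_functions[OF f, of t0]) (rule that)
 have sm: "\<bar>t0\<bar> * (2 * K) \<le> pi / 4" using t0 by simp
 define B where "B = pi / 4 / t0"
 \<comment> \<open>The phase is known to be small only on the state space; cutting it off elsewhere
   makes the bound \<open>B\<close> hold at all points, as \<open>adm\<close> demands.\<close>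
 define b where "b n x = (if \<bar>h n x\<bar> \<le> pi / 4 then h n x else 0) / t0" for n x
 have bm[measurable]: "b n \<in> borel_measurable (M n)" for n unfolding b_def using hm[of n] by measurable
 have bB: "\<bar>b n x\<bar> \<le> B" for n x
  unfolding b_def B_def abs_divide using t0(1) by (auto simp del: divide_divide_eq_left intro!: divide_right_mono)
 have bh: "t0 * b n x = h n x" if "x \<in> space (M n)" for n x using hs[OF sm that] t0 by (simp add: b_def)
 have B0: "0 \<le> B" using t0 by (simp add: B_def)
 define K' where "K' = 2 * (K + 2 * B)"
 have K': "0 < K'" using K B0 by (simp add: K'_def)
 define C0 where "C0 = pi\<^sup>2 / (2 * t0\<^sup>2) * (1 / \<epsilon> * (24 / \<epsilon> ^ 3))"
 have C0: "0 < C0" unfolding C0_def using t0 eps by simp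
 \<comment> \<open>At the times \<open>0\<close> and \<open>N\<close> the gauge is switched off, so
   that it changes the moment generating function only by a constant shift, for every starting
   point.\<close>
 define u where "u N n x = (if 0 < n \<and> n < N then b n x else 0)" for N n :: nat and x
 have um: "u N n \<in> borel_measurable (M n)" for N n unfolding u_def by measurable
 have uB: "\<bar>u N n x\<bar> \<le> B" for N n x using bB B0 by (simp add: u_def)
 define G where "G N n x y = f n x y + u N (Suc n) y - u N n x" for N n x y
 define F where "F N n x y = G N n x y - EE n (G N n)" for N n x y
 have G: "adm K' (F N)" "edge_centered (F N)" "bm (M n \<Otimes>\<^sub>M M (Suc n)) (\<lambda>w. G N n (fst w) (snd w))" for N n
  using adm_gauge[OF f, of "u N" B, OF um uB] unfolding F_def[abs_def] G_def[abs_def] K'_def by blast+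
 have inner: "ww (F N) n \<le> C0 * (DD f t0 n + (1 / 2) ^ n)" if n: "n = Suc j" "Suc n < N" for N n j
 proof -
  let ?t = "\<lambda>x y. t0 * f n x y + t0 * b (Suc n) y - t0 * b n x - t0 * c n"
  have t: "?t x y = t0 * (G N n x y - c n)" for x y using n by (simp add: G_def u_def algebra_simps)
  \<comment> \<open>The terms with \<open>f\<close> and \<open>c\<close> contribute at most
    \<open>pi / 8\<close> each and the two gauge terms at most \<open>pi / 4\<close> each, in total
    \<open>3 * pi / 4\<close>.\<close>
  have tb: "\<bar>?t x y\<bar> \<le> pi" for x y
  proof -
   have m: "t0 * v \<le> t0 * w" "- (t0 * w) \<le> t0 * v" if "\<bar>v\<bar> \<le> w" for v w
   proof -
    show "t0 * v \<le> t0 * w" using that t0(1) by (intro mult_left_mono) auto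
    have "t0 * (- w) \<le> t0 * v" using that t0(1) by (intro mult_left_mono) auto
    then show "- (t0 * w) \<le> t0 * v" by simp
   qed
   have "t0 * B = pi / 4" using t0 by (simp add: B_def)
   moreover have "t0 * K \<le> pi / 8" using t0(2) by simp
   ultimately show ?thesis unfolding abs_le_iff
    using m[OF adm_le[OF f], of n x y] m[OF c, of n] m[OF bB, of "Suc n" y] m[OF bB, of n x] pi_gt_zero
    by (intro conjI; linarith)
  qed
  have "ww (F N) n \<le> EE n (\<lambda>x y. (G N n x y - c n)\<^sup>2)" unfolding ww_def F_def by (rule ww_centered_le[OF G(3)])
  also have "\<dots> \<le> C0 * (DD f t0 n + (1 / 2) ^ n)"
   unfolding C0_def mult.assoc
  proof (rule second_moment_le_phase[OF n(1) _ _ _ _ D])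
   show "bm (M n \<Otimes>\<^sub>M M (Suc n)) (\<lambda>w. G N n (fst w) (snd w) - c n)" by (intro bm_diff G bm_const)
   show "\<bar>t0 * (G N n x y - c n)\<bar> \<le> pi" for x y using tb[of x y] unfolding t .
   show "cos (t0 * (G N n x y - c n)) = cos (t0 * f n x y + h (Suc n) y - h n x - t0 * c n)"
    if "x \<in> space (M n)" "y \<in> space (M (Suc n))" for x y unfolding t[symmetric] using that by (simp add: bh)
  qed (use t0 in simp)
  finally show ?thesis .
 qed
 have sum: "(\<Sum>n<N. ww (F N) n) \<le> (2 * C0 + 4 * K'\<^sup>2) * (psi f N t0 + 1)" if N: "4 \<le> N" for N
 proof -
  \<comment> \<open>The edges 0, 1, \<open>N - 2\<close> and \<open>N - 1\<close> are outside the
    range of \<open>psi\<close>. They number at most four and are bounded trivially by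
    \<open>K'\<^sup>2\<close>, a constant in \<open>N\<close>.\<close>
  have split: "{..<N} = {0, 1, N - 2, N - 1} \<union> {2..<N - 2}" using N by auto
  have "(\<Sum>n<N. ww (F N) n) \<le> (\<Sum>n\<in>{0, 1, N - 2, N - 1}. ww (F N) n) + (\<Sum>n\<in>{2..<N - 2}. ww (F N) n)"
   unfolding split by (subst sum.union_inter[symmetric]) (auto intro!: sum_nonneg ww_bounds(1)[OF G(1)])
  also have "(\<Sum>n\<in>{0, 1, N - 2, N - 1}. ww (F N) n) \<le> of_nat (card {0, 1, N - 2, N - 1}) * K'\<^sup>2"
   by (intro sum_bounded_above ww_bounds(2)[OF G(1)])
  also have "\<dots> \<le> 4 * K'\<^sup>2" by (intro mult_right_mono) (auto simp: card_insert_if)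
  also have "(\<Sum>n\<in>{2..<N - 2}. ww (F N) n) \<le> (\<Sum>n\<in>{2..<N - 2}. C0 * (DD f t0 n + (1 / 2) ^ n))"
  proof (rule sum_mono)
   fix n assume n: "n \<in> {2..<N - 2}"
   then have "n = Suc (n - 1)" "Suc n < N" by auto
   then show "ww (F N) n \<le> C0 * (DD f t0 n + (1 / 2) ^ n)" by (rule inner)
  qed
  also have "\<dots> = C0 * psi f N t0 + C0 * (\<Sum>n\<in>{2..<N - 2}. (1 / 2) ^ n)"
   unfolding psi_def by (simp add: sum_distrib_left sum.distrib distrib_left)
  also have "(\<Sum>n\<in>{2..<N - 2}. (1 / 2) ^ n) \<le> (\<Sum>n. (1 / 2 :: real) ^ n)"
   by (intro sum_le_suminf summable_geometric) auto
  also have "(\<Sum>n. (1 / 2 :: real) ^ n) = 2" using suminf_geometric[of "1 / 2 :: real"] by simp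
  finally have "(\<Sum>n<N. ww (F N) n) \<le> 4 * K'\<^sup>2 + (C0 * psi f N t0 + C0 * 2)" using C0 by simp
  also have "\<dots> \<le> (2 * C0 + 4 * K'\<^sup>2) * (psi f N t0 + 1)"
   using C0 psi_nonneg[of f N t0] mult_nonneg_nonneg[of C0 "psi f N t0"] mult_nonneg_nonneg[of "4 * K'\<^sup>2" "psi f N t0"]
   by (simp add: algebra_simps)
  finally show ?thesis .
 qed
 show ?thesis
 proof (rule that[OF K' _ G(1) G(2)])
  show "0 < 2 * C0 + 4 * K'\<^sup>2" using C0 by (simp add: add_pos_nonneg)
  show "HH (F N) s N 0 x = exp (- s * of_real (\<Sum>i\<in>{0..<N}. EE i (G N i))) * HH f s N 0 x" for N s x
  proof -
   have "HH (F N) s N 0 x = exp (- s * of_real (u N 0 x + (\<Sum>i\<in>{0..<0 + N}. EE i (G N i)))) * HH f s N 0 x"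
    by (rule HH_gauge) (auto simp: F_def G_def u_def)
   then show ?thesis by (simp add: u_def)
  qed
 qed (rule sum)
qed

end

section \<open>The local limit theorem for the chain\<close>

text \<open>A bound without linear term for all small real \<open>s\<close> pins down the mean:
  \<open>exp (A * s^2) - s * k\<close> has a minimum at 0, so its derivative \<open>- k\<close>
  vanishes. Adding the bounds at \<open>s\<close> and \<open>- s\<close>, using
  \<open>2 + t^2 \<le> exp t + exp (- t)\<close> and letting \<open>s\<close> tend to 0, compares
  the quadratic coefficients.\<close>

lemma subgaussian_moments:
 fixes T :: "'b \<Rightarrow> real"
 assumes P: "prob_space P" and T: "bm P T" and r: "0 < r"
  and le: "\<And>s. \<bar>s\<bar> \<le> r \<Longrightarrow> (\<integral>w. exp (s * (T w - d)) \<partial>P) \<le> exp (A * s\<^sup>2)"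
 shows "(\<integral>w. T w \<partial>P) = d" "(\<integral>w. (T w - d)\<^sup>2 \<partial>P) \<le> 2 * A"
proof -
 interpret prob_space P by fact
 have fin: "finite_measure P" by unfold_locales
 define U where "U w = T w - d" for w
 have U: "bm P U" unfolding U_def by (intro bm_intros T)
 have e: "bm P (\<lambda>w. exp (s * U w))" for s by (intro bm_intros U)
 have le': "(\<integral>w. exp (s * U w) \<partial>P) \<le> exp (A * s\<^sup>2)" if "\<bar>s\<bar> \<le> r" for s using le[OF that] by (simp add: U_def)
 define k where "k = (\<integral>w. U w \<partial>P)"
 have "k = 0"
 proof -
  let ?h = "\<lambda>s. exp (A * s\<^sup>2) - s * k"
  have "(?h has_real_derivative - k) (at 0)" by (auto intro!: derivative_eq_intros)
  moreover have "?h 0 \<le> ?h s" if "\<bar>0 - s\<bar> < r" for s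
  proof -
   have "(\<integral>w. 1 + s * U w \<partial>P) \<le> (\<integral>w. exp (s * U w) \<partial>P)"
    by (rule bm_integral_mono[OF fin _ e]) (intro bm_intros U, rule exp_ge_add_one_self)
   also have "(\<integral>w. 1 + s * U w \<partial>P) = 1 + s * k" using bm_integrable[OF fin U] by (simp add: k_def prob_space)
   finally show ?thesis using le'[of s] that by simp
  qed
  ultimately have "- k = 0" using DERIV_local_min[of ?h "- k" 0 r] r by blast
  then show ?thesis by simp
 qed
 then show "(\<integral>w. T w \<partial>P) = d" unfolding k_def U_def using bm_integrable[OF fin T] by (simp add: prob_space)
 define v where "v = (\<integral>w. (U w)\<^sup>2 \<partial>P)"
 have vs: "v \<le> 2 * (exp (A * s\<^sup>2) - 1) / s\<^sup>2" if s: "0 < s" "s \<le> r" for s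
 proof -
  have "(\<integral>w. 2 + s\<^sup>2 * (U w)\<^sup>2 \<partial>P) \<le> (\<integral>w. exp (s * U w) + exp (- s * U w) \<partial>P)"
  proof (rule bm_integral_mono[OF fin])
   fix w
   have c: "2 + t\<^sup>2 \<le> exp t + exp (- t)" for t :: real
   proof -
    let ?f = "\<lambda>n. if even n then t ^ n /\<^sub>R fact n else 0"
    have "sum ?f {..<3} \<le> cosh t"
     unfolding sums_unique[OF cosh_converges[of t]]
     by (intro sum_le_suminf sums_summable[OF cosh_converges]) (auto simp: zero_le_even_power)
    then show ?thesis by (simp add: cosh_field_def eval_nat_numeral scaleR_conv_of_real)
   qed
   show "2 + s\<^sup>2 * (U w)\<^sup>2 \<le> exp (s * U w) + exp (- s * U w)" using c[of "s * U w"] by (simp add: power_mult_distrib)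
  qed (intro bm_intros U)+
  also have "\<dots> = (\<integral>w. exp (s * U w) \<partial>P) + (\<integral>w. exp (- s * U w) \<partial>P)"
   by (rule Bochner_Integration.integral_add[OF bm_integrable[OF fin e] bm_integrable[OF fin e]])
  also have "\<dots> \<le> exp (A * s\<^sup>2) + exp (A * s\<^sup>2)" using le'[of s] le'[of "- s"] s by simp
  also have "(\<integral>w. 2 + s\<^sup>2 * (U w)\<^sup>2 \<partial>P) = 2 + s\<^sup>2 * v"
   using bm_integrable[OF fin bm_power[OF U, of 2]] by (simp add: v_def prob_space)
  finally have "s\<^sup>2 * v \<le> 2 * (exp (A * s\<^sup>2) - 1)" by simp
  then show ?thesis using s by (simp add: pos_le_divide_eq mult.commute)
 qed
 have "v \<le> 2 * A"
 proof (rule tendsto_lowerbound)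
  show "((\<lambda>s. 2 * (exp (A * s\<^sup>2) - 1) / s\<^sup>2) \<longlongrightarrow> 2 * A) (at_right 0)" by real_asymp
  show "\<forall>\<^sub>F s in at_right 0. v \<le> 2 * (exp (A * s\<^sup>2) - 1) / s\<^sup>2"
   using vs r by (auto simp: eventually_at_right_field intro!: exI[of _ r])
 qed simp
 then show "(\<integral>w. (T w - d)\<^sup>2 \<partial>P) \<le> 2 * A" unfolding v_def U_def .
qed

text \<open>The real part of the characteristic function is at least \<open>1 - t^2 * v / 2\<close>,
  so decay like \<open>exp (- A * t^2)\<close> forces \<open>v \<ge> 2 * A\<close> as
  \<open>t\<close> tends to 0.\<close>

lemma variance_lower_bound:
 fixes T :: "'b \<Rightarrow> real"
 assumes P: "prob_space P" and T: "bm P T" and r: "0 < r"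
  and le: "\<And>t. 0 < t \<Longrightarrow> t \<le> r \<Longrightarrow> norm (\<integral>w. exp (\<i> * of_real t * of_real (T w)) \<partial>P) \<le> exp (- A * t\<^sup>2)"
 shows "2 * A \<le> (\<integral>w. (T w - d)\<^sup>2 \<partial>P)"
proof -
 interpret prob_space P by fact
 have fin: "finite_measure P" by unfold_locales
 define U where "U w = T w - d" for w
 have U: "bm P U" unfolding U_def by (intro bm_intros T)
 define v where "v = (\<integral>w. (U w)\<^sup>2 \<partial>P)"
 have vs: "2 * (1 - exp (- A * t\<^sup>2)) / t\<^sup>2 \<le> v" if t: "0 < t" "t \<le> r" for t
 proof -
  have bE: "bm P (\<lambda>w. exp (\<i> * of_real t * of_real (U w)))" by (intro bm_intros U)
  have Re: "Re (exp (\<i> * of_real t * of_real u)) = cos (t * u)" for u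
   by (simp add: Re_exp)
  have "1 - t\<^sup>2 * v / 2 = (\<integral>w. 1 - t\<^sup>2 / 2 * (U w)\<^sup>2 \<partial>P)"
   using bm_integrable[OF fin bm_power[OF U, of 2]] by (simp add: v_def prob_space)
  also have "\<dots> \<le> (\<integral>w. Re (exp (\<i> * of_real t * of_real (U w))) \<partial>P)"
  proof (rule bm_integral_mono[OF fin])
   show "1 - t\<^sup>2 / 2 * (U w)\<^sup>2 \<le> Re (exp (\<i> * of_real t * of_real (U w)))" for w
    unfolding Re using one_minus_cos_le[of "t * U w"] by (simp add: power_mult_distrib)
  qed (intro bm_intros U)+
  also have "\<dots> = Re (\<integral>w. exp (\<i> * of_real t * of_real (U w)) \<partial>P)" by (rule integral_Re[OF bm_integrable[OF fin bE]])
  also have "\<dots> \<le> norm (\<integral>w. exp (\<i> * of_real t * of_real (U w)) \<partial>P)" by (rule complex_Re_le_cmod)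
  also have "(\<integral>w. exp (\<i> * of_real t * of_real (U w)) \<partial>P) = exp (- \<i> * of_real (t * d)) * (\<integral>w. exp (\<i> * of_real t * of_real (T w)) \<partial>P)"
   unfolding integral_mult_right_zero[symmetric] U_def
   by (intro integral_congI) (simp add: algebra_simps flip: exp_add)
  also have "norm \<dots> = norm (\<integral>w. exp (\<i> * of_real t * of_real (T w)) \<partial>P)"
   by (simp add: norm_mult)
  also have "\<dots> \<le> exp (- A * t\<^sup>2)" by (rule le[OF t])
  finally have "2 * (1 - exp (- A * t\<^sup>2)) \<le> v * t\<^sup>2" by (simp add: mult.commute)
  then show ?thesis using t by (simp add: pos_divide_le_eq)
 qed
 have "2 * A \<le> v"
 proof (rule tendsto_upperbound)
  show "((\<lambda>t. 2 * (1 - exp (- A * t\<^sup>2)) / t\<^sup>2) \<longlongrightarrow> 2 * A) (at_right 0)" by real_asymp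
  show "\<forall>\<^sub>F t in at_right 0. 2 * (1 - exp (- A * t\<^sup>2)) / t\<^sup>2 \<le> v"
   using vs r by (auto simp: eventually_at_right_field intro!: exI[of _ r])
 qed simp
 then show ?thesis unfolding v_def U_def .
qed

context chain_law
begin

text \<open>The quantity \<open>psi f N t0\<close> ties the scales together. Decay of characteristic
  functions makes the variance at least a multiple of it, while after the gauge the sum of second
  moments, and hence the variance, is at most a multiple of \<open>psi f N t0 + 1\<close>. So the
  variance diverges with \<open>psi\<close>, and the logarithm of the moment generating function is
  bounded by a multiple of the variance on a fixed disc.\<close>

theorem chain_local_limit:
 fixes T :: "nat \<Rightarrow> 'b \<Rightarrow> real" and T' :: "nat \<Rightarrow> 'c \<Rightarrow> real" and V m z :: "nat \<Rightarrow> real"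
 assumes f: "adm K f" and K: "0 < K" and x: "x \<in> space (M 0)"
  and P: "prob_space P" and T: "\<And>N. bm P (T N)" and Q: "prob_space Q" and T': "\<And>N. bm Q (T' N)"
  and m: "\<And>N. m N = (\<integral>v. T N v \<partial>P)" and V: "\<And>N. V N = (\<integral>v. (T N v - m N)\<^sup>2 \<partial>P)"
  and mP: "\<And>N \<zeta>. (\<integral>v. exp (\<zeta> * of_real (T N v)) \<partial>P) = Lam f \<zeta> N 0"
  and mQ: "\<And>N \<zeta>. (\<integral>v. exp (\<zeta> * of_real (T' N v)) \<partial>Q) = HH f \<zeta> N 0 x"
  and div: "\<And>t. t \<noteq> 0 \<Longrightarrow> filterlim (\<lambda>N. psi f N t) at_top sequentially"
  and zm: "(\<lambda>N. (z N - m N) / V N) \<longlonglongrightarrow> 0" and ab: "a < b"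
 obtains \<xi> w h where "filterlim V at_top sequentially" "h \<longlonglongrightarrow> 0"
  "\<forall>\<^sub>F N in sequentially. (\<integral>v. T N v * exp (\<xi> N * T N v) \<partial>P) = z N * (\<integral>v. exp (\<xi> N * T N v) \<partial>P)"
  "\<forall>\<^sub>F N in sequentially. exp (w N) = exp (- \<xi> N * z N) * (\<integral>v. exp (\<xi> N * T N v) \<partial>P)"
  "\<forall>\<^sub>F N in sequentially. w N = - (1 + h N) / 2 * ((z N - m N) / sqrt (V N))\<^sup>2"
  "(\<lambda>N. measure Q {v\<in>space Q. T' N v - z N \<in> {a<..<b}}) \<sim>[sequentially] (\<lambda>N. (b - a) / sqrt (2 * pi * V N) * exp (w N))"
proof -
 \<comment> \<open>Small enough both for the gauge, whose phases must stay within \<open>pi\<close>,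
   and for the quadratic lower bound on \<open>DD\<close>, which asks for
   \<open>t0 * (6 * K) \<le> pi\<close>.\<close>
 define t0 where "t0 = pi / (8 * K)"
 have t0: "0 < t0" "t0 * (8 * K) \<le> pi" "t0 * (6 * K) \<le> pi" using K by (simp_all add: t0_def)
 obtain K' C F d where K': "0 < K'" and C: "0 < C" and F: "\<And>N. adm K' (F N)" "\<And>N. edge_centered (F N)"
  and FH: "\<And>N \<zeta> x. HH (F N) \<zeta> N 0 x = exp (- \<zeta> * of_real (d N)) * HH f \<zeta> N 0 x"
  and Fw: "\<And>N. 4 \<le> N \<Longrightarrow> (\<Sum>n<N. ww (F N) n) \<le> C * (psi f N t0 + 1)"
  by (rule centered_gauge[OF f K t0(1,2)]) (rule that)
 obtain r C1 where r: "0 < r" and C1: "0 < C1"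
  and est: "\<And>f N \<zeta>. adm K' f \<Longrightarrow> edge_centered f \<Longrightarrow> 2 \<le> N \<Longrightarrow> norm \<zeta> \<le> r \<Longrightarrow>
   exp (- (C1 * (norm \<zeta>)\<^sup>2 * (\<Sum>n<N. ww f n))) \<le> norm (Lam f \<zeta> N 0) \<and>
   norm (Lam f \<zeta> N 0) \<le> exp (C1 * (norm \<zeta>)\<^sup>2 * (\<Sum>n<N. ww f n)) \<and>
   (\<forall>x\<in>space (M 0). norm (HH f \<zeta> N 0 x - Lam f \<zeta> N 0) \<le> C1 * norm \<zeta> * norm (Lam f \<zeta> N 0))"
  by (rule mgf_estimates[OF K']) (rule that)
 define W where "W N = (\<Sum>n<N. ww (F N) n)" for N
 have FL: "Lam (F N) \<zeta> N 0 = exp (- \<zeta> * of_real (d N)) * Lam f \<zeta> N 0" for N \<zeta>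
  unfolding Lam_def FH by simp
 define c where "c = exp (- (24 * K)) * \<epsilon> ^ 6 / 10"
 have c: "0 < c" using eps by (simp add: c_def)
 have decay: "norm (HH f (Complex \<xi> t) N 0 y) \<le> exp (- c * psi f N t) * HHr f \<xi> N 0 y" if "\<bar>\<xi>\<bar> \<le> 1" "y \<in> space (M 0)" for \<xi> t N y
  unfolding psi_def by (rule char_decay[OF f that]) (simp add: c_def)
 define c1 where "c1 = 4 / (pi * t0)\<^sup>2"
 have c1: "0 < c1" using t0 by (simp add: c1_def)
 \<comment> \<open>The moment generating function of \<open>T N - d N\<close> is that of the gauged
   centred functional and has no linear term, which identifies the constant \<open>d N\<close> with
   the mean.\<close>
 have mean: "m N = d N" and V_le: "V N \<le> 2 * (C1 * W N)" if N: "4 \<le> N" for N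
 proof -
  have le: "(\<integral>v. exp (s * (T N v - d N)) \<partial>P) \<le> exp (C1 * W N * s\<^sup>2)" if "\<bar>s\<bar> \<le> r" for s
  proof -
   have "complex_of_real (\<integral>v. exp (s * (T N v - d N)) \<partial>P) = (\<integral>v. exp (- of_real s * of_real (d N)) * exp (of_real s * of_real (T N v)) \<partial>P)"
    unfolding integral_complex_of_real'[symmetric]
    by (intro integral_congI) (simp add: algebra_simps exp_of_real[symmetric] flip: exp_add)
   also have "\<dots> = Lam (F N) (of_real s) N 0" unfolding FL mP[symmetric] by simp
   finally have "(\<integral>v. exp (s * (T N v - d N)) \<partial>P) \<le> norm (Lam (F N) (of_real s) N 0)"
    by (metis norm_of_real abs_ge_self)
   also have "\<dots> \<le> exp (C1 * s\<^sup>2 * W N)"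
    using est[OF F, of N "of_real s"] N that by (simp add: W_def)
   finally show ?thesis by (simp only: mult_ac)
  qed
  show md: "m N = d N" unfolding m by (rule subgaussian_moments(1)[OF P T r le])
  show "V N \<le> 2 * (C1 * W N)" unfolding V md by (rule subgaussian_moments(2)[OF P T r le])
 qed
 \<comment> \<open>At tilt 0 the decay estimate bounds the characteristic function by
   \<open>exp (- c * psi)\<close>, and for \<open>t \<le> t0\<close> the quadratic growth of
   \<open>psi\<close> makes this Gaussian in \<open>t\<close>.\<close>
 have V_ge: "2 * (c * c1 * psi f N t0) \<le> V N" for N
  unfolding V
 proof (rule variance_lower_bound[OF P T t0(1)])
  fix t :: real assume t: "0 < t" "t \<le> t0"
  have 1: "\<i> * of_real t = Complex 0 t" by (simp add: complex_eq_iff)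
  have "norm (Lam f (Complex 0 t) N 0) \<le> (\<integral>y. exp (- c * psi f N t) \<partial>\<nu> 0)"
   unfolding Lam_def
  proof (rule nu_norm_le[OF bm_HH[OF f] bm_const])
   fix y assume y: "y \<in> space (M 0)"
   have "HHr f 0 N 0 y = 1"
   proof -
    have "HHr f 0 k n y = 1" if "y \<in> space (M n)" for k n y using that
    proof (induction k arbitrary: n y)
     case (Suc k)
     have "HHr f 0 (Suc k) n y = LLr f 0 n (\<lambda>_. 1) y" using Suc.IH by (simp, intro LLr_cong) simp
     then show ?case using p_integral[OF Suc.prems] by (simp add: LLr_def)
    qed simp
    then show ?thesis using y .
   qed
   then show "norm (HH f (Complex 0 t) N 0 y) \<le> exp (- c * psi f N t)" using decay[OF _ y, of 0 t N] by simp
  qed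
  also have "\<dots> = exp (- c * psi f N t)" by simp
  also have "\<dots> \<le> exp (- (c * c1 * psi f N t0) * t\<^sup>2)"
   using mult_left_mono[OF psi_quadratic[OF f t0(1,3), of t N], of c] t c by (simp add: c1_def mult_ac)
  finally show "norm (\<integral>v. exp (\<i> * of_real t * of_real (T N v)) \<partial>P) \<le> exp (- (c * c1 * psi f N t0) * t\<^sup>2)"
   unfolding 1 mP .
 qed
 define c2 where "c2 = 2 * (c * c1)"
 have c2: "0 < c2" using c c1 by (simp add: c2_def)
 have V_ge': "c2 * psi f N t0 \<le> V N" for N using V_ge[of N] by (simp add: c2_def)
 have ginf: "filterlim (\<lambda>N. psi f N t0) at_top sequentially" using div[of t0] t0 by simp
 have Vinf: "filterlim V at_top sequentially"
  by (rule filterlim_at_top_mono[OF filterlim_tendsto_pos_mult_at_top[OF tendsto_const c2 ginf]]) (simp add: V_ge')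
 have big: "\<forall>\<^sub>F N in sequentially. 4 \<le> N \<and> 1 < psi f N t0"
  using ginf by (intro eventually_conj eventually_ge_at_top) (simp add: filterlim_at_top_dense)
 \<comment> \<open>Converts the exponent \<open>C1 * |\<zeta>|^2 * W N\<close>, for
   \<open>|\<zeta>| < r\<close>, into a multiple of \<open>V N\<close> by means of
   \<open>W N \<le> 2 * C / c2 * V N\<close>.\<close>
 define C3 where "C3 = C1 * r\<^sup>2 * (2 * C / c2)"
 have C3: "0 < C3" unfolding C3_def using C1 C r c2 by simp
 define C4 where "C4 = max C1 C3"
 have C4: "0 < C4" "C1 \<le> C4" "C3 \<le> C4" using C1 by (auto simp: C4_def)
 have W_le: "W N \<le> 2 * C / c2 * V N" if "4 \<le> N" "1 < psi f N t0" for N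
 proof -
  have "W N \<le> C * (psi f N t0 + 1)" unfolding W_def by (rule Fw[OF that(1)])
  also have "\<dots> \<le> C * (2 * (V N / c2))"
  proof (rule mult_left_mono)
   have "psi f N t0 \<le> V N / c2" using V_ge'[of N] c2 by (simp add: pos_le_divide_eq mult.commute)
   then show "psi f N t0 + 1 \<le> 2 * (V N / c2)" using that by linarith
  qed (use C in simp)
  also have "C * (2 * (V N / c2)) = 2 * C / c2 * V N" by simp
  finally show ?thesis .
 qed
 have nz: "\<forall>\<^sub>F N in sequentially. \<forall>\<zeta>. norm \<zeta> < r \<longrightarrow> Lam f \<zeta> N 0 \<noteq> 0 \<and> norm (Lam f \<zeta> N 0 * exp (- \<zeta> * of_real (m N))) \<le> exp (C4 * V N)"
  using big
 proof eventually_elim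
  case (elim N)
  then have N: "4 \<le> N" and g: "1 < psi f N t0" by auto
  have V0: "0 \<le> V N" using V_ge'[of N] c2 g by (smt (verit) mult_pos_pos)
  show ?case
  proof (intro allI impI)
   fix \<zeta> :: complex assume \<zeta>: "norm \<zeta> < r"
   have e: "exp (- (C1 * (norm \<zeta>)\<^sup>2 * W N)) \<le> norm (Lam (F N) \<zeta> N 0)" "norm (Lam (F N) \<zeta> N 0) \<le> exp (C1 * (norm \<zeta>)\<^sup>2 * W N)"
    using est[OF F, of N \<zeta>] N \<zeta> by (auto simp: W_def)
   have nz: "Lam (F N) \<zeta> N 0 \<noteq> 0" using e(1) by (smt (verit) exp_gt_zero norm_zero)
   have W0: "0 \<le> W N" unfolding W_def by (intro sum_nonneg ww_bounds(1)[OF F(1)])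
   have "C1 * (norm \<zeta>)\<^sup>2 * W N \<le> C1 * r\<^sup>2 * (2 * C / c2 * V N)"
    using \<zeta> C1 W0 by (intro mult_mono W_le N g power_mono) auto
   also have "\<dots> = C3 * V N" by (simp add: C3_def)
   also have "\<dots> \<le> C4 * V N" using C4 V0 by (intro mult_right_mono) auto
   finally have "norm (Lam (F N) \<zeta> N 0) \<le> exp (C4 * V N)" using e(2) by (smt (verit) exp_le_cancel_iff)
   then show "Lam f \<zeta> N 0 \<noteq> 0 \<and> norm (Lam f \<zeta> N 0 * exp (- \<zeta> * of_real (m N))) \<le> exp (C4 * V N)"
    using nz unfolding FL mean[OF N] by (simp only: mult.commute mult_eq_0_iff) auto
  qed
 qed
 have comp: "\<forall>\<^sub>F N in sequentially. \<forall>\<zeta>. norm \<zeta> < r \<longrightarrow> norm (HH f \<zeta> N 0 x - Lam f \<zeta> N 0) \<le> C4 * norm \<zeta> * norm (Lam f \<zeta> N 0)"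
  using eventually_ge_at_top[of 4]
 proof eventually_elim
  case (elim N)
  show ?case
  proof (intro allI impI)
   fix \<zeta> :: complex assume \<zeta>: "norm \<zeta> < r"
   let ?e = "exp (- \<zeta> * of_real (d N))"
   have "norm (HH (F N) \<zeta> N 0 x - Lam (F N) \<zeta> N 0) \<le> C1 * norm \<zeta> * norm (Lam (F N) \<zeta> N 0)"
    using est[OF F, of N \<zeta>] elim \<zeta> x by auto
   then have "norm ?e * norm (HH f \<zeta> N 0 x - Lam f \<zeta> N 0) \<le> norm ?e * (C1 * norm \<zeta> * norm (Lam f \<zeta> N 0))"
    unfolding FL FH right_diff_distrib[symmetric] norm_mult by (simp only: mult.left_commute)
   then have "norm (HH f \<zeta> N 0 x - Lam f \<zeta> N 0) \<le> C1 * norm \<zeta> * norm (Lam f \<zeta> N 0)"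
    by (rule mult_left_le_imp_le) simp
   also have "\<dots> \<le> C4 * norm \<zeta> * norm (Lam f \<zeta> N 0)" using C4 by (intro mult_right_mono) auto
   finally show "norm (HH f \<zeta> N 0 x - Lam f \<zeta> N 0) \<le> C4 * norm \<zeta> * norm (Lam f \<zeta> N 0)" .
  qed
 qed
 have tail: "small_tail V (\<lambda>N t. exp (- c * psi f N t))"
 proof (rule subquadratic_small_tail[where d = c1 and C = "2 * C1 * C" and r = t0])
  show "psi f N t \<le> psi f N' t" if "N \<le> N'" for N N' t
   unfolding psi_def using that by (intro sum_mono2) (auto simp: DD_nonneg)
  show "continuous_on UNIV (psi f N)" for N
  proof -
   have "continuous_on UNIV (\<lambda>t. DD f t n)" for n
    by (rule lipschitz_on_continuous_on[where L = "6 * K / \<epsilon> ^ 6"])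
      (use DD_Lipschitz[OF f] K eps in \<open>auto simp: lipschitz_on_def dist_real_def\<close>)
   then show ?thesis unfolding psi_def by (intro continuous_on_sum)
  qed
  show "psi f N (a + b) \<le> 2 * psi f N a + 2 * psi f N b" for N a b
   unfolding psi_def sum_distrib_left sum.distrib[symmetric] by (intro sum_mono DD_subadd[OF f])
  show "psi f N (- a) = psi f N a" for N a unfolding psi_def DD_even ..
  show "c1 * t\<^sup>2 * psi f N t0 \<le> psi f N t" if "\<bar>t\<bar> \<le> t0" for N t
   unfolding c1_def by (rule psi_quadratic[OF f t0(1,3) that])
  show "\<forall>\<^sub>F N in sequentially. 0 \<le> V N \<and> V N \<le> 2 * C1 * C * (psi f N t0 + 1)" using big
  proof eventually_elim
   case (elim N)
   have "V N \<le> 2 * (C1 * W N)" using V_le elim by blast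
   also have "\<dots> \<le> 2 * (C1 * (C * (psi f N t0 + 1)))" unfolding W_def using Fw elim C1 by simp
   finally show ?case unfolding V by (simp add: mult.assoc)
  qed
 qed (use psi_nonneg t0 c1 div C1 C c in auto)
 have far: "\<forall>\<^sub>F N in sequentially. \<forall>\<xi> t. \<bar>\<xi>\<bar> \<le> 1 \<longrightarrow> norm (HH f (Complex \<xi> t) N 0 x) \<le> exp (- c * psi f N t) * norm (HH f (of_real \<xi>) N 0 x)"
 proof (intro always_eventually allI impI)
  fix N \<xi> t assume \<xi>: "\<bar>\<xi>\<bar> \<le> (1 :: real)"
  have "norm (HH f (of_real \<xi>) N 0 x) = HHr f \<xi> N 0 x"
   unfolding HH_of_real using HHr_pos'[OF f \<xi> x, of N] by simp
  then show "norm (HH f (Complex \<xi> t) N 0 x) \<le> exp (- c * psi f N t) * norm (HH f (of_real \<xi>) N 0 x)"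
   using decay[OF \<xi> x] by simp
 qed
 show ?thesis
  by (rule moderate_local_limit[OF P T Q T' m V Vinf mP[symmetric] mQ[symmetric] r C4(1) nz comp tail far zm ab])
    (rule that[OF Vinf])
qed

end

section \<open>Processes with elliptic transition densities\<close>

text \<open>The Markov property is stated for rectangles only, so that a process given through
  conditional expectations can be fitted in by integrating over an event of the past.\<close>

locale markov_process = elliptic_chain +
 fixes P :: "'w measure" and \<F> :: "nat \<Rightarrow> 'w measure" and X :: "nat \<Rightarrow> 'w \<Rightarrow> 'a"
 assumes prob_P: "prob_space P" and subalg: "subalgebra P (\<F> n)"
  and X_measurable: "i \<le> n \<Longrightarrow> X i \<in> measurable (\<F> n) (M i)"
  and rectangle: "A \<in> sets (\<F> n) \<Longrightarrow> E \<in> sets (M (Suc n)) \<Longrightarrow>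
   measure P (A \<inter> (X (Suc n) -` E \<inter> space P)) = (\<integral>\<omega>. indicator A \<omega> * (\<integral>y. p n (X n \<omega>) y * indicator E y \<partial>M (Suc n)) \<partial>P)"
begin

lemma fin_P: "finite_measure P"
 using prob_P by (rule prob_space.finite_measure)

lemma space_F: "space (\<F> n) = space P"
 using subalg[of n] by (simp add: subalgebra_def)

lemma from_F: "G \<in> measurable (\<F> n) N \<Longrightarrow> G \<in> measurable P N"
 by (rule measurable_from_subalg[OF subalg])

lemma bm_from_F: "bm (\<F> n) G \<Longrightarrow> bm P G"
 unfolding bm_def using from_F space_F by blast

lemma X_P [measurable]: "X n \<in> measurable P (M n)"
 using from_F[OF X_measurable[of n n]] by simp

text \<open>The joint law of \<open>\<omega>\<close> and the next state, on the product of the past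
  with the state space, has the density \<open>p n (X n \<omega>) y\<close>: both measures agree on
  rectangles, which generate the product. The measure \<open>P\<close> is restricted to the past so
  that \<open>H\<close> may depend on the whole history.\<close>

lemma step_integral:
 fixes H :: "'w \<times> 'a \<Rightarrow> complex"
 assumes H: "bm (\<F> n \<Otimes>\<^sub>M M (Suc n)) H"
 shows "(\<integral>\<omega>. H (\<omega>, X (Suc n) \<omega>) \<partial>P) = (\<integral>\<omega>. \<integral>y. of_real (p n (X n \<omega>) y) * H (\<omega>, y) \<partial>M (Suc n) \<partial>P)"
proof -
 interpret P: prob_space P by (rule prob_P)
 interpret M': prob_space "M (Suc n)" by (rule prob_M)
 define R where "R = restr_to_subalg P (\<F> n)"
 have sR: "sets R = sets (\<F> n)" unfolding R_def by (rule sets_restr_to_subalg[OF subalg])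
 have spR: "space R = space P" using sR space_F sets_eq_imp_space_eq by metis
 have pR: "prob_space R"
 proof (rule prob_spaceI)
  have "space P \<in> sets (\<F> n)" using sets.top[of "\<F> n"] unfolding space_F .
  from emeasure_restr_to_subalg[OF subalg this] show "emeasure R (space R) = 1"
   unfolding spR unfolding R_def by (simp add: P.emeasure_space_1)
 qed
 interpret R: prob_space R by (rule pR)
 interpret RM: pair_prob_space R "M (Suc n)" ..
 let ?RM = "R \<Otimes>\<^sub>M M (Suc n)"
 have XR: "X n \<in> measurable R (M n)" using X_measurable[of n n] sR by (simp cong: measurable_cong_sets)
 have idR: "(\<lambda>\<omega>. \<omega>) \<in> measurable P R"
  using subalg[of n] sR spR by (intro measurableI) (auto simp: subalgebra_def)
 have RP: "(\<integral>\<omega>. G \<omega> \<partial>R) = (\<integral>\<omega>. G \<omega> \<partial>P)" if "G \<in> borel_measurable R" for G :: "'w \<Rightarrow> 'c::{banach,second_countable_topology}"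
  unfolding R_def using that sR by (intro integral_subalgebra2[OF subalg]) (simp cong: measurable_cong_sets)
 have bp: "bm ?RM (\<lambda>w. p n (X n (fst w)) (snd w))"
  by (intro bm_p measurable_compose[OF measurable_fst XR] measurable_snd)
 note pm[measurable] = bm_measurable[OF bp]
 let ?m1 = "distr P ?RM (\<lambda>\<omega>. (\<omega>, X (Suc n) \<omega>))"
 let ?m2 = "density ?RM (\<lambda>w. ennreal (p n (X n (fst w)) (snd w)))"
 have idX: "(\<lambda>\<omega>. (\<omega>, X (Suc n) \<omega>)) \<in> measurable P ?RM" using idR X_P by (intro measurable_Pair)
 have eq: "?m1 = ?m2"
 proof (rule measure_eqI_generator_eq[OF Int_stable_pair_measure_generator[of R "M (Suc n)"], where \<Omega> = "space R \<times> space (M (Suc n))" and A = "\<lambda>_. space R \<times> space (M (Suc n))"])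
  show "{a \<times> b |a b. a \<in> sets R \<and> b \<in> sets (M (Suc n))} \<subseteq> Pow (space R \<times> space (M (Suc n)))"
   by (rule pair_measure_closed)
  fix Z assume "Z \<in> {a \<times> b |a b. a \<in> sets R \<and> b \<in> sets (M (Suc n))}"
  then obtain A E where Z: "Z = A \<times> E" and A: "A \<in> sets R" and E: "E \<in> sets (M (Suc n))" by blast
  have AF: "A \<in> sets (\<F> n)" using A sR by simp
  have AP: "A \<subseteq> space P" using sets.sets_into_space[OF A] spR by simp
  have ZRM: "Z \<in> sets ?RM" unfolding Z using A E by simp
  have bG: "bm ?RM (\<lambda>w. p n (X n (fst w)) (snd w) * indicator Z w)"
   by (intro bm_mult bp bmI[where B = 1] borel_measurable_indicator[OF ZRM]) (simp add: indicator_def)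
  have "emeasure ?m1 Z = emeasure P (A \<inter> (X (Suc n) -` E \<inter> space P))"
  proof -
   have "(\<lambda>\<omega>. (\<omega>, X (Suc n) \<omega>)) -` Z \<inter> space P = A \<inter> (X (Suc n) -` E \<inter> space P)" using AP by (auto simp: Z)
   then show ?thesis by (simp only: emeasure_distr[OF idX ZRM])
  qed
  also have "\<dots> = ennreal (\<integral>\<omega>. indicator A \<omega> * (\<integral>y. p n (X n \<omega>) y * indicator E y \<partial>M (Suc n)) \<partial>P)"
   unfolding P.emeasure_eq_measure rectangle[OF AF E] ..
  also have "(\<integral>\<omega>. indicator A \<omega> * (\<integral>y. p n (X n \<omega>) y * indicator E y \<partial>M (Suc n)) \<partial>P) =
    (\<integral>\<omega>. \<integral>y. p n (X n \<omega>) y * indicator Z (\<omega>, y) \<partial>M (Suc n) \<partial>P)"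
   unfolding integral_mult_right_zero[symmetric] by (intro integral_congI) (simp add: Z indicator_times)
  also have "\<dots> = (\<integral>\<omega>. \<integral>y. p n (X n \<omega>) y * indicator Z (\<omega>, y) \<partial>M (Suc n) \<partial>R)"
   by (rule RP[symmetric], rule bm_measurable, rule bm_integral[OF prob_M]) (use bG in simp)
  also have "\<dots> = (\<integral>w. p n (X n (fst w)) (snd w) * indicator Z w \<partial>?RM)"
   using bm_integral_pair[OF pR prob_M bG] by simp
  also have "ennreal \<dots> = (\<integral>\<^sup>+w. ennreal (p n (X n (fst w)) (snd w) * indicator Z w) \<partial>?RM)"
   using bm_integrable[OF _ bG] RM.finite_measure_axioms
   by (intro nn_integral_eq_integral[symmetric]) (auto intro!: mult_nonneg_nonneg p_nonneg)
  also have "\<dots> = emeasure ?m2 Z"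
  proof -
   have "ennreal (p n (X n (fst w)) (snd w) * indicator Z w) = ennreal (p n (X n (fst w)) (snd w)) * indicator Z w" for w
    by (simp add: indicator_def)
   moreover have "(\<lambda>w. ennreal (p n (X n (fst w)) (snd w))) \<in> borel_measurable ?RM" by measurable
   ultimately show ?thesis by (simp only: emeasure_density[OF _ ZRM])
  qed
  finally show "emeasure ?m1 Z = emeasure ?m2 Z" .
 next
  fix i :: nat
  show "emeasure ?m1 (space R \<times> space (M (Suc n))) \<noteq> \<infinity>"
   using P.prob_space_distr[OF idX] prob_space.finite_measure finite_measure.emeasure_finite by fastforce
 qed (auto simp: sets_pair_measure space_pair_measure)
 have HR: "bm ?RM H" using H bm_sets_cong[OF sets_pair_measure_cong[OF sR refl], of "M (Suc n)" H] by simp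
 note Hm[measurable] = bm_measurable[OF HR]
 have bH: "bm ?RM (\<lambda>w. of_real (p n (X n (fst w)) (snd w)) * H w)" by (intro bm_mult bm_of_real bp HR)
 have "(\<integral>\<omega>. H (\<omega>, X (Suc n) \<omega>) \<partial>P) = (\<integral>w. H w \<partial>?m1)" by (rule integral_distr[OF idX Hm, symmetric])
 also have "\<dots> = (\<integral>w. p n (X n (fst w)) (snd w) *\<^sub>R H w \<partial>?RM)"
  unfolding eq by (rule integral_density) (auto simp: p_nonneg)
 also have "\<dots> = (\<integral>w. of_real (p n (X n (fst w)) (snd w)) * H w \<partial>?RM)" by (simp only: scaleR_conv_of_real)
 also have "\<dots> = (\<integral>\<omega>. \<integral>y. of_real (p n (X n \<omega>) y) * H (\<omega>, y) \<partial>M (Suc n) \<partial>R)"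
  using bm_integral_pair[OF pR prob_M bH] by simp
 also have "\<dots> = (\<integral>\<omega>. \<integral>y. of_real (p n (X n \<omega>) y) * H (\<omega>, y) \<partial>M (Suc n) \<partial>P)"
  by (rule RP, rule bm_measurable, rule bm_integral[OF prob_M]) (use bH in simp)
 finally show ?thesis .
qed

definition Sf :: "(nat \<Rightarrow> 'a \<Rightarrow> 'a \<Rightarrow> real) \<Rightarrow> nat \<Rightarrow> 'w \<Rightarrow> real" where
 "Sf f N \<omega> = (\<Sum>i<N. f i (X i \<omega>) (X (Suc i) \<omega>))"

lemma bm_sum: "finite I \<Longrightarrow> (\<And>i. i \<in> I \<Longrightarrow> bm N (g i)) \<Longrightarrow> bm N (\<lambda>\<omega>. \<Sum>i\<in>I. g i \<omega>)"
 by (induction I rule: finite_induct) (auto intro: bm_intros)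

lemma bm_Sf_F: "adm K f \<Longrightarrow> bm (\<F> n) (Sf f n)"
 unfolding Sf_def by (intro bm_sum bm_f X_measurable) auto

lemma bm_Sf: "adm K f \<Longrightarrow> bm P (Sf f n)"
 using bm_Sf_F bm_from_F by blast

theorem mgf_eq:
 assumes f: "adm K f"
 shows "(\<integral>\<omega>. exp (s * of_real (Sf f N \<omega>)) \<partial>P) = (\<integral>\<omega>. HH f s N 0 (X 0 \<omega>) \<partial>P)"
proof -
 \<comment> \<open>This interpolates between the two sides: the first \<open>k\<close> terms of the
   sum are explicit, the others are already averaged in \<open>HH\<close>.\<close>
 have "(\<integral>\<omega>. exp (s * of_real (Sf f k \<omega>)) * HH f s (N - k) k (X k \<omega>) \<partial>P) = (\<integral>\<omega>. HH f s N 0 (X 0 \<omega>) \<partial>P)" if "k \<le> N" for k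
  using that
 proof (induction k)
  case 0 then show ?case by (simp add: Sf_def)
 next
  case (Suc k)
  let ?h = "HH f s (N - Suc k) (Suc k)"
  let ?H = "\<lambda>w. exp (s * of_real (Sf f k (fst w))) * (exp (s * of_real (f k (X k (fst w)) (snd w))) * ?h (snd w))"
  have bH: "bm (\<F> k \<Otimes>\<^sub>M M (Suc k)) ?H"
   by (intro bm_mult bm_exp bm_const bm_of_real bm_comp[OF bm_Sf_F[OF f]] bm_f[OF f] bm_comp[OF bm_HH[OF f]]
     measurable_compose[OF measurable_fst X_measurable] measurable_fst measurable_snd order.refl)
  have "(\<integral>\<omega>. exp (s * of_real (Sf f (Suc k) \<omega>)) * ?h (X (Suc k) \<omega>) \<partial>P) = (\<integral>\<omega>. ?H (\<omega>, X (Suc k) \<omega>) \<partial>P)"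
   by (simp add: Sf_def distrib_left exp_add mult.assoc)
  also have "\<dots> = (\<integral>\<omega>. \<integral>y. of_real (p k (X k \<omega>) y) * ?H (\<omega>, y) \<partial>M (Suc k) \<partial>P)" by (rule step_integral[OF bH])
  also have "\<dots> = (\<integral>\<omega>. exp (s * of_real (Sf f k \<omega>)) * HH f s (N - k) k (X k \<omega>) \<partial>P)"
  proof (intro integral_congI)
   fix \<omega>
   have "N - k = Suc (N - Suc k)" using Suc.prems by simp
   then have "HH f s (N - k) k (X k \<omega>) = LL f s k ?h (X k \<omega>)" by simp
   then show "(\<integral>y. of_real (p k (X k \<omega>) y) * ?H (\<omega>, y) \<partial>M (Suc k)) = exp (s * of_real (Sf f k \<omega>)) * HH f s (N - k) k (X k \<omega>)"
    by (simp only: LL_def fst_conv snd_conv mult.left_commute[of _ "exp (s * of_real (Sf f k \<omega>))"] integral_mult_right_zero)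
  qed
  also have "\<dots> = (\<integral>\<omega>. HH f s N 0 (X 0 \<omega>) \<partial>P)" using Suc by simp
  finally show ?case .
 qed
 from this[of N] show ?thesis by simp
qed

definition law :: "nat \<Rightarrow> 'a measure" where
 "law n = distr P (M n) (X n)"

lemma law_integral: "g \<in> borel_measurable (M n) \<Longrightarrow> (\<integral>x. g x \<partial>law n) = (\<integral>\<omega>. g (X n \<omega>) \<partial>P)"
 for g :: "'a \<Rightarrow> 'c::{banach,second_countable_topology}"
 unfolding law_def by (intro integral_distr) auto

lemma chain_law_law: "chain_law M p \<epsilon> law"
proof (intro chain_law.intro elliptic_chain_axioms chain_law_axioms.intro)
 interpret P: prob_space P by (rule prob_P)
 show "prob_space (law n)" for n unfolding law_def by (rule P.prob_space_distr[OF X_P])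
 show "sets (law n) = sets (M n)" for n by (simp add: law_def)
 fix n and g :: "'a \<Rightarrow> complex" assume g: "bm (M (Suc n)) g"
 have "(\<integral>x. PP n g x \<partial>law n) = (\<integral>\<omega>. PP n g (X n \<omega>) \<partial>P)" by (rule law_integral[OF bm_measurable[OF bm_PP[OF g]]])
 also have "\<dots> = (\<integral>\<omega>. g (snd (\<omega>, X (Suc n) \<omega>)) \<partial>P)"
  unfolding PP_def using step_integral[OF bm_comp[OF g measurable_snd]] by simp
 also have "\<dots> = (\<integral>y. g y \<partial>law (Suc n))" using law_integral[OF bm_measurable[OF g]] by simp
 finally show "(\<integral>x. PP n g x \<partial>law n) = (\<integral>y. g y \<partial>law (Suc n))" .
qed

sublocale law: chain_law M p \<epsilon> law
 by (rule chain_law_law)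

lemma Lam_law: "adm K f \<Longrightarrow> law.Lam f s N 0 = (\<integral>\<omega>. exp (s * of_real (Sf f N \<omega>)) \<partial>P)"
 unfolding law.Lam_def mgf_eq by (intro law_integral bm_measurable[OF bm_HH])

end

section \<open>Summable hexagon quantities and lattice-valued functionals\<close>

context markov_process
begin

text \<open>Bounded total second moments bound the exponential moments at the fixed arguments
  \<open>r\<close> and \<open>- r\<close> uniformly in \<open>N\<close>; the exponential Markov
  inequality then gives tightness.\<close>

lemma centered_sum_tight:
 assumes F: "adm K F" and K: "0 < K" and cent: "law.edge_centered F" and A: "\<And>N. (\<Sum>n<N. law.ww F n) \<le> A" and e: "0 < e"
 obtains B where "\<And>N. 2 \<le> N \<Longrightarrow> measure P {w\<in>space P. \<bar>Sf F N w\<bar> > B} < e"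
proof -
 interpret P: prob_space P by (rule prob_P)
 obtain r C where r: "0 < r" and C: "0 < C"
  and est: "\<And>f N c. adm K f \<Longrightarrow> law.edge_centered f \<Longrightarrow> 2 \<le> N \<Longrightarrow> norm c \<le> r \<Longrightarrow>
   exp (- (C * (norm c)\<^sup>2 * (\<Sum>n<N. law.ww f n))) \<le> norm (law.Lam f c N 0) \<and>
   norm (law.Lam f c N 0) \<le> exp (C * (norm c)\<^sup>2 * (\<Sum>n<N. law.ww f n)) \<and>
   (\<forall>x\<in>space (M 0). norm (HH f c N 0 x - law.Lam f c N 0) \<le> C * norm c * norm (law.Lam f c N 0))"
  by (rule law.mgf_estimates[OF K]) (rule that)
 define H where "H = exp (C * r\<^sup>2 * A)"
 have mgf: "(\<integral>w. exp (s * Sf F N w) \<partial>P) \<le> H" if N: "2 \<le> N" and s: "\<bar>s\<bar> = r" for s N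
 proof -
  have "complex_of_real (\<integral>w. exp (s * Sf F N w) \<partial>P) = law.Lam F (of_real s) N 0"
   unfolding Lam_law[OF F] integral_complex_of_real'[symmetric] by (simp add: exp_of_real[symmetric])
  then have "(\<integral>w. exp (s * Sf F N w) \<partial>P) \<le> norm (law.Lam F (of_real s) N 0)" by (metis norm_of_real abs_ge_self)
  also have "\<dots> \<le> exp (C * r\<^sup>2 * (\<Sum>n<N. law.ww F n))" using est[OF F cent N, of "of_real s"] s by simp
  also have "\<dots> \<le> H" unfolding H_def using A[of N] C by (simp add: mult_left_mono)
  finally show ?thesis .
 qed
 have bS: "bm P (Sf F N)" for N by (rule bm_Sf[OF F])
 have [measurable]: "Sf F N \<in> borel_measurable P" for N by (rule bm_measurable[OF bS])
 have tail: "measure P {w\<in>space P. \<bar>Sf F N w\<bar> > B} \<le> exp (- r * B) * (2 * H)" if N: "2 \<le> N" for N B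
 proof -
  let ?A = "{w\<in>space P. \<bar>Sf F N w\<bar> > B}"
  have be: "bm P (\<lambda>w. exp (s * Sf F N w))" for s by (intro bm_exp bm_mult bm_const bS)
  have "measure P ?A = (\<integral>w. indicator ?A w \<partial>P)" by simp
  also have "\<dots> \<le> (\<integral>w. exp (- r * B) * (exp (r * Sf F N w) + exp (- r * Sf F N w)) \<partial>P)"
  proof (rule bm_integral_mono[OF fin_P])
   show "bm P (indicator ?A :: _ \<Rightarrow> real)" by (rule bmI[where B = 1]) (auto simp: indicator_def)
   show "bm P (\<lambda>w. exp (- r * B) * (exp (r * Sf F N w) + exp (- r * Sf F N w)))"
    by (intro bm_mult bm_const bm_add be)
   fix w
   have "exp (r * B) \<le> exp (r * Sf F N w) + exp (- r * Sf F N w)" if "B < \<bar>Sf F N w\<bar>"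
   proof -
    have "exp (r * B) \<le> exp (r * \<bar>Sf F N w\<bar>)" using that r by simp
    also have "\<dots> \<le> exp (r * Sf F N w) + exp (- r * Sf F N w)"
     by (cases "0 \<le> Sf F N w") (simp_all add: add_increasing add_increasing2)
    finally show ?thesis .
   qed
   then have "1 \<le> exp (- r * B) * (exp (r * Sf F N w) + exp (- r * Sf F N w))" if "B < \<bar>Sf F N w\<bar>"
    using mult_left_mono[of "exp (r * B)" _ "exp (- r * B)"] that by (simp add: exp_minus)
   then show "indicator ?A w \<le> exp (- r * B) * (exp (r * Sf F N w) + exp (- r * Sf F N w))"
    by (auto simp: indicator_def intro!: mult_nonneg_nonneg add_nonneg_nonneg)
  qed
  also have "\<dots> = exp (- r * B) * ((\<integral>w. exp (r * Sf F N w) \<partial>P) + (\<integral>w. exp (- r * Sf F N w) \<partial>P))"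
   unfolding integral_mult_right_zero
   by (subst Bochner_Integration.integral_add[OF bm_integrable[OF fin_P be] bm_integrable[OF fin_P be]]) (rule refl)
  also have "\<dots> \<le> exp (- r * B) * (H + H)" using r by (intro mult_left_mono add_mono mgf N) auto
  finally show ?thesis by simp
 qed
 define B where "B = ln (4 * H / e) / r"
 have G: "0 < H" by (simp add: H_def)
 have "exp (- r * B) * (2 * H) = e / 2"
  unfolding B_def using G e r by (simp add: exp_minus)
 then have "exp (- r * B) * (2 * H) < e" using e by simp
 then show ?thesis using tail[of _ B] by (intro that[of B]) (meson le_less_trans)
qed

text \<open>After adding the coboundary of \<open>\<beta> / h\<close> and subtracting
  \<open>c\<close>, the phase \<open>h * t\<close> is close to multiples of \<open>2 * pi\<close> in
  mean square, with summable errors. Rounding it yields \<open>g\<close>; the remainders, once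
  centred, have tight sums, and the coboundary telescopes to a bounded term.\<close>

theorem rounding:
 assumes f: "adm K f" and h: "h \<noteq> 0" and sum: "summable (DD f h)"
 obtains g m where "\<And>n. (\<lambda>w. g n (fst w) (snd w)) \<in> borel_measurable (M n \<Otimes>\<^sub>M M (Suc n))"
  "\<And>n x y. \<exists>k::int. g n x y = 2 * pi / h * of_int k"
  "\<And>e. 0 < e \<Longrightarrow> \<exists>B. \<forall>N. measure P {v\<in>space P. \<bar>Sf f N v - Sf g N v - m N\<bar> > B} < e"
proof -
 obtain \<beta> c where \<beta>m: "\<And>n. \<beta> n \<in> borel_measurable (M n)" and \<beta>pi: "\<And>n x. \<bar>\<beta> n x\<bar> \<le> pi"
  and c: "\<And>n. \<bar>c n\<bar> \<le> K"
  and "\<And>n x. \<bar>h\<bar> * (2 * K) \<le> pi / 4 \<Longrightarrow> x \<in> space (M n) \<Longrightarrow> \<bar>\<beta> n x\<bar> \<le> pi / 4"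
  and D: "\<And>n. (\<integral>x. \<integral>y. p n x y * (1 - cos (h * f n x y + \<beta> (Suc n) y - \<beta> n x - h * c n)) \<partial>M (Suc n) \<partial>M n)
   \<le> 24 / \<epsilon> ^ 3 * (DD f h n + (1 / 2) ^ n)"
  by (rule phase_functions[OF f, of h]) (rule that)
 define B where "B = pi / \<bar>h\<bar>"
 have B: "0 < B" using h by (simp add: B_def)
 define u where "u n x = \<beta> n x / h" for n x
 have uB: "\<bar>u n x\<bar> \<le> B" for n x unfolding u_def B_def abs_divide by (intro divide_right_mono \<beta>pi) simp
 define t where "t n x y = f n x y + u (Suc n) y - u n x - c n" for n x y
 have ht: "h * t n x y = h * f n x y + \<beta> (Suc n) y - \<beta> n x - h * c n" for n x y
  using h by (simp add: t_def u_def algebra_simps)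
 have tm[measurable]: "(\<lambda>w. t n (fst w) (snd w)) \<in> borel_measurable (M n \<Otimes>\<^sub>M M (Suc n))" for n
 proof -
  have [measurable]: "(\<lambda>w. f n (fst w) (snd w)) \<in> borel_measurable (M n \<Otimes>\<^sub>M M (Suc n))" by (rule bm_measurable[OF law.bm_f_pair[OF f]])
  show ?thesis unfolding t_def u_def using \<beta>m[of n, measurable] \<beta>m[of "Suc n", measurable] by measurable
 qed
 \<comment> \<open>Time 0 is exempt because the estimate of the remainder uses a law with bounded
   density; the value 0 also lies in the lattice.\<close>
 define g where "g n x y = (if n = 0 then 0 else 2 * pi / h * of_int (round (h * t n x y / (2 * pi))))" for n x y
 have gm[measurable]: "(\<lambda>w. g n (fst w) (snd w)) \<in> borel_measurable (M n \<Otimes>\<^sub>M M (Suc n))" for n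
  unfolding g_def round_def by measurable
 define e where "e n x y = (if n = 0 then 0 else t n x y - g n x y)" for n x y
 have he: "\<bar>h * e n x y\<bar> \<le> pi" "cos (h * e n x y) = cos (h * t n x y)" if "n \<noteq> 0" for n x y
 proof -
  let ?k = "round (h * t n x y / (2 * pi))"
  have e: "h * e n x y = h * t n x y - 2 * pi * of_int ?k" using that h by (simp add: e_def g_def right_diff_distrib)
  have "\<bar>h * e n x y\<bar> = 2 * pi * \<bar>of_int ?k - h * t n x y / (2 * pi)\<bar>"
  proof -
   have "h * e n x y = - (2 * pi * (of_int ?k - h * t n x y / (2 * pi)))" unfolding e by (simp add: right_diff_distrib)
   then show ?thesis by (simp add: abs_mult)
  qed
  also have "\<dots> \<le> 2 * pi * (1 / 2)" by (intro mult_left_mono of_int_round_abs_le) simp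
  finally show "\<bar>h * e n x y\<bar> \<le> pi" by simp
  show "cos (h * e n x y) = cos (h * t n x y)" unfolding e cos_diff by (simp add: cos_int_2pin sin_int_2pin)
 qed
 have eB: "\<bar>e n x y\<bar> \<le> B" for n x y
 proof (cases "n = 0")
  case False
  then show ?thesis using he(1)[OF False, of x y] h by (simp add: B_def abs_mult pos_le_divide_eq mult.commute)
 qed (use B in \<open>simp add: e_def\<close>)
 have eadm: "adm B e"
  unfolding adm_def
 proof (intro conjI allI eB)
  show "(\<lambda>w. e n (fst w) (snd w)) \<in> borel_measurable (M n \<Otimes>\<^sub>M M (Suc n))" for n unfolding e_def by measurable
 qed
 define F where "F n x y = e n x y - law.EE n (e n)" for n x y
 have F: "adm (2 * B) F" "law.edge_centered F"
  using law.adm_gauge[OF eadm, of "\<lambda>_ _. 0" 0] unfolding F_def[abs_def] by simp_all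
 have EE0: "law.EE 0 (e 0) = 0" unfolding e_def[abs_def] by simp
 define C0 where "C0 = pi\<^sup>2 / (2 * h\<^sup>2) * (1 / \<epsilon> * (24 / \<epsilon> ^ 3))"
 have C0: "0 < C0" unfolding C0_def using h eps by simp
 have wF: "law.ww F n \<le> C0 * (DD f h n + (1 / 2) ^ n)" for n
 proof (cases n)
  case 0
  have "F 0 x y = 0" for x y by (simp add: F_def EE0 e_def)
  then have "law.ww F n = 0" unfolding law.ww_def 0 by simp
  then show ?thesis using C0 DD_nonneg[of f h n] by simp
 next
  case (Suc j)
  have n0: "n \<noteq> 0" using Suc by simp
  have be: "bm (M n \<Otimes>\<^sub>M M (Suc n)) (\<lambda>w. e n (fst w) (snd w))" by (rule law.bm_f_pair[OF eadm])
  have "law.ww F n \<le> law.EE n (\<lambda>x y. (e n x y - 0)\<^sup>2)" unfolding law.ww_def F_def by (rule law.ww_centered_le[OF be])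
  also have "\<dots> = law.EE n (\<lambda>x y. (e n x y)\<^sup>2)" by simp
  also have "\<dots> \<le> C0 * (DD f h n + (1 / 2) ^ n)"
   unfolding C0_def mult.assoc
   by (rule law.second_moment_le_phase[OF Suc h be he(1)[OF n0] _ D]) (simp only: he(2)[OF n0] ht)
  finally show ?thesis .
 qed
 define A where "A = C0 * (\<Sum>n. DD f h n + (1 / 2) ^ n)"
 have A: "(\<Sum>n<N. law.ww F n) \<le> A" for N
 proof -
  have s: "summable (\<lambda>n. DD f h n + (1 / 2) ^ n)" by (intro summable_add sum summable_geometric) simp
  have "(\<Sum>n<N. law.ww F n) \<le> (\<Sum>n<N. C0 * (DD f h n + (1 / 2) ^ n))" by (intro sum_mono wF)
  also have "\<dots> \<le> A" unfolding A_def sum_distrib_left[symmetric]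
   using C0 by (intro mult_left_mono sum_le_suminf s) (auto intro!: add_nonneg_nonneg DD_nonneg)
  finally show ?thesis .
 qed
 define m where "m N = (\<Sum>n<N. law.EE n (e n) + (if n = 0 then 0 else c n))" for N
 \<comment> \<open>Since \<open>g 0 = 0\<close> and \<open>F 0 = 0\<close>, the first term of
   \<open>f\<close> survives unchanged. The gauge terms telescope from time 1 on, which leaves one
   term bounded by \<open>K\<close> and two bounded by \<open>B\<close>.\<close>
 have diff: "\<bar>Sf f N v - Sf g N v - m N\<bar> \<le> \<bar>Sf F N v\<bar> + (K + 2 * B)" for N v
 proof (cases N)
  case 0
  then show ?thesis using adm_nonneg[OF f] B by (simp add: Sf_def m_def)
 next
  case (Suc k)
  have "Sf f (Suc k) v - Sf g (Suc k) v - m (Suc k) - Sf F (Suc k) v = f 0 (X 0 v) (X 1 v) + u 1 (X 1 v) - u (Suc k) (X (Suc k) v)"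
  proof (induction k)
   case 0
   show ?case by (simp add: Sf_def m_def g_def F_def e_def)
  next
   case (Suc k)
   have "f (Suc k) x y - g (Suc k) x y - law.EE (Suc k) (e (Suc k)) - c (Suc k) - F (Suc k) x y = u (Suc k) x - u (Suc (Suc k)) y" for x y
    by (simp add: F_def e_def t_def)
   from this[of "X (Suc k) v" "X (Suc (Suc k)) v"] Suc.IH show ?case
    unfolding Sf_def m_def sum.lessThan_Suc[of _ "Suc k"] by simp
  qed
  then show ?thesis
   using adm_le[OF f, of 0 "X 0 v" "X 1 v"] uB[of 1 "X 1 v"] uB[of "Suc k" "X (Suc k) v"] unfolding Suc by linarith
 qed
 show ?thesis
 proof (rule that[OF gm])
  show "\<exists>k::int. g n x y = 2 * pi / h * of_int k" for n x y
   unfolding g_def by (cases "n = 0") (auto intro: exI[of _ 0])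
  fix \<delta> :: real assume \<delta>: "0 < \<delta>"
  obtain B' where B': "\<And>N. 2 \<le> N \<Longrightarrow> measure P {v\<in>space P. \<bar>Sf F N v\<bar> > B'} < \<delta>"
   by (rule centered_sum_tight[OF F(1) _ F(2) A \<delta>]) (use B in simp, rule that)
  show "\<exists>B. \<forall>N. measure P {v\<in>space P. \<bar>Sf f N v - Sf g N v - m N\<bar> > B} < \<delta>"
  proof (intro exI allI)
   fix N
   let ?L = "{v\<in>space P. \<bar>Sf f N v - Sf g N v - m N\<bar> > max 0 B' + (K + 2 * B)}"
   show "measure P ?L < \<delta>"
   proof (cases "2 \<le> N")
    case True
    have [measurable]: "Sf F N \<in> borel_measurable P" by (rule bm_measurable[OF bm_Sf[OF F(1)]])
    have "measure P ?L \<le> measure P {v\<in>space P. \<bar>Sf F N v\<bar> > B'}"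
    proof (rule finite_measure.finite_measure_mono[OF fin_P])
     show "?L \<subseteq> {v\<in>space P. \<bar>Sf F N v\<bar> > B'}"
     proof
      fix v assume "v \<in> ?L"
      then show "v \<in> {v\<in>space P. \<bar>Sf F N v\<bar> > B'}" using diff[of N v] by auto
     qed
    qed measurable
    then show ?thesis using B'[OF True] by simp
   next
    case False
    then have "N = 0 \<or> N = 1" by auto
    then have "Sf F N v = 0" for v by (auto simp: Sf_def F_def EE0 e_def)
    then have d: "\<bar>Sf f N v - Sf g N v - m N\<bar> \<le> K + 2 * B" for v using diff[of N v] by simp
    have "?L = {}"
    proof (intro equals0I)
     fix v assume "v \<in> ?L"
     then have "max 0 B' + (K + 2 * B) < \<bar>Sf f N v - Sf g N v - m N\<bar>" by simp
     then show False using d[of v] max.cobounded1[of 0 B'] by linarith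
    qed
    then show ?thesis using \<delta> by (simp only: measure_empty)
   qed
  qed
 qed
qed

lemma psi_at_top_or_summable:
 "filterlim (\<lambda>N. psi f N t) at_top sequentially \<or> summable (DD f t)"
proof (rule disjCI)
 assume ns: "\<not> summable (DD f t)"
 show "filterlim (\<lambda>N. psi f N t) at_top sequentially"
  unfolding filterlim_at_top_ge[where c = 0]
 proof (intro allI impI)
  fix B :: real assume "0 \<le> B"
  have "\<exists>N. B + (DD f t 0 + DD f t 1) < (\<Sum>n<N. DD f t n)"
  proof (rule ccontr)
   assume "\<not> ?thesis"
   then have "(\<Sum>k\<le>n. DD f t k) \<le> B + (DD f t 0 + DD f t 1)" for n
    unfolding lessThan_Suc_atMost[symmetric] by (auto simp: not_less simp del: sum.lessThan_Suc)
   then have "summable (DD f t)" by (intro bounded_imp_summable DD_nonneg)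
   then show False using ns by blast
  qed
  then obtain N0 where N0: "B + (DD f t 0 + DD f t 1) < (\<Sum>n<N0. DD f t n)" by blast
  show "\<forall>\<^sub>F N in sequentially. B \<le> psi f N t"
   using eventually_ge_at_top[of "N0 + 2"]
  proof eventually_elim
   case (elim N)
   have "(\<Sum>n<N0. DD f t n) \<le> (\<Sum>n\<in>{0, 1} \<union> {2..<N - 2}. DD f t n)"
    using elim by (intro sum_mono2) (auto simp: DD_nonneg)
   also have "\<dots> = DD f t 0 + DD f t 1 + psi f N t"
    unfolding psi_def by (subst sum.union_disjoint) auto
   finally show ?case using N0 by linarith
  qed
 qed
qed

end

section \<open>The rate function\<close>

text \<open>With \<open>U = T - z\<close>, both hypotheses say that
  \<open>U * exp (\<xi> * U)\<close> has mean zero. This mean is strictly increasing in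
  \<open>\<xi>\<close>: by convexity of the exponential,
  \<open>U * (exp (y * U) - exp (x * U)) \<ge> c * U\<^sup>2\<close> for \<open>x < y\<close>, with
  \<open>c > 0\<close> because \<open>U\<close> is bounded, and \<open>U\<^sup>2\<close> has
  positive mean.\<close>

lemma tilt_unique:
 fixes T :: "'b \<Rightarrow> real"
 assumes P: "prob_space P" and T: "bm P T" and pos: "0 < (\<integral>w. (T w - m)\<^sup>2 \<partial>P)" and m: "m = (\<integral>w. T w \<partial>P)"
  and e1: "(\<integral>w. T w * exp (\<xi>1 * T w) \<partial>P) = z * (\<integral>w. exp (\<xi>1 * T w) \<partial>P)"
  and e2: "(\<integral>w. T w * exp (\<xi>2 * T w) \<partial>P) = z * (\<integral>w. exp (\<xi>2 * T w) \<partial>P)"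
 shows "\<xi>1 = \<xi>2"
proof -
 interpret prob_space P by fact
 have fin: "finite_measure P" by unfold_locales
 define U where "U w = T w - z" for w
 have U: "bm P U" unfolding U_def by (intro bm_intros T)
 obtain B where B: "0 \<le> B" "\<And>w. w \<in> space P \<Longrightarrow> norm (U w) \<le> B" using bmE[OF U] by blast
 have be: "bm P (\<lambda>w. U w * exp (\<xi> * U w))" for \<xi> by (intro bm_intros U)
 have zero: "(\<integral>w. U w * exp (\<xi> * U w) \<partial>P) = 0"
  if e: "(\<integral>w. T w * exp (\<xi> * T w) \<partial>P) = z * (\<integral>w. exp (\<xi> * T w) \<partial>P)" for \<xi>
 proof -
  have b: "bm P (\<lambda>w. T w * exp (\<xi> * T w))" "bm P (\<lambda>w. z * exp (\<xi> * T w))" by (intro bm_intros T)+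
  have "U w * exp (\<xi> * U w) = exp (- \<xi> * z) * (T w * exp (\<xi> * T w) - z * exp (\<xi> * T w))" for w
   by (simp add: U_def algebra_simps exp_diff exp_minus divide_inverse)
  then have "(\<integral>w. U w * exp (\<xi> * U w) \<partial>P) = exp (- \<xi> * z) * ((\<integral>w. T w * exp (\<xi> * T w) \<partial>P) - (\<integral>w. z * exp (\<xi> * T w) \<partial>P))"
   using Bochner_Integration.integral_diff[OF bm_integrable[OF fin b(1)] bm_integrable[OF fin b(2)]] by (simp only: integral_mult_right_zero)
  then show ?thesis using e by simp
 qed
 have vpos: "0 < (\<integral>w. (U w)\<^sup>2 \<partial>P)"
 proof -
  have b: "bm P (\<lambda>w. (T w - m)\<^sup>2)" by (intro bm_intros T)
  have "(\<integral>w. (U w)\<^sup>2 \<partial>P) = (\<integral>w. (T w - m)\<^sup>2 + (2 * (m - z) * (T w - m) + (m - z)\<^sup>2) \<partial>P)"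
   by (intro integral_congI) (simp add: U_def power2_eq_square algebra_simps)
  also have "\<dots> = (\<integral>w. (T w - m)\<^sup>2 \<partial>P) + (m - z)\<^sup>2"
   using bm_integrable[OF fin T] bm_integrable[OF fin b] m by (simp add: prob_space)
  finally show ?thesis using pos by (simp add: add_pos_nonneg)
 qed
 have False if lt: "x < y" and zx: "(\<integral>w. U w * exp (x * U w) \<partial>P) = 0" and zy: "(\<integral>w. U w * exp (y * U w) \<partial>P) = 0" for x y
 proof -
  define c where "c = exp (- (max \<bar>x\<bar> \<bar>y\<bar> * B)) * (y - x)"
  have c: "0 < c" using lt by (simp add: c_def)
  have conv: "exp b * (a - b) \<le> exp a - exp b" for a b :: real
   using exp_ge_add_one_self[of "a - b"] mult_left_mono[of "1 + (a - b)" "exp (a - b)" "exp b"]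
   by (simp add: algebra_simps flip: exp_add)
  have "(\<integral>w. c * (U w)\<^sup>2 \<partial>P) \<le> (\<integral>w. U w * exp (y * U w) - U w * exp (x * U w) \<partial>P)"
  proof (rule bm_integral_mono[OF fin])
   show "bm P (\<lambda>w. c * (U w)\<^sup>2)" by (intro bm_intros U)
   show "bm P (\<lambda>w. U w * exp (y * U w) - U w * exp (x * U w))" by (intro bm_diff be)
   fix w assume w: "w \<in> space P"
   let ?u = "U w"
   have low: "exp (- (max \<bar>x\<bar> \<bar>y\<bar> * B)) \<le> exp (s * ?u)" if "s = x \<or> s = y" for s
   proof -
    have "\<bar>s * ?u\<bar> \<le> max \<bar>x\<bar> \<bar>y\<bar> * B" unfolding abs_mult using that B(2)[OF w] by (intro mult_mono) auto
    then show ?thesis by (simp add: abs_le_iff)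
   qed
   have "c * ?u\<^sup>2 \<le> ?u * (exp (y * ?u) - exp (x * ?u))"
   proof (cases "0 \<le> ?u")
    case True
    have "exp (- (max \<bar>x\<bar> \<bar>y\<bar> * B)) * ((y - x) * ?u) \<le> exp (x * ?u) * ((y - x) * ?u)"
     using low[of x] lt True by (intro mult_right_mono) auto
    also have "\<dots> \<le> exp (y * ?u) - exp (x * ?u)" using conv[of "x * ?u" "y * ?u"] by (simp only: left_diff_distrib)
    finally have "?u * (exp (- (max \<bar>x\<bar> \<bar>y\<bar> * B)) * ((y - x) * ?u)) \<le> ?u * (exp (y * ?u) - exp (x * ?u))"
     using True by (intro mult_left_mono) auto
    then show ?thesis by (simp add: c_def power2_eq_square mult_ac)
   next
    case False
    have "exp (- (max \<bar>x\<bar> \<bar>y\<bar> * B)) * ((x - y) * ?u) \<le> exp (y * ?u) * ((x - y) * ?u)"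
     using low[of y] lt False by (intro mult_right_mono) (auto simp: mult_nonpos_nonpos)
    also have "\<dots> \<le> exp (x * ?u) - exp (y * ?u)" using conv[of "y * ?u" "x * ?u"] by (simp only: left_diff_distrib)
    finally have "- ?u * (exp (- (max \<bar>x\<bar> \<bar>y\<bar> * B)) * ((x - y) * ?u)) \<le> - ?u * (exp (x * ?u) - exp (y * ?u))"
     using False by (intro mult_left_mono) auto
    then show ?thesis by (simp add: c_def power2_eq_square algebra_simps)
   qed
   then show "c * ?u\<^sup>2 \<le> ?u * exp (y * ?u) - ?u * exp (x * ?u)" by (simp only: right_diff_distrib)
  qed
  also have "\<dots> = 0"
   using Bochner_Integration.integral_diff[OF bm_integrable[OF fin be] bm_integrable[OF fin be], of y x] zx zy by simp
  finally have "c * (\<integral>w. (U w)\<^sup>2 \<partial>P) \<le> 0" by simp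
  then show False using c vpos by (simp add: mult_le_0_iff)
 qed
 from this[of \<xi>1 \<xi>2] this[of \<xi>2 \<xi>1] zero[OF e1] zero[OF e2] show ?thesis by (cases \<xi>1 \<xi>2 rule: linorder_cases) auto
qed

lemma mgf_real_derivative:
 fixes T :: "'b \<Rightarrow> real"
 assumes fin: "finite_measure P" and T: "bm P T"
 shows "((\<lambda>\<xi>. \<integral>w. exp (\<xi> * T w) \<partial>P) has_real_derivative (\<integral>w. T w * exp (\<xi> * T w) \<partial>P)) (at \<xi>)"
proof -
 let ?G = "\<lambda>s. \<integral>w. of_real (1::real) * exp (s * of_real (T w)) \<partial>P :: complex"
 have "((\<lambda>x. ?G (of_real x)) has_vector_derivative (\<integral>w. of_real (1 * T w) * exp (of_real \<xi> * of_real (T w)) \<partial>P)) (at \<xi>)"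
  by (rule has_vector_derivative_real_field[OF mgf_has_derivative[OF fin T bm_const[of P "1::real"]]])
 moreover have "?G (of_real x) = of_real (\<integral>w. exp (x * T w) \<partial>P)" for x
  unfolding integral_complex_of_real'[symmetric] by (simp add: exp_of_real[symmetric])
 moreover have "(\<integral>w. of_real (1 * T w) * exp (of_real \<xi> * of_real (T w)) \<partial>P) = complex_of_real (\<integral>w. T w * exp (\<xi> * T w) \<partial>P)"
  unfolding integral_complex_of_real'[symmetric] by (simp add: exp_of_real[symmetric])
 ultimately have "((\<lambda>x. complex_of_real (\<integral>w. exp (x * T w) \<partial>P)) has_vector_derivative of_real (\<integral>w. T w * exp (\<xi> * T w) \<partial>P)) (at \<xi>)"
  by simp
 from bounded_linear.has_vector_derivative[OF bounded_linear_Re this] show ?thesis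
  by (simp add: has_real_derivative_iff_has_vector_derivative)
qed

text \<open>The description in \<open>rate_fun\<close> is satisfied by exactly the solutions of the
  tilt equation, of which there is at most one. Hence a tilt found by any means evaluates the
  Legendre transform, and the sum may be replaced by its bounded version \<open>T\<close>, which
  agrees with it almost surely.\<close>

lemma rate_fun_eq:
 fixes T :: "'b \<Rightarrow> real"
 assumes P: "prob_space P" and T: "bm P T" and Sm: "partial_sum X f N \<in> borel_measurable P"
  and ae: "AE w in P. partial_sum X f N w = T w" and V: "0 < var_sum P X f N"
  and e: "(\<integral>w. T w * exp (\<xi> * T w) \<partial>P) = z * (\<integral>w. exp (\<xi> * T w) \<partial>P)"
 shows "- var_sum P X f N * rate_fun P X f N (z / var_sum P X f N) = ln (exp (- \<xi> * z) * (\<integral>w. exp (\<xi> * T w) \<partial>P))"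
proof -
 interpret prob_space P by fact
 have fin: "finite_measure P" by unfold_locales
 have Tm[measurable]: "T \<in> borel_measurable P" by (rule bm_measurable[OF T])
 note Sm[measurable]
 define m where "m = (\<integral>w. T w \<partial>P)"
 have m: "mean_sum P X f N = m" unfolding mean_sum_def m_def by (rule integral_cong_AE[OF Sm Tm ae])
 have Veq: "var_sum P X f N = (\<integral>w. (T w - m)\<^sup>2 \<partial>P)"
  unfolding var_sum_def m by (rule integral_cong_AE) (use ae in auto)
 let ?V = "var_sum P X f N"
 let ?Z = "\<lambda>\<xi>. \<integral>w. exp (\<xi> * T w) \<partial>P"
 have Z: "0 < ?Z \<xi>" for \<xi> by (rule tilted_distribution(1)[OF P T])
 have lm: "log_mgf P X f N = (\<lambda>\<xi>. 1 / ?V * ln (?Z \<xi>))"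
 proof
  fix \<xi>
  have "(\<integral>w. exp (\<xi> * partial_sum X f N w) \<partial>P) = ?Z \<xi>" by (rule integral_cong_AE) (use ae in auto)
  then show "log_mgf P X f N \<xi> = 1 / ?V * ln (?Z \<xi>)" unfolding log_mgf_def by (simp only:)
 qed
 have d: "deriv (log_mgf P X f N) \<xi> = 1 / ?V * ((\<integral>w. T w * exp (\<xi> * T w) \<partial>P) / ?Z \<xi>)" for \<xi>
  unfolding lm
  by (rule DERIV_imp_deriv) (use Z[of \<xi>] V in \<open>auto intro!: derivative_eq_intros mgf_real_derivative[OF fin T]\<close>)
 have iff: "deriv (log_mgf P X f N) \<xi>' = z / ?V \<longleftrightarrow> (\<integral>w. T w * exp (\<xi>' * T w) \<partial>P) = z * ?Z \<xi>'" for \<xi>'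
  unfolding d using V Z[of \<xi>'] by (simp add: field_simps)
 have "(THE \<xi>. deriv (log_mgf P X f N) \<xi> = z / ?V) = \<xi>"
 proof (rule the_equality)
  show "deriv (log_mgf P X f N) \<xi> = z / ?V" using e iff by blast
  fix \<xi>' assume "deriv (log_mgf P X f N) \<xi>' = z / ?V"
  then have "(\<integral>w. T w * exp (\<xi>' * T w) \<partial>P) = z * ?Z \<xi>'" using iff by blast
  from tilt_unique[OF P T V[unfolded Veq] m_def this e] show "\<xi>' = \<xi>" .
 qed
 then have "rate_fun P X f N (z / ?V) = \<xi> * (z / ?V) - 1 / ?V * ln (?Z \<xi>)"
  unfolding rate_fun_def Let_def by (simp only: lm)
 then have "- ?V * rate_fun P X f N (z / ?V) = - \<xi> * z + ln (?Z \<xi>)" using V by (simp add: field_simps)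
 also have "\<dots> = ln (exp (- \<xi> * z) * ?Z \<xi>)" using Z[of \<xi>] by (simp add: ln_mult)
 finally show ?thesis .
qed

section \<open>From Markov chains to processes with densities\<close>

lemma space_borel_of_metric [simp]: "space (borel_of_metric m) = mspace m"
 unfolding borel_of_metric_def by (simp add: space_measure_of_conv)

locale density_data =
 fixes S :: "nat \<Rightarrow> 'a metric" and \<pi> :: "nat \<Rightarrow> 'a \<Rightarrow> 'a measure"
  and \<epsilon>0 :: real and \<mu> :: "nat \<Rightarrow> 'a measure" and p :: "nat \<Rightarrow> 'a \<times> 'a \<Rightarrow> real"
 assumes kernels: "transition_kernels S \<pi>"
  and eps0: "0 < \<epsilon>0" "\<epsilon>0 < 1"
  and mu: "\<forall>n\<ge>1. prob_space (\<mu> n) \<and> sets (\<mu> n) = sets (borel_of_metric (S n))"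
  and pm: "\<forall>n\<ge>1. p n \<in> borel_measurable (borel_of_metric (S n) \<Otimes>\<^sub>M borel_of_metric (S (Suc n)))"
  and dens: "\<forall>n\<ge>1. \<forall>x\<in>mspace (S n). \<pi> n x = density (\<mu> (Suc n)) (\<lambda>y. ennreal (p n (x, y)))"
  and pb: "\<forall>n\<ge>1. \<forall>x\<in>mspace (S n). \<forall>y\<in>mspace (S (Suc n)). 0 \<le> p n (x, y) \<and> p n (x, y) \<le> 1 / \<epsilon>0"
  and p2_gt: "\<forall>n\<ge>1. \<forall>x\<in>mspace (S n). \<forall>z\<in>mspace (S (Suc (Suc n))).
      (\<integral>y. p n (x, y) * p (Suc n) (y, z) \<partial>\<mu> (Suc n)) > \<epsilon>0"
begin

text \<open>Times are shifted by one, so that the chain indexed from 1 becomes a process indexed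
  from 0.\<close>

definition M :: "nat \<Rightarrow> 'a measure" where
 "M n = \<mu> (Suc n)"

text \<open>Extension by zero makes the bounds on the density hold at all points without affecting
  integrals over the state spaces.\<close>

definition q :: "nat \<Rightarrow> 'a \<Rightarrow> 'a \<Rightarrow> real" where
 "q n x y = (if x \<in> mspace (S (Suc n)) \<and> y \<in> mspace (S (Suc (Suc n))) then p (Suc n) (x, y) else 0)"

lemma prob_state: "prob_space (M n)"
 using mu by (simp add: M_def)

lemma sets_M: "sets (M n) = sets (borel_of_metric (S (Suc n)))"
 using mu by (simp add: M_def)

lemma space_M: "space (M n) = mspace (S (Suc n))"
 using sets_eq_imp_space_eq[OF sets_M] by simp

lemma q_measurable: "(\<lambda>w. q n (fst w) (snd w)) \<in> borel_measurable (M n \<Otimes>\<^sub>M M (Suc n))"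
proof -
 have "p (Suc n) \<in> borel_measurable (M n \<Otimes>\<^sub>M M (Suc n))"
 proof -
  have "p (Suc n) \<in> borel_measurable (borel_of_metric (S (Suc n)) \<Otimes>\<^sub>M borel_of_metric (S (Suc (Suc n))))" using pm by simp
  then show ?thesis by (simp only: measurable_cong_sets[OF sets_pair_measure_cong[OF sets_M sets_M] refl])
 qed
 then show ?thesis
  by (subst measurable_cong[where g = "p (Suc n)"]) (auto simp: q_def space_pair_measure space_M)
qed

lemma q_bounds: "0 \<le> q n x y" "q n x y \<le> 1 / \<epsilon>0"
 using pb eps0 by (auto simp: q_def)

lemma q_section: "x \<in> space (M n) \<Longrightarrow> bm (M (Suc n)) (q n x)"
 using measurable_compose[OF measurable_Pair1'[of x "M n" "M (Suc n)"] q_measurable] q_bounds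
 by (intro bmI[where B = "1 / \<epsilon>0"]) auto

lemma kernel_eq: "x \<in> space (M n) \<Longrightarrow> \<pi> (Suc n) x = density (M (Suc n)) (\<lambda>y. ennreal (q n x y))"
proof -
 assume x: "x \<in> space (M n)"
 note qm = bm_measurable[OF q_section[OF x]]
 have "(\<lambda>y. ennreal (p (Suc n) (x, y))) \<in> borel_measurable (M (Suc n)) \<longleftrightarrow> (\<lambda>y. ennreal (q n x y)) \<in> borel_measurable (M (Suc n))"
  using x by (intro measurable_cong) (simp add: q_def space_M)
 moreover have q: "(\<lambda>y. ennreal (q n x y)) \<in> borel_measurable (M (Suc n))" using qm by measurable
 ultimately have p: "(\<lambda>y. ennreal (p (Suc n) (x, y))) \<in> borel_measurable (M (Suc n))" by (simp only:)
 have "AE y in M (Suc n). ennreal (p (Suc n) (x, y)) = ennreal (q n x y)"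
  using x by (intro AE_I2) (simp add: q_def space_M)
 from density_cong[OF p q this] show ?thesis using dens x by (simp add: M_def[symmetric] space_M)
qed

lemma kernel_measure:
 assumes x: "x \<in> space (M n)" and E: "E \<in> sets (M (Suc n))"
 shows "measure (\<pi> (Suc n) x) E = (\<integral>y. q n x y * indicator E y \<partial>M (Suc n))"
proof -
 have fin: "finite_measure (M (Suc n))" using prob_state prob_space.finite_measure by blast
 note qm[measurable] = bm_measurable[OF q_section[OF x]]
 have b: "bm (M (Suc n)) (\<lambda>y. q n x y * indicator E y)"
  by (intro bm_mult q_section[OF x] bmI[where B = 1] borel_measurable_indicator[OF E]) (simp add: indicator_def)
 have "emeasure (\<pi> (Suc n) x) E = (\<integral>\<^sup>+y. ennreal (q n x y) * indicator E y \<partial>M (Suc n))"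
  unfolding kernel_eq[OF x] using E by (intro emeasure_density) measurable
 also have "\<dots> = (\<integral>\<^sup>+y. ennreal (q n x y * indicator E y) \<partial>M (Suc n))"
  by (intro nn_integral_cong) (simp add: indicator_def)
 also have "\<dots> = ennreal (\<integral>y. q n x y * indicator E y \<partial>M (Suc n))"
  by (rule nn_integral_eq_integral[OF bm_integrable[OF fin b]]) (simp add: q_bounds)
 finally show ?thesis unfolding measure_def by (simp add: q_bounds integral_nonneg_AE)
qed

sublocale elliptic_chain M q \<epsilon>0
proof (rule elliptic_chain.intro)
 show "prob_space (M n)" for n by (rule prob_state)
 show "(\<integral>y. q n x y \<partial>M (Suc n)) = 1" if x: "x \<in> space (M n)" for n x
 proof -
  have "\<pi> (Suc n) \<in> measurable (borel_of_metric (S (Suc n))) (prob_algebra (borel_of_metric (S (Suc (Suc n)))))"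
   using kernels by (simp add: transition_kernels_def)
  from measurable_space[OF this, of x] x have "prob_space (\<pi> (Suc n) x)" "space (\<pi> (Suc n) x) = space (M (Suc n))"
   by (auto simp: space_prob_algebra space_M dest: sets_eq_imp_space_eq)
  then have "measure (\<pi> (Suc n) x) (space (M (Suc n))) = 1" using prob_space.prob_space by metis
  then have "1 = (\<integral>y. q n x y * indicator (space (M (Suc n))) y \<partial>M (Suc n))"
   using kernel_measure[OF x sets.top] by simp
  also have "\<dots> = (\<integral>y. q n x y \<partial>M (Suc n))"
   by (intro integral_congI) simp
  finally show ?thesis by simp
 qed
 show "\<epsilon>0 \<le> (\<integral>y. q n x y * q (Suc n) y z \<partial>M (Suc n))"
  if x: "x \<in> space (M n)" and z: "z \<in> space (M (Suc (Suc n)))" for n x z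
 proof -
  have "(\<integral>y. q n x y * q (Suc n) y z \<partial>M (Suc n)) = (\<integral>y. p (Suc n) (x, y) * p (Suc (Suc n)) (y, z) \<partial>\<mu> (Suc (Suc n)))"
   unfolding M_def[symmetric] using x z by (intro integral_congI) (auto simp: q_def space_M)
  also have "\<dots> > \<epsilon>0" using p2_gt x z by (simp add: space_M)
  finally show ?thesis by simp
 qed
qed (use q_measurable q_bounds eps0 in auto)

text \<open>Integrating the conditional probability of the next state over an event of the past
  gives the rectangle formula; the version of the conditional expectation no longer matters
  there.\<close>

lemma markov_process_chain:
 assumes chain: "markov_chain S \<nu> \<pi> P X"
 shows "markov_process M q \<epsilon>0 P (\<lambda>n. past S P X (Suc n)) (\<lambda>n. X (Suc n))"
proof (intro markov_process.intro elliptic_chain_axioms markov_process_axioms.intro)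
 show P: "prob_space P" using chain by (simp add: markov_chain_def)
 interpret P: prob_space P by (rule P)
 have X: "X n \<in> measurable P (borel_of_metric (S n))" if "1 \<le> n" for n using chain that by (simp add: markov_chain_def)
 have XM: "X (Suc n) \<in> measurable P (M n)" for n using X[of "Suc n"] measurable_cong_sets[OF refl sets_M] by auto
 have path: "(\<lambda>w. \<lambda>i\<in>{1..n}. X i w) \<in> measurable P (PiM {1..n} (\<lambda>i. borel_of_metric (S i)))" for n
  by (intro measurable_restrict X) auto
 show sub: "subalgebra P (past S P X (Suc n))" for n
  unfolding subalgebra_def past_def using sets_image_in_sets[OF refl path] by simp
 show "X (Suc i) \<in> measurable (past S P X (Suc n)) (M i)" if i: "i \<le> n" for i n
 proof -
  have 1: "(\<lambda>w. \<lambda>i\<in>{1..Suc n}. X i w) \<in> measurable (past S P X (Suc n)) (PiM {1..Suc n} (\<lambda>i. borel_of_metric (S i)))"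
   unfolding past_def by (rule measurable_vimage_algebra1) (use measurable_space[OF path] in auto)
  have 2: "(\<lambda>v. v (Suc i)) \<in> measurable (PiM {1..Suc n} (\<lambda>i. borel_of_metric (S i))) (borel_of_metric (S (Suc i)))"
   using i by (intro measurable_component_singleton) auto
  have "(\<lambda>w. (\<lambda>i\<in>{1..Suc n}. X i w) (Suc i)) \<in> measurable (past S P X (Suc n)) (borel_of_metric (S (Suc i)))"
   by (rule measurable_compose[OF 1 2])
  moreover have "(\<lambda>w. (\<lambda>i\<in>{1..Suc n}. X i w) (Suc i)) = X (Suc i)" using i by (simp add: fun_eq_iff)
  ultimately show ?thesis using measurable_cong_sets[OF refl sets_M] by auto
 qed
 fix A E n assume A: "A \<in> sets (past S P X (Suc n))" and E: "E \<in> sets (M (Suc n))"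
 interpret sub: sigma_finite_subalgebra P "past S P X (Suc n)"
  by (intro finite_measure_subalgebra_is_sigma_finite finite_measure_subalgebra.intro finite_measure_subalgebra_axioms.intro sub) unfold_locales
 let ?g = "\<lambda>w. indicator E (X (Suc (Suc n)) w) :: real"
 let ?B = "X (Suc (Suc n)) -` E \<inter> space P"
 have AP: "A \<in> sets P" using A sub by (auto simp: subalgebra_def)
 have B: "?B \<in> sets P" by (rule measurable_sets[OF XM E])
 have gm: "?g \<in> borel_measurable P" using measurable_compose[OF XM borel_measurable_indicator[OF E]] .
 have gi: "integrable P ?g" by (rule P.integrable_const_bound[where B = 1]) (use gm in \<open>auto simp: indicator_def\<close>)
 have "measure P (A \<inter> ?B) = (\<integral>w. indicator (A \<inter> ?B) w \<partial>P)" using AP B by simp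
 also have "\<dots> = (\<integral>w\<in>A. ?g w \<partial>P)"
  unfolding set_lebesgue_integral_def by (intro integral_congI) (auto simp: indicator_def)
 also have "\<dots> = (\<integral>w\<in>A. real_cond_exp P (past S P X (Suc n)) ?g w \<partial>P)" by (rule sub.real_cond_exp_intA[OF gi A])
 also have "\<dots> = (\<integral>w. indicator A w * (\<integral>y. q n (X (Suc n) w) y * indicator E y \<partial>M (Suc n)) \<partial>P)"
  unfolding set_lebesgue_integral_def
 proof (rule integral_cong_AE)
  have "AE w in P. real_cond_exp P (past S P X (Suc n)) ?g w = measure (\<pi> (Suc n) (X (Suc n) w)) E"
   using chain E sets_M[of "Suc n"] unfolding markov_chain_def by auto
  then show "AE w in P. indicator A w *\<^sub>R real_cond_exp P (past S P X (Suc n)) ?g w =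
    indicator A w * (\<integral>y. q n (X (Suc n) w) y * indicator E y \<partial>M (Suc n))"
  proof (rule AE_mp, intro AE_I2 impI)
   fix w assume w: "w \<in> space P" and e: "real_cond_exp P (past S P X (Suc n)) ?g w = measure (\<pi> (Suc n) (X (Suc n) w)) E"
   show "indicator A w *\<^sub>R real_cond_exp P (past S P X (Suc n)) ?g w =
    indicator A w * (\<integral>y. q n (X (Suc n) w) y * indicator E y \<partial>M (Suc n))"
    unfolding e kernel_measure[OF measurable_space[OF XM w] E] by simp
  qed
  show "(\<lambda>w. indicator A w *\<^sub>R real_cond_exp P (past S P X (Suc n)) ?g w) \<in> borel_measurable P"
   using AP by measurable
  have "bm (M n) (\<lambda>x. \<integral>y. q n x y * indicator E y \<partial>M (Suc n))"
   by (intro bm_integral[OF prob_M] bm_mult bm_p measurable_fst measurable_snd bmI[where B = 1])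
     (use measurable_compose[OF measurable_snd borel_measurable_indicator[OF E]] in \<open>auto simp: indicator_def\<close>)
  from measurable_compose[OF XM bm_measurable[OF this]] AP
  show "(\<lambda>w. indicator A w * (\<integral>y. q n (X (Suc n) w) y * indicator E y \<partial>M (Suc n))) \<in> borel_measurable P" by measurable
 qed
 finally show "measure P (A \<inter> ?B) = (\<integral>w. indicator A w * (\<integral>y. q n (X (Suc n) w) y * indicator E y \<partial>M (Suc n)) \<partial>P)" .
qed

end

section \<open>The local limit theorem\<close>

lemma closed_subgroup_multiples:
 assumes "c \<noteq> 0" shows "closed_real_subgroup {x. \<exists>k::int. x = c * of_int k}"
proof -
 let ?G = "{x. \<exists>k::int. x = c * of_int k}"
 have "?G = (\<lambda>x. x / c) -` \<int>"
  using assms by (auto simp: Ints_def field_simps)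
 then have "closed ?G" by (auto intro!: closed_vimage continuous_intros)
 moreover have "0 \<in> ?G" by (intro CollectI exI[of _ 0]) simp
 moreover have "x + y \<in> ?G" if "x \<in> ?G" "y \<in> ?G" for x y
 proof -
  from that obtain k l :: int where "x = c * of_int k" "y = c * of_int l" by blast
  then show ?thesis by (intro CollectI exI[of _ "k + l"]) (simp add: distrib_left)
 qed
 moreover have "- x \<in> ?G" if "x \<in> ?G" for x
 proof -
  from that obtain k :: int where "x = c * of_int k" by blast
  then show ?thesis by (intro CollectI exI[of _ "- k"]) simp
 qed
 ultimately show ?thesis unfolding closed_real_subgroup_def by (intro conjI ballI)
qed

lemma as_uniformly_boundedE:
 assumes "as_uniformly_bounded P X f"
 obtains K where "0 < K" "\<And>n. 1 \<le> n \<Longrightarrow> AE w in P. \<bar>f n (X n w, X (Suc n) w)\<bar> \<le> K"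
proof -
 let ?e = "\<lambda>n. esssup P (\<lambda>w. ereal \<bar>f n (X n w, X (Suc n) w)\<bar>)"
 have "(SUP n\<in>{1..}. ?e n) < \<infinity>" using assms by (simp add: as_uniformly_bounded_def)
 then obtain k where k: "(SUP n\<in>{1..}. ?e n) < ereal (real k)" using less_PInf_Ex_of_nat by auto
 show ?thesis
 proof (rule that[of "real k + 1"])
  fix n :: nat assume "1 \<le> n"
  then have "?e n \<le> (SUP n\<in>{1..}. ?e n)" by (intro SUP_upper) simp
  then have e: "?e n \<le> ereal (real k)" using k by simp
  have "AE w in P. ereal \<bar>f n (X n w, X (Suc n) w)\<bar> \<le> ?e n" by (rule esssup_AE)
  then show "AE w in P. \<bar>f n (X n w, X (Suc n) w)\<bar> \<le> real k + 1"
  proof (rule AE_mp, intro AE_I2 impI)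
   fix w assume "ereal \<bar>f n (X n w, X (Suc n) w)\<bar> \<le> ?e n"
   then have "ereal \<bar>f n (X n w, X (Suc n) w)\<bar> \<le> ereal (real k)" using e by (rule order.trans)
   then show "\<bar>f n (X n w, X (Suc n) w)\<bar> \<le> real k + 1" by simp
  qed
 qed simp
qed

context density_data
begin

text \<open>Truncation leaves the partial sums unchanged almost surely when the bound
  \<open>K\<close> holds almost surely, and turns that bound into a pointwise one.\<close>

definition clamp :: "real \<Rightarrow> (nat \<Rightarrow> 'a \<times> 'a \<Rightarrow> real) \<Rightarrow> nat \<Rightarrow> 'a \<Rightarrow> 'a \<Rightarrow> real" where
 "clamp K f n x y = max (- K) (min K (f (Suc n) (x, y)))"

lemma functional_measurable:
 assumes "additive_functional S f"
 shows "f (Suc n) \<in> borel_measurable (M n \<Otimes>\<^sub>M M (Suc n))"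
proof -
 have "f (Suc n) \<in> borel_measurable (borel_of_metric (S (Suc n)) \<Otimes>\<^sub>M borel_of_metric (S (Suc (Suc n))))"
  using assms by (simp add: additive_functional_def)
 then show ?thesis by (simp only: measurable_cong_sets[OF sets_pair_measure_cong[OF sets_M sets_M] refl])
qed

lemma adm_clamp:
 assumes "additive_functional S f" "0 < K" shows "adm K (clamp K f)"
 unfolding adm_def
proof (intro conjI allI)
 show "(\<lambda>w. clamp K f n (fst w) (snd w)) \<in> borel_measurable (M n \<Otimes>\<^sub>M M (Suc n))" for n
  using functional_measurable[OF assms(1), of n] unfolding clamp_def by simp
 show "\<bar>clamp K f n x y\<bar> \<le> K" for n x y using assms(2) by (auto simp: clamp_def)
qed

context
 fixes \<nu> :: "'a measure" and P :: "'w measure" and X :: "nat \<Rightarrow> 'w \<Rightarrow> 'a"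
 assumes chain: "markov_chain S \<nu> \<pi> P X"
begin

interpretation markov_process M q \<epsilon>0 P "\<lambda>n. past S P X (Suc n)" "\<lambda>n. X (Suc n)"
 by (rule markov_process_chain[OF chain])

lemma partial_sum_shift: "partial_sum X f N w = (\<Sum>i<N. f (Suc i) (X (Suc i) w, X (Suc (Suc i)) w))"
 unfolding partial_sum_def by (rule sum.reindex_bij_witness[of _ Suc "\<lambda>n. n - 1"]) auto

lemma partial_sum_measurable:
 assumes "additive_functional S f" shows "partial_sum X f N \<in> borel_measurable P"
 unfolding partial_sum_shift[abs_def]
 by (intro borel_measurable_sum measurable_compose[OF _ functional_measurable[OF assms]] measurable_Pair X_P)

lemma partial_sum_clamp:
 assumes "\<And>n. 1 \<le> n \<Longrightarrow> AE w in P. \<bar>f n (X n w, X (Suc n) w)\<bar> \<le> K"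
 shows "AE w in P. partial_sum X f N w = Sf (clamp K f) N w"
proof -
 have "AE w in P. \<forall>n. \<bar>f (Suc n) (X (Suc n) w, X (Suc (Suc n)) w)\<bar> \<le> K"
  using assms by (simp add: AE_all_countable)
 then show ?thesis
 proof (rule AE_mp, intro AE_I2 impI)
  fix w assume "\<forall>n. \<bar>f (Suc n) (X (Suc n) w, X (Suc (Suc n)) w)\<bar> \<le> K"
  then have "clamp K f n (X (Suc n) w) (X (Suc (Suc n)) w) = f (Suc n) (X (Suc n) w, X (Suc (Suc n)) w)" for n
   by (auto simp: clamp_def abs_le_iff max_def min_def minus_le_iff intro: antisym)
  then show "partial_sum X f N w = Sf (clamp K f) N w" unfolding Sf_def partial_sum_shift by simp
 qed
qed

text \<open>A frequency at which the hexagon quantities are summable would allow \<open>f\<close> to be replaced, up to a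
 center-tight functional, with a functional taking values in a lattice.\<close>

lemma irreducible_psi:
 assumes f: "additive_functional S f" and K: "0 < K" "\<And>n. 1 \<le> n \<Longrightarrow> AE v in P. \<bar>f n (X n v, X (Suc n) v)\<bar> \<le> K"
  and irr: "irreducible_functional S P X f" and range: "G_alg P X f = UNIV" and t: "t \<noteq> 0"
 shows "filterlim (\<lambda>N. psi (clamp K f) N t) at_top sequentially"
proof (rule ccontr)
 assume "\<not> ?thesis"
 then have sum: "summable (DD (clamp K f) t)" using psi_at_top_or_summable[of "clamp K f" t] by blast
 note ad = adm_clamp[OF f K(1)]
 obtain g m where gm: "\<And>n. (\<lambda>w. g n (fst w) (snd w)) \<in> borel_measurable (M n \<Otimes>\<^sub>M M (Suc n))"
  and gk: "\<And>n x y. \<exists>k::int. g n x y = 2 * pi / t * of_int k"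
  and tight: "\<And>e. 0 < e \<Longrightarrow> \<exists>B. \<forall>N. measure P {v\<in>space P. \<bar>Sf (clamp K f) N v - Sf g N v - m N\<bar> > B} < e"
  by (rule rounding[OF ad t sum]) (rule that)
 define h where "h n u = g (n - 1) (fst u) (snd u)" for n and u :: "'a \<times> 'a"
 have h: "additive_functional S h"
  unfolding additive_functional_def
 proof (intro allI impI)
  fix n :: nat assume n: "1 \<le> n"
  then have "h n \<in> borel_measurable (M (n - 1) \<Otimes>\<^sub>M M (Suc (n - 1)))" using gm[of "n - 1"] by (simp add: h_def[abs_def])
  then show "h n \<in> borel_measurable (borel_of_metric (S n) \<Otimes>\<^sub>M borel_of_metric (S (Suc n)))"
   unfolding measurable_cong_sets[OF sets_pair_measure_cong[OF sets_M sets_M] refl] using n by simp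
 qed
 interpret P: prob_space P by (rule prob_P)
 have diff: "AE v in P. partial_sum X (\<lambda>n u. f n u - h n u) N v = Sf (clamp K f) N v - Sf g N v" for N
 proof -
  have "AE v in P. partial_sum X f N v = Sf (clamp K f) N v" by (rule partial_sum_clamp[OF K(2)])
  then show ?thesis
 proof (rule AE_mp, intro AE_I2 impI)
  fix v assume "partial_sum X f N v = Sf (clamp K f) N v"
  moreover have "partial_sum X h N v = Sf g N v" unfolding partial_sum_shift Sf_def h_def by simp
  ultimately show "partial_sum X (\<lambda>n u. f n u - h n u) N v = Sf (clamp K f) N v - Sf g N v"
   by (simp add: partial_sum_def sum_subtractf)
 qed
 qed
 have fh: "additive_functional S (\<lambda>n u. f n u - h n u)"
  unfolding additive_functional_def
 proof (intro allI impI)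
  fix n :: nat assume n: "1 \<le> n"
  show "(\<lambda>u. f n u - h n u) \<in> borel_measurable (borel_of_metric (S n) \<Otimes>\<^sub>M borel_of_metric (S (Suc n)))"
   using f h n by (intro borel_measurable_diff) (simp_all add: additive_functional_def)
 qed
 have "center_tight P X (\<lambda>n u. f n u - h n u)"
  unfolding center_tight_def
 proof (intro exI[of _ m] allI impI)
  fix e :: real assume "0 < e"
  from tight[OF this] obtain B where B: "\<And>N. measure P {v\<in>space P. \<bar>Sf (clamp K f) N v - Sf g N v - m N\<bar> > B} < e" by blast
  show "\<exists>B. \<forall>N\<ge>1. \<P>(v in P. \<bar>partial_sum X (\<lambda>n u. f n u - h n u) N v - m N\<bar> > B) < e"
  proof (intro exI allI impI)
   fix N :: nat
   have [measurable]: "partial_sum X (\<lambda>n u. f n u - h n u) N \<in> borel_measurable P" by (rule partial_sum_measurable[OF fh])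
   have "partial_sum X h N \<in> borel_measurable P" by (rule partial_sum_measurable[OF h])
   moreover have "partial_sum X h N = Sf g N" unfolding partial_sum_shift[abs_def] Sf_def[abs_def] h_def by simp
   ultimately have [measurable]: "Sf g N \<in> borel_measurable P" by simp
   have [measurable]: "Sf (clamp K f) N \<in> borel_measurable P" by (rule bm_measurable[OF bm_Sf[OF ad]])
   have "\<P>(v in P. \<bar>partial_sum X (\<lambda>n u. f n u - h n u) N v - m N\<bar> > B) =
     measure P {v\<in>space P. \<bar>Sf (clamp K f) N v - Sf g N v - m N\<bar> > B}"
   proof (rule P.finite_measure_eq_AE)
    show "AE v in P. (v \<in> {v\<in>space P. \<bar>partial_sum X (\<lambda>n u. f n u - h n u) N v - m N\<bar> > B}) =
      (v \<in> {v\<in>space P. \<bar>Sf (clamp K f) N v - Sf g N v - m N\<bar> > B})"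
     using diff[of N] by (rule AE_mp, intro AE_I2 impI) simp
   qed measurable
   then show "\<P>(v in P. \<bar>partial_sum X (\<lambda>n u. f n u - h n u) N v - m N\<bar> > B) < e" using B[of N] by simp
  qed
 qed
 then have "G_ess S P X f \<subseteq> G_alg P X h" unfolding G_ess_def using h by blast
 moreover have "G_alg P X h \<subseteq> {x. \<exists>k::int. x = 2 * pi / t * of_int k}"
 proof -
  have "closed_real_subgroup {x. \<exists>k::int. x = 2 * pi / t * of_int k}" using t by (intro closed_subgroup_multiples) simp
  moreover have "\<P>(v in P. h n (X n v, X (Suc n) v) - 0 \<in> {x. \<exists>k::int. x = 2 * pi / t * of_int k}) = 1" for n
  proof -
   have "{v\<in>space P. h n (X n v, X (Suc n) v) - 0 \<in> {x. \<exists>k::int. x = 2 * pi / t * of_int k}} = space P"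
    using gk by (simp add: h_def)
   then show ?thesis using P.prob_space by simp
  qed
  ultimately show ?thesis unfolding G_alg_def by (intro Inter_lower CollectI conjI exI[of _ "\<lambda>_. 0"] allI impI)
 qed
 \<comment> \<open>Half the lattice spacing is a real number outside the lattice, so the essential
   range is not the whole line, contrary to irreducibility with range
   \<open>\<real>\<close>.\<close>
 moreover have "pi / t \<notin> {x. \<exists>k::int. x = 2 * pi / t * of_int k}"
 proof
  assume "pi / t \<in> {x. \<exists>k::int. x = 2 * pi / t * of_int k}"
  then obtain k :: int where "pi / t = 2 * pi / t * of_int k" by blast
  then have "1 = 2 * real_of_int k" using t by (simp add: field_simps)
  then have "1 = 2 * k" by linarith
  then show False by presburger
 qed
 ultimately show False using irr range unfolding irreducible_functional_def by blast
qed

end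

end

theorem theorem6p3:
 fixes S :: "nat \<Rightarrow> 'a metric"
  and \<nu> :: "'a measure" and \<pi> :: "nat \<Rightarrow> 'a \<Rightarrow> 'a measure"
  and P :: "'w measure" and X :: "nat \<Rightarrow> 'w \<Rightarrow> 'a"
  and f :: "nat \<Rightarrow> 'a \<times> 'a \<Rightarrow> real"
  and z :: "nat \<Rightarrow> real" and a b :: real
  and x :: 'a and Px :: "'v measure" and Y :: "nat \<Rightarrow> 'v \<Rightarrow> 'a"
 assumes chain: "markov_chain S \<nu> \<pi> P X"
  and elliptic: "uniformly_elliptic S \<pi>"
  and functional: "additive_functional S f"
  and bounded: "as_uniformly_bounded P X f"
  and irreducible: "irreducible_functional S P X f"
  and range: "G_alg P X f = UNIV"
  and z: "(\<lambda>N. (z N - mean_sum P X f N) / var_sum P X f N) \<longlonglongrightarrow> 0"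
  and ab: "a < b"
  and x: "x \<in> mspace (S 1)"
  and chain_x: "markov_chain S (return (borel_of_metric (S 1)) x) \<pi> Px Y"
  and bounded_x: "as_uniformly_bounded Px Y f"
 shows "((\<lambda>N. \<P>(\<omega> in Px. partial_sum Y f N \<omega> - z N \<in> {a<..<b}))
      \<sim>[sequentially]
     (\<lambda>N. \<bar>a - b\<bar> / sqrt (2 * pi * var_sum P X f N)
        * exp (- var_sum P X f N * rate_fun P X f N (z N / var_sum P X f N))))
    \<and> (\<exists>\<delta> :: nat \<Rightarrow> real. \<delta> \<longlonglongrightarrow> 0 \<and>
     (\<lambda>N. \<P>(\<omega> in Px. partial_sum Y f N \<omega> - z N \<in> {a<..<b}))
      \<sim>[sequentially]
     (\<lambda>N. \<bar>a - b\<bar> / sqrt (2 * pi * var_sum P X f N)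
        * exp (- (1 + \<delta> N) / 2
           * ((z N - mean_sum P X f N) / sqrt (var_sum P X f N))\<^sup>2)))"
proof -
 from elliptic obtain \<epsilon>0 \<mu> p where e: "0 < (\<epsilon>0::real)" "\<epsilon>0 < 1"
    "\<forall>n\<ge>1. prob_space (\<mu> n) \<and> sets (\<mu> n) = sets (borel_of_metric (S n))"
    "\<forall>n\<ge>1. p n \<in> borel_measurable (borel_of_metric (S n) \<Otimes>\<^sub>M borel_of_metric (S (Suc n)))"
    "\<forall>n\<ge>1. \<forall>x\<in>mspace (S n). \<pi> n x = density (\<mu> (Suc n)) (\<lambda>y. ennreal (p n (x, y)))"
    "\<forall>n\<ge>1. \<forall>x\<in>mspace (S n). \<forall>y\<in>mspace (S (Suc n)). 0 \<le> p n (x, y) \<and> p n (x, y) \<le> 1 / \<epsilon>0"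
    "\<forall>n\<ge>1. \<forall>x\<in>mspace (S n). \<forall>z\<in>mspace (S (Suc (Suc n))).
      (\<integral>y. p n (x, y) * p (Suc n) (y, z) \<partial>\<mu> (Suc n)) > \<epsilon>0"
  unfolding uniformly_elliptic_def by blast
 have "transition_kernels S \<pi>" using chain by (simp add: markov_chain_def)
 then interpret d: density_data S \<pi> \<epsilon>0 \<mu> p using e by (rule density_data.intro)
 interpret A: markov_process d.M d.q \<epsilon>0 P "\<lambda>n. past S P X (Suc n)" "\<lambda>n. X (Suc n)"
  by (rule d.markov_process_chain[OF chain])
 interpret B: markov_process d.M d.q \<epsilon>0 Px "\<lambda>n. past S Px Y (Suc n)" "\<lambda>n. Y (Suc n)"
  by (rule d.markov_process_chain[OF chain_x])
 interpret P: prob_space P by (rule A.prob_P)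
 interpret Px: prob_space Px by (rule B.prob_P)
 obtain K1 where K1: "0 < K1" "\<And>n. 1 \<le> n \<Longrightarrow> AE \<omega> in P. \<bar>f n (X n \<omega>, X (Suc n) \<omega>)\<bar> \<le> K1"
  by (rule as_uniformly_boundedE[OF bounded]) (rule that)
 obtain K2 where K2: "0 < K2" "\<And>n. 1 \<le> n \<Longrightarrow> AE \<omega> in Px. \<bar>f n (Y n \<omega>, Y (Suc n) \<omega>)\<bar> \<le> K2"
  by (rule as_uniformly_boundedE[OF bounded_x]) (rule that)
 \<comment> \<open>The laws with initial distributions \<open>\<nu>\<close> and the point mass may
   be mutually singular, so each has its own almost sure bound. The maximum allows one truncated
   functional to serve both processes, as the comparison of their moment generating functions
   requires.\<close>
 define K where "K = max K1 K2"
 have K: "0 < K" using K1 by (simp add: K_def)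
 have KP: "AE \<omega> in P. \<bar>f n (X n \<omega>, X (Suc n) \<omega>)\<bar> \<le> K" if "1 \<le> n" for n
  using K1(2)[OF that] by (rule AE_mp, intro AE_I2 impI) (simp add: K_def)
 have KPx: "AE \<omega> in Px. \<bar>f n (Y n \<omega>, Y (Suc n) \<omega>)\<bar> \<le> K" if "1 \<le> n" for n
  using K2(2)[OF that] by (rule AE_mp, intro AE_I2 impI) (simp add: K_def)
 let ?f = "d.clamp K f"
 note ad = d.adm_clamp[OF functional K]
 define T where "T = A.Sf ?f"
 define T' where "T' = B.Sf ?f"
 have T: "bm P (T N)" and T': "bm Px (T' N)" for N
  unfolding T_def T'_def by (rule A.bm_Sf[OF ad], rule B.bm_Sf[OF ad])
 have TX: "AE \<omega> in P. partial_sum X f N \<omega> = T N \<omega>" for N unfolding T_def by (rule d.partial_sum_clamp[OF chain KP])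
 have TY: "AE \<omega> in Px. partial_sum Y f N \<omega> = T' N \<omega>" for N unfolding T'_def by (rule d.partial_sum_clamp[OF chain_x KPx])
 have SX[measurable]: "partial_sum X f N \<in> borel_measurable P" for N by (rule d.partial_sum_measurable[OF chain functional])
 have SY[measurable]: "partial_sum Y f N \<in> borel_measurable Px" for N by (rule d.partial_sum_measurable[OF chain_x functional])
 have [measurable]: "T N \<in> borel_measurable P" "T' N \<in> borel_measurable Px" for N
  by (rule bm_measurable[OF T], rule bm_measurable[OF T'])
 define m where "m N = mean_sum P X f N" for N
 define V where "V N = var_sum P X f N" for N
 have m: "m N = (\<integral>\<omega>. T N \<omega> \<partial>P)" for N unfolding m_def mean_sum_def by (rule integral_cong_AE) (use TX in auto)
 have V: "V N = (\<integral>\<omega>. (T N \<omega> - m N)\<^sup>2 \<partial>P)" for N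
  unfolding V_def var_sum_def m_def[symmetric] by (rule integral_cong_AE) (use TX[of N] in auto)
 have mP: "(\<integral>\<omega>. exp (\<zeta> * of_real (T N \<omega>)) \<partial>P) = A.law.Lam ?f \<zeta> N 0" for N \<zeta>
  unfolding T_def by (rule A.Lam_law[OF ad, symmetric])
 have x0: "x \<in> space (d.M 0)" using x by (simp add: d.space_M)
 \<comment> \<open>The general formula averages \<open>HH\<close> over the initial law; for the
   point mass this is its value at \<open>x\<close>.\<close>
 have mQ: "(\<integral>\<omega>. exp (\<zeta> * of_real (T' N \<omega>)) \<partial>Px) = d.HH ?f \<zeta> N 0 x" for N \<zeta>
 proof -
  have HHm: "d.HH ?f \<zeta> N 0 \<in> borel_measurable (borel_of_metric (S 1))"
  proof -
   have "sets (d.M 0) = sets (borel_of_metric (S 1))" using d.sets_M[of 0] by simp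
   from measurable_cong_sets[OF this refl] show ?thesis
    using bm_measurable[OF d.bm_HH[OF ad, of 0 \<zeta> N]] by blast
  qed
  have Y1: "Y 1 \<in> measurable Px (borel_of_metric (S 1))" using chain_x by (simp add: markov_chain_def)
  have "(\<integral>\<omega>. exp (\<zeta> * of_real (T' N \<omega>)) \<partial>Px) = (\<integral>\<omega>. d.HH ?f \<zeta> N 0 (Y 1 \<omega>) \<partial>Px)"
   unfolding T'_def using B.mgf_eq[OF ad] by simp
  also have "\<dots> = (\<integral>y. d.HH ?f \<zeta> N 0 y \<partial>distr Px (borel_of_metric (S 1)) (Y 1))"
   by (rule integral_distr[OF Y1 HHm, symmetric])
  also have "distr Px (borel_of_metric (S 1)) (Y 1) = return (borel_of_metric (S 1)) x"
   using chain_x by (simp add: markov_chain_def)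
  also have "(\<integral>y. d.HH ?f \<zeta> N 0 y \<partial>\<dots>) = d.HH ?f \<zeta> N 0 x" using x HHm by (intro integral_return) auto
  finally show ?thesis .
 qed
 have zm: "(\<lambda>N. (z N - m N) / V N) \<longlonglongrightarrow> 0" using z by (simp add: m_def V_def)
 have div: "filterlim (\<lambda>N. d.psi ?f N \<theta>) at_top sequentially" if "\<theta> \<noteq> 0" for \<theta>
  by (rule d.irreducible_psi[OF chain functional K KP irreducible range that])
 obtain \<xi> w \<delta> where Vinf: "filterlim V at_top sequentially" and \<delta>: "\<delta> \<longlonglongrightarrow> 0"
  and tilt: "\<forall>\<^sub>F N in sequentially. (\<integral>\<omega>. T N \<omega> * exp (\<xi> N * T N \<omega>) \<partial>P) = z N * (\<integral>\<omega>. exp (\<xi> N * T N \<omega>) \<partial>P)"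
  and w: "\<forall>\<^sub>F N in sequentially. exp (w N) = exp (- \<xi> N * z N) * (\<integral>\<omega>. exp (\<xi> N * T N \<omega>) \<partial>P)"
  and w\<delta>: "\<forall>\<^sub>F N in sequentially. w N = - (1 + \<delta> N) / 2 * ((z N - m N) / sqrt (V N))\<^sup>2"
  and asym: "(\<lambda>N. measure Px {\<omega>\<in>space Px. T' N \<omega> - z N \<in> {a<..<b}}) \<sim>[sequentially] (\<lambda>N. (b - a) / sqrt (2 * pi * V N) * exp (w N))"
  by (rule A.law.chain_local_limit[OF ad K x0 A.prob_P T B.prob_P T' m V mP mQ div zm ab]) (assumption, rule that)
 have prob: "\<P>(\<omega> in Px. partial_sum Y f N \<omega> - z N \<in> {a<..<b}) = measure Px {\<omega>\<in>space Px. T' N \<omega> - z N \<in> {a<..<b}}" for N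
 proof (rule Px.finite_measure_eq_AE)
  show "AE \<omega> in Px. (\<omega> \<in> {\<omega>\<in>space Px. partial_sum Y f N \<omega> - z N \<in> {a<..<b}}) = (\<omega> \<in> {\<omega>\<in>space Px. T' N \<omega> - z N \<in> {a<..<b}})"
   using TY[of N] by (rule AE_mp, intro AE_I2 impI) simp
 qed measurable
 have "\<forall>\<^sub>F N in sequentially. 0 < V N" using Vinf by (simp add: filterlim_at_top_dense)
 \<comment> \<open>Both asymptotic formulas come from the single exponent \<open>w N\<close>, which
   equals the rate function term on the one hand and the perturbed quadratic on the other, for all
   large \<open>N\<close>.\<close>
 then have rate: "\<forall>\<^sub>F N in sequentially. w N = - V N * rate_fun P X f N (z N / V N)"
  using tilt w
 proof eventually_elim
  case (elim N)
  have "- V N * rate_fun P X f N (z N / V N) = ln (exp (- \<xi> N * z N) * (\<integral>\<omega>. exp (\<xi> N * T N \<omega>) \<partial>P))"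
   using rate_fun_eq[OF A.prob_P T SX TX _ elim(2)] elim(1) by (simp add: V_def)
  also have "\<dots> = w N" unfolding elim(3)[symmetric] by simp
  finally show ?case by simp
 qed
 have ab': "b - a = \<bar>a - b\<bar>" using ab by simp
 have *: "(\<lambda>N. \<P>(\<omega> in Px. partial_sum Y f N \<omega> - z N \<in> {a<..<b})) \<sim>[sequentially] (\<lambda>N. \<bar>a - b\<bar> / sqrt (2 * pi * V N) * exp (v N))"
  if "\<forall>\<^sub>F N in sequentially. w N = v N" for v
 proof -
  have "\<forall>\<^sub>F N in sequentially. (b - a) / sqrt (2 * pi * V N) * exp (w N) = \<bar>a - b\<bar> / sqrt (2 * pi * V N) * exp (v N)"
   using that by eventually_elim (simp only: ab')
  from asymp_equiv_cong[OF always_eventually[OF allI[OF refl]] this] asym show ?thesis unfolding prob by (simp only:)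
 qed
 show ?thesis
  using *[OF rate] *[OF w\<delta>] \<delta> unfolding V_def m_def by blast
qed

end
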